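(* There are a universal constant $C>0$ and a constant $\epsilon_0>0$ such that for every $0<\epsilon<\epsilon_0$ the following holds for all sufficiently large $R$ (depending on $\epsilon$): if $\Pi$ is an $(R,\epsilon)$-cuff-good pants in a closed hyperbolic $n$-manifold $M$, then $\Pi$ is either $(R,C\epsilon)$-good or $(R,C\epsilon)$-bad.
   Context: Fix $n\ge 4$; $M=\Gamma\backslash\mathbb{H}^n$ is a closed oriented hyperbolic $n$-manifold; "universal" means independent of $M$, $\Pi$, $R$, $\epsilon$. Closeness: on $\mathrm{SO}(m)$, $d$ is the bi-invariant Riemannian metric induced by $\langle X,Y\rangle=-\frac12\mathrm{tr}(XY)$ on $\mathfrak{so}(m)$, so that a rotation by $\theta\in[0,\pi]$ in a 2-plane is at distance $\theta$ from the identity $\mathbf e$; $g,g'$ are $\epsilon$-close if $d(g,g')<\epsilon$. Good curves: the monodromy of a closed geodesic $\gamma$ is parallel transport once around $\gamma$ acting on the normal space, an element of $\mathrm{SO}(n-1)$ up to conjugacy. $\gamma$ is $(R,\epsilon)$-good if $|l(\gamma)-2R|<2\epsilon$ and its monodromy is $\epsilon$-close to $\mathbf e$. Pants: let $\Pi_0$ be a topological pair of pants with boundary components $C_i$, $i\in\mathbb{Z}/3\mathbb{Z}$, oriented so that $\Pi_0$ lies on their left. A pants in $M$ is an injective homomorphism $\pi_1(\Pi_0)\to\pi_1(M)$ up to conjugacy, equivalently a map $f\colon\Pi_0\to M$ up to homotopy. Its cuffs are the closed geodesics $\gamma_i$ freely homotopic to $f(C_i)$. It is $(R,\epsilon)$-cuff-good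 if each cuff is an $(R,\epsilon)$-good curve. Framed tripods: a tripod at $x\in M$ is an ordered triple $(v_0,v_1,v_2)$ of unit tangent vectors at $x$ lying in a 2-plane $V$ and pairwise at angle $2\pi/3$; $V$ is oriented by the cyclic order, and $v_i^\perp\in V$ is the unit vector with $(v_i,v_i^\perp)$ a positive orthonormal frame of $V$. A framed tripod is a pair $((v_0,v_1,v_2),E)$ with $E$ a positive orthonormal frame of the orthogonal complement of $V$. Right action: $X\in\mathrm{SO}(n)$ acts on an orthonormal frame $(e_1,\dots,e_n)$ by $e_j\mapsto\sum_i X_{ij}e_i$; this $X$ is the element transforming the old frame to the new one. Framed tripods $((v_0,v_1,v_2),E)$ at $p$ and $((u_0,u_1,u_2),F)$ at $q$ are $(R,\epsilon)$-well-connected if there are geodesic segments $\gamma_i$, $i\in\mathbb{Z}/3\mathbb{Z}$, from $p$ to $q$ such that: (1) $R+\log\frac43-\epsilon<l(\gamma_i)<R+\log\frac43+\epsilon$; (2) the angle between $v_i$ and $\gamma_i'$ at $p$ is at most $e^{-R/4}$; (3) the angle between $u_{-i}$ and $-\gamma_i'$ at $q$ is at most $e^{-R/4}$; (4) with $E_i=(v_i,v_i^\perp,E)$ at $p$, $F_i=(u_{-i},u_{-i}^\perp,F)$ at $q$, and $\hat E_i$ the frame at $q$ obtained by parallel transporting $E_i$ along $\gamma_i$ and negating its first two vectors, the element of $\mathrm{SO}(n)$ transforming $\hat E_i$ to $F_i$ is $\epsilon$-close to $\mathbf e$. They are $(R,\epsilon)$-badly-connected if (1)–(3) hold and, instead of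 (4), the element transforming $\hat E_i$ to $F_i$ is $\epsilon$-close to $\mathrm{diag}(1,-1,-1,1,\dots,1)$. The segments $\gamma_i$ are called good (respectively bad) connections. A pants $f\colon\Pi_0\to M$ is $(R,\epsilon)$-good (respectively $(R,\epsilon)$-bad) if there are two $(R,\epsilon)$-well-connected (respectively badly-connected) framed tripods in $M$ with good (respectively bad) connections $\gamma_i$ generating the pants, in the sense that $\gamma_{i+1}\gamma_{i-1}^{-1}$ is freely homotopic to $f(C_i)$ for $i\in\mathbb{Z}/3\mathbb{Z}$. *)

theory Defs
  imports "HOL-Analysis.Analysis" "HOL-Library.Numeral_Type" "Jordan_Normal_Form.Determinant"
begin

no_notation vec_nth (infixl "$" 90)
hide_type (open) Finite_Cartesian_Product.vec
hide_const (open) Finite_Cartesian_Product.vec Finite_Cartesian_Product.mat Determinants.det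
  Finite_Cartesian_Product.transpose

text \<open>Vectors and matrices are those of \<^theory>\<open>Jordan_Normal_Form.Matrix\<close>, and indices in
  $\mathbb{Z}/3\mathbb{Z}$ are elements of the type \<open>3\<close>.\<close>


section \<open>The metric on the rotation group\<close>

definition SO :: "nat \<Rightarrow> real mat set" where
  "SO m = {A \<in> carrier_mat m m. transpose_mat A * A = 1\<^sub>m m \<and> det A = 1}"

definition so_norm :: "real mat \<Rightarrow> real" where
  "so_norm X = sqrt (- (1/2) * sum_list (diag_mat (X * X)))"

definition SO_C1_path :: "nat \<Rightarrow> (real \<Rightarrow> real mat) \<Rightarrow> (real \<Rightarrow> real mat) \<Rightarrow> bool" where
  "SO_C1_path m \<gamma> \<gamma>' \<longleftrightarrow>
     (\<forall>t\<in>{0..1}. \<gamma> t \<in> SO m \<and> \<gamma>' t \<in> carrier_mat m m) \<and>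
     (\<forall>i<m. \<forall>j<m.
        (\<forall>t\<in>{0..1}. ((\<lambda>s. \<gamma> s $$ (i, j)) has_real_derivative \<gamma>' t $$ (i, j)) (at t within {0..1})) \<and>
        continuous_on {0..1} (\<lambda>t. \<gamma>' t $$ (i, j)))"

text \<open>The Riemannian distance: the infimum of the lengths of $C^1$ paths (not required to be
  regular), where a tangent vector $\dot\gamma$ at $\gamma$ is moved to the Lie algebra as
  $\gamma^{-1}\dot\gamma = \gamma^T\dot\gamma$.\<close>

definition SO_dist :: "nat \<Rightarrow> real mat \<Rightarrow> real mat \<Rightarrow> real" where
  "SO_dist m g h = Inf {integral {0..1} (\<lambda>t. so_norm (transpose_mat (\<gamma> t) * \<gamma>' t)) | \<gamma> \<gamma>'.
     SO_C1_path m \<gamma> \<gamma>' \<and> \<gamma> 0 = g \<and> \<gamma> 1 = h}"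


section \<open>Hyperbolic space in the hyperboloid model\<close>

text \<open>Coordinate \<open>0\<close> of $\mathbb{R}^{n+1}$ is the timelike one.  The tangent space at \<open>p\<close> is the
  Minkowski-orthogonal complement of \<open>p\<close>.\<close>

definition mink :: "real vec \<Rightarrow> real vec \<Rightarrow> real" where
  "mink u v = (\<Sum>i = 1..<dim_vec v. u $ i * v $ i) - u $ 0 * v $ 0"

definition hyp :: "nat \<Rightarrow> real vec set" where
  "hyp n = {x \<in> carrier_vec (n + 1). mink x x = - 1 \<and> x $ 0 > 0}"

definition tangent :: "nat \<Rightarrow> real vec \<Rightarrow> real vec set" where
  "tangent n p = {v \<in> carrier_vec (n + 1). mink p v = 0}"

definition unit_tangent :: "nat \<Rightarrow> real vec \<Rightarrow> real vec set" where
  "unit_tangent n p = {v \<in> tangent n p. mink v v = 1}"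

definition hangle :: "real vec \<Rightarrow> real vec \<Rightarrow> real" where
  "hangle u v = arccos (mink u v / (sqrt (mink u u) * sqrt (mink v v)))"

text \<open>The unit speed geodesic with initial point \<open>p\<close> and initial velocity \<open>v\<close>, and its velocity.\<close>

definition geod :: "real vec \<Rightarrow> real vec \<Rightarrow> real \<Rightarrow> real vec" where
  "geod p v t = cosh t \<cdot>\<^sub>v p + sinh t \<cdot>\<^sub>v v"

definition geod_vel :: "real vec \<Rightarrow> real vec \<Rightarrow> real \<Rightarrow> real vec" where
  "geod_vel p v t = sinh t \<cdot>\<^sub>v p + cosh t \<cdot>\<^sub>v v"

text \<open>The covariant derivative of a tangent field along a curve in the hyperboloid is the tangential
  part of its ordinary derivative; so the field is parallel iff its derivative is a multiple of the
  normal vector, which at \<open>\<sigma> t\<close> is \<open>\<sigma> t\<close> itself.\<close>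

definition parallel_field ::
    "nat \<Rightarrow> (real \<Rightarrow> real vec) \<Rightarrow> real \<Rightarrow> (real \<Rightarrow> real vec) \<Rightarrow> bool" where
  "parallel_field n \<sigma> L W \<longleftrightarrow>
     (\<forall>t\<in>{0..L}. W t \<in> tangent n (\<sigma> t) \<and>
        (\<exists>c. \<forall>k<n + 1. ((\<lambda>s. W s $ k) has_real_derivative c * \<sigma> t $ k) (at t within {0..L})))"

definition parallel_transport ::
    "nat \<Rightarrow> (real \<Rightarrow> real vec) \<Rightarrow> real \<Rightarrow> real vec \<Rightarrow> real vec \<Rightarrow> bool" where
  "parallel_transport n \<sigma> L w w' \<longleftrightarrow> (\<exists>W. parallel_field n \<sigma> L W \<and> W 0 = w \<and> W L = w')"

text \<open>A positive orthonormal frame of the tangent space at \<open>p\<close>, as the list $(e_1,\dots,e_n)$; the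
  orientation of hyperbolic space is the one for which $(p,e_1,\dots,e_n)$ is positive in
  $\mathbb{R}^{n+1}$.\<close>

definition pos_frame :: "nat \<Rightarrow> real vec \<Rightarrow> real vec list \<Rightarrow> bool" where
  "pos_frame n p es \<longleftrightarrow> length es = n \<and> set es \<subseteq> tangent n p \<and>
     (\<forall>i<n. \<forall>j<n. mink (es ! i) (es ! j) = (if i = j then 1 else 0)) \<and>
     det (mat_of_cols (n + 1) (p # es)) > 0"

text \<open>\<open>X\<close> transforms the frame \<open>es\<close> to \<open>fs\<close> by the right action $e_j\mapsto\sum_i X_{ij}e_i$.\<close>

definition transforms_frame :: "nat \<Rightarrow> real mat \<Rightarrow> real vec list \<Rightarrow> real vec list \<Rightarrow> bool" where
  "transforms_frame n X es fs \<longleftrightarrow> mat_of_cols (n + 1) fs = mat_of_cols (n + 1) es * X"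


section \<open>Closed oriented hyperbolic manifolds\<close>

text \<open>The group of orientation-preserving isometries of hyperbolic space, $SO^+(n,1)$.\<close>

definition hyp_isom :: "nat \<Rightarrow> real mat monoid" where
  "hyp_isom n =
    \<lparr>carrier = {A \<in> carrier_mat (n + 1) (n + 1).
        (\<forall>u\<in>carrier_vec (n + 1). \<forall>v\<in>carrier_vec (n + 1). mink (A *\<^sub>v u) (A *\<^sub>v v) = mink u v) \<and>
        (\<forall>x\<in>hyp n. A *\<^sub>v x \<in> hyp n) \<and> det A = 1},
     mult = (*), one = 1\<^sub>m (n + 1)\<rparr>"

text \<open>The subspace topology inherited from $\mathbb{R}^{n+1}$.\<close>

definition hyp_topology :: "nat \<Rightarrow> real vec topology" where
  "hyp_topology n =
     pullback_topology (hyp n) (\<lambda>x i. if i < n + 1 then x $ i else 0)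
       (euclidean :: (nat \<Rightarrow> real) topology)"

definition orbit_map :: "real mat set \<Rightarrow> real vec \<Rightarrow> real vec set" where
  "orbit_map \<Gamma> x = (\<lambda>g. g *\<^sub>v x) ` \<Gamma>"

text \<open>\<open>\<Gamma>\<close> acts freely and properly discontinuously with compact quotient, so that
  $M = \Gamma\backslash\mathbb{H}^n$ is a closed oriented hyperbolic manifold with fundamental group
  \<open>\<Gamma>\<close>.\<close>

definition closed_hyperbolic :: "nat \<Rightarrow> real mat set \<Rightarrow> bool" where
  "closed_hyperbolic n \<Gamma> \<longleftrightarrow> subgroup \<Gamma> (hyp_isom n) \<and>
     (\<forall>g\<in>\<Gamma>. \<forall>x\<in>hyp n. g *\<^sub>v x = x \<longrightarrow> g = 1\<^sub>m (n + 1)) \<and>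
     (\<forall>K. compactin (hyp_topology n) K \<longrightarrow> finite {g \<in> \<Gamma>. (\<lambda>x. g *\<^sub>v x) ` K \<inter> K \<noteq> {}}) \<and>
     (\<exists>Q. quotient_map (hyp_topology n) Q (orbit_map \<Gamma>) \<and> compact_space Q)"

abbreviation deck_group :: "nat \<Rightarrow> real mat set \<Rightarrow> real mat monoid" where
  "deck_group n \<Gamma> \<equiv> (hyp_isom n)\<lparr>carrier := \<Gamma>\<rparr>"

text \<open>A loop in \<open>M\<close> corresponds to the deck transformation \<open>g\<close> such that a lift of the loop runs
  from some \<open>x\<close> to \<open>g x\<close>; the deck transformation is determined up to conjugacy by the free homotopy
  class, and determines it.  (With this convention, concatenation of loops from left to right is the
  product in \<open>\<Gamma>\<close>.)\<close>

definition freely_homotopic :: "nat \<Rightarrow> real mat set \<Rightarrow> real mat \<Rightarrow> real mat \<Rightarrow> bool" where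
  "freely_homotopic n \<Gamma> a b \<longleftrightarrow>
     (\<exists>h\<in>\<Gamma>. b = h \<otimes>\<^bsub>deck_group n \<Gamma>\<^esub> a \<otimes>\<^bsub>deck_group n \<Gamma>\<^esub> inv\<^bsub>deck_group n \<Gamma>\<^esub> h)"


section \<open>Good curves\<close>

text \<open>\<open>geod p v\<close> is a lift of the closed geodesic of length \<open>l\<close> in the free homotopy class of \<open>a\<close>.\<close>

definition closed_geodesic ::
    "nat \<Rightarrow> real mat \<Rightarrow> real vec \<Rightarrow> real vec \<Rightarrow> real \<Rightarrow> bool" where
  "closed_geodesic n a p v l \<longleftrightarrow> p \<in> hyp n \<and> v \<in> unit_tangent n p \<and> l > 0 \<and>
     (\<forall>t. a *\<^sub>v geod p v t = geod p v (t + l))"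

text \<open>\<open>X\<close> is the matrix, in a positive orthonormal basis \<open>ws\<close> of the normal space at \<open>p\<close>, of parallel
  transport once around the closed geodesic: the transported basis lives at \<open>geod p v l = a p\<close>, which
  is the same point of \<open>M\<close> as \<open>p\<close>, and is compared with \<open>ws\<close> moved there by \<open>a\<close>.\<close>

definition monodromy ::
    "nat \<Rightarrow> real mat \<Rightarrow> real vec \<Rightarrow> real vec \<Rightarrow> real \<Rightarrow> real mat \<Rightarrow> bool" where
  "monodromy n a p v l X \<longleftrightarrow> X \<in> SO (n - 1) \<and>
     (\<exists>ws ws'. pos_frame n p (v # ws) \<and> list_all2 (parallel_transport n (geod p v) l) ws ws' \<and>
        transforms_frame n X (map (\<lambda>w. a *\<^sub>v w) ws) ws')"

definition good_curve :: "nat \<Rightarrow> real \<Rightarrow> real \<Rightarrow> real mat \<Rightarrow> bool" where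
  "good_curve n R \<epsilon> a \<longleftrightarrow>
     (\<exists>p v l X. closed_geodesic n a p v l \<and> monodromy n a p v l X \<and>
        \<bar>l - 2 * R\<bar> < 2 * \<epsilon> \<and> SO_dist (n - 1) X (1\<^sub>m (n - 1)) < \<epsilon>)"


section \<open>Pants\<close>

text \<open>The fundamental group of a pair of pants is free on two of the boundary curves; a letter is a
  generator (\<open>False\<close> for $c_0$, \<open>True\<close> for $c_1$) with a sign (\<open>True\<close> for the generator itself,
  \<open>False\<close> for its inverse).  Elements are reduced words.\<close>

type_synonym pants_word = "(bool \<times> bool) list"

definition cancels :: "bool \<times> bool \<Rightarrow> bool \<times> bool \<Rightarrow> bool" where
  "cancels x y \<longleftrightarrow> fst x = fst y \<and> snd x \<noteq> snd y"

fun cons_reduce :: "bool \<times> bool \<Rightarrow> pants_word \<Rightarrow> pants_word" where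
  "cons_reduce x [] = [x]"
| "cons_reduce x (y # w) = (if cancels x y then w else x # y # w)"

definition pants_group :: "pants_word monoid" where
  "pants_group = \<lparr>carrier = {w. successively (\<lambda>x y. \<not> cancels x y) w},
     mult = (\<lambda>u w. foldr cons_reduce u w), one = []\<rparr>"

text \<open>Since the boundary curves are all oriented in the same way relative to the pants, representatives
  can be chosen with $c_0c_1c_2=1$, whatever the cyclic order of the labels.\<close>

definition pants_boundary :: "3 \<Rightarrow> pants_word" where
  "pants_boundary i =
     (if i = 0 then [(False, True)] else if i = 1 then [(True, True)]
      else [(True, False), (False, False)])"

lemma pants_boundary_relation:
  "pants_boundary 0 \<otimes>\<^bsub>pants_group\<^esub> pants_boundary 1 \<otimes>\<^bsub>pants_group\<^esub> pants_boundary 2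
     = \<one>\<^bsub>pants_group\<^esub>"
  by (simp add: pants_group_def pants_boundary_def cancels_def)

definition pants_in :: "nat \<Rightarrow> real mat set \<Rightarrow> (pants_word \<Rightarrow> real mat) \<Rightarrow> bool" where
  "pants_in n \<Gamma> \<rho> \<longleftrightarrow> \<rho> \<in> hom pants_group (deck_group n \<Gamma>) \<and> inj_on \<rho> (carrier pants_group)"

definition cuff_good :: "nat \<Rightarrow> real \<Rightarrow> real \<Rightarrow> (pants_word \<Rightarrow> real mat) \<Rightarrow> bool" where
  "cuff_good n R \<epsilon> \<rho> \<longleftrightarrow> (\<forall>i. good_curve n R \<epsilon> (\<rho> (pants_boundary i)))"


section \<open>Framed tripods\<close>

text \<open>Tripods at a point of \<open>M\<close> are represented by a lift to hyperbolic space.  Three unit vectors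
  pairwise at angle $2\pi/3$ have sum zero, so they automatically lie in a plane.\<close>

definition tripod :: "nat \<Rightarrow> real vec \<Rightarrow> (3 \<Rightarrow> real vec) \<Rightarrow> bool" where
  "tripod n p v \<longleftrightarrow> p \<in> hyp n \<and> (\<forall>i. v i \<in> unit_tangent n p) \<and>
     (\<forall>i j. i \<noteq> j \<longrightarrow> hangle (v i) (v j) = 2 * pi / 3)"

text \<open>By the orientation of the plane, $v_{i\pm1} = -\frac12 v_i \pm \frac{\sqrt3}2 v_i^\perp$.\<close>

definition perp :: "(3 \<Rightarrow> real vec) \<Rightarrow> 3 \<Rightarrow> real vec" where
  "perp v i = (1 / sqrt 3) \<cdot>\<^sub>v (v (i + 1) - v (i - 1))"

definition tripod_frame :: "(3 \<Rightarrow> real vec) \<Rightarrow> real vec list \<Rightarrow> 3 \<Rightarrow> real vec list" where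
  "tripod_frame v E i = v i # perp v i # E"

definition framed_tripod :: "nat \<Rightarrow> real vec \<Rightarrow> (3 \<Rightarrow> real vec) \<Rightarrow> real vec list \<Rightarrow> bool" where
  "framed_tripod n p v E \<longleftrightarrow> tripod n p v \<and> pos_frame n p (tripod_frame v E 0)"

fun negate_first_two :: "real vec list \<Rightarrow> real vec list" where
  "negate_first_two (x # y # zs) = (- x) # (- y) # zs"
| "negate_first_two zs = zs"

text \<open>A geodesic segment $\gamma_i$ in \<open>M\<close> between the base points \<open>p\<close>, \<open>q\<close> of the tripods is
  represented by its lift starting at \<open>p\<close>, which ends at \<open>g i q\<close> for a unique \<open>g i \<in> \<Gamma>\<close>; the second
  tripod is moved there by \<open>g i\<close>.  \<open>D\<close> is the element near which the frame comparison has to be.\<close>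

definition connected_near ::
    "nat \<Rightarrow> real \<Rightarrow> real \<Rightarrow> real mat
     \<Rightarrow> real vec \<Rightarrow> (3 \<Rightarrow> real vec) \<Rightarrow> real vec list
     \<Rightarrow> real vec \<Rightarrow> (3 \<Rightarrow> real vec) \<Rightarrow> real vec list \<Rightarrow> (3 \<Rightarrow> real mat) \<Rightarrow> bool" where
  "connected_near n R \<epsilon> D p v E q u F g \<longleftrightarrow>
     (\<forall>i. \<exists>w\<in>unit_tangent n p. \<exists>l>0. geod p w l = g i *\<^sub>v q \<and>
        R + ln (4/3) - \<epsilon> < l \<and> l < R + ln (4/3) + \<epsilon> \<and>
        hangle (v i) w \<le> exp (- R / 4) \<and>
        hangle (g i *\<^sub>v u (- i)) (- geod_vel p w l) \<le> exp (- R / 4) \<and>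
        (\<exists>E' X. list_all2 (parallel_transport n (geod p w) l) (tripod_frame v E i) E' \<and>
           X \<in> SO n \<and>
           transforms_frame n X (negate_first_two E')
             (map (\<lambda>x. g i *\<^sub>v x) (tripod_frame u F (- i))) \<and>
           SO_dist n X D < \<epsilon>))"

definition generates_pants ::
    "nat \<Rightarrow> real mat set \<Rightarrow> (3 \<Rightarrow> real mat) \<Rightarrow> (pants_word \<Rightarrow> real mat) \<Rightarrow> bool" where
  "generates_pants n \<Gamma> g \<rho> \<longleftrightarrow>
     (\<forall>i. freely_homotopic n \<Gamma>
        (g (i + 1) \<otimes>\<^bsub>deck_group n \<Gamma>\<^esub> inv\<^bsub>deck_group n \<Gamma>\<^esub> (g (i - 1))) (\<rho> (pants_boundary i)))"

definition connected_pants ::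
    "nat \<Rightarrow> real mat set \<Rightarrow> real \<Rightarrow> real \<Rightarrow> real mat \<Rightarrow> (pants_word \<Rightarrow> real mat) \<Rightarrow> bool" where
  "connected_pants n \<Gamma> R \<epsilon> D \<rho> \<longleftrightarrow>
     (\<exists>p v E q u F g. framed_tripod n p v E \<and> framed_tripod n q u F \<and> (\<forall>i. g i \<in> \<Gamma>) \<and>
        connected_near n R \<epsilon> D p v E q u F g \<and> generates_pants n \<Gamma> g \<rho>)"

definition good_pants :: "nat \<Rightarrow> real mat set \<Rightarrow> real \<Rightarrow> real \<Rightarrow> (pants_word \<Rightarrow> real mat) \<Rightarrow> bool" where
  "good_pants n \<Gamma> R \<epsilon> \<rho> \<longleftrightarrow> connected_pants n \<Gamma> R \<epsilon> (1\<^sub>m n) \<rho>"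

text \<open>The target element is $\mathrm{diag}(1,-1,-1,1,\dots,1)$; matrix indices start at \<open>0\<close>.\<close>

definition bad_pants :: "nat \<Rightarrow> real mat set \<Rightarrow> real \<Rightarrow> real \<Rightarrow> (pants_word \<Rightarrow> real mat) \<Rightarrow> bool" where
  "bad_pants n \<Gamma> R \<epsilon> \<rho> \<longleftrightarrow>
     connected_pants n \<Gamma> R \<epsilon> (mat_diag n (\<lambda>i. if i = 1 \<or> i = 2 then - 1 else 1)) \<rho>"

end

theory Submission
  imports Defs "HOL-Real_Asymp.Real_Asymp"
begin

text \<open>The pants are straightened along an ideal triangulation that spins around the cuffs. In the
hyperboloid model a cuff \<open>a\<^sub>i\<close> of length \<open>l\<^sub>i\<close> has an attracting fixed point at infinity, that is, a
null vector with \<open>a\<^sub>i m\<^sub>i = exp l\<^sub>i m\<^sub>i\<close>. The three rays are distinct: if two of them agreed, then,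
because the deck group is discrete, some power of one cuff would commute with the other one, which
is impossible in a free group (lemma \<open>attracting_distinct\<close>). So they span an ideal triangle, and
rescaling the \<open>m\<^sub>i\<close> and applying an isometry turns it into a standard triangle centred at \<open>e 0\<close>. The pants are
the union of this triangle and one other, glued along three edges, each of which spirals
towards two of the cuffs.

A gluing along an edge is described by a shear along the edge and by a bend, a linear isometry of the
\<open>(n - 1)\<close>-dimensional normal space of the edge. The shears are forced by the cuff lengths: the
shear \<open>s\<^sub>j\<close> is \<open>(l\<^bsub>j+1\<^esub> + l\<^bsub>j-1\<^esub> - l\<^sub>j) / 2\<close>, which is within \<open>3\<epsilon>\<close> of \<open>R\<close>. The bends are controlled by
the monodromies: two gluings that meet at a cuff differ by that cuff, which acts almost trivially on the
normal directions, so their bends agree up to \<open>O(\<epsilon>)\<close>, except that the normal of the edge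
within the triangle, \<open>nu\<close>, is reversed in passing from one edge to the next. There are three edges,
an odd number, so a matrix entry of the bend that mixes \<open>nu\<close> with another normal direction is
\<open>O(\<epsilon>)\<close>-close to its own negative. Therefore \<open>nu\<close> is sent close to \<open>nu\<close> or to \<open>- nu\<close>: the second triangle
is folded back over the first one or continues it. The normal frame of the second
triangle is still free, up to orientation; a suitable choice makes all three bends \<open>O(\<epsilon>)\<close>-close to the same diagonal
matrix, one of the two of \<open>bend_sign\<close> (theorem \<open>spun_gluing\<close>). This dichotomy is the one
between good and bad pants.

The tripods sit at the centres of the two triangles, with legs towards the ideal vertices. Since the
shears are close to \<open>R\<close>, hyperbolic trigonometry gives connecting segments of length \<open>R + ln (4/3) + O(\<epsilon>)\<close>
leaving and arriving almost along the legs, and parallel transport along such a segment reproduces the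
bend up to \<open>O(exp (- R))\<close> (lemma \<open>connection\<close>). All these estimates concern matrix entries. They are
translated from and into the Riemannian distance of the rotation group by \<open>entries_le_SO_dist\<close> and
\<open>SO_dist_le_entries\<close>, which compare it with the largest difference of entries.\<close>

section \<open>Orthogonal matrices\<close>

lemma mult_mat_entry:
  assumes "A \<in> carrier_mat m k" "B \<in> carrier_mat k l" "i < m" "j < l"
  shows "(A * B) $$ (i, j) = (\<Sum>r = 0..<k. A $$ (i, r) * B $$ (r, j))"
  using assms by (auto simp: scalar_prod_def)

lemma transpose_mult_entry:
  assumes "A \<in> carrier_mat m m" "B \<in> carrier_mat m m" "i < m" "j < m"
  shows "(transpose_mat A * B) $$ (i, j) = (\<Sum>r = 0..<m. A $$ (r, i) * B $$ (r, j))"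
  using assms by (auto simp: scalar_prod_def)

lemma det_transpose_mult_one:
  fixes A :: "real mat"
  assumes "A \<in> carrier_mat m m" "transpose_mat A * A = 1\<^sub>m m"
  shows "det A * det A = 1"
proof -
  have "det (transpose_mat A * A) = det (transpose_mat A) * det A"
    using assms by (intro det_mult) auto
  then show ?thesis using assms by (simp add: det_transpose)
qed

lemma SO_right_inverse: "A \<in> SO m \<Longrightarrow> A * transpose_mat A = 1\<^sub>m m"
  unfolding SO_def by (auto intro: mat_mult_left_right_inverse)

lemma SO_columns:
  assumes "A \<in> SO m" "i < m" "j < m"
  shows "(\<Sum>r = 0..<m. A $$ (r, i) * A $$ (r, j)) = (if i = j then 1 else 0)"
proof -
  have "(transpose_mat A * A) $$ (i, j) = (if i = j then 1 else 0)"
    using assms by (simp add: SO_def)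
  then show ?thesis using assms transpose_mult_entry[of A m A i j] by (simp add: SO_def)
qed

lemma SO_entry_le_1:
  assumes "A \<in> SO m" "i < m" "j < m"
  shows "\<bar>A $$ (i, j)\<bar> \<le> 1"
proof -
  have "(A $$ (i, j))\<^sup>2 \<le> (\<Sum>r = 0..<m. (A $$ (r, j))\<^sup>2)"
    by (rule member_le_sum) (use assms in auto)
  also have "\<dots> = 1" using SO_columns[OF assms(1,3,3)] by (simp add: power2_eq_square)
  finally show ?thesis by (simp add: abs_square_le_1)
qed

lemma SO_one: "1\<^sub>m m \<in> SO m"
  by (simp add: SO_def)

lemma SO_mult:
  assumes "A \<in> SO m" "B \<in> SO m"
  shows "A * B \<in> SO m"
proof -
  have c: "A \<in> carrier_mat m m" "B \<in> carrier_mat m m" using assms by (auto simp: SO_def)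
  have "transpose_mat (A * B) * (A * B) = transpose_mat B * (transpose_mat A * A) * B"
    using c by (simp add: transpose_mult assoc_mult_mat[where n\<^sub>1=m and n\<^sub>2=m and n\<^sub>3=m and n\<^sub>4=m])
  also have "\<dots> = 1\<^sub>m m" using assms c by (simp add: SO_def)
  finally show ?thesis using assms c by (simp add: SO_def det_mult)
qed

lemma SO_transpose:
  assumes "A \<in> SO m"
  shows "transpose_mat A \<in> SO m"
  using assms SO_right_inverse[OF assms] by (auto simp: SO_def det_transpose[where n=m])

section \<open>The distance on the rotation group and matrix entries\<close>

definition skew_mat :: "nat \<Rightarrow> real mat \<Rightarrow> bool" where
  "skew_mat m S \<longleftrightarrow> S \<in> carrier_mat m m \<and> (\<forall>i<m. \<forall>j<m. S $$ (i, j) = - S $$ (j, i))"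

text \<open>The trace form is definite only on skew matrices, so the speed of a path says something about its
entries only after its logarithmic derivative is known to be skew.\<close>

lemma so_norm_skew:
  assumes "skew_mat m S"
  shows "so_norm S = sqrt ((1/2) * (\<Sum>i = 0..<m. \<Sum>j = 0..<m. (S $$ (i, j))\<^sup>2))"
proof -
  have c: "S \<in> carrier_mat m m" and s: "\<And>i j. i < m \<Longrightarrow> j < m \<Longrightarrow> S $$ (i, j) = - S $$ (j, i)"
    using assms unfolding skew_mat_def by blast+
  have "sum_list (diag_mat (S * S)) = (\<Sum>i = 0..<m. (S * S) $$ (i, i))"
    using c by (simp add: diag_mat_def interv_sum_list_conv_sum_set_nat)
  also have "\<dots> = (\<Sum>i = 0..<m. \<Sum>j = 0..<m. S $$ (i, j) * S $$ (j, i))"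
    by (intro sum.cong refl) (simp add: mult_mat_entry[OF c c] del: index_mult_mat)
  also have "\<dots> = (\<Sum>i = 0..<m. \<Sum>j = 0..<m. - (S $$ (i, j))\<^sup>2)"
  proof (intro sum.cong refl)
    fix i j assume "i \<in> {0..<m}" "j \<in> {0..<m}"
    then show "S $$ (i, j) * S $$ (j, i) = - (S $$ (i, j))\<^sup>2"
      using s[of j i] by (simp add: power2_eq_square)
  qed
  finally show ?thesis by (simp add: so_norm_def sum_negf)
qed

lemma so_norm_nonneg: "skew_mat m S \<Longrightarrow> so_norm S \<ge> 0"
  by (simp add: so_norm_skew sum_nonneg)

lemma skew_entry_le_so_norm:
  assumes "skew_mat m S" "i < m" "j < m"
  shows "\<bar>S $$ (i, j)\<bar> \<le> so_norm S"
proof (cases "i = j")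
  case True
  have "S $$ (i, i) = - S $$ (i, i)" using assms unfolding skew_mat_def by blast
  then show ?thesis using True so_norm_nonneg[OF assms(1)] by simp
next
  case False
  have e: "S $$ (j, i) = - S $$ (i, j)" using assms unfolding skew_mat_def by blast
  define f where "f p = (\<Sum>q = 0..<m. (S $$ (p, q))\<^sup>2)" for p
  have a: "(S $$ (p, q))\<^sup>2 \<le> f p" if "p < m" "q < m" for p q
    unfolding f_def by (rule member_le_sum) (use that in auto)
  have "f i + f j = sum f {i, j}" using False by simp
  also have "\<dots> \<le> sum f {0..<m}"
    by (rule sum_mono2) (use assms in \<open>auto simp: f_def sum_nonneg\<close>)
  finally have "2 * (S $$ (i, j))\<^sup>2 \<le> sum f {0..<m}"
    using a[of i j] a[of j i] assms e by simp
  then have "(S $$ (i, j))\<^sup>2 \<le> (1/2) * sum f {0..<m}" by simp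
  then show ?thesis unfolding so_norm_skew[OF assms(1)] f_def
    by (intro real_le_rsqrt) simp
qed

lemma so_norm_le:
  assumes "skew_mat m S" "c \<ge> 0" "\<And>i j. i < m \<Longrightarrow> j < m \<Longrightarrow> \<bar>S $$ (i, j)\<bar> \<le> c"
  shows "so_norm S \<le> m * c"
proof -
  have "(\<Sum>i = 0..<m. \<Sum>j = 0..<m. (S $$ (i, j))\<^sup>2) \<le> (\<Sum>i = 0..<m. \<Sum>j = 0..<m. c\<^sup>2)"
    using assms(2,3) by (intro sum_mono) (auto intro!: abs_le_square_iff[THEN iffD1])
  also have "\<dots> = (m * c)\<^sup>2" by (simp add: power2_eq_square)
  finally have "(1/2) * (\<Sum>i = 0..<m. \<Sum>j = 0..<m. (S $$ (i, j))\<^sup>2) \<le> (m * c)\<^sup>2"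
    using zero_le_power2[of "m * c"] by linarith
  then show ?thesis unfolding so_norm_skew[OF assms(1)]
    using assms(2) by (intro real_le_lsqrt) (auto simp: sum_nonneg)
qed

text \<open>Differentiate the relations saying that the columns are orthonormal.\<close>

lemma SO_C1_path_skew:
  assumes P: "SO_C1_path m \<gamma> \<gamma>'" and t: "t \<in> {0..1}"
  shows "skew_mat m (transpose_mat (\<gamma> t) * \<gamma>' t)"
proof -
  have c: "\<gamma> s \<in> carrier_mat m m" "\<gamma>' s \<in> carrier_mat m m" "\<gamma> s \<in> SO m" if "s \<in> {0..1}" for s
    using P that unfolding SO_C1_path_def SO_def by blast+
  have d: "((\<lambda>s. \<gamma> s $$ (i, j)) has_real_derivative \<gamma>' t $$ (i, j)) (at t within {0..1})"
    if "i < m" "j < m" for i j using P t that unfolding SO_C1_path_def by blast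
  have "(\<Sum>r = 0..<m. \<gamma> t $$ (r, i) * \<gamma>' t $$ (r, j)) = - (\<Sum>r = 0..<m. \<gamma> t $$ (r, j) * \<gamma>' t $$ (r, i))"
    if ij: "i < m" "j < m" for i j
  proof -
    let ?h = "\<lambda>s. (\<Sum>r = 0..<m. \<gamma> s $$ (r, i) * \<gamma> s $$ (r, j))"
    let ?D = "\<Sum>r = 0..<m. (\<gamma>' t $$ (r, i) * \<gamma> t $$ (r, j) + \<gamma>' t $$ (r, j) * \<gamma> t $$ (r, i))"
    have 1: "(?h has_real_derivative ?D) (at t within {0..1})"
      by (intro DERIV_sum DERIV_mult d) (use ij in auto)
    have 2: "(?h has_real_derivative 0) (at t within {0..1})"
      by (rule has_field_derivative_transform_within[where f="\<lambda>s. if i = j then 1 else 0" and d=1])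
        (use t c SO_columns ij in auto)
    have "?D = 0"
      by (rule vector_derivative_unique_within_closed_interval[of 0 1 t ?h])
        (use t 1 2 in \<open>auto simp: has_real_derivative_iff_has_vector_derivative\<close>)
    then show ?thesis by (simp add: sum.distrib mult.commute)
  qed
  note * = this
  show ?thesis unfolding skew_mat_def
  proof (intro conjI allI impI)
    fix i j assume "i < m" "j < m"
    then show "(transpose_mat (\<gamma> t) * \<gamma>' t) $$ (i, j) = - (transpose_mat (\<gamma> t) * \<gamma>' t) $$ (j, i)"
      unfolding transpose_mult_entry[OF c(1,2)[OF t] \<open>i < m\<close> \<open>j < m\<close>]
        transpose_mult_entry[OF c(1,2)[OF t] \<open>j < m\<close> \<open>i < m\<close>] by (rule *)
  qed (use c[OF t] in auto)
qed

lemma continuous_speed: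
  assumes P: "SO_C1_path m \<gamma> \<gamma>'"
  shows "continuous_on {0..1} (\<lambda>t. so_norm (transpose_mat (\<gamma> t) * \<gamma>' t))"
proof -
  have c: "\<gamma> s \<in> carrier_mat m m" "\<gamma>' s \<in> carrier_mat m m" if "s \<in> {0..1}" for s
    using P that unfolding SO_C1_path_def SO_def by blast+
  have c1: "continuous_on {0..1} (\<lambda>s. \<gamma> s $$ (i, j))" if "i < m" "j < m" for i j
    using P that unfolding SO_C1_path_def
    by (meson DERIV_continuous_on)
  have c2: "continuous_on {0..1} (\<lambda>s. \<gamma>' s $$ (i, j))" if "i < m" "j < m" for i j
    using P that unfolding SO_C1_path_def by blast
  have "continuous_on {0..1} (\<lambda>t. sqrt ((1/2) * (\<Sum>i = 0..<m. \<Sum>j = 0..<m.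
      (\<Sum>r = 0..<m. \<gamma> t $$ (r, i) * \<gamma>' t $$ (r, j))\<^sup>2)))"
    by (intro continuous_intros c1 c2) auto
  moreover have "(transpose_mat (\<gamma> t) * \<gamma>' t) $$ (i, j) = (\<Sum>r = 0..<m. \<gamma> t $$ (r, i) * \<gamma>' t $$ (r, j))"
    if "t \<in> {0..1}" "i < m" "j < m" for t i j
    using c that by (intro transpose_mult_entry) auto
  ultimately show ?thesis
    by (auto simp: so_norm_skew[OF SO_C1_path_skew[OF P]] simp del: index_mult_mat(1)
        elim!: continuous_on_eq intro!: sum.cong)
qed

text \<open>The derivative is the product of the path, whose entries are at most 1, and the logarithmic
derivative, whose entries are bounded by the speed. So no entry moves by more than \<open>m\<close> times the length of the
path.\<close>

lemma SO_path_displacement: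
  assumes P: "SO_C1_path m \<gamma> \<gamma>'" and ij: "i < m" "j < m"
  shows "\<bar>\<gamma> 1 $$ (i, j) - \<gamma> 0 $$ (i, j)\<bar>
    \<le> m * integral {0..1} (\<lambda>t. so_norm (transpose_mat (\<gamma> t) * \<gamma>' t))"
proof -
  let ?S = "\<lambda>t. transpose_mat (\<gamma> t) * \<gamma>' t"
  have c: "\<gamma> s \<in> carrier_mat m m" "\<gamma>' s \<in> carrier_mat m m" "\<gamma> s \<in> SO m" if "s \<in> {0..1}" for s
    using P that unfolding SO_C1_path_def SO_def by blast+
  have I: "((\<lambda>t. \<gamma>' t $$ (i, j)) has_integral (\<gamma> 1 $$ (i, j) - \<gamma> 0 $$ (i, j))) {0..1}"
    by (rule fundamental_theorem_of_calculus)
      (use P ij in \<open>auto simp: SO_C1_path_def has_real_derivative_iff_has_vector_derivative\<close>)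
  have le: "norm (\<gamma>' t $$ (i, j)) \<le> m * so_norm (?S t)" if t: "t \<in> {0..1}" for t
  proof -
    have sk: "skew_mat m (?S t)" by (rule SO_C1_path_skew[OF P t])
    have "\<gamma>' t = (\<gamma> t * transpose_mat (\<gamma> t)) * \<gamma>' t"
      using c[OF t] by (simp add: SO_right_inverse)
    also have "\<dots> = \<gamma> t * ?S t"
      using c[OF t] by (intro assoc_mult_mat[where n\<^sub>1=m and n\<^sub>2=m and n\<^sub>3=m and n\<^sub>4=m]) auto
    finally have "\<gamma>' t $$ (i, j) = (\<gamma> t * ?S t) $$ (i, j)" by simp
    also have "\<dots> = (\<Sum>r = 0..<m. \<gamma> t $$ (i, r) * ?S t $$ (r, j))"
      using c[OF t] ij by (intro mult_mat_entry[where l=m]) auto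
    also have "norm \<dots> \<le> (\<Sum>r = 0..<m. 1 * so_norm (?S t))"
    proof (rule sum_norm_le)
      fix r assume "r \<in> {0..<m}"
      then show "norm (\<gamma> t $$ (i, r) * ?S t $$ (r, j)) \<le> 1 * so_norm (?S t)"
        unfolding real_norm_def abs_mult
        by (intro mult_mono SO_entry_le_1[OF c(3)[OF t]] skew_entry_le_so_norm[OF sk]) (use ij in auto)
    qed
    finally show ?thesis by simp
  qed
  have "norm (integral {0..1} (\<lambda>t. \<gamma>' t $$ (i, j))) \<le> integral {0..1} (\<lambda>t. m * so_norm (?S t))"
    by (rule integral_norm_bound_integral)
      (use le in \<open>auto intro!: has_integral_integrable[OF I] integrable_continuous_interval
        continuous_intros continuous_speed[OF P]\<close>)
  then show ?thesis using integral_unique[OF I] by simp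
qed

section \<open>Short paths between nearby rotations\<close>

text \<open>Bounding the entries of the logarithmic derivative along the whole path bounds its length, and is easy to
carry through products. That a path exists at all is part of the notion, which matters because the infimum
of an empty set of lengths would be meaningless.\<close>

definition slow_path :: "nat \<Rightarrow> real \<Rightarrow> real mat \<Rightarrow> bool" where
  "slow_path m c Y \<longleftrightarrow> (\<exists>\<gamma> \<gamma>'. SO_C1_path m \<gamma> \<gamma>' \<and> \<gamma> 0 = 1\<^sub>m m \<and> \<gamma> 1 = Y \<and>
     (\<forall>t\<in>{0..1}. \<forall>i<m. \<forall>j<m. \<bar>(transpose_mat (\<gamma> t) * \<gamma>' t) $$ (i, j)\<bar> \<le> c))"

lemma SO_C1_path_mult:
  assumes A: "SO_C1_path m \<alpha> \<alpha>'" and B: "SO_C1_path m \<beta> \<beta>'"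
  shows "SO_C1_path m (\<lambda>t. \<alpha> t * \<beta> t) (\<lambda>t. \<alpha>' t * \<beta> t + \<alpha> t * \<beta>' t)"
  unfolding SO_C1_path_def
proof (intro conjI ballI allI impI)
  have c: "\<alpha> s \<in> carrier_mat m m" "\<alpha>' s \<in> carrier_mat m m" "\<alpha> s \<in> SO m"
     "\<beta> s \<in> carrier_mat m m" "\<beta>' s \<in> carrier_mat m m" "\<beta> s \<in> SO m" if "s \<in> {0..1}" for s
    using A B that unfolding SO_C1_path_def SO_def by blast+
  {
    fix t :: real assume t: "t \<in> {0..1}"
    show "\<alpha> t * \<beta> t \<in> SO m" by (intro SO_mult c t)
    show "\<alpha>' t * \<beta> t + \<alpha> t * \<beta>' t \<in> carrier_mat m m" using c[OF t] by auto
  }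
  fix i j assume ij: "i < m" "j < m"
  have ent: "(\<alpha>' t * \<beta> t + \<alpha> t * \<beta>' t) $$ (i, j)
      = (\<Sum>r = 0..<m. \<alpha>' t $$ (i, r) * \<beta> t $$ (r, j) + \<beta>' t $$ (r, j) * \<alpha> t $$ (i, r))"
    if t: "t \<in> {0..1}" for t
    using c[OF t] ij by (simp add: scalar_prod_def sum.distrib mult.commute[of "\<beta>' t $$ _"])
  have ent0: "(\<alpha> t * \<beta> t) $$ (i, j) = (\<Sum>r = 0..<m. \<alpha> t $$ (i, r) * \<beta> t $$ (r, j))"
    if t: "t \<in> {0..1}" for t
    using c[OF t] ij by (simp add: scalar_prod_def)
  {
    fix t :: real assume t: "t \<in> {0..1}"
    have "((\<lambda>s. \<Sum>r = 0..<m. \<alpha> s $$ (i, r) * \<beta> s $$ (r, j)) has_real_derivative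
        (\<alpha>' t * \<beta> t + \<alpha> t * \<beta>' t) $$ (i, j)) (at t within {0..1})"
      unfolding ent[OF t]
      by (intro DERIV_sum DERIV_mult) (use A B t ij in \<open>auto simp: SO_C1_path_def\<close>)
    then show "((\<lambda>s. (\<alpha> s * \<beta> s) $$ (i, j)) has_real_derivative
        (\<alpha>' t * \<beta> t + \<alpha> t * \<beta>' t) $$ (i, j)) (at t within {0..1})"
      by (rule has_field_derivative_transform_within[where d=1]) (use t ent0 in auto)
  }
  have c1: "continuous_on {0..1} (\<lambda>s. \<alpha> s $$ (p, q))" "continuous_on {0..1} (\<lambda>s. \<beta> s $$ (p, q))"
      if "p < m" "q < m" for p q
    using A B that unfolding SO_C1_path_def by (meson DERIV_continuous_on)+
  have "continuous_on {0..1} (\<lambda>t. \<Sum>r = 0..<m. \<alpha>' t $$ (i, r) * \<beta> t $$ (r, j) + \<beta>' t $$ (r, j) * \<alpha> t $$ (i, r))"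
    by (intro continuous_intros c1) (use A B ij in \<open>auto simp: SO_C1_path_def\<close>)
  then show "continuous_on {0..1} (\<lambda>t. (\<alpha>' t * \<beta> t + \<alpha> t * \<beta>' t) $$ (i, j))"
    by (rule continuous_on_eq) (use ent in auto)
qed

text \<open>The logarithmic derivative of a product is that of the second factor plus a conjugate of that of
the first; each of the two multiplications in the conjugation costs a factor \<open>m\<close>.\<close>

lemma slow_path_mult:
  assumes "slow_path m c Y" "slow_path m c' Y'"
  shows "slow_path m (m * (m * c) + c') (Y * Y')"
proof -
  obtain \<alpha> \<alpha>' where A: "SO_C1_path m \<alpha> \<alpha>'" "\<alpha> 0 = 1\<^sub>m m" "\<alpha> 1 = Y"
     and Ac: "\<And>t i j. t \<in> {0..1} \<Longrightarrow> i < m \<Longrightarrow> j < m \<Longrightarrow> \<bar>(transpose_mat (\<alpha> t) * \<alpha>' t) $$ (i, j)\<bar> \<le> c"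
    using assms(1) unfolding slow_path_def by blast
  obtain \<beta> \<beta>' where B: "SO_C1_path m \<beta> \<beta>'" "\<beta> 0 = 1\<^sub>m m" "\<beta> 1 = Y'"
     and Bc: "\<And>t i j. t \<in> {0..1} \<Longrightarrow> i < m \<Longrightarrow> j < m \<Longrightarrow> \<bar>(transpose_mat (\<beta> t) * \<beta>' t) $$ (i, j)\<bar> \<le> c'"
    using assms(2) unfolding slow_path_def by blast
  have "\<bar>(transpose_mat (\<alpha> t * \<beta> t) * (\<alpha>' t * \<beta> t + \<alpha> t * \<beta>' t)) $$ (i, j)\<bar> \<le> m * (m * c) + c'"
    if t: "t \<in> {0..1}" and ij: "i < m" "j < m" for t i j
  proof -
    have C: "\<alpha> t \<in> carrier_mat m m" "\<alpha>' t \<in> carrier_mat m m" "\<alpha> t \<in> SO m"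
       "\<beta> t \<in> carrier_mat m m" "\<beta>' t \<in> carrier_mat m m" "\<beta> t \<in> SO m"
      using A B t unfolding SO_C1_path_def SO_def by blast+
    note assoc = assoc_mult_mat[where n\<^sub>1=m and n\<^sub>2=m and n\<^sub>3=m and n\<^sub>4=m]
    define S where "S = transpose_mat (\<alpha> t) * \<alpha>' t"
    have Sc: "S \<in> carrier_mat m m" using C by (simp add: S_def)
    have "transpose_mat (\<alpha> t * \<beta> t) * (\<alpha>' t * \<beta> t + \<alpha> t * \<beta>' t)
       = transpose_mat (\<beta> t) * transpose_mat (\<alpha> t) * (\<alpha>' t * \<beta> t)
        + transpose_mat (\<beta> t) * transpose_mat (\<alpha> t) * (\<alpha> t * \<beta>' t)"
      using C by (simp add: transpose_mult mult_add_distrib_mat[where nr=m and n=m and nc=m])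
    also have "transpose_mat (\<beta> t) * transpose_mat (\<alpha> t) * (\<alpha>' t * \<beta> t) = transpose_mat (\<beta> t) * (S * \<beta> t)"
      using C by (simp add: S_def assoc)
    also have "transpose_mat (\<beta> t) * transpose_mat (\<alpha> t) * (\<alpha> t * \<beta>' t)
        = transpose_mat (\<beta> t) * ((transpose_mat (\<alpha> t) * \<alpha> t) * \<beta>' t)"
      using C by (simp add: assoc)
    also have "transpose_mat (\<alpha> t) * \<alpha> t = 1\<^sub>m m" using C by (simp add: SO_def)
    finally have "(transpose_mat (\<alpha> t * \<beta> t) * (\<alpha>' t * \<beta> t + \<alpha> t * \<beta>' t)) $$ (i, j)
       = (transpose_mat (\<beta> t) * (S * \<beta> t)) $$ (i, j) + (transpose_mat (\<beta> t) * \<beta>' t) $$ (i, j)"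
      using C Sc ij by simp
    moreover have "\<bar>(transpose_mat (\<beta> t) * (S * \<beta> t)) $$ (i, j)\<bar> \<le> m * (m * c)"
    proof -
      have Sb: "\<bar>(S * \<beta> t) $$ (r, j)\<bar> \<le> m * c" if r: "r < m" for r
      proof -
        have "(S * \<beta> t) $$ (r, j) = (\<Sum>q = 0..<m. S $$ (r, q) * \<beta> t $$ (q, j))"
          using Sc C ij r by (intro mult_mat_entry[where l=m]) auto
        also have "norm \<dots> \<le> (\<Sum>q = 0..<m. c * 1)"
        proof (rule sum_norm_le)
          fix q assume "q \<in> {0..<m}"
          then show "norm (S $$ (r, q) * \<beta> t $$ (q, j)) \<le> c * 1"
            unfolding real_norm_def abs_mult
            using Ac[OF t r, of q] SO_entry_le_1[OF C(6), of q j] ij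
            by (intro mult_mono) (auto simp: S_def intro: order_trans[OF abs_ge_zero])
        qed
        finally show ?thesis by simp
      qed
      have "(transpose_mat (\<beta> t) * (S * \<beta> t)) $$ (i, j) = (\<Sum>r = 0..<m. \<beta> t $$ (r, i) * (S * \<beta> t) $$ (r, j))"
        using C Sc ij by (intro transpose_mult_entry) auto
      also have "norm \<dots> \<le> (\<Sum>r = 0..<m. 1 * (m * c))"
      proof (rule sum_norm_le)
        fix r assume "r \<in> {0..<m}"
        then show "norm (\<beta> t $$ (r, i) * (S * \<beta> t) $$ (r, j)) \<le> 1 * (m * c)"
          unfolding real_norm_def abs_mult
          using Sb[of r] SO_entry_le_1[OF C(6), of r i] ij
          by (intro mult_mono) (auto intro: order_trans[OF abs_ge_zero])
      qed
      finally show ?thesis by simp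
    qed
    ultimately show ?thesis using Bc[OF t ij] by linarith
  qed
  then show ?thesis unfolding slow_path_def
    using SO_C1_path_mult[OF A(1) B(1)] A B
    by (intro exI[of _ "\<lambda>t. \<alpha> t * \<beta> t"] exI[of _ "\<lambda>t. \<alpha>' t * \<beta> t + \<alpha> t * \<beta>' t"]) simp
qed

subsection \<open>Plane rotations\<close>

text \<open>For an orthonormal pair \<open>a\<close>, \<open>b\<close> this is the rotation by \<open>\<theta>\<close> from \<open>a\<close> towards \<open>b\<close>, and the identity on the
orthogonal complement of the two.\<close>

definition plane_rotation :: "nat \<Rightarrow> (nat \<Rightarrow> real) \<Rightarrow> (nat \<Rightarrow> real) \<Rightarrow> real \<Rightarrow> real mat" where
  "plane_rotation m a b \<theta> = mat m m (\<lambda>(k, i). (if k = i then 1 else 0) +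
     (((cos \<theta> - 1) * a i - sin \<theta> * b i) * a k + (sin \<theta> * a i + (cos \<theta> - 1) * b i) * b k))"

lemma sum_delta_combination:
  fixes f :: "nat \<Rightarrow> real"
  assumes "i < m"
  shows "(\<Sum>k = 0..<m. ((if k = i then 1 else 0) + g k) * f k) = f i + (\<Sum>k = 0..<m. g k * f k)"
proof -
  have "(\<Sum>k = 0..<m. ((if k = i then 1 else 0) + g k) * f k)
    = (\<Sum>k = 0..<m. (if k = i then f k else 0)) + (\<Sum>k = 0..<m. g k * f k)"
    unfolding sum.distrib[symmetric] by (intro sum.cong) (auto simp: algebra_simps)
  then show ?thesis using assms by simp
qed

text \<open>The polynomial identities behind the orthogonality of a plane rotation, its square, and its
logarithmic derivative.\<close>

lemma rotation_identities:
  fixes c s x y z w \<theta> :: real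
  assumes "c * c = 1 - s * s"
  shows "(((c - 1) * x - s * y) * z + (s * x + (c - 1) * y) * w) + (((c - 1) * z - s * w) * x + (s * z + (c - 1) * w) * y)
      + (((c - 1) * x - s * y) * ((c - 1) * z - s * w) + (s * x + (c - 1) * y) * (s * z + (c - 1) * w)) = 0"
    and "(((c - 1) * x + s * y) * z + ((c - 1) * y - s * x) * w) + (((c - 1) * z - s * w) * x + (s * z + (c - 1) * w) * y)
      + (((c - 1) * x + s * y) * ((c - 1) * z - s * w) + ((c - 1) * y - s * x) * (s * z + (c - 1) * w))
      = ((c * c - s * s - 1) * z - 2 * s * c * w) * x + (2 * s * c * z + (c * c - s * s - 1) * w) * y"
    and "\<theta> * (- s * z - c * w) * x + \<theta> * (c * z - s * w) * y
      + (((c - 1) * x - s * y) * (\<theta> * (- s * z - c * w)) + (s * x + (c - 1) * y) * (\<theta> * (c * z - s * w)))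
      = \<theta> * (y * z - x * w)"
proof -
  have "(((c - 1) * x - s * y) * z + (s * x + (c - 1) * y) * w) + (((c - 1) * z - s * w) * x + (s * z + (c - 1) * w) * y)
      + (((c - 1) * x - s * y) * ((c - 1) * z - s * w) + (s * x + (c - 1) * y) * (s * z + (c - 1) * w))
      = (x * z + y * w) * (c * c + s * s - 1)" by (simp add: algebra_simps)
  then show "(((c - 1) * x - s * y) * z + (s * x + (c - 1) * y) * w) + (((c - 1) * z - s * w) * x + (s * z + (c - 1) * w) * y)
      + (((c - 1) * x - s * y) * ((c - 1) * z - s * w) + (s * x + (c - 1) * y) * (s * z + (c - 1) * w)) = 0"
    using assms by simp
  show "(((c - 1) * x + s * y) * z + ((c - 1) * y - s * x) * w) + (((c - 1) * z - s * w) * x + (s * z + (c - 1) * w) * y)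
      + (((c - 1) * x + s * y) * ((c - 1) * z - s * w) + ((c - 1) * y - s * x) * (s * z + (c - 1) * w))
      = ((c * c - s * s - 1) * z - 2 * s * c * w) * x + (2 * s * c * z + (c * c - s * s - 1) * w) * y"
    by (simp add: algebra_simps)
  have "\<theta> * (- s * z - c * w) * x + \<theta> * (c * z - s * w) * y
      + (((c - 1) * x - s * y) * (\<theta> * (- s * z - c * w)) + (s * x + (c - 1) * y) * (\<theta> * (c * z - s * w)))
      = \<theta> * (y * z - x * w) * (c * c + s * s)" by (simp add: algebra_simps)
  then show "\<theta> * (- s * z - c * w) * x + \<theta> * (c * z - s * w) * y
      + (((c - 1) * x - s * y) * (\<theta> * (- s * z - c * w)) + (s * x + (c - 1) * y) * (\<theta> * (c * z - s * w)))
      = \<theta> * (y * z - x * w)" using assms by simp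
qed

locale orthonormal_pair =
  fixes m :: nat and a b :: "nat \<Rightarrow> real"
  assumes aa: "(\<Sum>k = 0..<m. a k * a k) = 1" and bb: "(\<Sum>k = 0..<m. b k * b k) = 1"
    and ab: "(\<Sum>k = 0..<m. a k * b k) = 0"
begin

lemma entry_le_1:
  assumes "k < m" shows "\<bar>a k\<bar> \<le> 1" "\<bar>b k\<bar> \<le> 1"
proof -
  have "a k * a k \<le> (\<Sum>k = 0..<m. a k * a k)" "b k * b k \<le> (\<Sum>k = 0..<m. b k * b k)"
    by (rule member_le_sum; use assms in auto)+
  then show "\<bar>a k\<bar> \<le> 1" "\<bar>b k\<bar> \<le> 1"
    by (simp_all add: aa bb abs_square_le_1[symmetric] power2_eq_square)
qed

lemma combination_dot:
  "(\<Sum>k = 0..<m. (p * a k + q * b k) * (p' * a k + q' * b k)) = p * p' + q * q'"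
proof -
  have "(\<Sum>k = 0..<m. (p * a k + q * b k) * (p' * a k + q' * b k))
     = p * p' * (\<Sum>k = 0..<m. a k * a k) + q * q' * (\<Sum>k = 0..<m. b k * b k)
       + (p * q' + q * p') * (\<Sum>k = 0..<m. a k * b k)"
    by (simp add: sum_distrib_left sum.distrib[symmetric] algebra_simps)
  then show ?thesis using aa bb ab by simp
qed

lemma column_dot:
  assumes "i < m" "j < m"
  shows "(\<Sum>k = 0..<m. ((if k = i then 1 else 0) + (u * a k + v * b k)) * ((if k = j then 1 else 0) + (u' * a k + v' * b k)))
    = (if i = j then 1 else 0) + (u * a j + v * b j) + (u' * a i + v' * b i) + (u * u' + v * v')"
proof -
  have "(\<Sum>k = 0..<m. (u * a k + v * b k) * ((if k = j then 1 else 0) + (u' * a k + v' * b k)))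
    = (\<Sum>k = 0..<m. ((if k = j then 1 else 0) + (u' * a k + v' * b k)) * (u * a k + v * b k))"
    by (simp add: mult.commute)
  also have "\<dots> = (u * a j + v * b j) + (u' * u + v' * v)"
    by (simp add: sum_delta_combination[OF assms(2)] combination_dot)
  finally show ?thesis
    by (subst sum_delta_combination[OF assms(1)]) simp
qed

lemma plane_rotation_orthogonal:
  "transpose_mat (plane_rotation m a b \<theta>) * plane_rotation m a b \<theta> = 1\<^sub>m m"
proof (rule eq_matI)
  fix i j assume "i < dim_row (1\<^sub>m m :: real mat)" "j < dim_col (1\<^sub>m m :: real mat)"
  then have ij: "i < m" "j < m" by auto
  let ?c = "cos \<theta>" and ?s = "sin \<theta>"
  have cs: "?c * ?c = 1 - ?s * ?s" using sin_cos_squared_add[of \<theta>] by (simp add: power2_eq_square eq_diff_eq add.commute)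
  have "(transpose_mat (plane_rotation m a b \<theta>) * plane_rotation m a b \<theta>) $$ (i, j) =
     (\<Sum>k = 0..<m. ((if k = i then 1 else 0) + (((?c - 1) * a i - ?s * b i) * a k + (?s * a i + (?c - 1) * b i) * b k))
      * ((if k = j then 1 else 0) + (((?c - 1) * a j - ?s * b j) * a k + (?s * a j + (?c - 1) * b j) * b k)))"
    using ij by (subst transpose_mult_entry[where m=m]) (auto simp: plane_rotation_def)
  also have "\<dots> = (if i = j then 1 else 0)"
    using rotation_identities(1)[OF cs, of "a i" "b i" "a j" "b j"] by (subst column_dot[OF ij]) linarith
  finally show "(transpose_mat (plane_rotation m a b \<theta>) * plane_rotation m a b \<theta>) $$ (i, j) = 1\<^sub>m m $$ (i, j)"
    using ij by simp
qed (auto simp: plane_rotation_def)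

text \<open>A rotation is the square of the rotation by half the angle, so its determinant is a square, which
excludes \<open>- 1\<close>.\<close>

lemma plane_rotation_double:
  "plane_rotation m a b (2 * \<theta>) = plane_rotation m a b \<theta> * plane_rotation m a b \<theta>"
proof (rule eq_matI)
  fix i j assume "i < dim_row (plane_rotation m a b \<theta> * plane_rotation m a b \<theta>)"
    "j < dim_col (plane_rotation m a b \<theta> * plane_rotation m a b \<theta>)"
  then have ij: "i < m" "j < m" by (auto simp: plane_rotation_def)
  let ?c = "cos \<theta>" and ?s = "sin \<theta>"
  have cs: "?c * ?c = 1 - ?s * ?s" using sin_cos_squared_add[of \<theta>] by (simp add: power2_eq_square eq_diff_eq add.commute)
  have "(plane_rotation m a b \<theta> * plane_rotation m a b \<theta>) $$ (i, j) =
     (\<Sum>k = 0..<m. ((if k = i then 1 else 0) + (((?c - 1) * a i + ?s * b i) * a k + ((?c - 1) * b i - ?s * a i) * b k))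
      * ((if k = j then 1 else 0) + (((?c - 1) * a j - ?s * b j) * a k + (?s * a j + (?c - 1) * b j) * b k)))"
    using ij by (subst mult_mat_entry[where m=m and k=m and l=m])
      (auto simp: plane_rotation_def algebra_simps intro!: sum.cong)
  also have "\<dots> = (if i = j then 1 else 0) + (((?c - 1) * a i + ?s * b i) * a j + ((?c - 1) * b i - ?s * a i) * b j)
     + (((?c - 1) * a j - ?s * b j) * a i + (?s * a j + (?c - 1) * b j) * b i)
     + (((?c - 1) * a i + ?s * b i) * ((?c - 1) * a j - ?s * b j) + ((?c - 1) * b i - ?s * a i) * (?s * a j + (?c - 1) * b j))"
    by (rule column_dot[OF ij])
  also have "\<dots> = (if i = j then 1 else 0) + (((?c * ?c - ?s * ?s - 1) * a j - 2 * ?s * ?c * b j) * a i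
      + (2 * ?s * ?c * a j + (?c * ?c - ?s * ?s - 1) * b j) * b i)"
    using rotation_identities(2)[OF cs, of "a i" "b i" "a j" "b j"] by linarith
  also have "\<dots> = plane_rotation m a b (2 * \<theta>) $$ (i, j)"
    using ij by (simp add: plane_rotation_def cos_double sin_double power2_eq_square)
  finally show "plane_rotation m a b (2 * \<theta>) $$ (i, j) = (plane_rotation m a b \<theta> * plane_rotation m a b \<theta>) $$ (i, j)" ..
qed (auto simp: plane_rotation_def)

lemma plane_rotation_SO: "plane_rotation m a b \<theta> \<in> SO m"
proof -
  have c: "plane_rotation m a b \<phi> \<in> carrier_mat m m" for \<phi> by (simp add: plane_rotation_def)
  have "det (plane_rotation m a b \<theta>) = det (plane_rotation m a b (\<theta> / 2)) * det (plane_rotation m a b (\<theta> / 2))"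
    using plane_rotation_double[of "\<theta> / 2"] c by (simp add: det_mult[where n=m])
  then show ?thesis
    using det_transpose_mult_one[OF c plane_rotation_orthogonal] plane_rotation_orthogonal c by (simp add: SO_def)
qed

text \<open>A one-parameter group has constant logarithmic derivative, here the matrix with entries
\<open>\<theta> (b\<^sub>i a\<^sub>j - a\<^sub>i b\<^sub>j)\<close>.\<close>

lemma slow_path_plane_rotation: "slow_path m (2 * \<bar>\<theta>\<bar>) (plane_rotation m a b \<theta>)"
proof -
  define \<gamma> where "\<gamma> t = plane_rotation m a b (t * \<theta>)" for t
  define \<gamma>' where "\<gamma>' t = mat m m (\<lambda>(k, i).
      \<theta> * (- sin (t * \<theta>) * a i - cos (t * \<theta>) * b i) * a k + \<theta> * (cos (t * \<theta>) * a i - sin (t * \<theta>) * b i) * b k)" for t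
  have "SO_C1_path m \<gamma> \<gamma>'"
    unfolding SO_C1_path_def
  proof (intro conjI ballI allI impI)
    show "\<gamma> t \<in> SO m" for t unfolding \<gamma>_def by (rule plane_rotation_SO)
    show "\<gamma>' t \<in> carrier_mat m m" for t by (simp add: \<gamma>'_def)
    fix i j assume ij: "i < m" "j < m"
    show "((\<lambda>s. \<gamma> s $$ (i, j)) has_real_derivative \<gamma>' t $$ (i, j)) (at t within {0..1})" for t
      unfolding \<gamma>_def \<gamma>'_def plane_rotation_def using ij
      by (auto intro!: derivative_eq_intros simp: algebra_simps)
    show "continuous_on {0..1} (\<lambda>t. \<gamma>' t $$ (i, j))"
      unfolding \<gamma>'_def using ij by (auto intro!: continuous_intros)
  qed
  moreover have "\<gamma> 0 = 1\<^sub>m m" by (rule eq_matI) (auto simp: \<gamma>_def plane_rotation_def)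
  moreover have "\<bar>(transpose_mat (\<gamma> t) * \<gamma>' t) $$ (i, j)\<bar> \<le> 2 * \<bar>\<theta>\<bar>" if ij: "i < m" "j < m" for t i j
  proof -
    let ?c = "cos (t * \<theta>)" and ?s = "sin (t * \<theta>)"
    have cs: "?c * ?c = 1 - ?s * ?s" using sin_cos_squared_add[of "t * \<theta>"] by (simp add: power2_eq_square eq_diff_eq add.commute)
    have "(transpose_mat (\<gamma> t) * \<gamma>' t) $$ (i, j) =
      (\<Sum>k = 0..<m. ((if k = i then 1 else 0) + (((?c - 1) * a i - ?s * b i) * a k + (?s * a i + (?c - 1) * b i) * b k))
       * ((\<theta> * (- ?s * a j - ?c * b j)) * a k + (\<theta> * (?c * a j - ?s * b j)) * b k))"
      using ij by (subst transpose_mult_entry[where m=m]) (auto simp: \<gamma>_def \<gamma>'_def plane_rotation_def)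
    also have "\<dots> = \<theta> * (b i * a j - a i * b j)"
      using rotation_identities(3)[OF cs, of \<theta> "a j" "b j" "a i" "b i"]
      by (subst sum_delta_combination[OF ij(1)], subst combination_dot) simp
    finally have "\<bar>(transpose_mat (\<gamma> t) * \<gamma>' t) $$ (i, j)\<bar> = \<bar>\<theta>\<bar> * \<bar>b i * a j - a i * b j\<bar>"
      by (simp add: abs_mult)
    moreover have "\<bar>b i * a j - a i * b j\<bar> \<le> \<bar>b i\<bar> * \<bar>a j\<bar> + \<bar>a i\<bar> * \<bar>b j\<bar>"
      unfolding abs_mult[symmetric] by (rule abs_triangle_ineq4)
    moreover have "\<bar>b i\<bar> * \<bar>a j\<bar> + \<bar>a i\<bar> * \<bar>b j\<bar> \<le> 1 * 1 + 1 * 1"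
      by (intro add_mono mult_mono entry_le_1 ij) auto
    ultimately show ?thesis
      using mult_left_mono[of "\<bar>b i * a j - a i * b j\<bar>" 2 "\<bar>\<theta>\<bar>"] by simp
  qed
  ultimately show ?thesis unfolding slow_path_def
    by (intro exI[of _ \<gamma>] exI[of _ \<gamma>']) (auto simp: \<gamma>_def simp del: index_mult_mat(1))
qed

end

subsection \<open>Clearing one column at a time\<close>

lemma half_le_sin:
  fixes x :: real
  assumes x: "0 \<le> x" "x \<le> 1.6"
  shows "x / 2 \<le> sin x"
proof -
  have "\<bar>sin x - (\<Sum>m<3. sin_coeff m * x ^ m)\<bar> \<le> inverse (fact 3) * \<bar>x\<bar> ^ 3"
    by (rule Maclaurin_sin_bound)
  moreover have "(\<Sum>m<3. sin_coeff m * x ^ m) = x"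
    by (simp add: sin_coeff_def numeral_3_eq_3 lessThan_Suc)
  moreover have "inverse (fact 3) * \<bar>x\<bar> ^ 3 = x ^ 3 / 6"
    using x by (simp add: fact_numeral)
  ultimately have 1: "sin x \<ge> x - x ^ 3 / 6" by linarith
  have "x ^ 3 = x * (x * x)" by (simp only: power3_eq_cube mult.assoc)
  also have "\<dots> \<le> x * (1.6 * 1.6)" using x by (intro mult_left_mono mult_mono) auto
  finally show ?thesis using 1 x by simp
qed

text \<open>The two terms on the right can be read off from matrix entries; both are needed, since
\<open>1 - cos \<theta>\<close> is quadratic near \<open>0\<close> and \<open>sin \<theta>\<close> vanishes at \<open>\<pi>\<close>.\<close>

lemma angle_le_chord:
  fixes \<theta> :: real
  assumes "0 \<le> \<theta>" "\<theta> \<le> pi"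
  shows "\<theta> \<le> 2 * (1 - cos \<theta>) + 2 * sin \<theta>"
proof -
  let ?x = "\<theta> / 2"
  have "0 \<le> ?x" "?x \<le> 1.6" using assms pi_approx by auto
  then have 2: "?x / 2 \<le> sin ?x" by (rule half_le_sin)
  \<comment> \<open>the chord has squared length \<open>2 - 2 cos \<theta>\<close>, and is shorter than the sum of its two legs\<close>
  have s: "0 \<le> sin \<theta>" "0 \<le> 1 - cos \<theta>" using assms by (auto intro: sin_ge_zero)
  have "(2 * sin ?x)\<^sup>2 = 2 * (1 - cos \<theta>)"
    using cos_double_sin[of ?x] by (simp add: power2_eq_square)
  also have "\<dots> = (1 - cos \<theta>)\<^sup>2 + (sin \<theta>)\<^sup>2"
    using sin_cos_squared_add[of \<theta>] by (simp add: power2_eq_square algebra_simps)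
  also have "\<dots> \<le> ((1 - cos \<theta>) + sin \<theta>)\<^sup>2" using s by (simp add: power2_sum)
  finally have "2 * sin ?x \<le> (1 - cos \<theta>) + sin \<theta>" by (rule power2_le_imp_le) (use s in auto)
  then show ?thesis using 2 by simp
qed

text \<open>If all columns except possibly the last are standard, the last one is standard up to sign, and the
determinant fixes the sign. So the clearing of columns ends one step before there is no room for a rotation.\<close>

lemma SO_columns_standard_imp_one:
  assumes X: "X \<in> SO m" and j: "m \<le> Suc j" and st: "\<And>i k. i < m \<Longrightarrow> k < m \<Longrightarrow> k < j \<Longrightarrow> X $$ (i, k) = (if i = k then 1 else 0)"
  shows "X = 1\<^sub>m m"
proof -
  have c: "X \<in> carrier_mat m m" "det X = 1" using X by (auto simp: SO_def)
  have up: "X $$ (i, k) = 0" if "i < m" "k < m" "i \<noteq> k" for i k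
  proof (cases "k < j")
    case False
    then have "i < j" using that j by auto
    have "0 = (\<Sum>r = 0..<m. X $$ (r, i) * X $$ (r, k))" using SO_columns[OF X, of i k] that by simp
    also have "\<dots> = (\<Sum>r = 0..<m. if r = i then X $$ (r, k) else 0)"
      using st \<open>i < j\<close> that by (intro sum.cong) auto
    finally show ?thesis using that by simp
  qed (use st that in auto)
  have diag: "X $$ (k, k) = 1" if k: "k < m" for k
  proof (cases "k < j")
    case False
    then have m: "m = Suc j" and kj: "k = j" using k j by auto
    have "upper_triangular X" using up c by (auto simp: upper_triangular_def)
    then have "1 = prod_list (diag_mat X)" using det_upper_triangular[of X m] c by simp
    also have "\<dots> = (\<Prod>i = 0..<m. X $$ (i, i))" using c by (simp add: diag_mat_def prod.list_conv_set_nth)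
    also have "\<dots> = (\<Prod>i = 0..<j. X $$ (i, i)) * X $$ (j, j)" by (simp add: m)
    also have "(\<Prod>i = 0..<j. X $$ (i, i)) = 1" using st m by (intro prod.neutral) auto
    finally show ?thesis using kj by simp
  qed (use st that in auto)
  show ?thesis by (rule eq_matI) (use c up diag in auto)
qed

lemma slow_path_one: "slow_path m 0 (1\<^sub>m m)"
  unfolding slow_path_def
proof (intro exI conjI)
  show "SO_C1_path m (\<lambda>t. 1\<^sub>m m) (\<lambda>t. 0\<^sub>m m m)"
    by (auto simp: SO_C1_path_def SO_one)
qed auto

lemma slow_path_mono: "slow_path m c Y \<Longrightarrow> c \<le> c' \<Longrightarrow> slow_path m c' Y"
proof -
  assume s: "slow_path m c Y" and le: "c \<le> c'"
  obtain \<gamma> \<gamma>' where g: "SO_C1_path m \<gamma> \<gamma>'" "\<gamma> 0 = 1\<^sub>m m" "\<gamma> 1 = Y"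
     and c: "\<And>t i j. t \<in> {0..1} \<Longrightarrow> i < m \<Longrightarrow> j < m \<Longrightarrow> \<bar>(transpose_mat (\<gamma> t) * \<gamma>' t) $$ (i, j)\<bar> \<le> c"
    using s unfolding slow_path_def by blast
  show ?thesis unfolding slow_path_def
    by (intro exI[of _ \<gamma>] exI[of _ \<gamma>'] conjI g ballI allI impI order_trans[OF c le])
qed

text \<open>Downward induction on the number \<open>j\<close> of columns that are already standard. If the entries of \<open>X\<close> are
\<open>\<delta>\<close>-close to those of the identity, a plane rotation by an angle of order \<open>\<delta>\<close> carries the basis vector
\<open>j\<close> to column \<open>j\<close> of \<open>X\<close> and fixes the earlier ones. After dividing it out, one more column is standard, and the
entries are still of order \<open>\<delta>\<close> from those of the identity.\<close>

lemma slow_path_fixing_columns: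
  assumes "j \<le> m"
  shows "\<exists>K\<ge>0. \<forall>X\<in>SO m. \<forall>\<delta>. (\<forall>i<m. \<forall>k<m. k < j \<longrightarrow> X $$ (i, k) = (if i = k then 1 else 0)) \<and>
     (\<forall>i<m. \<forall>k<m. \<bar>X $$ (i, k) - (if i = k then 1 else 0)\<bar> \<le> \<delta>) \<longrightarrow> slow_path m (K * \<delta>) X"
  using assms
proof (induction rule: inc_induct)
  case base
  show ?case
  proof (intro exI[of _ 0] conjI ballI allI impI)
    fix X \<delta> assume "X \<in> SO m" "(\<forall>i<m. \<forall>k<m. k < m \<longrightarrow> X $$ (i, k) = (if i = k then 1 else 0)) \<and>
        (\<forall>i<m. \<forall>k<m. \<bar>X $$ (i, k) - (if i = k then 1 else 0)\<bar> \<le> \<delta>)"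
    then have "X = 1\<^sub>m m" by (intro SO_columns_standard_imp_one[of X m m]) auto
    then show "slow_path m (0 * \<delta>) X" using slow_path_one by simp
  qed simp
next
  case (step j)
  from step.IH obtain K where K: "K \<ge> 0" and IH0: "\<forall>X\<in>SO m. \<forall>\<delta>. (\<forall>i<m. \<forall>k<m. k < Suc j \<longrightarrow> X $$ (i, k) = (if i = k then 1 else 0)) \<and>
     (\<forall>i<m. \<forall>k<m. \<bar>X $$ (i, k) - (if i = k then 1 else 0)\<bar> \<le> \<delta>) \<longrightarrow> slow_path m (K * \<delta>) X"
    by (elim exE conjE)
  have IH: "slow_path m (K * \<delta>) X" if "X \<in> SO m"
      "\<And>i k. i < m \<Longrightarrow> k < m \<Longrightarrow> k < Suc j \<Longrightarrow> X $$ (i, k) = (if i = k then 1 else 0)"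
      "\<And>i k. i < m \<Longrightarrow> k < m \<Longrightarrow> \<bar>X $$ (i, k) - (if i = k then 1 else 0)\<bar> \<le> \<delta>" for X \<delta>
    by (intro IH0[THEN bspec, THEN spec, THEN mp] conjI allI impI that)
  \<comment> \<open>the rotation angle is at most \<open>T * \<delta>\<close>, and what remains has entries within \<open>(m + 4 * T) * \<delta>\<close>\<close>
  define T :: real where "T = 2 + 2 * m"
  define K' where "K' = m * (m * (2 * T)) + K * (m + 4 * T)"
  show ?case
  proof (intro exI[of _ K'] conjI ballI allI impI)
    show "K' \<ge> 0" using K by (simp add: K'_def T_def)
    fix X \<delta> assume X: "X \<in> SO m"
      and A: "(\<forall>i<m. \<forall>k<m. k < j \<longrightarrow> X $$ (i, k) = (if i = k then 1 else 0)) \<and>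
        (\<forall>i<m. \<forall>k<m. \<bar>X $$ (i, k) - (if i = k then 1 else 0)\<bar> \<le> \<delta>)"
    have st: "X $$ (i, k) = (if i = k then 1 else 0)" if "i < m" "k < m" "k < j" for i k
      using A that by blast
    have le: "\<bar>X $$ (i, k) - (if i = k then 1 else 0)\<bar> \<le> \<delta>" if "i < m" "k < m" for i k
      using A that by blast
    have c: "X \<in> carrier_mat m m" using X by (simp add: SO_def)
    have j: "j < m" using step by simp
    have \<delta>: "\<delta> \<ge> 0" using le[OF j j] by linarith
    show "slow_path m (K' * \<delta>) X"
    proof (cases "Suc j = m")
      case True
      then have "X = 1\<^sub>m m" using SO_columns_standard_imp_one[OF X, of j] st by auto
      then show ?thesis
        using slow_path_mono[OF slow_path_one, of "K' * \<delta>" m] \<delta> K by (simp add: K'_def T_def)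
    next
      case False
      with j have j': "Suc j < m" by simp
      define u where "u k = X $$ (k, j)" for k
      have uu: "(\<Sum>k = 0..<m. u k * u k) = 1" using SO_columns[OF X j j] by (simp add: u_def)
      have u0: "u k = 0" if "k < j" for k
      proof -
        have "0 = (\<Sum>r = 0..<m. X $$ (r, k) * X $$ (r, j))" using SO_columns[OF X, of k j] that j by simp
        also have "\<dots> = (\<Sum>r = 0..<m. if r = k then X $$ (r, j) else 0)"
          using st that j by (intro sum.cong) auto
        finally show ?thesis using that j by (simp add: u_def)
      qed
      define a :: "nat \<Rightarrow> real" where "a k = (if k = j then 1 else 0)" for k
      define \<rho> where "\<rho> = sqrt (\<Sum>k\<in>{0..<m}-{j}. u k * u k)"
      have sq: "(\<Sum>k\<in>{0..<m}-{j}. u k * u k) = 1 - u j * u j"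
        using uu j by (simp add: sum.remove[of "{0..<m}" j])
      have nn: "(\<Sum>k\<in>{0..<m}-{j}. u k * u k) \<ge> 0" by (simp add: sum_nonneg)
      have \<rho>2: "\<rho> * \<rho> = 1 - u j * u j" and \<rho>0: "\<rho> \<ge> 0"
        using sq nn by (simp_all add: \<rho>_def)
      define \<theta> where "\<theta> = arccos (u j)"
      have uj: "\<bar>u j\<bar> \<le> 1" using SO_entry_le_1[OF X j j] by (simp add: u_def)
      have th: "0 \<le> \<theta>" "\<theta> \<le> pi" "cos \<theta> = u j" using uj by (auto simp: \<theta>_def arccos_lbound arccos_ubound abs_le_iff)
      have sth: "sin \<theta> = \<rho>"
      proof -
        have "(sin \<theta>)\<^sup>2 = \<rho>\<^sup>2" using \<rho>2 th sin_cos_squared_add[of \<theta>] by (simp add: power2_eq_square algebra_simps)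
        then show ?thesis using \<rho>0 sin_ge_zero[OF th(1,2)] power2_eq_iff_nonneg by blast
      qed
      \<comment> \<open>for \<open>\<rho> = 0\<close> the column is a multiple of the basis vector and any plane containing it will do\<close>
      define b where "b k = (if \<rho> = 0 then (if k = Suc j then 1 else 0) else if k = j then 0 else u k / \<rho>)" for k
      have bb: "(\<Sum>k = 0..<m. b k * b k) = 1"
      proof (cases "\<rho> = 0")
        case True
        then have "(\<Sum>k = 0..<m. b k * b k) = (\<Sum>k = 0..<m. if k = Suc j then 1 else 0)"
          by (intro sum.cong) (auto simp: b_def)
        then show ?thesis using j' by simp
      next
        case F: False
        have "(\<Sum>k = 0..<m. b k * b k) = (\<Sum>k\<in>{0..<m}-{j}. u k * u k) / (\<rho> * \<rho>)"
          using F j by (simp add: sum.remove[of "{0..<m}" j] b_def sum_divide_distrib)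
        moreover have "\<rho> * \<rho> \<noteq> 0" using F by simp
        ultimately show ?thesis using sq \<rho>2 by (metis divide_self)
      qed
      have ab: "(\<Sum>k = 0..<m. a k * b k) = 0" by (intro sum.neutral) (auto simp: a_def b_def)
      have aa: "(\<Sum>k = 0..<m. a k * a k) = 1"
        using j by (simp add: a_def if_distrib[of "\<lambda>x. x * _"] cong: if_cong)
      interpret orthonormal_pair m a b by (rule orthonormal_pair.intro[OF aa bb ab])
      have b0: "b k = 0" if "k \<le> j" for k using u0[of k] that by (auto simp: b_def)
      have u_ab: "u k = cos \<theta> * a k + sin \<theta> * b k" if "k < m" for k
      proof (cases "k = j \<or> \<rho> \<noteq> 0")
        case F: False
        then have "(\<Sum>k\<in>{0..<m}-{j}. u k * u k) = 0" using sq \<rho>2 by simp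
        then have "u k * u k = 0" using F that sum_nonneg_eq_0_iff[of "{0..<m}-{j}" "\<lambda>k. u k * u k"] by auto
        then show ?thesis using F by (simp add: th sth a_def)
      qed (auto simp: th sth a_def b_def)
      \<comment> \<open>the rotation taking the standard vector to the first nonstandard column\<close>
      define r where "r = plane_rotation m a b \<theta>"
      have r: "r \<in> SO m" unfolding r_def by (rule plane_rotation_SO)
      have rc: "r \<in> carrier_mat m m" using r by (simp add: SO_def)
      have r_ent: "r $$ (k, i) = (if k = i then 1 else 0) +
        (((cos \<theta> - 1) * a i - sin \<theta> * b i) * a k + (sin \<theta> * a i + (cos \<theta> - 1) * b i) * b k)" if "k < m" "i < m" for k i
        using that by (simp add: r_def plane_rotation_def)
      have r_lt: "r $$ (k, i) = (if k = i then 1 else 0)" if "k < m" "i < j" for k i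
        using that j b0[of i] by (simp add: r_ent a_def)
      have r_j: "r $$ (k, j) = X $$ (k, j)" if "k < m" for k
        using that j b0[of j] u_ab[of k] by (auto simp: r_ent a_def u_def)
      have \<rho>_le: "\<rho> \<le> m * \<delta>"
      proof -
        have "\<rho> \<le> (\<Sum>k\<in>{0..<m}-{j}. \<bar>u k\<bar>)"
          unfolding \<rho>_def using L2_set_le_sum_abs[of u "{0..<m}-{j}"] by (simp add: L2_set_def power2_eq_square)
        also have "\<dots> \<le> (\<Sum>k\<in>{0..<m}-{j}. \<delta>)"
        proof (intro sum_mono)
          fix k assume "k \<in> {0..<m}-{j}"
          then show "\<bar>u k\<bar> \<le> \<delta>" using le[of k j] j by (simp add: u_def)
        qed
        also have "\<dots> \<le> m * \<delta>" using \<delta> j by (simp add: mult_right_mono)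
        finally show ?thesis .
      qed
      have th_le: "\<theta> \<le> T * \<delta>"
      proof -
        have "1 - cos \<theta> \<le> \<delta>" using le[OF j j] th by (simp add: u_def)
        then show ?thesis using angle_le_chord[OF th(1,2)] \<rho>_le sth by (simp add: T_def algebra_simps)
      qed
      have cs: "\<bar>cos \<theta> - 1\<bar> \<le> \<theta>" "\<bar>sin \<theta>\<bar> \<le> \<theta>"
      proof -
        show "\<bar>sin \<theta>\<bar> \<le> \<theta>" using abs_sin_x_le_abs_x[of \<theta>] th by simp
        have "\<bar>cos \<theta> - cos 0\<bar> \<le> \<bar>\<theta> - 0\<bar>"
        proof -
          have "cos 0 - cos \<theta> = 2 * sin (\<theta>/2) * sin (\<theta>/2)" using cos_double_sin[of "\<theta>/2"] by (simp add: power2_eq_square)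
          also have "\<dots> \<le> 2 * (\<theta>/2) * 1"
            using th sin_x_le_x[of "\<theta>/2"] sin_ge_zero[of "\<theta>/2"] by (intro mult_mono) auto
          finally show ?thesis using th cos_le_one[of \<theta>] by simp
        qed
        then show "\<bar>cos \<theta> - 1\<bar> \<le> \<theta>" using th by simp
      qed
      have r_le: "\<bar>r $$ (k, i) - (if k = i then 1 else 0)\<bar> \<le> 4 * (T * \<delta>)" if "k < m" "i < m" for k i
      proof -
        have p: "\<bar>x * y\<bar> \<le> z" if "\<bar>x\<bar> \<le> z" "\<bar>y\<bar> \<le> 1" for x y z :: real
          using mult_mono[OF that] that by (simp add: abs_mult)
        have "\<bar>((cos \<theta> - 1) * a i - sin \<theta> * b i) * a k\<bar> \<le> 2 * \<theta>"
          by (rule p[OF _ entry_le_1(1)[OF \<open>k < m\<close>]])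
            (use p[OF cs(1) entry_le_1(1)[OF \<open>i < m\<close>]] p[OF cs(2) entry_le_1(2)[OF \<open>i < m\<close>]] in linarith)
        moreover have "\<bar>(sin \<theta> * a i + (cos \<theta> - 1) * b i) * b k\<bar> \<le> 2 * \<theta>"
          by (rule p[OF _ entry_le_1(2)[OF \<open>k < m\<close>]])
            (use p[OF cs(1) entry_le_1(2)[OF \<open>i < m\<close>]] p[OF cs(2) entry_le_1(1)[OF \<open>i < m\<close>]] in linarith)
        ultimately show ?thesis using that th_le unfolding r_ent[OF that] by linarith
      qed
      define Y where "Y = transpose_mat r * X"
      have Y: "Y \<in> SO m" unfolding Y_def by (intro SO_mult SO_transpose r X)
      have Y_ent: "Y $$ (i, k) = (\<Sum>l = 0..<m. r $$ (l, i) * X $$ (l, k))" if "i < m" "k < m" for i k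
        unfolding Y_def using that rc c by (rule transpose_mult_entry[rotated 2])
      have rY: "r * Y = X"
        unfolding Y_def using rc c SO_right_inverse[OF r]
        by (simp add: assoc_mult_mat[where n\<^sub>1=m and n\<^sub>2=m and n\<^sub>3=m and n\<^sub>4=m, symmetric])
      have "slow_path m (K * ((m + 4 * T) * \<delta>)) Y"
      proof (rule IH[OF Y])
        fix i k assume ik: "i < m" "k < m" "k < Suc j"
        have "Y $$ (i, k) = (\<Sum>l = 0..<m. r $$ (l, i) * r $$ (l, k))"
          unfolding Y_ent[OF ik(1,2)]
        proof (intro sum.cong refl)
          fix l assume "l \<in> {0..<m}"
          then show "r $$ (l, i) * X $$ (l, k) = r $$ (l, i) * r $$ (l, k)"
            using ik st[of l k] r_lt[of l k] r_j[of l] by (cases "k = j") auto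
        qed
        then show "Y $$ (i, k) = (if i = k then 1 else 0)" using SO_columns[OF r ik(1,2)] by simp
      next
        fix i k assume ik: "i < m" "k < m"
        have "Y $$ (i, k) - (if i = k then 1 else 0) =
          (\<Sum>l = 0..<m. r $$ (l, i) * (X $$ (l, k) - (if l = k then 1 else 0))) + (r $$ (k, i) - (if k = i then 1 else 0))"
          using ik unfolding Y_ent[OF ik] right_diff_distrib sum_subtractf
          by (simp add: if_distrib[of "\<lambda>x. _ * x"] cong: if_cong)
        also have "\<bar>\<dots>\<bar> \<le> (\<Sum>l = 0..<m. 1 * \<delta>) + 4 * (T * \<delta>)"
        proof (intro order_trans[OF abs_triangle_ineq] add_mono r_le ik order_trans[OF sum_abs] sum_mono)
          fix l assume "l \<in> {0..<m}"
          then show "\<bar>r $$ (l, i) * (X $$ (l, k) - (if l = k then 1 else 0))\<bar> \<le> 1 * \<delta>"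
            unfolding abs_mult using SO_entry_le_1[OF r, of l i] le[of l k] ik by (intro mult_mono) auto
        qed
        finally show "\<bar>Y $$ (i, k) - (if i = k then 1 else 0)\<bar> \<le> (m + 4 * T) * \<delta>" by (simp add: algebra_simps)
      qed
      then have "slow_path m (m * (m * (2 * \<bar>\<theta>\<bar>)) + K * ((m + 4 * T) * \<delta>)) (r * Y)"
        using slow_path_plane_rotation[of \<theta>] unfolding r_def by (rule slow_path_mult[rotated])
      moreover have "m * (m * (2 * \<bar>\<theta>\<bar>)) + K * ((m + 4 * T) * \<delta>) \<le> K' * \<delta>"
      proof -
        have "m * (m * (2 * \<bar>\<theta>\<bar>)) \<le> m * (m * (2 * (T * \<delta>)))"
          using th_le th by (intro mult_left_mono) auto
        then show ?thesis by (simp add: K'_def algebra_simps)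
      qed
      ultimately show ?thesis unfolding rY by (rule slow_path_mono)
    qed
  qed
qed

lemma slow_path_from_one:
  "\<exists>K\<ge>0. \<forall>X\<in>SO m. \<forall>\<delta>. (\<forall>i<m. \<forall>k<m. \<bar>X $$ (i, k) - (if i = k then 1 else 0)\<bar> \<le> \<delta>) \<longrightarrow>
     slow_path m (K * \<delta>) X"
proof -
  from slow_path_fixing_columns[of 0 m, OF le0] obtain K where K: "K \<ge> 0" and H: "\<forall>X\<in>SO m. \<forall>\<delta>.
     (\<forall>i<m. \<forall>k<m. k < 0 \<longrightarrow> X $$ (i, k) = (if i = k then 1 else 0)) \<and>
     (\<forall>i<m. \<forall>k<m. \<bar>X $$ (i, k) - (if i = k then 1 else 0)\<bar> \<le> \<delta>) \<longrightarrow> slow_path m (K * \<delta>) X"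
    by (elim exE conjE)
  show ?thesis
    by (intro exI[of _ K] conjI K ballI allI impI H[THEN bspec, THEN spec, THEN mp])
      (assumption, erule less_zeroE, blast)
qed

lemma bdd_below_path_lengths:
  "bdd_below {integral {0..1} (\<lambda>t. so_norm (transpose_mat (\<gamma> t) * \<gamma>' t)) | \<gamma> \<gamma>'.
     SO_C1_path m \<gamma> \<gamma>' \<and> \<gamma> 0 = g \<and> \<gamma> 1 = h}"
proof (rule bdd_belowI[of _ 0])
  fix x assume "x \<in> {integral {0..1} (\<lambda>t. so_norm (transpose_mat (\<gamma> t) * \<gamma>' t)) | \<gamma> \<gamma>'.
     SO_C1_path m \<gamma> \<gamma>' \<and> \<gamma> 0 = g \<and> \<gamma> 1 = h}"
  then obtain \<gamma> \<gamma>' where x: "x = integral {0..1} (\<lambda>t. so_norm (transpose_mat (\<gamma> t) * \<gamma>' t))"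
    and P: "SO_C1_path m \<gamma> \<gamma>'" by blast
  show "0 \<le> x" unfolding x
    by (rule integral_nonneg) (use so_norm_nonneg[OF SO_C1_path_skew[OF P]] in
      \<open>auto intro!: integrable_continuous_interval continuous_speed[OF P]\<close>)
qed

text \<open>Left translation by \<open>X\<close> does not change the logarithmic derivative.\<close>

lemma SO_path_from_slow_path:
  assumes X: "X \<in> SO m" and D: "D \<in> SO m" and s: "slow_path m c (transpose_mat X * D)" and c: "c \<ge> 0"
  shows "\<exists>\<gamma> \<gamma>'. SO_C1_path m \<gamma> \<gamma>' \<and> \<gamma> 0 = X \<and> \<gamma> 1 = D \<and>
    integral {0..1} (\<lambda>t. so_norm (transpose_mat (\<gamma> t) * \<gamma>' t)) \<le> m * c"
proof -
  obtain \<beta> \<beta>' where B: "SO_C1_path m \<beta> \<beta>'" "\<beta> 0 = 1\<^sub>m m" "\<beta> 1 = transpose_mat X * D"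
     and Bc: "\<And>t i j. t \<in> {0..1} \<Longrightarrow> i < m \<Longrightarrow> j < m \<Longrightarrow> \<bar>(transpose_mat (\<beta> t) * \<beta>' t) $$ (i, j)\<bar> \<le> c"
    using s unfolding slow_path_def by blast
  note assoc = assoc_mult_mat[where n\<^sub>1=m and n\<^sub>2=m and n\<^sub>3=m and n\<^sub>4=m]
  have C: "X \<in> carrier_mat m m" "D \<in> carrier_mat m m" using X D by (auto simp: SO_def)
  have "SO_C1_path m (\<lambda>t. X) (\<lambda>t. 0\<^sub>m m m)" using X by (auto simp: SO_C1_path_def)
  note P = SO_C1_path_mult[OF this B(1)]
  let ?\<gamma>' = "\<lambda>t. 0\<^sub>m m m * \<beta> t + X * \<beta>' t"
  have sp: "transpose_mat (X * \<beta> t) * ?\<gamma>' t = transpose_mat (\<beta> t) * \<beta>' t" if "t \<in> {0..1}" for t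
  proof -
    have b: "\<beta> t \<in> carrier_mat m m" "\<beta>' t \<in> carrier_mat m m" "\<beta> t \<in> SO m"
      using B that unfolding SO_C1_path_def SO_def by blast+
    have "transpose_mat (X * \<beta> t) * ?\<gamma>' t = transpose_mat (\<beta> t) * ((transpose_mat X * X) * \<beta>' t)"
      using b C by (simp add: assoc transpose_mult left_mult_zero_mat[where n=m] left_add_zero_mat[where nr=m and nc=m])
    then show ?thesis using b X by (simp add: SO_def)
  qed
  have "integral {0..1} (\<lambda>t. so_norm (transpose_mat (X * \<beta> t) * ?\<gamma>' t)) \<le> integral {0..1} (\<lambda>t::real. m * c)"
  proof (rule integral_le)
    fix t :: real assume t: "t \<in> {0..1}"
    show "so_norm (transpose_mat (X * \<beta> t) * ?\<gamma>' t) \<le> m * c" unfolding sp[OF t]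
      by (rule so_norm_le[OF SO_C1_path_skew[OF B(1) t] c Bc[OF t]])
  qed (auto intro!: integrable_continuous_interval continuous_speed[OF P])
  then have "integral {0..1} (\<lambda>t. so_norm (transpose_mat (X * \<beta> t) * ?\<gamma>' t)) \<le> m * c" by simp
  moreover have "X * \<beta> 1 = D"
    using C SO_right_inverse[OF X] by (simp add: B assoc[symmetric])
  moreover have "X * \<beta> 0 = X" using C by (simp add: B(2))
  ultimately show ?thesis using P by (intro exI conjI)
qed

text \<open>Rotations with nearby entries are nearby in the Riemannian distance, because slow paths join them. The next theorem is
the converse for the distance from the identity.\<close>

theorem SO_dist_le_entries:
  "\<exists>K>0. \<forall>X\<in>SO m. \<forall>D\<in>SO m. \<forall>\<delta>. (\<forall>i<m. \<forall>j<m. \<bar>X $$ (i, j) - D $$ (i, j)\<bar> \<le> \<delta>) \<longrightarrow>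
     \<delta> \<ge> 0 \<longrightarrow> SO_dist m X D \<le> K * \<delta>"
proof -
  from slow_path_from_one[of m] obtain K where K: "K \<ge> 0" and path0: "\<forall>X\<in>SO m. \<forall>\<delta>.
      (\<forall>i<m. \<forall>k<m. \<bar>X $$ (i, k) - (if i = k then 1 else 0)\<bar> \<le> \<delta>) \<longrightarrow> slow_path m (K * \<delta>) X"
    by (elim exE conjE)
  have path: "slow_path m (K * \<delta>) X" if "X \<in> SO m"
      "\<And>i k. i < m \<Longrightarrow> k < m \<Longrightarrow> \<bar>X $$ (i, k) - (if i = k then 1 else 0)\<bar> \<le> \<delta>" for X \<delta>
    by (intro path0[THEN bspec, THEN spec, THEN mp] allI impI that)
  show ?thesis
  proof (intro exI[of _ "m * (K * m) + 1"] conjI ballI allI impI)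
    show "m * (K * m) + 1 > 0" using K by (intro add_nonneg_pos mult_nonneg_nonneg) auto
    fix X D \<delta> assume X: "X \<in> SO m" and D: "D \<in> SO m"
      and le: "\<forall>i<m. \<forall>j<m. \<bar>X $$ (i, j) - D $$ (i, j)\<bar> \<le> \<delta>" and \<delta>: "\<delta> \<ge> 0"
    have C: "X \<in> carrier_mat m m" "D \<in> carrier_mat m m" using X D by (auto simp: SO_def)
    have "slow_path m (K * (m * \<delta>)) (transpose_mat X * D)"
    proof (rule path)
      show "transpose_mat X * D \<in> SO m" by (intro SO_mult SO_transpose X D)
      fix i k assume ik: "i < m" "k < m"
      have "(transpose_mat X * D) $$ (i, k) - (if i = k then 1 else 0)
        = (\<Sum>r = 0..<m. X $$ (r, i) * (D $$ (r, k) - X $$ (r, k)))"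
        unfolding transpose_mult_entry[OF C ik] SO_columns[OF X ik, symmetric] sum_subtractf[symmetric]
        by (simp add: algebra_simps)
      also have "\<bar>\<dots>\<bar> \<le> (\<Sum>r = 0..<m. 1 * \<delta>)"
      proof (intro order_trans[OF sum_abs] sum_mono)
        fix l assume "l \<in> {0..<m}"
        then show "\<bar>X $$ (l, i) * (D $$ (l, k) - X $$ (l, k))\<bar> \<le> 1 * \<delta>"
          unfolding abs_mult using SO_entry_le_1[OF X, of l i] le ik
          by (intro mult_mono) (auto simp: abs_minus_commute)
      qed
      finally show "\<bar>(transpose_mat X * D) $$ (i, k) - (if i = k then 1 else 0)\<bar> \<le> m * \<delta>" by simp
    qed
    then obtain \<gamma> \<gamma>' where g: "SO_C1_path m \<gamma> \<gamma>'" "\<gamma> 0 = X" "\<gamma> 1 = D"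
      "integral {0..1} (\<lambda>t. so_norm (transpose_mat (\<gamma> t) * \<gamma>' t)) \<le> m * (K * (m * \<delta>))"
      using SO_path_from_slow_path[OF X D, of "K * (m * \<delta>)"] K \<delta> by auto
    have "SO_dist m X D \<le> integral {0..1} (\<lambda>t. so_norm (transpose_mat (\<gamma> t) * \<gamma>' t))"
      unfolding SO_dist_def by (rule cInf_lower[OF _ bdd_below_path_lengths]) (use g in blast)
    also have "\<dots> \<le> m * (K * (m * \<delta>))" by (fact g(4))
    also have "\<dots> \<le> (m * (K * m) + 1) * \<delta>" using \<delta> by (simp add: algebra_simps)
    finally show "SO_dist m X D \<le> (m * (K * m) + 1) * \<delta>" .
  qed
qed

text \<open>A path of length less than \<open>\<epsilon>\<close> exists only because the set of lengths is nonempty; otherwise its infimum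
would carry no information. This is a second use of the slow paths.\<close>

theorem entries_le_SO_dist:
  assumes X: "X \<in> SO m" and d: "SO_dist m X (1\<^sub>m m) < \<epsilon>" and ij: "i < m" "j < m"
  shows "\<bar>X $$ (i, j) - (if i = j then 1 else 0)\<bar> \<le> m * \<epsilon>"
proof -
  let ?L = "{integral {0..1} (\<lambda>t. so_norm (transpose_mat (\<gamma> t) * \<gamma>' t)) | \<gamma> \<gamma>'.
     SO_C1_path m \<gamma> \<gamma>' \<and> \<gamma> 0 = X \<and> \<gamma> 1 = 1\<^sub>m m}"
  from slow_path_from_one[of m] obtain K where K: "K \<ge> 0" and path0: "\<forall>X\<in>SO m. \<forall>\<delta>.
      (\<forall>i<m. \<forall>k<m. \<bar>X $$ (i, k) - (if i = k then 1 else 0)\<bar> \<le> \<delta>) \<longrightarrow> slow_path m (K * \<delta>) X"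
    by (elim exE conjE)
  have path: "slow_path m (K * \<delta>) X" if "X \<in> SO m"
      "\<And>i k. i < m \<Longrightarrow> k < m \<Longrightarrow> \<bar>X $$ (i, k) - (if i = k then 1 else 0)\<bar> \<le> \<delta>" for X \<delta>
    by (intro path0[THEN bspec, THEN spec, THEN mp] allI impI that)
  have Y: "transpose_mat X * 1\<^sub>m m \<in> SO m" by (intro SO_mult SO_transpose X SO_one)
  have "slow_path m (K * 2) (transpose_mat X * 1\<^sub>m m)"
  proof (rule path[OF Y])
    fix i k assume "i < m" "k < m"
    then show "\<bar>(transpose_mat X * 1\<^sub>m m) $$ (i, k) - (if i = k then 1 else 0)\<bar> \<le> 2"
      using SO_entry_le_1[OF Y, of i k] by (auto simp: abs_if split: if_splits)
  qed
  then obtain \<gamma>\<^sub>0 \<gamma>\<^sub>0' where "SO_C1_path m \<gamma>\<^sub>0 \<gamma>\<^sub>0'" "\<gamma>\<^sub>0 0 = X" "\<gamma>\<^sub>0 1 = 1\<^sub>m m"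
    using SO_path_from_slow_path[OF X SO_one, of "K * 2"] K by auto
  then have "integral {0..1} (\<lambda>t. so_norm (transpose_mat (\<gamma>\<^sub>0 t) * \<gamma>\<^sub>0' t)) \<in> ?L" by blast
  then have "?L \<noteq> {}" by blast
  then obtain x where "x \<in> ?L" "x < \<epsilon>" using cInf_lessD[of ?L \<epsilon>] d unfolding SO_dist_def by blast
  then obtain \<gamma> \<gamma>' where g: "SO_C1_path m \<gamma> \<gamma>'" "\<gamma> 0 = X" "\<gamma> 1 = 1\<^sub>m m"
    "integral {0..1} (\<lambda>t. so_norm (transpose_mat (\<gamma> t) * \<gamma>' t)) < \<epsilon>" by blast
  have "\<bar>1\<^sub>m m $$ (i, j) - X $$ (i, j)\<bar> \<le> m * integral {0..1} (\<lambda>t. so_norm (transpose_mat (\<gamma> t) * \<gamma>' t))"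
    using SO_path_displacement[OF g(1) ij] g by simp
  also have "\<dots> \<le> m * \<epsilon>" using g(4) by (intro mult_left_mono) auto
  finally show ?thesis using ij by (simp add: abs_minus_commute)
qed

section \<open>Minkowski space and its isometries\<close>

declare sum.op_ivl_Suc [simp del]

text \<open>The determinant identity \<open>det (1 - U W) = det (1 - W U)\<close> in rank one, from two block triangular factorisations of
the same matrix. It yields the determinant of a reflection.\<close>

lemma det_one_minus_rank_one:
  fixes U W :: "real mat"
  assumes U: "U \<in> carrier_mat d 1" and W: "W \<in> carrier_mat 1 d"
  shows "det (1\<^sub>m d - U * W) = 1 - (W * U) $$ (0, 0)"
proof -
  let ?I1 = "1\<^sub>m 1 :: real mat" and ?Id = "1\<^sub>m d :: real mat"
  let ?Z = "0\<^sub>m 1 d :: real mat" and ?Z' = "0\<^sub>m d 1 :: real mat"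
  let ?L = "four_block_mat ?I1 ?Z U ?Id"
  have UW: "U * W \<in> carrier_mat d d" and WU: "W * U \<in> carrier_mat 1 1" using U W by auto
  have IUW: "?Id - U * W \<in> carrier_mat d d" by (rule minus_carrier_mat[OF UW])
  have IWU: "?I1 - W * U \<in> carrier_mat 1 1" by (rule minus_carrier_mat[OF WU])
  have cL: "?L \<in> carrier_mat (1 + d) (1 + d)" by (rule four_block_carrier_mat) auto
  have c1: "four_block_mat ?I1 W ?Z' (?Id - U * W) \<in> carrier_mat (1 + d) (1 + d)"
    using four_block_carrier_mat[OF one_carrier_mat IUW] .
  have c2: "four_block_mat (?I1 - W * U) W ?Z' ?Id \<in> carrier_mat (1 + d) (1 + d)"
    using four_block_carrier_mat[OF IWU one_carrier_mat] .
  have "?L * four_block_mat ?I1 W ?Z' (?Id - U * W)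
     = four_block_mat (?I1 * ?I1 + ?Z * ?Z') (?I1 * W + ?Z * (?Id - U * W)) (U * ?I1 + ?Id * ?Z') (U * W + ?Id * (?Id - U * W))"
    by (rule mult_four_block_mat[OF one_carrier_mat zero_carrier_mat U one_carrier_mat one_carrier_mat W zero_carrier_mat IUW])
  moreover have "?I1 * ?I1 + ?Z * ?Z' = ?I1" by (rule eq_matI) (auto simp: scalar_prod_def)
  moreover have "?I1 * W + ?Z * (?Id - U * W) = W"
  proof -
    have "?Z * (?Id - U * W) = 0\<^sub>m 1 d" by (rule left_mult_zero_mat[OF IUW])
    then show ?thesis using W by simp
  qed
  moreover have "U * ?I1 + ?Id * ?Z' = U" using U by simp
  moreover have "U * W + ?Id * (?Id - U * W) = ?Id"
  proof -
    have "?Id * (?Id - U * W) = ?Id - U * W" by (rule left_mult_one_mat[OF IUW])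
    moreover have "U * W + (?Id - U * W) = ?Id" by (rule eq_matI) (use U W in auto)
    ultimately show ?thesis by simp
  qed
  ultimately have e1: "?L * four_block_mat ?I1 W ?Z' (?Id - U * W) = four_block_mat ?I1 W U ?Id" by simp
  have "four_block_mat (?I1 - W * U) W ?Z' ?Id * ?L
     = four_block_mat ((?I1 - W * U) * ?I1 + W * U) ((?I1 - W * U) * ?Z + W * ?Id) (?Z' * ?I1 + ?Id * U) (?Z' * ?Z + ?Id * ?Id)"
    by (rule mult_four_block_mat[OF IWU W zero_carrier_mat one_carrier_mat one_carrier_mat zero_carrier_mat U one_carrier_mat])
  moreover have "(?I1 - W * U) * ?I1 + W * U = ?I1"
  proof -
    have "(?I1 - W * U) * ?I1 = ?I1 - W * U" by (rule right_mult_one_mat[OF IWU])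
    moreover have "(?I1 - W * U) + W * U = ?I1" by (rule eq_matI) (use U W in auto)
    ultimately show ?thesis by simp
  qed
  moreover have "(?I1 - W * U) * ?Z + W * ?Id = W"
  proof -
    have "(?I1 - W * U) * ?Z = 0\<^sub>m 1 d" by (rule right_mult_zero_mat[OF IWU])
    then show ?thesis using W by simp
  qed
  moreover have "?Z' * ?I1 + ?Id * U = U" using U by simp
  moreover have "?Z' * ?Z + ?Id * ?Id = ?Id" by simp
  ultimately have e2: "four_block_mat (?I1 - W * U) W ?Z' ?Id * ?L = four_block_mat ?I1 W U ?Id" by simp
  have d0: "det ?L = 1"
    using det_four_block_mat_upper_right_zero[OF one_carrier_mat refl U one_carrier_mat] by simp
  have d1: "det (four_block_mat ?I1 W ?Z' (?Id - U * W)) = det (?Id - U * W)"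
    using det_four_block_mat_lower_left_zero[OF one_carrier_mat W refl IUW] by simp
  have d2: "det (four_block_mat (?I1 - W * U) W ?Z' ?Id) = det (?I1 - W * U)"
    using det_four_block_mat_lower_left_zero[OF IWU W refl one_carrier_mat] by simp
  have "det (?I1 - W * U) = 1 - (W * U) $$ (0, 0)"
    using U W IWU by (simp add: det_single)
  then show ?thesis
    using det_mult[OF cL c1] det_mult[OF c2 cL] unfolding e1 e2 d0 d1 d2 by simp
qed

text \<open>The triangles live in the coordinates 0, 1, 2. At least one direction \<open>e 3\<close> normal to that plane is
needed to tell the two kinds of bends apart.\<close>

locale minkowski_space =
  fixes n :: nat
  assumes dim3: "3 \<le> n"
begin

abbreviation V :: "real vec set" where "V \<equiv> carrier_vec (Suc n)"

abbreviation e :: "nat \<Rightarrow> real vec" where "e \<equiv> unit_vec (Suc n)"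

lemma mink_eq: "v \<in> V \<Longrightarrow> mink u v = (\<Sum>i = 1..n. u $ i * v $ i) - u $ 0 * v $ 0"
  by (simp add: mink_def atLeastLessThanSuc_atLeastAtMost)

lemma mink_split:
  assumes "v \<in> V"
  shows "mink u v = u $ 1 * v $ 1 + u $ 2 * v $ 2 + (\<Sum>i = 3..n. u $ i * v $ i) - u $ 0 * v $ 0"
proof -
  have "{1..n} = {1, 2} \<union> {3..n}" using dim3 by auto
  moreover have "(\<Sum>i\<in>{1, 2} \<union> {3..n}. u $ i * v $ i) = (\<Sum>i\<in>{1, 2}. u $ i * v $ i) + (\<Sum>i = 3..n. u $ i * v $ i)"
    by (intro sum.union_disjoint) auto
  ultimately show ?thesis using assms by (simp add: mink_eq)
qed

lemma mink_commute: "u \<in> V \<Longrightarrow> v \<in> V \<Longrightarrow> mink u v = mink v u"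
  by (simp add: mink_eq mult.commute)

lemma mink_linear [simp]:
  assumes "a \<in> V" "c \<in> V"
  shows "b \<in> V \<Longrightarrow> mink (a + b) c = mink a c + mink b c" "b \<in> V \<Longrightarrow> mink (a - b) c = mink a c - mink b c"
    "mink (t \<cdot>\<^sub>v a) c = t * mink a c" "mink (- a) c = - mink a c"
    "b \<in> V \<Longrightarrow> mink c (a + b) = mink c a + mink c b" "b \<in> V \<Longrightarrow> mink c (a - b) = mink c a - mink c b"
    "mink c (t \<cdot>\<^sub>v a) = t * mink c a" "mink c (- a) = - mink c a"
  using assms
  by (simp_all add: mink_eq sum.distrib sum_subtractf sum_distrib_left sum_negf algebra_simps)

lemma mink_zero [simp]: "a \<in> V \<Longrightarrow> mink (0\<^sub>v (Suc n)) a = 0" "a \<in> V \<Longrightarrow> mink a (0\<^sub>v (Suc n)) = 0"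
  by (simp_all add: mink_eq)

lemma mink_e:
  assumes "u \<in> V" "k \<le> n"
  shows "mink (e k) u = (if k = 0 then - u $ 0 else u $ k)"
  using assms
  by (cases "k = 0") (auto simp: mink_eq unit_vec_def if_distrib[of "\<lambda>x. x * _"] cong: if_cong)

lemma mink_e_e: "j \<le> n \<Longrightarrow> k \<le> n \<Longrightarrow> mink (e j) (e k) = (if j = k then if j = 0 then - 1 else 1 else 0)"
  by (subst mink_e) auto

lemma vec_eq_by_mink:
  assumes "u \<in> V" "v \<in> V" "\<And>w. w \<in> V \<Longrightarrow> mink w u = mink w v"
  shows "u = v"
proof (rule eq_vecI)
  fix k assume "k < dim_vec v"
  then have "k \<le> n" using assms by auto
  then show "u $ k = v $ k" using assms(3)[of "e k"] assms(1,2) by (auto simp: mink_e split: if_splits)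
qed (use assms in auto)

subsection \<open>Adjoint and inverse\<close>

definition eta :: "nat \<Rightarrow> real" where "eta i = (if i = 0 then - 1 else 1)"

lemma eta_sq [simp]: "eta i * eta i = 1" by (simp add: eta_def)

lemma mink_eta: "v \<in> V \<Longrightarrow> mink u v = (\<Sum>i = 0..<Suc n. eta i * (u $ i * v $ i))"
proof -
  assume v: "v \<in> V"
  have "(\<Sum>i = 0..<Suc n. eta i * (u $ i * v $ i)) = eta 0 * (u $ 0 * v $ 0) + (\<Sum>i = 1..<Suc n. eta i * (u $ i * v $ i))"
    by (subst sum.atLeast_Suc_lessThan) auto
  also have "(\<Sum>i = 1..<Suc n. eta i * (u $ i * v $ i)) = (\<Sum>i = 1..<Suc n. u $ i * v $ i)"
    by (intro sum.cong) (auto simp: eta_def)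
  finally show ?thesis using v by (simp add: mink_eq eta_def atLeastLessThanSuc_atLeastAtMost)
qed

text \<open>The adjoint with respect to the Minkowski form, which on isometries is the inverse.\<close>

definition adj :: "real mat \<Rightarrow> real mat" where
  "adj A = mat (Suc n) (Suc n) (\<lambda>(i, j). eta i * (eta j * A $$ (j, i)))"

lemma adj_carrier [simp]: "adj A \<in> carrier_mat (Suc n) (Suc n)"
  by (simp add: adj_def)

lemma mult_mat_vec_entry:
  assumes "A \<in> carrier_mat (Suc n) (Suc n)" "v \<in> V" "i < Suc n"
  shows "(A *\<^sub>v v) $ i = (\<Sum>j = 0..<Suc n. A $$ (i, j) * v $ j)"
  using assms by (auto simp: scalar_prod_def)

lemma mink_adj:
  assumes A: "A \<in> carrier_mat (Suc n) (Suc n)" and u: "u \<in> V" and v: "v \<in> V"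
  shows "mink (A *\<^sub>v u) v = mink u (adj A *\<^sub>v v)"
proof -
  have "mink (A *\<^sub>v u) v = (\<Sum>i = 0..<Suc n. \<Sum>j = 0..<Suc n. eta i * (A $$ (i, j) * u $ j * v $ i))"
    unfolding mink_eta[OF v]
    by (intro sum.cong refl) (subst mult_mat_vec_entry[OF A u], auto simp: sum_distrib_left sum_distrib_right)
  also have "\<dots> = (\<Sum>j = 0..<Suc n. \<Sum>i = 0..<Suc n. eta i * (A $$ (i, j) * u $ j * v $ i))"
    by (rule sum.swap)
  also have "\<dots> = (\<Sum>j = 0..<Suc n. eta j * (u $ j * (adj A *\<^sub>v v) $ j))"
  proof (intro sum.cong refl)
    fix j assume j: "j \<in> {0..<Suc n}"
    have "eta j * (u $ j * (adj A *\<^sub>v v) $ j) = (\<Sum>i = 0..<Suc n. eta j * (u $ j * (eta j * (eta i * A $$ (i, j)) * v $ i)))"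
      using j v by (subst mult_mat_vec_entry[OF adj_carrier v]) (auto simp: sum_distrib_left adj_def)
    also have "\<dots> = (\<Sum>i = 0..<Suc n. eta i * (A $$ (i, j) * u $ j * v $ i))"
    proof (intro sum.cong refl)
      fix i
      have "eta j * (u $ j * (eta j * (eta i * A $$ (i, j)) * v $ i)) = (eta j * eta j) * (eta i * (A $$ (i, j) * u $ j * v $ i))"
        by (simp only: mult_ac)
      then show "eta j * (u $ j * (eta j * (eta i * A $$ (i, j)) * v $ i)) = eta i * (A $$ (i, j) * u $ j * v $ i)" by simp
    qed
    finally show "(\<Sum>i = 0..<Suc n. eta i * (A $$ (i, j) * u $ j * v $ i)) = eta j * (u $ j * (adj A *\<^sub>v v) $ j)" ..
  qed
  also have "\<dots> = mink u (adj A *\<^sub>v v)"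
    by (subst mink_eta) (use v in \<open>auto intro!: mult_mat_vec_carrier[OF adj_carrier]\<close>)
  finally show ?thesis .
qed

text \<open>The full Lorentz group: reflections, which reverse orientation or time, have to be included because
isometries are built from them.\<close>

definition Lor :: "real mat set" where
  "Lor = {A \<in> carrier_mat (Suc n) (Suc n). \<forall>u\<in>V. \<forall>v\<in>V. mink (A *\<^sub>v u) (A *\<^sub>v v) = mink u v}"

lemma Lor_carrier: "A \<in> Lor \<Longrightarrow> A \<in> carrier_mat (Suc n) (Suc n)" by (simp add: Lor_def)

lemma Lor_V [simp]: "A \<in> Lor \<Longrightarrow> v \<in> V \<Longrightarrow> A *\<^sub>v v \<in> V"
  by (auto simp: Lor_def)

lemma Lor_mink [simp]: "A \<in> Lor \<Longrightarrow> u \<in> V \<Longrightarrow> v \<in> V \<Longrightarrow> mink (A *\<^sub>v u) (A *\<^sub>v v) = mink u v"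
  by (auto simp: Lor_def)

lemma mat_eq_by_vec:
  assumes "A \<in> carrier_mat (Suc n) (Suc n)" "B \<in> carrier_mat (Suc n) (Suc n)" "\<And>v. v \<in> V \<Longrightarrow> A *\<^sub>v v = B *\<^sub>v v"
  shows "A = B"
proof (rule eq_matI)
  fix i j assume "i < dim_row B" "j < dim_col B"
  then have ij: "i < Suc n" "j < Suc n" using assms by auto
  have *: "(C *\<^sub>v e j) $ i = C $$ (i, j)" if "C \<in> carrier_mat (Suc n) (Suc n)" for C :: "real mat"
    using that ij by (subst mult_mat_vec_entry) (auto simp: unit_vec_def if_distrib[of "\<lambda>x. _ * x"] cong: if_cong)
  have "A *\<^sub>v e j = B *\<^sub>v e j" by (rule assms(3)) simp
  then show "A $$ (i, j) = B $$ (i, j)" using *[OF assms(1)] *[OF assms(2)] by metis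
qed (use assms in auto)

lemma Lor_adj_left:
  assumes "A \<in> Lor" shows "adj A * A = 1\<^sub>m (Suc n)"
proof (rule mat_eq_by_vec)
  fix v assume v: "v \<in> V"
  have "(adj A * A) *\<^sub>v v = adj A *\<^sub>v (A *\<^sub>v v)"
    by (rule assoc_mult_mat_vec[OF adj_carrier Lor_carrier[OF assms] v])
  also have "\<dots> = v"
  proof (rule vec_eq_by_mink)
    show "adj A *\<^sub>v (A *\<^sub>v v) \<in> V" using assms v by (intro mult_mat_vec_carrier[OF adj_carrier]) auto
    fix w assume "w \<in> V"
    then show "mink w (adj A *\<^sub>v (A *\<^sub>v v)) = mink w v"
      using assms v by (simp add: mink_adj[symmetric] Lor_carrier)
  qed (fact v)
  finally show "(adj A * A) *\<^sub>v v = 1\<^sub>m (Suc n) *\<^sub>v v" using v by simp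
qed (use mult_carrier_mat[OF adj_carrier[of A] Lor_carrier[OF assms]] in auto)

lemma Lor_adj_right: "A \<in> Lor \<Longrightarrow> A * adj A = 1\<^sub>m (Suc n)"
  by (rule mat_mult_left_right_inverse[OF adj_carrier Lor_carrier Lor_adj_left])

lemma Lor_adj_vec [simp]:
  assumes "A \<in> Lor" "v \<in> V" shows "adj A *\<^sub>v (A *\<^sub>v v) = v" "A *\<^sub>v (adj A *\<^sub>v v) = v"
  using assms assoc_mult_mat_vec[OF adj_carrier[of A] Lor_carrier[OF assms(1)] assms(2)]
    assoc_mult_mat_vec[OF Lor_carrier[OF assms(1)] adj_carrier[of A] assms(2)]
  by (simp_all add: Lor_adj_left Lor_adj_right)

lemma adj_Lor [simp]: "A \<in> Lor \<Longrightarrow> adj A \<in> Lor"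
  unfolding Lor_def[THEN set_eq_iff[THEN iffD1], rule_format, of "adj A"]
proof (intro CollectI conjI ballI)
  fix u v assume A: "A \<in> Lor" and u: "u \<in> V" and v: "v \<in> V"
  have "adj A *\<^sub>v u \<in> V" "adj A *\<^sub>v v \<in> V" using u v by (auto intro!: mult_mat_vec_carrier[OF adj_carrier])
  then show "mink (adj A *\<^sub>v u) (adj A *\<^sub>v v) = mink u v"
    using Lor_mink[OF A, of "adj A *\<^sub>v u" "adj A *\<^sub>v v"] A u v by simp
qed simp

lemma Lor_mult [simp]: "A \<in> Lor \<Longrightarrow> B \<in> Lor \<Longrightarrow> A * B \<in> Lor"
  unfolding Lor_def[THEN set_eq_iff[THEN iffD1], rule_format, of "A * B"]
  using Lor_carrier[of A] Lor_carrier[of B]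
  by (auto simp: assoc_mult_mat_vec[where n\<^sub>1="Suc n" and n\<^sub>2="Suc n" and n\<^sub>3="Suc n"])

lemma Lor_mult_vec [simp]: "A \<in> Lor \<Longrightarrow> B \<in> Lor \<Longrightarrow> v \<in> V \<Longrightarrow> (A * B) *\<^sub>v v = A *\<^sub>v (B *\<^sub>v v)"
  by (rule assoc_mult_mat_vec[OF Lor_carrier Lor_carrier])

lemma Lor_one [simp]: "1\<^sub>m (Suc n) \<in> Lor" by (simp add: Lor_def)

lemma Lor_eqI: "A \<in> Lor \<Longrightarrow> B \<in> Lor \<Longrightarrow> (\<And>v. v \<in> V \<Longrightarrow> A *\<^sub>v v = B *\<^sub>v v) \<Longrightarrow> A = B"
  by (rule mat_eq_by_vec[OF Lor_carrier Lor_carrier])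

lemma Lor_move: "A \<in> Lor \<Longrightarrow> u \<in> V \<Longrightarrow> v \<in> V \<Longrightarrow> mink u (A *\<^sub>v v) = mink (adj A *\<^sub>v u) v"
  using Lor_mink[of A "adj A *\<^sub>v u" v] by simp

lemma Lor_det_sq: 
  assumes "A \<in> Lor" shows "det A * det A = 1"
proof -
  let ?E = "mat_diag (Suc n) eta"
  have c: "A \<in> carrier_mat (Suc n) (Suc n)" using assms by (rule Lor_carrier)
  have E: "?E \<in> carrier_mat (Suc n) (Suc n)" by simp
  have "adj A = ?E * (transpose_mat A * ?E)"
    using c by (intro eq_matI) (auto simp: adj_def mat_diag_mult_left[where n="Suc n" and nr="Suc n"]
      mat_diag_mult_right[where n="Suc n" and nr="Suc n"])
  moreover have "?E * ?E = 1\<^sub>m (Suc n)"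
    by (subst mat_diag_diag) (auto simp: mat_diag_def one_mat_def intro!: eq_matI)
  then have "det ?E * det ?E = 1" using det_mult[OF E E] by simp
  ultimately have "det (adj A) = det A"
    using c E by (simp add: det_mult[where n="Suc n"] det_transpose[where n="Suc n"] mult_ac)
  then show ?thesis using det_mult[OF adj_carrier[of A] c] Lor_adj_left[OF assms] by simp
qed

subsection \<open>Time orientation\<close>

lemma hyp_V: "p \<in> hyp n \<Longrightarrow> p \<in> V" by (simp add: hyp_def)

lemma hyp_mink: "p \<in> hyp n \<Longrightarrow> mink p p = - 1" by (simp add: hyp_def)

text \<open>The reversed Cauchy-Schwarz inequality for causal vectors pointing to the future.\<close>

lemma causal_mink:
  assumes "u \<in> V" "v \<in> V" "mink u u \<le> 0" "mink v v \<le> 0" "u $ 0 > 0" "v $ 0 > 0"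
  shows "mink u v \<le> 0" and "mink u u < 0 \<Longrightarrow> mink u v < 0"
proof -
  define su sv where "su = (\<Sum>i = 1..n. (u $ i)\<^sup>2)" and "sv = (\<Sum>i = 1..n. (v $ i)\<^sup>2)"
  have s0: "su \<ge> 0" "sv \<ge> 0" by (simp_all add: su_def sv_def sum_nonneg)
  have su: "mink u u = su - (u $ 0)\<^sup>2" and sv: "mink v v = sv - (v $ 0)\<^sup>2"
    using assms by (simp_all add: mink_eq power2_eq_square su_def sv_def)
  have le: "(\<Sum>i = 1..n. u $ i * v $ i)\<^sup>2 \<le> su * sv" unfolding su_def sv_def by (rule Cauchy_Schwarz_ineq_sum)
  also have "\<dots> \<le> (u $ 0)\<^sup>2 * (v $ 0)\<^sup>2" using su sv s0 assms by (intro mult_mono) auto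
  finally have "(\<Sum>i = 1..n. u $ i * v $ i)\<^sup>2 \<le> (u $ 0 * v $ 0)\<^sup>2" by (simp add: power_mult_distrib)
  then have "(\<Sum>i = 1..n. u $ i * v $ i) \<le> u $ 0 * v $ 0" by (rule power2_le_imp_le) (use assms in auto)
  then show "mink u v \<le> 0" using assms by (simp add: mink_eq)
  assume "mink u u < 0"
  then have "su < (u $ 0)\<^sup>2" "sv \<le> (v $ 0)\<^sup>2" using su sv assms by auto
  then have "su * sv \<le> su * (v $ 0)\<^sup>2" "su * (v $ 0)\<^sup>2 < (u $ 0)\<^sup>2 * (v $ 0)\<^sup>2"
    using s0 assms by (auto intro: mult_left_mono)
  then have "su * sv < (u $ 0)\<^sup>2 * (v $ 0)\<^sup>2" by simp
  then have "(\<Sum>i = 1..n. u $ i * v $ i)\<^sup>2 < (u $ 0 * v $ 0)\<^sup>2" using le by (simp add: power_mult_distrib)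
  then have "(\<Sum>i = 1..n. u $ i * v $ i) < u $ 0 * v $ 0" by (rule power2_less_imp_less) (use assms in auto)
  then show "mink u v < 0" using assms by (simp add: mink_eq)
qed

lemma causal_time_nonzero:
  assumes "v \<in> V" "mink v v \<le> 0" "v \<noteq> 0\<^sub>v (Suc n)" shows "v $ 0 \<noteq> 0"
proof
  assume 0: "v $ 0 = 0"
  then have "(\<Sum>i = 1..n. (v $ i)\<^sup>2) = 0"
    using assms(1,2) sum_nonneg[of "{1..n}" "\<lambda>i. (v $ i)\<^sup>2"] by (simp add: mink_eq power2_eq_square)
  then have "\<forall>i\<in>{1..n}. v $ i = 0" by (subst (asm) sum_nonneg_eq_0_iff) auto
  then have "v = 0\<^sub>v (Suc n)" using 0 assms(1)
    by (intro eq_vecI) (auto, metis One_nat_def Suc_leI atLeastAtMost_iff bot_nat_0.not_eq_extremum less_Suc_eq_le)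
  then show False using assms(3) by simp
qed

lemma future_by_causal:
  assumes p: "p \<in> V" "mink p p \<le> 0" "p $ 0 > 0" and v: "v \<in> V" "mink v v \<le> 0" "mink v p < 0"
  shows "v $ 0 > 0"
proof (rule ccontr)
  assume "\<not> v $ 0 > 0"
  moreover have "v $ 0 \<noteq> 0" by (rule causal_time_nonzero) (use v p in auto)
  ultimately have "v $ 0 < 0" by simp
  then have "(- v) $ 0 > 0" using v by simp
  have "mink (- v) p \<le> 0"
    by (rule causal_mink(1)[OF _ _ _ _ \<open>(- v) $ 0 > 0\<close>]) (use p v in auto)
  then show False using v p by simp
qed

lemma future_by_mink:
  assumes p: "p \<in> hyp n" and v: "v \<in> V" "mink v v \<le> 0" "mink v p < 0"
  shows "v $ 0 > 0"
  by (rule future_by_causal[OF _ _ _ v]) (use p in \<open>auto simp: hyp_def\<close>)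

lemma hyp_mink_less: "p \<in> hyp n \<Longrightarrow> q \<in> hyp n \<Longrightarrow> mink p q < 0"
  by (rule causal_mink(2)) (auto simp: hyp_def)

lemma hyp_by_mink:
  assumes "p \<in> hyp n" "v \<in> V" "mink v v = - 1" "mink v p < 0"
  shows "v \<in> hyp n"
  using future_by_mink[of p v] assms by (simp add: hyp_def)

abbreviation Isom :: "real mat set" where "Isom \<equiv> carrier (hyp_isom n)"

text \<open>A single point suffices to test the time direction, because two unit timelike vectors lie on the same
sheet exactly if their product is negative.\<close>

lemma Isom_iff:
  assumes p: "p \<in> hyp n"
  shows "A \<in> Isom \<longleftrightarrow> A \<in> Lor \<and> A *\<^sub>v p \<in> hyp n \<and> det A = 1"
proof -
  have "A *\<^sub>v x \<in> hyp n" if A: "A \<in> Lor" "A *\<^sub>v p \<in> hyp n" and x: "x \<in> hyp n" for x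
    by (rule hyp_by_mink[OF A(2)]) (use A x p hyp_mink_less[OF x p] in \<open>auto simp: hyp_V hyp_mink\<close>)
  then show ?thesis using p by (auto simp: hyp_isom_def Lor_def)
qed

lemma e0_hyp: "e 0 \<in> hyp n" by (simp add: hyp_def mink_e_e)

lemma Isom_Lor [simp]: "A \<in> Isom \<Longrightarrow> A \<in> Lor" using Isom_iff[OF e0_hyp] by blast

lemma Isom_hyp: "A \<in> Isom \<Longrightarrow> p \<in> hyp n \<Longrightarrow> A *\<^sub>v p \<in> hyp n" by (auto simp: hyp_isom_def)

lemma Isom_det: "A \<in> Isom \<Longrightarrow> det A = 1" by (auto simp: hyp_isom_def)

lemma Isom_mult [simp]:
  assumes "A \<in> Isom" "B \<in> Isom" shows "A * B \<in> Isom"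
  unfolding Isom_iff[OF e0_hyp]
  using assms e0_hyp Isom_hyp[OF assms(1) Isom_hyp[OF assms(2) e0_hyp]]
  by (auto simp: det_mult[OF Lor_carrier Lor_carrier] Isom_det)

lemma Isom_one [simp]: "1\<^sub>m (Suc n) \<in> Isom"
  unfolding Isom_iff[OF e0_hyp] using e0_hyp by simp

lemma Isom_adj [simp]:
  assumes A: "A \<in> Isom" shows "adj A \<in> Isom"
  unfolding Isom_iff[OF e0_hyp]
proof (intro conjI)
  have "mink (adj A *\<^sub>v e 0) (e 0) < 0"
    using A hyp_mink_less[OF e0_hyp Isom_hyp[OF A e0_hyp]] by (simp add: Lor_move)
  then show "adj A *\<^sub>v e 0 \<in> hyp n"
    using A by (intro hyp_by_mink[OF e0_hyp]) (auto simp: mink_e_e)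
  show "det (adj A) = 1" using det_mult[OF adj_carrier Lor_carrier, of A A] A Isom_det[OF A] by (simp add: Lor_adj_left)
qed (use A in simp)

lemma hyp_isom_simps: "A \<otimes>\<^bsub>hyp_isom n\<^esub> B = A * B" "\<one>\<^bsub>hyp_isom n\<^esub> = 1\<^sub>m (Suc n)"
  by (simp_all add: hyp_isom_def)

lemma group_hyp_isom: "group (hyp_isom n)"
proof (rule groupI)
  fix A assume "A \<in> Isom"
  then show "\<exists>B\<in>Isom. B \<otimes>\<^bsub>hyp_isom n\<^esub> A = \<one>\<^bsub>hyp_isom n\<^esub>"
    by (intro bexI[of _ "adj A"]) (auto simp: hyp_isom_simps Lor_adj_left)
next
  fix A B C assume "A \<in> Isom" "B \<in> Isom" "C \<in> Isom"
  then have "A \<in> Lor" "B \<in> Lor" "C \<in> Lor" by auto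
  then show "A \<otimes>\<^bsub>hyp_isom n\<^esub> B \<otimes>\<^bsub>hyp_isom n\<^esub> C = A \<otimes>\<^bsub>hyp_isom n\<^esub> (B \<otimes>\<^bsub>hyp_isom n\<^esub> C)"
    by (auto simp: hyp_isom_simps intro: assoc_mult_mat dest!: Lor_carrier)
next
  fix A assume "A \<in> Isom"
  then show "\<one>\<^bsub>hyp_isom n\<^esub> \<otimes>\<^bsub>hyp_isom n\<^esub> A = A" using Lor_carrier[of A] by (simp add: hyp_isom_simps)
qed (auto simp: hyp_isom_simps)

lemma hyp_isom_inv: "A \<in> Isom \<Longrightarrow> inv\<^bsub>hyp_isom n\<^esub> A = adj A"
  using group.inv_equality[OF group_hyp_isom, of "adj A" A] by (simp add: hyp_isom_simps Lor_adj_left)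

subsection \<open>Reflections\<close>

text \<open>The reflection in the hyperplane Minkowski-orthogonal to \<open>z\<close>, meaningful if \<open>z\<close> is not null.\<close>

definition mrefl :: "real vec \<Rightarrow> real mat" where
  "mrefl z = mat (Suc n) (Suc n) (\<lambda>(i, j). (if i = j then 1 else 0) - z $ i * (2 / mink z z * (eta j * z $ j)))"

lemma mrefl_carrier: "mrefl z \<in> carrier_mat (Suc n) (Suc n)" by (simp add: mrefl_def)

lemma mrefl_vec:
  assumes z: "z \<in> V" and x: "x \<in> V"
  shows "mrefl z *\<^sub>v x = x - (2 * mink z x / mink z z) \<cdot>\<^sub>v z"
proof (rule eq_vecI)
  fix i assume "i < dim_vec (x - (2 * mink z x / mink z z) \<cdot>\<^sub>v z)"
  then have i: "i < Suc n" using z by auto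
  have "(mrefl z *\<^sub>v x) $ i = (\<Sum>j = 0..<Suc n. (if j = i then x $ j else 0) - z $ i * 2 / mink z z * (eta j * (z $ j * x $ j)))"
    unfolding mult_mat_vec_entry[OF mrefl_carrier x i]
    by (intro sum.cong) (use i in \<open>auto simp: mrefl_def algebra_simps\<close>)
  also have "\<dots> = x $ i - z $ i * 2 / mink z z * mink z x"
    using i x by (simp only: sum_subtractf mink_eta[OF x] sum_distrib_left) simp
  finally show "(mrefl z *\<^sub>v x) $ i = (x - (2 * mink z x / mink z z) \<cdot>\<^sub>v z) $ i"
    using i z x by simp
qed (use z x in \<open>auto simp: mrefl_def\<close>)

lemma mrefl_Lor:
  assumes z: "z \<in> V" and nz: "mink z z \<noteq> 0" shows "mrefl z \<in> Lor"
  unfolding Lor_def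
proof (intro CollectI conjI ballI mrefl_carrier)
  fix u v assume u: "u \<in> V" and v: "v \<in> V"
  have "mink u z = mink z u" using u z by (rule mink_commute)
  then show "mink (mrefl z *\<^sub>v u) (mrefl z *\<^sub>v v) = mink u v"
    using z u v nz by (simp add: mrefl_vec field_simps)
qed

lemma mrefl_det:
  assumes z: "z \<in> V" and nz: "mink z z \<noteq> 0" shows "det (mrefl z) = - 1"
proof -
  let ?U = "mat (Suc n) 1 (\<lambda>(i, j). z $ i)" and ?W = "mat 1 (Suc n) (\<lambda>(i, j). 2 / mink z z * (eta j * z $ j))"
  have "mrefl z = 1\<^sub>m (Suc n) - ?U * ?W"
    by (rule eq_matI) (auto simp: mrefl_def scalar_prod_def)
  moreover have "(?W * ?U) $$ (0, 0) = 2 / mink z z * mink z z"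
  proof -
    have "(?W * ?U) $$ (0, 0) = (\<Sum>j = 0..<Suc n. 2 / mink z z * (eta j * (z $ j * z $ j)))"
      by (auto simp: scalar_prod_def mult.assoc intro!: sum.cong)
    then show ?thesis unfolding sum_distrib_left[symmetric] mink_eta[OF z, of z, symmetric] .
  qed
  ultimately show ?thesis using det_one_minus_rank_one[of ?U "Suc n" ?W] nz by simp
qed

section \<open>Frames and rotations\<close>

definition Rot :: "real \<Rightarrow> real mat" where
  "Rot \<theta> = mat (Suc n) (Suc n) (\<lambda>(i, j). if i = 1 \<and> j = 1 \<or> i = 2 \<and> j = 2 then cos \<theta>
     else if i = 1 \<and> j = 2 then - sin \<theta> else if i = 2 \<and> j = 1 then sin \<theta>
     else if i = j then 1 else 0)"

lemma Rot_carrier: "Rot \<theta> \<in> carrier_mat (Suc n) (Suc n)" by (simp add: Rot_def)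

lemma sum_two_deltas:
  fixes f :: "nat \<Rightarrow> real"
  shows "p < m \<Longrightarrow> q < m \<Longrightarrow> p \<noteq> q \<Longrightarrow>
    (\<Sum>j = 0..<m. (if j = p then a else if j = q then b else 0) * f j) = a * f p + b * f q"
proof -
  assume pq: "p < m" "q < m" "p \<noteq> q"
  have "(\<Sum>j = 0..<m. (if j = p then a else if j = q then b else 0) * f j)
    = (\<Sum>j = 0..<m. (if j = p then a * f p else 0) + (if j = q then b * f q else 0))"
    by (intro sum.cong) (use pq in auto)
  also have "\<dots> = a * f p + b * f q" using pq by (simp add: sum.distrib)
  finally show ?thesis .
qed

lemma Rot_vec:
  assumes x: "x \<in> V"
  shows "Rot \<theta> *\<^sub>v x = vec (Suc n) (\<lambda>i. if i = 1 then cos \<theta> * x $ 1 - sin \<theta> * x $ 2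
    else if i = 2 then sin \<theta> * x $ 1 + cos \<theta> * x $ 2 else x $ i)"
proof (rule eq_vecI)
  fix i assume "i < dim_vec (vec (Suc n) (\<lambda>i. if i = 1 then cos \<theta> * x $ 1 - sin \<theta> * x $ 2
    else if i = 2 then sin \<theta> * x $ 1 + cos \<theta> * x $ 2 else x $ i))"
  then have i: "i < Suc n" by simp
  have lt: "1 < Suc n" "2 < Suc n" using dim3 by auto
  have "(Rot \<theta> *\<^sub>v x) $ i = (\<Sum>j = 0..<Suc n. Rot \<theta> $$ (i, j) * x $ j)"
    by (rule mult_mat_vec_entry[OF Rot_carrier x i])
  also have "\<dots> = (if i = 1 then cos \<theta> * x $ 1 + (- sin \<theta>) * x $ 2
    else if i = 2 then sin \<theta> * x $ 1 + cos \<theta> * x $ 2 else x $ i)"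
  proof -
    consider "i = 1" | "i = 2" | "i \<noteq> 1" "i \<noteq> 2" by blast
    then show ?thesis
    proof cases
      case 1
      have "(\<Sum>j = 0..<Suc n. Rot \<theta> $$ (i, j) * x $ j)
          = (\<Sum>j = 0..<Suc n. (if j = 1 then cos \<theta> else if j = 2 then - sin \<theta> else 0) * x $ j)"
        by (intro sum.cong) (use 1 lt in \<open>auto simp: Rot_def\<close>)
      then show ?thesis using 1 sum_two_deltas[OF lt, of "cos \<theta>" "- sin \<theta>" "vec_index x"] by simp
    next
      case 2
      have "(\<Sum>j = 0..<Suc n. Rot \<theta> $$ (i, j) * x $ j)
          = (\<Sum>j = 0..<Suc n. (if j = 1 then sin \<theta> else if j = 2 then cos \<theta> else 0) * x $ j)"
        by (intro sum.cong) (use 2 lt in \<open>auto simp: Rot_def\<close>)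
      then show ?thesis using 2 sum_two_deltas[OF lt, of "sin \<theta>" "cos \<theta>" "vec_index x"] by simp
    next
      case 3
      have "(\<Sum>j = 0..<Suc n. Rot \<theta> $$ (i, j) * x $ j) = (\<Sum>j = 0..<Suc n. if j = i then x $ j else 0)"
        by (intro sum.cong) (use 3 i in \<open>auto simp: Rot_def\<close>)
      then show ?thesis using 3 i by simp
    qed
  qed
  finally show "(Rot \<theta> *\<^sub>v x) $ i = vec (Suc n) (\<lambda>i. if i = 1 then cos \<theta> * x $ 1 - sin \<theta> * x $ 2
    else if i = 2 then sin \<theta> * x $ 1 + cos \<theta> * x $ 2 else x $ i) $ i"
    using i by simp
qed (simp add: Rot_def)

lemma Rot_add: "Rot (\<theta> + \<phi>) = Rot \<theta> * Rot \<phi>"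
proof (rule mat_eq_by_vec)
  fix v assume v: "v \<in> V"
  have lt: "1 < Suc n" "2 < Suc n" using dim3 by auto
  have "(Rot \<theta> * Rot \<phi>) *\<^sub>v v = Rot \<theta> *\<^sub>v (Rot \<phi> *\<^sub>v v)"
    by (rule assoc_mult_mat_vec[OF Rot_carrier Rot_carrier v])
  also have "\<dots> = Rot (\<theta> + \<phi>) *\<^sub>v v"
    using lt by (subst (1 2 3) Rot_vec) (auto simp: v Rot_vec cos_add sin_add algebra_simps intro!: eq_vecI)
  finally show "Rot (\<theta> + \<phi>) *\<^sub>v v = (Rot \<theta> * Rot \<phi>) *\<^sub>v v" ..
qed (use mult_carrier_mat[OF Rot_carrier Rot_carrier] Rot_carrier in auto)

lemma Rot_Lor [simp]: "Rot \<theta> \<in> Lor"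
  unfolding Lor_def
proof (intro CollectI conjI ballI Rot_carrier)
  fix u v assume u: "u \<in> V" and v: "v \<in> V"
  have lt: "1 < Suc n" "2 < Suc n" using dim3 by auto
  let ?c = "cos \<theta>" and ?s = "sin \<theta>"
  have "mink (Rot \<theta> *\<^sub>v u) (Rot \<theta> *\<^sub>v v) = (?c * u $ 1 - ?s * u $ 2) * (?c * v $ 1 - ?s * v $ 2)
     + (?s * u $ 1 + ?c * u $ 2) * (?s * v $ 1 + ?c * v $ 2) + (\<Sum>i = 3..n. u $ i * v $ i) - u $ 0 * v $ 0"
    using lt by (subst mink_split) (auto simp: Rot_vec u v)
  also have "(?c * u $ 1 - ?s * u $ 2) * (?c * v $ 1 - ?s * v $ 2)
     + (?s * u $ 1 + ?c * u $ 2) * (?s * v $ 1 + ?c * v $ 2) = (?c\<^sup>2 + ?s\<^sup>2) * (u $ 1 * v $ 1 + u $ 2 * v $ 2)"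
    unfolding power2_eq_square by (simp add: algebra_simps del: sin_cos_squared_add3)
  finally show "mink (Rot \<theta> *\<^sub>v u) (Rot \<theta> *\<^sub>v v) = mink u v"
    unfolding mink_split[OF v, of u] by (simp only: sin_cos_squared_add2) simp
qed

lemma Rot_Isom [simp]: "Rot \<theta> \<in> Isom"
proof -
  have "det (Rot \<theta>) = det (Rot (\<theta>/2)) * det (Rot (\<theta>/2))"
    using Rot_add[of "\<theta>/2" "\<theta>/2"] det_mult[OF Rot_carrier Rot_carrier] by simp
  then have "det (Rot \<theta>) = 1" using Lor_det_sq[of "Rot (\<theta>/2)"] by simp
  moreover have "Rot \<theta> *\<^sub>v e 0 = e 0" using dim3 by (auto simp: Rot_vec intro!: eq_vecI)
  ultimately show ?thesis unfolding Isom_iff[OF e0_hyp] using e0_hyp by simp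
qed

lemma Rot_e: 
  shows "Rot \<theta> *\<^sub>v e 1 = cos \<theta> \<cdot>\<^sub>v e 1 + sin \<theta> \<cdot>\<^sub>v e 2"
    and "Rot \<theta> *\<^sub>v e 2 = cos \<theta> \<cdot>\<^sub>v e 2 - sin \<theta> \<cdot>\<^sub>v e 1"
    and "k = 0 \<or> 3 \<le> k \<Longrightarrow> k \<le> n \<Longrightarrow> Rot \<theta> *\<^sub>v e k = e k"
  using dim3 by (auto simp: Rot_vec intro!: eq_vecI)

text \<open>Every positive orthonormal frame has this form for a unique isometry (lemma \<open>frame_matrix\<close>), so
frames can be handled as isometries.\<close>

definition frame_of :: "real mat \<Rightarrow> real vec list" where
  "frame_of H = map (\<lambda>j. H *\<^sub>v e (Suc j)) [0..<n]"

lemma frame_of_nth: "j < n \<Longrightarrow> frame_of H ! j = H *\<^sub>v e (Suc j)" by (simp add: frame_of_def)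

lemma length_frame_of [simp]: "length (frame_of H) = n" by (simp add: frame_of_def)

lemma mat_vec_e:
  assumes "H \<in> carrier_mat (Suc n) (Suc n)" "j \<le> n" "i \<le> n"
  shows "(H *\<^sub>v e j) $ i = H $$ (i, j)"
  using assms by (subst mult_mat_vec_entry) (auto simp: unit_vec_def if_distrib[of "\<lambda>x. _ * x"] cong: if_cong)

lemma Lor_entry: 
  assumes "A \<in> Lor" "i \<le> n" "j \<le> n" shows "A $$ (i, j) = eta i * mink (e i) (A *\<^sub>v e j)"
  using assms mat_vec_e[OF Lor_carrier[OF assms(1)] assms(3,2)]
  by (cases "i = 0") (simp_all add: mink_e eta_def del: index_mult_mat_vec)

lemma mat_of_cols_frame_of:
  assumes "H \<in> Lor" shows "mat_of_cols (Suc n) ((H *\<^sub>v e 0) # frame_of H) = H"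
proof (rule eq_matI)
  fix i j assume "i < dim_row H" "j < dim_col H"
  then have ij: "i \<le> n" "j \<le> n" using Lor_carrier[OF assms] by auto
  then show "mat_of_cols (Suc n) ((H *\<^sub>v e 0) # frame_of H) $$ (i, j) = H $$ (i, j)"
    using mat_vec_e[OF Lor_carrier[OF assms], of j i] 
    by (cases j) (auto simp: mat_of_cols_index frame_of_nth)
qed (use Lor_carrier[OF assms] in auto)

lemma pos_frame_frame_of:
  assumes H: "H \<in> Isom" shows "pos_frame n (H *\<^sub>v e 0) (frame_of H)"
  using H Isom_det[OF H] mat_of_cols_frame_of[of H]
  by (auto simp: pos_frame_def frame_of_def tangent_def mink_e_e)

lemma Lor_by_basis:
  assumes A: "A \<in> carrier_mat (Suc n) (Suc n)"
    and b: "\<And>i j. i \<le> n \<Longrightarrow> j \<le> n \<Longrightarrow> mink (A *\<^sub>v e i) (A *\<^sub>v e j) = mink (e i) (e j)"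
  shows "A \<in> Lor"
proof -
  have "adj A * A = 1\<^sub>m (Suc n)"
  proof (rule eq_matI)
    fix i j assume "i < dim_row (1\<^sub>m (Suc n) :: real mat)" "j < dim_col (1\<^sub>m (Suc n) :: real mat)"
    then have ij: "i < Suc n" "j < Suc n" by auto
    have c: "A *\<^sub>v e j \<in> V" using A by simp
    have "(adj A * A) $$ (i, j) = (\<Sum>r = 0..<Suc n. adj A $$ (i, r) * A $$ (r, j))"
      by (rule mult_mat_entry[OF adj_carrier A ij])
    also have "\<dots> = (\<Sum>r = 0..<Suc n. eta i * (eta r * ((A *\<^sub>v e i) $ r * (A *\<^sub>v e j) $ r)))"
      by (intro sum.cong refl) (use ij A in \<open>simp add: adj_def mat_vec_e del: index_mult_mat_vec\<close>)
    also have "\<dots> = eta i * mink (A *\<^sub>v e i) (A *\<^sub>v e j)"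
      by (simp add: mink_eta[OF c] sum_distrib_left del: index_mult_mat_vec)
    also have "\<dots> = 1\<^sub>m (Suc n) $$ (i, j)" using ij by (simp add: b mink_e_e eta_def)
    finally show "(adj A * A) $$ (i, j) = 1\<^sub>m (Suc n) $$ (i, j)" .
  qed (use A carrier_matD[OF adj_carrier[of A]] in auto)
  then have "mink (A *\<^sub>v u) (A *\<^sub>v v) = mink u v" if "u \<in> V" "v \<in> V" for u v
    using that A assoc_mult_mat_vec[OF adj_carrier[of A] A, of v] by (subst mink_adj[OF A]) auto
  then show ?thesis using A by (simp add: Lor_def)
qed

lemma frame_matrix:
  assumes pf: "pos_frame n p es" and p: "p \<in> hyp n"
  obtains H where "H \<in> Isom" "H *\<^sub>v e 0 = p" "frame_of H = es"
proof -
  let ?cs = "p # es"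
  define H where "H = mat_of_cols (Suc n) ?cs"
  have len: "length es = n" and es: "\<And>i. i < n \<Longrightarrow> es ! i \<in> V \<and> mink p (es ! i) = 0"
    and on: "\<And>i j. i < n \<Longrightarrow> j < n \<Longrightarrow> mink (es ! i) (es ! j) = (if i = j then 1 else 0)"
    and dt: "det H > 0"
    using pf by (auto simp: pos_frame_def tangent_def H_def dest!: nth_mem)
  have pV: "p \<in> V" using p by (rule hyp_V)
  have Hc: "H \<in> carrier_mat (Suc n) (Suc n)" using mat_of_cols_carrier(1)[of "Suc n" "p # es"] by (simp add: H_def len)
  have col: "H *\<^sub>v e j = ?cs ! j" if "j \<le> n" for j
  proof (rule eq_vecI)
    have cV: "?cs ! j \<in> V" using that pV es len by (cases j) auto
    then show "dim_vec (H *\<^sub>v e j) = dim_vec (?cs ! j)" using Hc by simp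
    fix i assume "i < dim_vec (?cs ! j)"
    then have "i \<le> n" using cV by auto
    then show "(H *\<^sub>v e j) $ i = ?cs ! j $ i"
      using that len by (simp add: mat_vec_e[OF Hc] del: index_mult_mat_vec) (simp add: H_def mat_of_cols_index)
  qed
  have HL: "H \<in> Lor"
  proof (rule Lor_by_basis[OF Hc])
    fix i j assume "i \<le> n" "j \<le> n"
    then show "mink (H *\<^sub>v e i) (H *\<^sub>v e j) = mink (e i) (e j)"
      using pV es on hyp_mink[OF p] mink_commute[OF _ pV, of "es ! (i - 1)"]
      by (cases i; cases j) (auto simp: col mink_e_e)
  qed
  have "det H = 1" using Lor_det_sq[OF HL] dt by (simp add: square_eq_1_iff)
  then have "H \<in> Isom" unfolding Isom_iff[OF e0_hyp] using HL p col[of 0] by simp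
  moreover have "frame_of H = es" by (rule nth_equalityI) (auto simp: len frame_of_nth col)
  ultimately show ?thesis using that[of H] col[of 0] by simp
qed

text \<open>On frames, multiplying by an isometry \<open>Y\<close> on the right is the right action. If \<open>Y\<close> fixes \<open>e 0\<close>, the
base point stays the same and the spatial block of \<open>Y\<close> is the matrix of the action.\<close>

lemma frame_of_change:
  assumes H: "H \<in> Lor" and Y: "Y \<in> Isom" and Y0: "Y *\<^sub>v e 0 = e 0"
  defines "X \<equiv> mat n n (\<lambda>(i, j). Y $$ (Suc i, Suc j))"
  shows "X \<in> SO n" and "transforms_frame n X (frame_of H) (frame_of (H * Y))"
proof -
  have YL: "Y \<in> Lor" and Yc: "Y \<in> carrier_mat (Suc n) (Suc n)" and Hc: "H \<in> carrier_mat (Suc n) (Suc n)"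
    using Y H by (auto simp: Lor_carrier)
  have row0: "Y $$ (0, Suc j) = 0" if "j < n" for j
  proof -
    have "mink (Y *\<^sub>v e 0) (Y *\<^sub>v e (Suc j)) = 0" using YL that by (subst Lor_mink) (auto simp: mink_e_e)
    then show ?thesis using that Lor_entry[OF YL, of 0 "Suc j"] Y0 by simp
  qed
  have col0: "Y $$ (i, 0) = (if i = 0 then 1 else 0)" if "i \<le> n" for i
    using mat_vec_e[OF Yc, of 0 i] that Y0 by auto
  have Xc: "X \<in> carrier_mat n n" by (simp add: X_def)
  have "transpose_mat X * X = 1\<^sub>m n"
  proof (rule eq_matI)
    fix i j assume "i < dim_row (1\<^sub>m n :: real mat)" "j < dim_col (1\<^sub>m n :: real mat)"
    then have ij: "i < n" "j < n" by auto
    have "(transpose_mat X * X) $$ (i, j) = (\<Sum>r = 0..<n. Y $$ (Suc r, Suc i) * Y $$ (Suc r, Suc j))"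
      unfolding transpose_mult_entry[OF Xc Xc ij] by (intro sum.cong) (use ij in \<open>auto simp: X_def\<close>)
    also have "\<dots> = (\<Sum>r = 1..n. (Y *\<^sub>v e (Suc i)) $ r * (Y *\<^sub>v e (Suc j)) $ r)"
      unfolding sum.atLeast_Suc_atMost_Suc_shift[symmetric] 
      by (rule sum.reindex_bij_witness[of _ "\<lambda>r. r - 1" Suc]) (use ij in \<open>auto simp: mat_vec_e[OF Yc] simp del: index_mult_mat_vec\<close>)
    also have "\<dots> = mink (Y *\<^sub>v e (Suc i)) (Y *\<^sub>v e (Suc j))"
      using ij YL row0 by (subst mink_eq) (auto simp: mat_vec_e[OF Yc] simp del: index_mult_mat_vec)
    also have "\<dots> = 1\<^sub>m n $$ (i, j)" using ij YL by (subst Lor_mink) (auto simp: mink_e_e)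
    finally show "(transpose_mat X * X) $$ (i, j) = 1\<^sub>m n $$ (i, j)" .
  qed (use Xc in auto)
  moreover have "Y = four_block_mat (1\<^sub>m 1) (0\<^sub>m 1 n) (0\<^sub>m n 1) X"
    using Yc row0 col0 by (intro eq_matI) (auto simp: X_def less_Suc_eq_0_disj)
  then have "det X = 1"
    using det_four_block_mat_lower_left_zero[OF one_carrier_mat zero_carrier_mat refl Xc] Isom_det[OF Y] by simp
  ultimately show "X \<in> SO n" using Xc by (simp add: SO_def)
  show "transforms_frame n X (frame_of H) (frame_of (H * Y))"
    unfolding transforms_frame_def
  proof (rule eq_matI)
    fix r j assume "r < dim_row (mat_of_cols (n + 1) (frame_of H) * X)" "j < dim_col (mat_of_cols (n + 1) (frame_of H) * X)"
    then have rj: "r < Suc n" "j < n" using Xc by auto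
    have "mat_of_cols (n + 1) (frame_of (H * Y)) $$ (r, j) = ((H * Y) *\<^sub>v e (Suc j)) $ r"
      using rj by (simp add: mat_of_cols_index frame_of_nth)
    also have "\<dots> = (H * Y) $$ (r, Suc j)"
      using rj mat_vec_e[OF mult_carrier_mat[OF Hc Yc], of "Suc j" r] by simp
    also have "\<dots> = (\<Sum>k = 0..<Suc n. H $$ (r, k) * Y $$ (k, Suc j))"
      using rj by (intro mult_mat_entry[OF Hc Yc]) auto
    also have "\<dots> = (\<Sum>k = 0..<n. H $$ (r, Suc k) * Y $$ (Suc k, Suc j))"
      using row0 rj by (simp add: sum.atLeast0_lessThan_Suc_shift del: sum.op_ivl_Suc)
    also have "\<dots> = (mat_of_cols (Suc n) (frame_of H) * X) $$ (r, j)"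
      using rj by (subst mult_mat_entry[where k=n and l=n and m="Suc n"])
        (auto simp: X_def mat_of_cols_index frame_of_nth mat_vec_e[OF Hc] simp del: index_mult_mat_vec intro!: sum.cong)
    finally show "mat_of_cols (n + 1) (frame_of (H * Y)) $$ (r, j) = (mat_of_cols (n + 1) (frame_of H) * X) $$ (r, j)" by simp
  qed (use Xc in auto)
qed

section \<open>Comparing frames along a geodesic segment\<close>

lemma unit_tangentD:
  assumes "w \<in> unit_tangent n p" shows "w \<in> V" "mink p w = 0" "mink w w = 1"
  using assms by (auto simp: unit_tangent_def tangent_def)

lemma unit_tangentI: "w \<in> V \<Longrightarrow> mink p w = 0 \<Longrightarrow> mink w w = 1 \<Longrightarrow> w \<in> unit_tangent n p"
  by (auto simp: unit_tangent_def tangent_def)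

lemma tangentI: "w \<in> V \<Longrightarrow> mink p w = 0 \<Longrightarrow> w \<in> tangent n p"
  by (auto simp: tangent_def)

lemma geod_V [simp]: "p \<in> V \<Longrightarrow> w \<in> V \<Longrightarrow> geod p w t \<in> V" "p \<in> V \<Longrightarrow> w \<in> V \<Longrightarrow> geod_vel p w t \<in> V"
  by (simp_all add: geod_def geod_vel_def)

text \<open>The component along the geodesic follows the velocity, and the normal component is constant as a vector of the
ambient space.\<close>

lemma parallel_transport_explicit:
  assumes p: "p \<in> hyp n" and w: "w \<in> unit_tangent n p" and x: "x \<in> tangent n p"
  shows "parallel_transport n (geod p w) l x (x + mink w x \<cdot>\<^sub>v (geod_vel p w l - w))"
proof -
  define W where "W t = x + mink w x \<cdot>\<^sub>v (geod_vel p w t - w)" for t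
  note wD = unit_tangentD[OF w]
  have pV: "p \<in> V" and xV: "x \<in> V" and px: "mink p x = 0" using p x by (auto simp: hyp_V tangent_def)
  have wp: "mink w p = 0" using wD pV mink_commute by auto
  have "parallel_field n (geod p w) l W"
    unfolding parallel_field_def
  proof (intro ballI conjI)
    fix t
    have "mink (geod p w t) (W t) = 0"
      using pV xV wD px wp hyp_mink[OF p] by (simp add: W_def geod_def geod_vel_def algebra_simps)
    then show "W t \<in> tangent n (geod p w t)" using pV xV wD by (intro tangentI) (auto simp: W_def)
    show "\<exists>c. \<forall>k<n + 1. ((\<lambda>s. W s $ k) has_real_derivative c * geod p w t $ k) (at t within {0..l})"
    proof (intro exI[of _ "mink w x"] allI impI)
      fix k assume k: "k < n + 1"
      have eq: "(\<lambda>s. W s $ k) = (\<lambda>s. x $ k + mink w x * (sinh s * p $ k + cosh s * w $ k - w $ k))"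
        using k pV xV wD by (auto simp: W_def geod_vel_def)
      have "geod p w t $ k = cosh t * p $ k + sinh t * w $ k" using k pV wD by (simp add: geod_def)
      then show "((\<lambda>s. W s $ k) has_real_derivative mink w x * geod p w t $ k) (at t within {0..l})"
        unfolding eq by (auto intro!: derivative_eq_intros simp: algebra_simps)
    qed
  qed
  moreover have "W 0 = x" using pV xV wD by (auto simp: W_def geod_vel_def intro!: eq_vecI)
  ultimately show ?thesis unfolding parallel_transport_def W_def by blast
qed

text \<open>The translation along the geodesic is a product of the reflections in the two timelike vectors \<open>e 0\<close> and
\<open>e 0 + y\<close>, with \<open>y\<close> the end point; its differential is parallel transport.\<close>

lemma boost:
  assumes w: "w \<in> unit_tangent n (e 0)"
  obtains L where "L \<in> Isom" "L *\<^sub>v e 0 = geod (e 0) w l"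
    "\<And>x. x \<in> V \<Longrightarrow> mink (e 0) x = 0 \<Longrightarrow> L *\<^sub>v x = x + mink w x \<cdot>\<^sub>v (geod_vel (e 0) w l - w)"
proof -
  note wD = unit_tangentD[OF w]
  have we: "mink w (e 0) = 0" using wD mink_commute[of w "e 0"] by simp
  have ee: "mink (e 0) (e 0) = - 1" by (simp add: mink_e_e)
  define y where "y = geod (e 0) w l"
  have yV: "y \<in> V" using wD by (simp add: y_def)
  have c1: "1 + cosh l > 0" "1 + cosh l \<noteq> (0::real)" using cosh_real_pos[of l] by linarith+
  define z where "z = e 0 + y"
  have zV: "z \<in> V" using yV by (simp add: z_def)
  have sq: "sinh l * sinh l = cosh l * cosh l - 1" using cosh_square_eq[of l] by (simp add: power2_eq_square)
  have ze: "mink z (e 0) = - (1 + cosh l)" 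
    using wD we ee by (simp add: z_def y_def geod_def)
  have zz: "mink z z = - 2 * (1 + cosh l)"
    using wD we ee sq by (simp add: z_def y_def geod_def algebra_simps)
  define L where "L = mrefl z * mrefl (e 0)"
  have r: "mrefl z \<in> Lor" "mrefl (e 0) \<in> Lor" using zV zz c1 ee by (auto intro!: mrefl_Lor)
  have LL: "L \<in> Lor" using r by (simp add: L_def)
  have "L *\<^sub>v e 0 = mrefl z *\<^sub>v (e 0 - 2 \<cdot>\<^sub>v e 0)"
    using r ee by (simp add: L_def mrefl_vec)
  also have "e 0 - 2 \<cdot>\<^sub>v e 0 = - e 0" by (intro eq_vecI) auto
  also have "mrefl z *\<^sub>v (- e 0) = y"
  proof -
    have "2 * mink z (- e 0) / mink z z = - 1" using zV ze c1 unfolding zz by (simp add: divide_eq_eq) (simp add: algebra_simps)?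
    then have "mrefl z *\<^sub>v (- e 0) = - e 0 - (- 1) \<cdot>\<^sub>v z" using zV by (simp only: mrefl_vec uminus_carrier_vec unit_vec_carrier)
    then show ?thesis using yV by (auto simp: z_def intro!: eq_vecI)
  qed
  finally have L0: "L *\<^sub>v e 0 = y" .
  have yh: "y \<in> hyp n"
    by (rule hyp_by_mink[OF e0_hyp yV]) (use wD we ee sq in \<open>auto simp: y_def geod_def\<close>)
  have "det L = 1" unfolding L_def
    using det_mult[OF mrefl_carrier[of z] mrefl_carrier[of "e 0"]] mrefl_det[of z] mrefl_det[of "e 0"] zV zz c1 ee by simp
  then have LI: "L \<in> Isom" unfolding Isom_iff[OF e0_hyp] using LL L0 yh by simp
  have "L *\<^sub>v x = x + mink w x \<cdot>\<^sub>v (geod_vel (e 0) w l - w)" if x: "x \<in> V" "mink (e 0) x = 0" for x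
  proof -
    have zx: "mink z x = sinh l * mink w x" using x wD by (simp add: z_def y_def geod_def)
    have "mrefl (e 0) *\<^sub>v x = x" using x by (simp add: mrefl_vec) (auto intro!: eq_vecI)
    then have "L *\<^sub>v x = x - (2 * mink z x / mink z z) \<cdot>\<^sub>v z" using x r zV by (simp add: L_def mrefl_vec)
    also have "2 * mink z x / mink z z = - (mink w x * sinh l / (1 + cosh l))" unfolding zx zz using c1 by (simp add: field_simps)
    also have "x - (- (mink w x * sinh l / (1 + cosh l))) \<cdot>\<^sub>v z = x + mink w x \<cdot>\<^sub>v (geod_vel (e 0) w l - w)"
    proof (rule eq_vecI)
      fix i assume "i < dim_vec (x + mink w x \<cdot>\<^sub>v (geod_vel (e 0) w l - w))"
      then have i: "i < Suc n" using wD by (simp add: geod_vel_def)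
      have "sinh l / (1 + cosh l) * ((1 + cosh l) * e 0 $ i + sinh l * w $ i) = sinh l * e 0 $ i + (cosh l - 1) * w $ i"
      proof -
        have "sinh l / (1 + cosh l) * ((1 + cosh l) * e 0 $ i + sinh l * w $ i)
          = sinh l * e 0 $ i + (sinh l * sinh l) / (1 + cosh l) * w $ i" using c1 by (simp add: field_simps)
        also have "(sinh l * sinh l) / (1 + cosh l) = cosh l - 1" unfolding sq using c1 by (simp add: field_simps)
        finally show ?thesis .
      qed
      then have "mink w x * (sinh l / (1 + cosh l) * ((1 + cosh l) * e 0 $ i + sinh l * w $ i))
          = mink w x * (sinh l * e 0 $ i + (cosh l - 1) * w $ i)" by simp
      then show "(x - (- (mink w x * sinh l / (1 + cosh l))) \<cdot>\<^sub>v z) $ i = (x + mink w x \<cdot>\<^sub>v (geod_vel (e 0) w l - w)) $ i"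
        using i x wD by (simp add: z_def y_def geod_def geod_vel_def algebra_simps del: index_unit_vec(1,2))
    qed (use x wD zV in auto)
    finally show ?thesis .
  qed
  then show ?thesis using that[of L] LI L0 y_def by blast
qed

lemma negate_first_two_frame_of:
  assumes "H \<in> Lor" shows "negate_first_two (frame_of H) = frame_of (H * Rot pi)"
proof -
  have up: "[0..<n] = 0 # 1 # [2..<n]" using dim3 by (simp add: upt_conv_Cons numeral_2_eq_2)
  have 1: "(H * Rot pi) *\<^sub>v e (Suc 0) = - (H *\<^sub>v e (Suc 0))"
    using assms Rot_e(1)[of pi] by (intro vec_eq_by_mink) (auto simp: Lor_move)
  have 2: "(H * Rot pi) *\<^sub>v e 2 = - (H *\<^sub>v e 2)"
    using assms Rot_e(2)[of pi] by (intro vec_eq_by_mink) (auto simp: Lor_move)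
  have 3: "(H * Rot pi) *\<^sub>v e (Suc k) = H *\<^sub>v e (Suc k)" if "2 \<le> k" "k < n" for k
    using assms Rot_e(3)[of "Suc k" pi] that by simp
  show ?thesis unfolding frame_of_def up using 1 2 3 by (simp add: numeral_2_eq_2[symmetric])
qed

text \<open>Let \<open>L\<close> be the translation along the geodesic from \<open>e 0\<close> to \<open>G e 0\<close>. Parallel transport takes the
frame of \<open>H\<close> to the frame of \<open>H L\<close>, and negating the first two vectors is multiplication by the half turn \<open>Rot pi\<close>. So
the comparison is made by \<open>Y = adj (L Rot pi) G\<close>, which fixes \<open>e 0\<close>, and the explicit form of \<open>L\<close> gives
its entries.\<close>

lemma frame_comparison:
  assumes H: "H \<in> Isom" and G: "G \<in> Isom"
    and c: "G $$ (0, 0) > 1"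
  defines "l \<equiv> arcosh (G $$ (0, 0))" and "p \<equiv> H *\<^sub>v e 0"
  obtains w X E' where "w \<in> unit_tangent n p" "geod p w l = (H * G) *\<^sub>v e 0" "l > 0"
    "hangle (H *\<^sub>v e 1) w = arccos (G $$ (1, 0) / sinh l)"
    "hangle ((H * G) *\<^sub>v e 1) (- geod_vel p w l) = arccos (- G $$ (0, 1) / sinh l)"
    "list_all2 (parallel_transport n (geod p w) l) (frame_of H) E'" "X \<in> SO n"
    "transforms_frame n X (negate_first_two E') (frame_of (H * G))"
    "\<And>a b. a < n \<Longrightarrow> b < n \<Longrightarrow> X $$ (a, b) = (if a < 2 then - 1 else 1) *
       (G $$ (Suc a, Suc b) - G $$ (Suc a, 0) * G $$ (0, Suc b) / (1 + G $$ (0, 0)))"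
proof -
  define c where "c = G $$ (0, 0)"
  have n1: "1 \<le> n" using dim3 by simp
  have GL: "G \<in> Lor" and HL: "H \<in> Lor" using G H by auto
  have ch: "cosh l = c" unfolding l_def c_def using assms(3) by simp
  have l0: "l > 0" unfolding l_def using assms(3) arcosh_real_strict_mono[of 1 "G $$ (0, 0)"] by simp
  have sh: "sinh l > 0" using l0 by simp
  have sq: "sinh l * sinh l = c * c - 1" using cosh_square_eq[of l] ch by (simp add: power2_eq_square)
  define y where "y = G *\<^sub>v e 0"
  have yV: "y \<in> V" using GL by (simp add: y_def)
  have ey: "mink (e 0) y = - c" using Lor_entry[OF GL, of 0 0] by (simp add: y_def c_def eta_def)
  have ye: "mink y (e 0) = - c" using ey mink_commute[OF yV, of "e 0"] by simp
  have yy: "mink y y = - 1" using GL by (simp add: y_def mink_e_e)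
  have ee: "mink (e 0) (e 0) = - 1" by (simp add: mink_e_e)
  define w0 where "w0 = (1 / sinh l) \<cdot>\<^sub>v (y - c \<cdot>\<^sub>v e 0)"
  have w0V: "w0 \<in> V" using yV by (simp add: w0_def)
  have ew: "mink (e 0) w0 = 0" using yV ey ee by (simp add: w0_def)
  have ww: "mink w0 w0 = 1"
  proof -
    have "mink w0 w0 = (c * c - 1) / (sinh l * sinh l)"
      using yV ey ye ee yy by (simp add: w0_def field_simps)
    moreover have "sinh l * sinh l \<noteq> 0" using sh by simp
    ultimately show ?thesis unfolding sq by simp
  qed
  have w0: "w0 \<in> unit_tangent n (e 0)" by (rule unit_tangentI[OF w0V ew ww])
  have yg: "geod (e 0) w0 l = y"
    using sh yV by (auto simp: geod_def w0_def ch intro!: eq_vecI)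
  obtain L where L: "L \<in> Isom" "L *\<^sub>v e 0 = y"
     "\<And>x. x \<in> V \<Longrightarrow> mink (e 0) x = 0 \<Longrightarrow> L *\<^sub>v x = x + mink w0 x \<cdot>\<^sub>v (geod_vel (e 0) w0 l - w0)"
    using boost[OF w0, of l] yg by metis
  define w where "w = H *\<^sub>v w0"
  have w: "w \<in> unit_tangent n p" using HL w0V ew ww by (intro unit_tangentI) (auto simp: w_def p_def)
  have lin: "H *\<^sub>v (s \<cdot>\<^sub>v u + t \<cdot>\<^sub>v v) = s \<cdot>\<^sub>v (H *\<^sub>v u) + t \<cdot>\<^sub>v (H *\<^sub>v v)" if "u \<in> V" "v \<in> V" for s t u v
    by (rule vec_eq_by_mink) (use that HL in \<open>auto simp: Lor_move\<close>)
  have gy: "geod p w l = H *\<^sub>v y" unfolding yg[symmetric] geod_def p_def w_def using w0V by (simp add: lin)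
  have vel: "geod_vel p w l = H *\<^sub>v geod_vel (e 0) w0 l" unfolding geod_vel_def p_def w_def using w0V by (simp add: lin)
  have HGy: "(H * G) *\<^sub>v e 0 = H *\<^sub>v y" using HL GL by (simp add: y_def)
  have ph: "p \<in> hyp n" using Isom_hyp[OF H e0_hyp] by (simp add: p_def)
  \<comment> \<open>the transported frame is the frame of the boosted matrix\<close>
  have tr: "list_all2 (parallel_transport n (geod p w) l) (frame_of H) (frame_of (H * L))"
  proof (rule list_all2_all_nthI)
    fix j assume "j < length (frame_of H)"
    then have j: "j < n" by simp
    have x: "H *\<^sub>v e (Suc j) \<in> tangent n p" using HL j by (intro tangentI) (auto simp: p_def mink_e_e)
    have "(H * L) *\<^sub>v e (Suc j) = H *\<^sub>v (e (Suc j) + mink w0 (e (Suc j)) \<cdot>\<^sub>v (geod_vel (e 0) w0 l - w0))"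
      using HL L j by (simp add: mink_e_e)
    also have "\<dots> = H *\<^sub>v e (Suc j) + mink w (H *\<^sub>v e (Suc j)) \<cdot>\<^sub>v (geod_vel p w l - w)"
      unfolding vel by (rule vec_eq_by_mink) (use HL w0V in \<open>auto simp: w_def Lor_move\<close>)
    finally show "parallel_transport n (geod p w) l (frame_of H ! j) (frame_of (H * L) ! j)"
      using parallel_transport_explicit[OF ph w x, of l] j by (simp add: frame_of_nth)
  qed simp
  define Y where "Y = adj (L * Rot pi) * G"
  have LR: "L * Rot pi \<in> Isom" using L by simp
  have YI: "Y \<in> Isom" unfolding Y_def using LR G by simp
  have R0: "Rot pi *\<^sub>v e 0 = e 0" by (rule Rot_e(3)) auto
  have "(L * Rot pi) *\<^sub>v e 0 = y" using L R0 by simp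
  then have Y0: "Y *\<^sub>v e 0 = e 0"
    using LR GL Lor_adj_vec(1)[OF Isom_Lor[OF LR], of "e 0"] by (simp add: Y_def y_def[symmetric])
  define X where "X = mat n n (\<lambda>(i, j). Y $$ (Suc i, Suc j))"
  have HLR: "H * L * Rot pi \<in> Lor" using HL L by simp
  have "H * L * Rot pi * Y = H * G"
  proof (rule Lor_eqI)
    fix v assume v: "v \<in> V"
    have "L *\<^sub>v (Rot pi *\<^sub>v (adj (L * Rot pi) *\<^sub>v (G *\<^sub>v v))) = G *\<^sub>v v"
    proof -
      have LL: "L \<in> Lor" and GV: "G *\<^sub>v v \<in> V" using L GL v by auto
      have aV: "adj (L * Rot pi) *\<^sub>v (G *\<^sub>v v) \<in> V" using LR GV v GL by (intro Lor_V adj_Lor) auto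
      show ?thesis using Lor_adj_vec(2)[OF Isom_Lor[OF LR] GV]
        unfolding Lor_mult_vec[OF LL Rot_Lor aV] .
    qed
    then show "(H * L * Rot pi * Y) *\<^sub>v v = (H * G) *\<^sub>v v"
      using v HL L GL LR by (simp add: Y_def)
  qed (use HL L GL YI in auto)
  moreover note frame_of_change[OF HLR YI Y0, folded X_def]
  ultimately have XS: "X \<in> SO n" and "transforms_frame n X (frame_of (H * L * Rot pi)) (frame_of (H * G))" by auto
  then have XT: "transforms_frame n X (negate_first_two (frame_of (H * L))) (frame_of (H * G))"
    using HL L by (simp add: negate_first_two_frame_of)
  have Xe: "X $$ (a, b) = (if a < 2 then - 1 else 1) *
       (G $$ (Suc a, Suc b) - G $$ (Suc a, 0) * G $$ (0, Suc b) / (1 + G $$ (0, 0)))" if ab: "a < n" "b < n" for a b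
  proof -
    let ?a = "e (Suc a)" and ?b = "G *\<^sub>v e (Suc b)"
    have yb: "mink y ?b = 0" using GL ab by (simp add: y_def mink_e_e)
    have bV: "?b \<in> V" using GL by simp
    have "X $$ (a, b) = mink ?a (Y *\<^sub>v e (Suc b))"
      using ab Lor_entry[of Y "Suc a" "Suc b"] YI by (simp add: X_def eta_def)
    also have "\<dots> = mink ((L * Rot pi) *\<^sub>v ?a) ?b"
      unfolding Y_def using LR GL Lor_mink[OF Isom_Lor[OF LR], of ?a "adj (L * Rot pi) *\<^sub>v ?b"] by simp
    also have "(L * Rot pi) *\<^sub>v ?a = (if a < 2 then - 1 else 1) \<cdot>\<^sub>v (L *\<^sub>v ?a)"
    proof -
      consider "a = 0" | "a = 1" | "2 \<le> a" by linarith
      then have "Rot pi *\<^sub>v ?a = (if a < 2 then - 1 else 1) \<cdot>\<^sub>v ?a"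
      proof cases
        case 1 then show ?thesis using Rot_e(1)[of pi] by (auto intro!: eq_vecI)
      next
        case 2 then show ?thesis using Rot_e(2)[of pi] by (auto simp: numeral_2_eq_2 intro!: eq_vecI)
      next
        case 3 then show ?thesis using Rot_e(3)[of "Suc a" pi] ab by (auto intro!: eq_vecI)
      qed
      then show ?thesis using L
        by (intro vec_eq_by_mink) (auto simp: Lor_move)
    qed
    also have "mink ((if a < 2 then - 1 else 1) \<cdot>\<^sub>v (L *\<^sub>v ?a)) ?b = (if a < 2 then - 1 else 1) * mink (L *\<^sub>v ?a) ?b"
      using L bV by (intro mink_linear) auto
    also have "mink (L *\<^sub>v ?a) ?b = mink ?a ?b + mink w0 ?a * (mink (geod_vel (e 0) w0 l) ?b - mink w0 ?b)"
      using L(3)[of ?a] ab w0V bV by (simp add: mink_e_e)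
    also have "mink w0 ?a * (mink (geod_vel (e 0) w0 l) ?b - mink w0 ?b) = mink ?a y * mink (e 0) ?b / (1 + c)"
    proof -
      have 1: "mink w0 ?a = mink ?a y / sinh l" using yV ab mink_commute[OF yV, of ?a] by (simp add: w0_def mink_e_e)
      have 2: "mink w0 ?b = - c * mink (e 0) ?b / sinh l" using yV bV yb by (simp add: w0_def)
      have 3: "mink (geod_vel (e 0) w0 l) ?b = sinh l * mink (e 0) ?b + c * mink w0 ?b"
        using w0V bV by (simp add: geod_vel_def ch)
      have "mink (geod_vel (e 0) w0 l) ?b - mink w0 ?b = mink (e 0) ?b * ((sinh l * sinh l - (c - 1) * c) / sinh l)"
        unfolding 3 2 using sh by (simp add: field_simps)
      also have "(sinh l * sinh l - (c - 1) * c) = c - 1" unfolding sq by (simp add: algebra_simps)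
      finally have "mink w0 ?a * (mink (geod_vel (e 0) w0 l) ?b - mink w0 ?b)
         = mink ?a y * mink (e 0) ?b * ((c - 1) / (sinh l * sinh l))" unfolding 1 by simp
      also have "(c - 1) / (sinh l * sinh l) = 1 / (1 + c)"
      proof -
        have "c * c - 1 = (c - 1) * (1 + c)" by (simp add: algebra_simps)
        then show ?thesis unfolding sq using assms(3) by (simp add: c_def)
      qed
      finally show ?thesis by simp
    qed
    finally show ?thesis
      using ab Lor_entry[OF GL, of "Suc a" "Suc b"] Lor_entry[OF GL, of "Suc a" 0] Lor_entry[OF GL, of 0 "Suc b"]
      by (simp add: eta_def c_def y_def)
  qed
  have a1: "hangle (H *\<^sub>v e 1) w = arccos (G $$ (1, 0) / sinh l)"
  proof -
    have "mink (e 1) w0 = mink (e 1) y / sinh l" using yV n1 by (simp add: w0_def mink_e_e)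
    then show ?thesis
      using HL w0V ww n1 Lor_entry[OF GL n1, of 0]
      by (simp add: hangle_def w_def mink_e_e y_def eta_def)
  qed
  have a2: "hangle ((H * G) *\<^sub>v e 1) (- geod_vel p w l) = arccos (- G $$ (0, 1) / sinh l)"
  proof -
    let ?b = "G *\<^sub>v e 1" and ?v = "geod_vel (e 0) w0 l"
    have bV: "?b \<in> V" using GL by simp
    have vV: "?v \<in> V" using w0V by simp
    have we: "mink w0 (e 0) = 0" using ew mink_commute[OF w0V, of "e 0"] by simp
    have vv: "mink ?v ?v = 1" using w0V ew we ww ee sq by (simp add: geod_vel_def ch)
    have yb: "mink y ?b = 0" using GL n1 by (simp add: y_def mink_e_e)
    have 2: "mink w0 ?b = - c * mink (e 0) ?b / sinh l" using yV bV yb by (simp add: w0_def)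
    have "mink ?v ?b = sinh l * mink (e 0) ?b + c * mink w0 ?b" using w0V bV by (simp add: geod_vel_def ch)
    also have "\<dots> = mink (e 0) ?b * (sinh l * sinh l - c * c) / sinh l" unfolding 2 using sh by (simp add: field_simps)
    finally have "mink ?v ?b = - mink (e 0) ?b / sinh l" unfolding sq by simp
    then have "mink ?b ?v = - mink (e 0) ?b / sinh l" using mink_commute[OF vV bV] by simp
    then show ?thesis unfolding vel hangle_def
      using HL GL vV vv n1 Lor_entry[OF GL, of 0 1] by (simp add: mink_e_e eta_def)
  qed
  show ?thesis
    by (rule that[OF w _ l0 a1 a2 tr XS XT Xe]) (simp_all add: gy HGy)
qed

end

section \<open>The standard ideal triangle\<close>

lemma exhaust_mod_3: "(i :: 3) = 0 \<or> i = 1 \<or> i = 2"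
  using exhaust_3[of i] by auto

definition ang :: "3 \<Rightarrow> real" where
  "ang i = (if i = 0 then 0 else if i = 1 then 2 * pi / 3 else 4 * pi / 3)"

lemma cos_sin_ang [simp]:
  "cos (ang 0) = 1" "sin (ang 0) = 0" "cos (ang 1) = - 1/2" "sin (ang 1) = sqrt 3 / 2"
  "cos (ang 2) = - 1/2" "sin (ang 2) = - sqrt 3 / 2"
proof -
  have 4: "ang 2 = 2 * pi / 3 + 2 * pi / 3" by (simp add: ang_def)
  show "cos (ang 2) = - 1/2" "sin (ang 2) = - sqrt 3 / 2"
    unfolding 4 cos_add sin_add cos_120 sin_120 by auto
qed (auto simp: ang_def cos_120 sin_120)

lemma numeral_mod_3 [simp]: "(3 :: 3) = 0" "(4 :: 3) = 1" by simp_all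

lemma cos_sin_ang_add:
  "cos (ang i + ang j) = cos (ang (i + j))" "sin (ang i + ang j) = sin (ang (i + j))"
  using exhaust_mod_3[of i] exhaust_mod_3[of j] by (auto simp: cos_add sin_add)

context minkowski_space begin

text \<open>The symmetries of the standard ideal triangle that preserve its cyclic order.\<close>

definition turn :: "3 \<Rightarrow> real mat" where "turn i = Rot (ang i)"

text \<open>The ideal vertices of the regular triangle centred at \<open>e 0\<close>, represented by the null vectors with time
coordinate 1.\<close>

definition vertex :: "3 \<Rightarrow> real vec" where
  "vertex i = vec (Suc n) (\<lambda>j. if j = 0 then 1 else if j = 1 then cos (ang i) else if j = 2 then sin (ang i) else 0)"

text \<open>The unit vector in the span of the triangle that is orthogonal to the edge between the vertices 0 and
2, on the side of vertex 1.\<close>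

definition nu :: "real vec" where
  "nu = vec (Suc n) (\<lambda>j. if j = 0 then - (1 / sqrt 3) else if j = 1 then - (1 / sqrt 3) else if j = 2 then 1 else 0)"

text \<open>For indices from 2 to \<open>n\<close>, an orthonormal basis of the normal space of the edge between the vertices 0
and 2. The numbering starts at 2 so that it agrees with that of the coordinates from 3 on.\<close>

definition edge_frame :: "nat \<Rightarrow> real vec" where "edge_frame a = (if a = 2 then nu else e a)"

lemma vertex_V [simp]: "vertex i \<in> V" and nu_V [simp]: "nu \<in> V" and edge_frame_V [simp]: "edge_frame a \<in> V"
  by (simp_all add: vertex_def nu_def edge_frame_def)

lemma turn_Isom [simp]: "turn i \<in> Isom" by (simp add: turn_def)

lemma turn_add: "turn i * turn j = turn (i + j)"
proof -
  have "Rot (ang i + ang j) = Rot (ang (i + j))" unfolding Rot_def cos_sin_ang_add ..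
  then show ?thesis by (simp add: turn_def Rot_add)
qed

lemma turn_0: "turn 0 = 1\<^sub>m (Suc n)"
  by (rule mat_eq_by_vec) (auto simp: turn_def Rot_carrier Rot_vec intro!: eq_vecI)

lemma turn_turn_vec [simp]: "v \<in> V \<Longrightarrow> turn i *\<^sub>v (turn j *\<^sub>v v) = turn (i + j) *\<^sub>v v"
  by (simp add: turn_add[symmetric])

lemma turn_0_vec [simp]: "v \<in> V \<Longrightarrow> turn 0 *\<^sub>v v = v" by (simp add: turn_0)

lemma adj_turn: "adj (turn i) = turn (- i)"
proof -
  have "adj (turn i) = adj (turn i) * (turn i * turn (- i))" 
    using carrier_matD[OF adj_carrier[of "turn i"]] by (simp add: turn_add turn_0 adj_def)
  also have "\<dots> = (adj (turn i) * turn i) * turn (- i)"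
    by (rule assoc_mult_mat[OF adj_carrier Lor_carrier Lor_carrier, symmetric]) auto
  also have "\<dots> = turn (- i)" using Lor_carrier[of "turn (- i)"] by (simp add: Lor_adj_left)
  finally show ?thesis .
qed

lemma turn_move: "u \<in> V \<Longrightarrow> v \<in> V \<Longrightarrow> mink u (turn i *\<^sub>v v) = mink (turn (- i) *\<^sub>v u) v"
  by (simp add: Lor_move adj_turn)

lemma turn_vertex [simp]: "turn i *\<^sub>v vertex j = vertex (i + j)"
  using dim3 cos_sin_ang_add[of i j] by (auto simp: turn_def Rot_vec vertex_def cos_add sin_add intro!: eq_vecI)

lemma turn_e: "k = 0 \<or> 3 \<le> k \<Longrightarrow> k \<le> n \<Longrightarrow> turn i *\<^sub>v e k = e k"
  unfolding turn_def by (rule Rot_e(3))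

lemma mink_explicit:
  assumes "v \<in> V" "\<And>j. 3 \<le> j \<Longrightarrow> j \<le> n \<Longrightarrow> u $ j * v $ j = 0"
  shows "mink u v = u $ 1 * v $ 1 + u $ 2 * v $ 2 - u $ 0 * v $ 0"
proof -
  have "(\<Sum>i = 3..n. u $ i * v $ i) = 0" by (rule sum.neutral) (use assms(2) in auto)
  then show ?thesis using mink_split[OF assms(1), of u] by simp
qed

lemma vertex_index [simp]: "vertex i $ 0 = 1" "vertex i $ Suc 0 = cos (ang i)" "vertex i $ 2 = sin (ang i)"
  "3 \<le> j \<Longrightarrow> j \<le> n \<Longrightarrow> vertex i $ j = 0"
  using dim3 by (auto simp: vertex_def)

lemma nu_index [simp]: "nu $ 0 = - (1 / sqrt 3)" "nu $ Suc 0 = - (1 / sqrt 3)" "nu $ 2 = 1"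
  "3 \<le> j \<Longrightarrow> j \<le> n \<Longrightarrow> nu $ j = 0"
  using dim3 by (auto simp: nu_def)

lemma mink_vertex_vertex: "mink (vertex i) (vertex j) = (if i = j then 0 else - 3/2)"
  using exhaust_mod_3[of i] exhaust_mod_3[of j] by (auto simp: mink_explicit)

lemma mink_nu [simp]: "mink nu nu = 1" "mink nu (vertex 0) = 0" "mink nu (vertex 2) = 0" "mink (vertex 0) nu = 0" "mink (vertex 2) nu = 0"
  by (simp_all add: mink_explicit field_simps)

lemma mink_e_high [simp]:
  assumes "3 \<le> k" "k \<le> n"
  shows "mink (e k) (vertex i) = 0" "mink (vertex i) (e k) = 0" "mink (e k) nu = 0" "mink nu (e k) = 0"
  using assms mink_commute[of "vertex i" "e k"] mink_commute[of nu "e k"] by (auto simp: mink_e)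

lemma mink_edge_frame_vertex: 
  assumes "2 \<le> a" "a \<le> n" 
  shows "mink (edge_frame a) (vertex 0) = 0" "mink (edge_frame a) (vertex 2) = 0" "mink (vertex 0) (edge_frame a) = 0" "mink (vertex 2) (edge_frame a) = 0"
  using assms by (auto simp: edge_frame_def)

lemma mink_edge_frame: "2 \<le> a \<Longrightarrow> a \<le> n \<Longrightarrow> 2 \<le> b \<Longrightarrow> b \<le> n \<Longrightarrow> mink (edge_frame a) (edge_frame b) = (if a = b then 1 else 0)"
  by (auto simp: edge_frame_def mink_e_e)

lemma e_decomposition:
  "e 0 = (2/3) \<cdot>\<^sub>v (vertex 0 + vertex 2) + (1 / sqrt 3) \<cdot>\<^sub>v nu"
  "e 1 = vertex 0 - e 0"
  "e 2 = nu + (1 / sqrt 3) \<cdot>\<^sub>v vertex 0"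
  "vertex 1 = vertex 0 + vertex 2 + sqrt 3 \<cdot>\<^sub>v nu"
proof -
  have r: "sqrt 3 * sqrt 3 = (3::real)" by simp
  have idx: "i = 0 \<or> i = 1 \<or> i = 2 \<or> 3 \<le> i" for i :: nat by linarith
  show "e 0 = (2/3) \<cdot>\<^sub>v (vertex 0 + vertex 2) + (1 / sqrt 3) \<cdot>\<^sub>v nu"
  proof (rule eq_vecI)
    fix i assume "i < dim_vec ((2/3) \<cdot>\<^sub>v (vertex 0 + vertex 2) + (1 / sqrt 3) \<cdot>\<^sub>v nu)"
    then have "i < Suc n" by (simp add: nu_def)
    then show "e 0 $ i = ((2/3) \<cdot>\<^sub>v (vertex 0 + vertex 2) + (1 / sqrt 3) \<cdot>\<^sub>v nu) $ i"
      using r by (auto simp: vertex_def nu_def field_simps)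
  qed (simp add: nu_def)
  show "e 1 = vertex 0 - e 0" by (rule eq_vecI) (auto simp: vertex_def unit_vec_def)
  show "e 2 = nu + (1 / sqrt 3) \<cdot>\<^sub>v vertex 0" by (rule eq_vecI) (auto simp: vertex_def nu_def unit_vec_def)
  show "vertex 1 = vertex 0 + vertex 2 + sqrt 3 \<cdot>\<^sub>v nu"
    by (rule eq_vecI) (auto simp: vertex_def nu_def)
qed

section \<open>Gluing along an edge\<close>

text \<open>The neighbour of the standard triangle across the edge between the vertices 0 and 2 is its image under
\<open>G\<close>, which exchanges the ends of the edge. The logarithm of \<open>E\<close> is the shear.\<close>

definition glues :: "real mat \<Rightarrow> real \<Rightarrow> bool" where
  "glues G E \<longleftrightarrow> G \<in> Isom \<and> E > 0 \<and> G *\<^sub>v vertex 0 = (1 / E) \<cdot>\<^sub>v vertex 2 \<and> G *\<^sub>v vertex 2 = E \<cdot>\<^sub>v vertex 0"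

text \<open>The matrix of \<open>G\<close> on the normal space of the edge, in the basis \<open>edge_frame\<close>.\<close>

definition bend :: "real mat \<Rightarrow> nat \<Rightarrow> nat \<Rightarrow> real" where
  "bend G a b = mink (edge_frame a) (G *\<^sub>v edge_frame b)"

lemma glues_perp:
  assumes g: "glues G E" and x: "x \<in> V" "mink (vertex 0) x = 0" "mink (vertex 2) x = 0"
  shows "mink (vertex 0) (G *\<^sub>v x) = 0" "mink (vertex 2) (G *\<^sub>v x) = 0" "mink x (G *\<^sub>v vertex 0) = 0" "mink x (G *\<^sub>v vertex 2) = 0"
proof -
  have G: "G \<in> Lor" and E: "E > 0" and G0: "G *\<^sub>v vertex 0 = (1 / E) \<cdot>\<^sub>v vertex 2" and G2: "G *\<^sub>v vertex 2 = E \<cdot>\<^sub>v vertex 0"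
    using g by (auto simp: glues_def)
  have "mink (E \<cdot>\<^sub>v vertex 0) (G *\<^sub>v x) = mink (vertex 2) x" using G x by (simp add: G2[symmetric])
  then show "mink (vertex 0) (G *\<^sub>v x) = 0" using G x E by simp
  have "mink ((1 / E) \<cdot>\<^sub>v vertex 2) (G *\<^sub>v x) = mink (vertex 0) x" using G x by (simp only: G0[symmetric] Lor_mink vertex_V)
  then show "mink (vertex 2) (G *\<^sub>v x) = 0" using G x E by simp
  show "mink x (G *\<^sub>v vertex 0) = 0" "mink x (G *\<^sub>v vertex 2) = 0"
    using x mink_commute[of x "vertex 0"] mink_commute[of x "vertex 2"] by (simp_all add: G0 G2)
qed

text \<open>The form splits into the span of the two ends of the edge, where \<open>glues\<close> determines \<open>G\<close>, and the normal space,
where \<open>bend\<close> does. The formulas come from writing the standard basis in these terms.\<close>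

lemma glues_entries:
  assumes g: "glues G E"
  defines "P \<equiv> bend G 2 2" and "r \<equiv> sqrt 3" and "\<kappa> \<equiv> 1 / E" and "c \<equiv> G $$ (0, 0)"
  shows "c = (2/3) * (E + \<kappa>) - P / 3"
    and "G $$ (1, 0) = c - \<kappa>" "G $$ (0, 1) = \<kappa> - c"
    and "G $$ (2, 0) = (P - \<kappa>) / r" "G $$ (0, 2) = (\<kappa> - P) / r"
    and "G $$ (1, 1) = \<kappa> / 2 - c" "G $$ (1, 2) = - (P + \<kappa> / 2) / r" "G $$ (2, 1) = - (P + \<kappa> / 2) / r"
    and "G $$ (2, 2) = P - \<kappa> / 2"
    and "\<And>k. 3 \<le> k \<Longrightarrow> k \<le> n \<Longrightarrow> G $$ (k, 0) = bend G k 2 / r \<and> G $$ (0, k) = - bend G 2 k / r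
      \<and> G $$ (1, k) = - bend G 2 k / r \<and> G $$ (k, 1) = - bend G k 2 / r
      \<and> G $$ (2, k) = bend G 2 k \<and> G $$ (k, 2) = bend G k 2"
    and "\<And>k m. 3 \<le> k \<Longrightarrow> k \<le> n \<Longrightarrow> 3 \<le> m \<Longrightarrow> m \<le> n \<Longrightarrow> G $$ (k, m) = bend G k m"
proof -
  have G: "G \<in> Lor" and E: "E > 0" and G0: "G *\<^sub>v vertex 0 = (1 / E) \<cdot>\<^sub>v vertex 2" and G2: "G *\<^sub>v vertex 2 = E \<cdot>\<^sub>v vertex 0"
    using g by (auto simp: glues_def)
  define M where "M x y = mink x (G *\<^sub>v y)" for x y
  have Madj: "M x y = mink (adj G *\<^sub>v x) y" if "x \<in> V" "y \<in> V" for x y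
    using that G by (simp add: M_def Lor_move)
  have Mr: "z \<in> V \<Longrightarrow> M x (y + z) = M x y + M x z" "z \<in> V \<Longrightarrow> M x (y - z) = M x y - M x z" "M x (t \<cdot>\<^sub>v y) = t * M x y"
    if "x \<in> V" "y \<in> V" for x y z t
    using that G by (simp_all add: Madj)
  have Ml: "z \<in> V \<Longrightarrow> M (y + z) x = M y x + M z x" "z \<in> V \<Longrightarrow> M (y - z) x = M y x - M z x" "M (t \<cdot>\<^sub>v y) x = t * M y x"
    if "x \<in> V" "y \<in> V" for x y z t
    using that G by (simp_all add: M_def)
  have M00: "M (vertex 0) (vertex 0) = - (3/2) * \<kappa>" "M (vertex 2) (vertex 2) = - (3/2) * E" "M (vertex 0) (vertex 2) = 0" "M (vertex 2) (vertex 0) = 0"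
    by (simp_all add: M_def G0 G2 mink_vertex_vertex \<kappa>_def)
  have Mnu: "M (vertex 0) nu = 0" "M (vertex 2) nu = 0" "M nu (vertex 0) = 0" "M nu (vertex 2) = 0"
    using glues_perp[OF g, of nu] by (simp_all add: M_def)
  have Mk: "M (vertex 0) (e k) = 0" "M (vertex 2) (e k) = 0" "M (e k) (vertex 0) = 0" "M (e k) (vertex 2) = 0" if "3 \<le> k" "k \<le> n" for k
    using glues_perp[OF g, of "e k"] that by (simp_all add: M_def)
  have MP: "M nu nu = P" by (simp add: M_def P_def bend_def edge_frame_def)
  have Mb: "M nu (e k) = bend G 2 k" "M (e k) nu = bend G k 2" if "3 \<le> k" for k
    using that by (simp_all add: M_def bend_def edge_frame_def)
  have Mbb: "M (e k) (e m) = bend G k m" if "3 \<le> k" "3 \<le> m" for k m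
    using that by (simp_all add: M_def bend_def edge_frame_def)
  have r: "r * r = 3" "r > 0" by (simp_all add: r_def)
  have e0: "e 0 = (2/3) \<cdot>\<^sub>v (vertex 0 + vertex 2) + (1 / r) \<cdot>\<^sub>v nu" and e2: "e 2 = nu + (1 / r) \<cdot>\<^sub>v vertex 0"
    unfolding r_def by (fact e_decomposition)+
  have M0: "M (vertex 0) (e 0) = - \<kappa>" "M (e 0) (vertex 0) = - \<kappa>" "M (e 0) nu = P / r" "M nu (e 0) = P / r"
    unfolding e0 by (simp_all add: Mr Ml M00 Mnu MP)
  have M00': "M (e 0) (e 0) = - ((2/3) * (E + \<kappa>) - P / 3)"
    apply (subst (2) e0) apply (simp add: Mr M0) apply (subst e0) apply (simp add: Ml M00 Mnu)
    using r by (simp add: field_simps)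
  have M0k: "M (e 0) (e k) = bend G 2 k / r" "M (e k) (e 0) = bend G k 2 / r" if "3 \<le> k" "k \<le> n" for k
    unfolding e0 using that by (simp_all add: Mr Ml Mk Mb)
  have ent: "G $$ (i, j) = eta i * M (e i) (e j)" if "i \<le> n" "j \<le> n" for i j
    using Lor_entry[OF G that] by (simp add: M_def)
  have n2: "1 \<le> n" "2 \<le> n" using dim3 by auto
  have cM: "M (e 0) (e 0) = - c" using ent[of 0 0] by (simp add: c_def eta_def)
  show "c = (2/3) * (E + \<kappa>) - P / 3" using M00' cM by simp
  have e1: "e 1 = vertex 0 - e 0" by (fact e_decomposition)
  show "G $$ (1, 0) = c - \<kappa>" "G $$ (0, 1) = \<kappa> - c"
    using n2 by (simp_all add: ent eta_def e1[simplified] Mr Ml M0 cM)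
  show "G $$ (2, 0) = (P - \<kappa>) / r" "G $$ (0, 2) = (\<kappa> - P) / r"
    using n2 by (simp_all add: ent eta_def e2 Mr Ml M0 cM add_divide_distrib diff_divide_distrib)
  show "G $$ (1, 1) = \<kappa> / 2 - c"
    using n2 by (simp add: ent eta_def e1[simplified] Mr Ml M0 M00 cM)
  show "G $$ (1, 2) = - (P + \<kappa> / 2) / r" "G $$ (2, 1) = - (P + \<kappa> / 2) / r"
    using n2 r by (simp_all add: ent eta_def e1[simplified] e2 Mr Ml M0 M00 Mnu cM field_simps)
  show "G $$ (2, 2) = P - \<kappa> / 2"
  proof -
    have "G $$ (2, 2) = P - (3/2) * \<kappa> / (r * r)" using n2 by (simp add: ent eta_def e2 Mr Ml M00 Mnu MP field_simps)
    then show ?thesis unfolding r by simp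
  qed
  show "G $$ (k, 0) = bend G k 2 / r \<and> G $$ (0, k) = - bend G 2 k / r
      \<and> G $$ (1, k) = - bend G 2 k / r \<and> G $$ (k, 1) = - bend G k 2 / r
      \<and> G $$ (2, k) = bend G 2 k \<and> G $$ (k, 2) = bend G k 2" if k: "3 \<le> k" "k \<le> n" for k
    using n2 k by (simp add: ent eta_def e1[simplified] e2 Mr Ml M0k Mk Mb)
  show "G $$ (k, m) = bend G k m" if "3 \<le> k" "k \<le> n" "3 \<le> m" "m \<le> n" for k m
    using that by (simp add: ent eta_def Mbb)
qed

section \<open>The segment between the centres of adjacent triangles\<close>

text \<open>The diagonals of the two limiting bends. Reversing \<open>nu\<close>, the normal with index 2, makes the second triangle
continue the first one; fixing \<open>nu\<close> folds it back. In the second case another normal has to be reversed,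
since \<open>G\<close> preserves orientation and exchanges the ends of the edge.\<close>

definition bend_sign :: "bool \<Rightarrow> nat \<Rightarrow> real" where
  "bend_sign bad a = (if a = (if bad then 3 else 2) then - 1 else 1)"

text \<open>The matrix \<open>diag(1, -1, -1, 1, \<dots>)\<close> or the identity. It arises from \<open>bend_sign\<close> by shifting the
index by one and negating the entry of \<open>nu\<close>, one of the first two vectors of the frame.\<close>

definition frame_sign :: "bool \<Rightarrow> nat \<Rightarrow> real" where
  "frame_sign bad a = (if bad \<and> (a = 1 \<or> a = 2) then - 1 else 1)"

lemma abs_mult_le: "\<bar>x\<bar> \<le> a \<Longrightarrow> \<bar>y\<bar> \<le> b \<Longrightarrow> \<bar>x * y\<bar> \<le> a * (b :: real)"
  unfolding abs_mult by (intro mult_mono) auto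

lemma glues_size:
  assumes g: "glues G E" and E: "6 \<le> E" and P: "\<bar>bend G 2 2\<bar> \<le> 2"
  defines "c \<equiv> G $$ (0, 0)"
  shows "c > 1" "1 + c \<ge> (2/3) * E" "c - 1 / E \<le> sqrt (c * c - 1)"
proof -
  define k where "k = 1 / E"
  have k: "0 < k" "k \<le> 1/6" using E by (auto simp: k_def field_simps)
  have Ek: "E * k = 1" using E by (simp add: k_def)
  have c: "c = (2/3) * (E + k) - bend G 2 2 / 3" unfolding c_def k_def by (rule glues_entries(1)[OF g])
  have P': "- 2 \<le> bend G 2 2" "bend G 2 2 \<le> 2" using P by auto
  have Ekk: "E + k \<ge> 6" using E k by linarith
  show "c > 1" "1 + c \<ge> (2/3) * E" unfolding c using P' k Ekk unfolding distrib_left by linarith+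
  have "2 * (c * k) = (4/3) * (1 + k * k) - (2/3) * (bend G 2 2 * k)"
    unfolding Ek[symmetric] c by (simp add: algebra_simps)
  moreover have "bend G 2 2 * k \<le> 2 * (1/6)" using P' k by (intro mult_mono) auto
  moreover have "0 \<le> k * k" by simp
  moreover have "2 * x - z \<ge> 1" if "2 * x = (4/3) * (1 + z) - (2/3) * y" "y \<le> 2 * (1/6)" "0 \<le> z" for x y z :: real
    using that by (simp add: field_simps)
  ultimately have "2 * (c * k) - k * k \<ge> 1" by blast
  then have "(c - k)\<^sup>2 \<le> c * c - 1" by (simp add: power2_eq_square algebra_simps)
  then show "c - 1 / E \<le> sqrt (c * c - 1)" unfolding k_def by (rule real_le_rsqrt)
qed

text \<open>The entries of \<open>G\<close> with indices 0 and 1 are of order \<open>E\<close>, but in the formula of \<open>frame_comparison\<close> they cancel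
up to order \<open>1 / E\<close>, because \<open>G\<^sub>1\<^sub>0\<close> and \<open>- G\<^sub>0\<^sub>1\<close> agree with \<open>G\<^sub>0\<^sub>0\<close> up to \<open>1 / E\<close>. What
remains is the bend.\<close>

lemma frame_change_estimate:
  assumes g: "glues G E" and E: "6 \<le> E" and \<delta>: "\<delta> \<le> 1"
    and B: "\<And>a b. 2 \<le> a \<Longrightarrow> a \<le> n \<Longrightarrow> 2 \<le> b \<Longrightarrow> b \<le> n \<Longrightarrow> \<bar>bend G a b - (if a = b then bend_sign bad a else 0)\<bar> \<le> \<delta>"
    and ab: "a < n" "b < n"
  defines "X \<equiv> (if a < 2 then - 1 else 1) *
       (G $$ (Suc a, Suc b) - G $$ (Suc a, 0) * G $$ (0, Suc b) / (1 + G $$ (0, 0)))"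
  shows "\<bar>X - (if a = b then frame_sign bad a else 0)\<bar> \<le> \<delta> + 20 * (1 / E)"
proof -
  define \<kappa> P r c q \<rho> where "\<kappa> = 1 / E" and "P = bend G 2 2" and "r = sqrt 3" and "c = G $$ (0, 0)"
    and "q = 1 / (1 + c)" and "\<rho> = (1 + \<kappa>) * q"
  have n2: "2 \<le> n" using dim3 by simp
  have \<delta>0: "\<delta> \<ge> 0" using B[of 2 2] n2 by linarith
  have k: "0 < \<kappa>" "\<kappa> \<le> 1/6" "E * \<kappa> = 1" using E by (auto simp: \<kappa>_def field_simps)
  have Pd: "\<bar>P - bend_sign bad 2\<bar> \<le> \<delta>" using B[of 2 2] n2 by (simp add: P_def)
  have s: "\<bar>bend_sign bad x\<bar> \<le> 1" for x by (simp add: bend_sign_def)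
  have P2: "\<bar>P\<bar> \<le> 2" using Pd s[of 2] \<delta> by linarith
  note sz = glues_size[OF g E, folded P_def, OF P2, folded c_def \<kappa>_def]
  note ent = glues_entries[OF g, folded \<kappa>_def P_def r_def c_def]
  have r: "r \<ge> 1" "r * r = 3" "r > 0" by (simp_all add: r_def)
  have c1: "1 + c > 0" using sz by linarith
  have q: "0 < q" "q \<le> (3/2) * \<kappa>"
  proof -
    show "0 < q" using c1 by (simp add: q_def)
    have "E * 2 \<le> (1 + c) * 3" using sz(2) by simp
    then show "q \<le> (3/2) * \<kappa>" using c1 E unfolding q_def \<kappa>_def by (simp add: divide_le_eq pos_le_divide_eq field_simps)
  qed
  have cq: "c * q = 1 - q" using c1 by (simp add: q_def field_simps)
  have ck: "(c - \<kappa>) * q = 1 - \<rho>" using cq by (simp add: \<rho>_def algebra_simps)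
  have \<rho>: "0 \<le> \<rho>" "\<rho> \<le> 3 * \<kappa>"
  proof -
    show "0 \<le> \<rho>" using q k by (simp add: \<rho>_def)
    have "\<rho> \<le> 2 * q" unfolding \<rho>_def using k q by (intro mult_right_mono) auto
    then show "\<rho> \<le> 3 * \<kappa>" using q by simp
  qed
  have divr: "\<bar>x / r\<bar> \<le> y" if "\<bar>x\<bar> \<le> y" for x y :: real
  proof -
    have "\<bar>x / r\<bar> = \<bar>x\<bar> / r" using r by simp
    also have "\<dots> \<le> \<bar>x\<bar>" using r by (simp add: divide_le_eq mult_le_cancel_left1)
    finally show ?thesis using that by simp
  qed
  have off: "\<bar>bend G x y\<bar> \<le> \<delta>" "\<bar>bend G x y\<bar> \<le> 1" if "2 \<le> x" "x \<le> n" "2 \<le> y" "y \<le> n" "x \<noteq> y" for x y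
    using B[OF that(1-4)] that \<delta> by auto
  have Pk: "\<bar>P - \<kappa>\<bar> \<le> 3" using P2 k by linarith
  have X: "X = (if a < 2 then - 1 else 1) * (G $$ (Suc a, Suc b) - G $$ (Suc a, 0) * G $$ (0, Suc b) * q)"
    by (simp add: X_def q_def c_def)
  have q1: "\<bar>q\<bar> \<le> (3/2) * \<kappa>" and \<rho>1: "\<bar>\<rho>\<bar> \<le> 3 * \<kappa>" using q \<rho> by auto
  note ent1 = ent(2-9)[unfolded One_nat_def]
  note two = numeral_2_eq_2[symmetric]
  note distr = diff_divide_distrib add_divide_distrib algebra_simps
  have third: "\<bar>u + w / 3 - t\<bar> \<le> d + W" "\<bar>u - w / 3 - t\<bar> \<le> d + W" if "\<bar>u - t\<bar> \<le> d" "\<bar>w\<bar> \<le> W" for u w t d W :: real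
    using that by arith+
  have trichotomy: "x = 0 \<or> x = 1 \<or> 2 \<le> x" for x :: nat by linarith
  consider (c00) "a = 0" "b = 0" | (c01) "a = 0" "b = 1" | (c0k) "a = 0" "2 \<le> b"
    | (c10) "a = 1" "b = 0" | (c11) "a = 1" "b = 1" | (c1k) "a = 1" "2 \<le> b"
    | (ck0) "2 \<le> a" "b = 0" | (ck1) "2 \<le> a" "b = 1" | (ckk) "2 \<le> a" "2 \<le> b"
    using trichotomy[of a] trichotomy[of b] by blast
  then have "\<bar>X - (if a = b then frame_sign bad a else 0)\<bar> \<le> \<delta> + 20 * \<kappa>"
  proof cases
    case c00
    have "X = - (\<kappa> / 2 - c - (c - \<kappa>) * (\<kappa> - c) * q)" by (simp add: X c00 ent1)
    also have "(c - \<kappa>) * (\<kappa> - c) * q = - (c - \<kappa>) * ((c - \<kappa>) * q)" by (simp add: algebra_simps)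
    also have "- (\<kappa> / 2 - c - - (c - \<kappa>) * ((c - \<kappa>) * q)) = \<kappa> / 2 + (1 + \<kappa>) * ((c - \<kappa>) * q)"
      unfolding ck by (simp add: algebra_simps \<rho>_def cq) (simp add: cq[symmetric] algebra_simps)?
    finally have "X - 1 = 3 * \<kappa> / 2 - (1 + \<kappa>) * \<rho>" unfolding ck by (simp add: distr)
    moreover have "\<bar>(1 + \<kappa>) * \<rho>\<bar> \<le> 2 * (3 * \<kappa>)" by (rule abs_mult_le) (use k \<rho>1 in auto)
    ultimately show ?thesis using c00 k \<delta>0 by (simp add: frame_sign_def)
  next
    case c01
    have "X = ((P + \<kappa> / 2) + ((c - \<kappa>) * q) * (\<kappa> - P)) / r"
      by (simp add: X c01 ent1 two) (simp_all add: distr)?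
    then have Xr: "X = (3 * \<kappa> / 2 - \<rho> * (\<kappa> - P)) / r" unfolding ck by (simp add: distr)
    have "\<bar>\<rho> * (\<kappa> - P)\<bar> \<le> 3 * \<kappa> * 3" by (rule abs_mult_le[OF \<rho>1]) (use Pk in auto)
    then have "\<bar>3 * \<kappa> / 2 - \<rho> * (\<kappa> - P)\<bar> \<le> 3 * \<kappa> / 2 + 9 * \<kappa>" using k by linarith
    then have "\<bar>X\<bar> \<le> 3 * \<kappa> / 2 + 9 * \<kappa>" unfolding Xr by (rule divr)
    then show ?thesis using c01 k \<delta>0 by simp
  next
    case c0k
    then have hi: "3 \<le> Suc b" "Suc b \<le> n" using ab by auto
    have "X = bend G 2 (Suc b) / r - ((c - \<kappa>) * q) * (bend G 2 (Suc b) / r)"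
      using c0k ent(10)[OF hi] by (simp add: X ent1)
    then have "X = \<rho> * (bend G 2 (Suc b) / r)" unfolding ck by (simp add: distr)
    also have "\<bar>\<dots>\<bar> \<le> 3 * \<kappa> * 1" by (rule abs_mult_le[OF \<rho>1 divr]) (use off[of 2 "Suc b"] c0k ab in auto)
    finally show ?thesis using c0k k \<delta>0 by simp
  next
    case c10
    have "X = ((P + \<kappa> / 2) - ((c - \<kappa>) * q) * (P - \<kappa>)) / r"
      by (simp add: X c10 ent1 two) (simp_all add: distr)?
    then have Xr: "X = (3 * \<kappa> / 2 + \<rho> * (P - \<kappa>)) / r" unfolding ck by (simp add: distr)
    have "\<bar>\<rho> * (P - \<kappa>)\<bar> \<le> 3 * \<kappa> * 3" by (rule abs_mult_le[OF \<rho>1]) (use Pk in auto)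
    then have "\<bar>3 * \<kappa> / 2 + \<rho> * (P - \<kappa>)\<bar> \<le> 3 * \<kappa> / 2 + 9 * \<kappa>" using k by linarith
    then have "\<bar>X\<bar> \<le> 3 * \<kappa> / 2 + 9 * \<kappa>" unfolding Xr by (rule divr)
    then show ?thesis using c10 k \<delta>0 by simp
  next
    case c11
    have "X = - P + \<kappa> / 2 - (P - \<kappa>) * (P - \<kappa>) / (r * r) * q"
      by (simp add: X c11 ent1 two) (simp_all add: distr)?
    then have Xr: "X = - P + \<kappa> / 2 - ((P - \<kappa>) * (P - \<kappa>)) * q / 3" unfolding r by simp
    have w: "\<bar>((P - \<kappa>) * (P - \<kappa>)) * q\<bar> \<le> (3 * 3) * ((3/2) * \<kappa>)"
      by (rule abs_mult_le[OF abs_mult_le[OF Pk Pk] q1])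
    have fs: "frame_sign bad 1 = - bend_sign bad 2" by (simp add: frame_sign_def bend_sign_def)
    have "\<bar>(- P + \<kappa> / 2) - frame_sign bad 1\<bar> \<le> \<delta> + \<kappa> / 2" unfolding fs using Pd k by linarith
    from third(2)[OF this w] have "\<bar>X - frame_sign bad 1\<bar> \<le> \<delta> + 20 * \<kappa>" unfolding Xr using k by linarith
    then show ?thesis using c11 by simp
  next
    case c1k
    then have hi: "3 \<le> Suc b" "Suc b \<le> n" using ab by auto
    have "X = - bend G 2 (Suc b) - (P - \<kappa>) * bend G 2 (Suc b) / (r * r) * q"
      using c1k ent(10)[OF hi] by (simp add: X ent1 two)
    then have Xr: "X = - bend G 2 (Suc b) - ((P - \<kappa>) * bend G 2 (Suc b)) * q / 3" unfolding r by simp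
    have w: "\<bar>((P - \<kappa>) * bend G 2 (Suc b)) * q\<bar> \<le> (3 * 1) * ((3/2) * \<kappa>)"
      by (rule abs_mult_le[OF abs_mult_le[OF Pk] q1]) (use off[of 2 "Suc b"] c1k ab in auto)
    have "\<bar>- bend G 2 (Suc b) - 0\<bar> \<le> \<delta>" using off[of 2 "Suc b"] c1k ab by simp
    from third(2)[OF this w] have "\<bar>X - 0\<bar> \<le> \<delta> + 20 * \<kappa>" unfolding Xr using k by linarith
    then show ?thesis using c1k by simp
  next
    case ck0
    then have hi: "3 \<le> Suc a" "Suc a \<le> n" using ab by auto
    have "X = - (bend G (Suc a) 2 / r) + ((c - \<kappa>) * q) * (bend G (Suc a) 2 / r)"
      using ck0 ent(10)[OF hi] by (simp add: X ent1) (simp_all add: distr)?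
    then have "X = \<rho> * (- bend G (Suc a) 2 / r)" unfolding ck by (simp add: distr)
    also have "\<bar>\<dots>\<bar> \<le> 3 * \<kappa> * 1" by (rule abs_mult_le[OF \<rho>1 divr]) (use off[of "Suc a" 2] ck0 ab in auto)
    finally show ?thesis using ck0 k \<delta>0 by simp
  next
    case ck1
    then have hi: "3 \<le> Suc a" "Suc a \<le> n" using ab by auto
    have "X = bend G (Suc a) 2 + (bend G (Suc a) 2) * (P - \<kappa>) / (r * r) * q"
      using ck1 ent(10)[OF hi] by (simp add: X ent1 two) (simp_all add: distr)?
    then have Xr: "X = bend G (Suc a) 2 + ((P - \<kappa>) * bend G (Suc a) 2) * q / 3" unfolding r by simp
    have w: "\<bar>((P - \<kappa>) * bend G (Suc a) 2) * q\<bar> \<le> (3 * 1) * ((3/2) * \<kappa>)"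
      by (rule abs_mult_le[OF abs_mult_le[OF Pk] q1]) (use off[of "Suc a" 2] ck1 ab in auto)
    have "\<bar>bend G (Suc a) 2 - 0\<bar> \<le> \<delta>" using off[of "Suc a" 2] ck1 ab by simp
    from third(1)[OF this w] have "\<bar>X - 0\<bar> \<le> \<delta> + 20 * \<kappa>" unfolding Xr using k by linarith
    then show ?thesis using ck1 by simp
  next
    case ckk
    then have hi: "3 \<le> Suc a" "Suc a \<le> n" "3 \<le> Suc b" "Suc b \<le> n" using ab by auto
    have "X = bend G (Suc a) (Suc b) + bend G (Suc a) 2 * bend G 2 (Suc b) / (r * r) * q"
      using ckk ent(10)[OF hi(1,2)] ent(10)[OF hi(3,4)] ent(11)[OF hi] by (simp add: X)
    then have Xr: "X = bend G (Suc a) (Suc b) + (bend G (Suc a) 2 * bend G 2 (Suc b)) * q / 3" unfolding r by simp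
    have w: "\<bar>(bend G (Suc a) 2 * bend G 2 (Suc b)) * q\<bar> \<le> (1 * 1) * ((3/2) * \<kappa>)"
      by (rule abs_mult_le[OF abs_mult_le q1]) (use off[of "Suc a" 2] off[of 2 "Suc b"] ckk ab in auto)
    have "frame_sign bad a = bend_sign bad (Suc a)" using ckk by (auto simp: frame_sign_def bend_sign_def)
    then have "\<bar>bend G (Suc a) (Suc b) - (if a = b then frame_sign bad a else 0)\<bar> \<le> \<delta>"
      using B[of "Suc a" "Suc b"] ckk ab by (cases "a = b") auto
    from third(1)[OF this w] show ?thesis unfolding Xr using k by linarith
  qed
  then show ?thesis by (simp add: \<kappa>_def)
qed

lemma arccos_le_small_angle:
  assumes "0 \<le> \<theta>" "\<theta> \<le> 1" "1 - \<theta>\<^sup>2 / 8 \<le> x" "x \<le> 1"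
  shows "arccos x \<le> \<theta>"
proof -
  have h: "\<theta> / 4 \<le> sin (\<theta> / 2)" using half_le_sin[of "\<theta> / 2"] assms by simp
  have "cos \<theta> = 1 - 2 * (sin (\<theta> / 2))\<^sup>2" using cos_double_sin[of "\<theta> / 2"] by simp
  also have "\<dots> \<le> 1 - 2 * (\<theta> / 4)\<^sup>2" using h assms by (simp add: power_mono)
  also have "\<dots> \<le> x" using assms by (simp add: power_divide)
  finally have "arccos x \<le> arccos (cos \<theta>)" using assms by (intro arccos_le_arccos) auto
  then show ?thesis using assms pi_gt3 by (simp add: arccos_cos)
qed

text \<open>If the shear is \<open>s\<close>, then \<open>cosh l = G\<^sub>0\<^sub>0\<close> is about \<open>(2/3) exp s\<close>, whence the length \<open>s + ln (4/3)\<close>. The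
segment leaves the centre of the triangle almost in the direction of the vertex 0, which is the first vector of
the frame, and arrives in the same way.\<close>

lemma connection:
  assumes h: "h \<in> Isom" and g: "glues G (exp s)" and E: "6 \<le> exp s" and \<delta>: "\<delta> \<le> 1"
    and B: "\<And>a b. 2 \<le> a \<Longrightarrow> a \<le> n \<Longrightarrow> 2 \<le> b \<Longrightarrow> b \<le> n \<Longrightarrow> \<bar>bend G a b - (if a = b then bend_sign bad a else 0)\<bar> \<le> \<delta>"
    and \<theta>: "0 \<le> \<theta>" "\<theta> \<le> 1" "8 * exp (- s) \<le> \<theta>\<^sup>2"
  obtains w l X E' where "w \<in> unit_tangent n (h *\<^sub>v e 0)" "l > 0" "geod (h *\<^sub>v e 0) w l = (h * G) *\<^sub>v e 0"
    "\<bar>l - (s + ln (4/3))\<bar> \<le> 6 * exp (- s)"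
    "hangle (h *\<^sub>v e 1) w \<le> \<theta>" "hangle ((h * G) *\<^sub>v e 1) (- geod_vel (h *\<^sub>v e 0) w l) \<le> \<theta>"
    "list_all2 (parallel_transport n (geod (h *\<^sub>v e 0) w) l) (frame_of h) E'" "X \<in> SO n"
    "transforms_frame n X (negate_first_two E') (frame_of (h * G))"
    "\<And>a b. a < n \<Longrightarrow> b < n \<Longrightarrow> \<bar>X $$ (a, b) - (if a = b then frame_sign bad a else 0)\<bar> \<le> \<delta> + 20 * exp (- s)"
proof -
  define \<kappa> P c l where "\<kappa> = exp (- s)" and "P = bend G 2 2" and "c = G $$ (0, 0)" and "l = arcosh (G $$ (0, 0))"
  have k: "1 / exp s = \<kappa>" by (simp add: \<kappa>_def exp_minus divide_inverse)
  have Ek: "exp s * \<kappa> = 1" by (simp add: \<kappa>_def exp_minus)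
  have k0: "0 < \<kappa>" "\<kappa> \<le> 1/6" using E unfolding k[symmetric] by (auto simp: divide_le_eq)
  have n2: "2 \<le> n" using dim3 by simp
  have P2: "\<bar>P\<bar> \<le> 2" using B[of 2 2] n2 \<delta> by (auto simp: P_def bend_sign_def split: if_splits)
  have G: "G \<in> Isom" using g by (simp add: glues_def)
  note sz = glues_size[OF g E, folded P_def, OF P2, folded c_def, unfolded k]
  note ent = glues_entries[OF g, folded P_def c_def, unfolded k]
  have c1: "G $$ (0, 0) > 1" using sz(1) by (simp add: c_def)
  have ch: "cosh l = c" using c1 by (simp add: l_def c_def)
  have sh: "sinh l = sqrt (c * c - 1)" using c1 by (simp add: l_def c_def sinh_arcosh_real power2_eq_square)
  have shpos: "sinh l > 0" unfolding sh using sz(1) by (simp add: less_1_mult)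
  have shc: "sinh l \<le> c" using sz(1) unfolding sh by (intro real_le_lsqrt) (auto simp: power2_eq_square)
  have kt: "\<kappa> \<le> \<theta>\<^sup>2 / 8" using \<theta> by (simp add: \<kappa>_def)
  have ang: "arccos ((c - \<kappa>) / sinh l) \<le> \<theta>"
  proof (rule arccos_le_small_angle[OF \<theta>(1,2)])
    show "(c - \<kappa>) / sinh l \<le> 1" using shpos sz(3) by (simp add: sh)
    have "(1 - \<theta>\<^sup>2 / 8) * sinh l \<le> (1 - \<kappa>) * sinh l" using kt shpos by (intro mult_right_mono) auto
    also have "\<dots> \<le> (1 - \<kappa>) * c" using shc k0 by (intro mult_left_mono) auto
    also have "\<dots> \<le> c - \<kappa>" using k0 sz(1) by (simp add: algebra_simps)
    finally show "1 - \<theta>\<^sup>2 / 8 \<le> (c - \<kappa>) / sinh l" using shpos by (simp add: pos_le_divide_eq)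
  qed
  have ll: "\<bar>l - (s + ln (4/3))\<bar> \<le> 6 * \<kappa>"
  proof -
    have ex: "exp l + exp (- l) = 2 * c" using ch by (simp add: cosh_def)
    have l0: "l > 0" using shpos by simp
    then have em: "0 < exp (- l)" "exp (- l) \<le> 1" by auto
    have cc: "2 * c = (4/3) * exp s + (4/3) * \<kappa> - (2/3) * P" using ent(1) by simp
    have t: "exp (s + ln (4/3)) = (4/3) * exp s" by (simp add: exp_add)
    have up: "exp l \<le> (4/3) * exp s * (1 + 3 * \<kappa>)"
    proof -
      have "(4/3) * exp s * (1 + 3 * \<kappa>) = (4/3) * exp s + 4 * (exp s * \<kappa>)" by (simp add: algebra_simps)
      then show ?thesis using ex em cc P2 k0 Ek by linarith
    qed
    also have "\<dots> \<le> (4/3) * exp s * exp (3 * \<kappa>)" by (intro mult_left_mono exp_ge_add_one_self) auto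
    also have "\<dots> = exp (s + ln (4/3) + 3 * \<kappa>)" using t by (simp add: exp_add)
    finally have 1: "l \<le> s + ln (4/3) + 3 * \<kappa>" by simp
    have "(4/3) * exp s \<le> exp l * (1 + 6 * \<kappa>)"
    proof -
      have lo: "exp l \<ge> (4/3) * exp s * (1 - 3 * \<kappa>)"
      proof -
        have "(4/3) * exp s * (1 - 3 * \<kappa>) = (4/3) * exp s - 4 * (exp s * \<kappa>)" by (simp add: field_simps)
        then show ?thesis using ex em cc P2 k0 Ek by linarith
      qed
      have "1 \<le> (1 - 3 * \<kappa>) * (1 + 6 * \<kappa>)"
      proof -
        have "\<kappa> * \<kappa> \<le> (1/6) * \<kappa>" using k0 by (intro mult_right_mono) auto
        then show ?thesis by (simp add: algebra_simps)
      qed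
      then have "(4/3) * exp s * 1 \<le> (4/3) * exp s * ((1 - 3 * \<kappa>) * (1 + 6 * \<kappa>))" by (intro mult_left_mono) auto
      also have "\<dots> \<le> exp l * (1 + 6 * \<kappa>)" using mult_right_mono[OF lo, of "1 + 6 * \<kappa>"] k0 by (simp add: mult.assoc)
      finally show ?thesis by simp
    qed
    also have "\<dots> \<le> exp l * exp (6 * \<kappa>)" by (intro mult_left_mono exp_ge_add_one_self) auto
    finally have "exp (s + ln (4/3)) \<le> exp (l + 6 * \<kappa>)" unfolding t by (simp add: exp_add)
    then have 2: "s + ln (4/3) \<le> l + 6 * \<kappa>" by simp
    show ?thesis using 1 2 k0 by linarith
  qed
  obtain w X E' where H: "w \<in> unit_tangent n (h *\<^sub>v e 0)" "geod (h *\<^sub>v e 0) w l = (h * G) *\<^sub>v e 0" "l > 0"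
    "hangle (h *\<^sub>v e 1) w = arccos (G $$ (1, 0) / sinh l)"
    "hangle ((h * G) *\<^sub>v e 1) (- geod_vel (h *\<^sub>v e 0) w l) = arccos (- G $$ (0, 1) / sinh l)"
    "list_all2 (parallel_transport n (geod (h *\<^sub>v e 0) w) l) (frame_of h) E'" "X \<in> SO n"
    "transforms_frame n X (negate_first_two E') (frame_of (h * G))"
    "\<And>a b. a < n \<Longrightarrow> b < n \<Longrightarrow> X $$ (a, b) = (if a < 2 then - 1 else 1) *
       (G $$ (Suc a, Suc b) - G $$ (Suc a, 0) * G $$ (0, Suc b) / (1 + G $$ (0, 0)))"
    by (rule frame_comparison[OF h G c1, folded l_def]) (rule that; assumption)
  show ?thesis
  proof (rule that[OF H(1,3,2)])
    show "\<bar>l - (s + ln (4/3))\<bar> \<le> 6 * exp (- s)" using ll by (simp add: \<kappa>_def)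
    show "hangle (h *\<^sub>v e 1) w \<le> \<theta>" unfolding H(4) ent(2) by (rule ang)
    show "hangle ((h * G) *\<^sub>v e 1) (- geod_vel (h *\<^sub>v e 0) w l) \<le> \<theta>" unfolding H(5) ent(3) using ang by simp
    show "\<bar>X $$ (a, b) - (if a = b then frame_sign bad a else 0)\<bar> \<le> \<delta> + 20 * exp (- s)" if ab: "a < n" "b < n" for a b
      unfolding H(9)[OF ab] using frame_change_estimate[OF g E \<delta> B ab] by (simp add: k \<kappa>_def)
  qed (fact H)+
qed

section \<open>Gluings with a prescribed normal\<close>

lemma mrefl_fix: "z \<in> V \<Longrightarrow> x \<in> V \<Longrightarrow> mink z x = 0 \<Longrightarrow> mrefl z *\<^sub>v x = x"
  by (subst mrefl_vec) (auto intro!: eq_vecI)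

lemma mrefl_self: "z \<in> V \<Longrightarrow> mink z z \<noteq> 0 \<Longrightarrow> mrefl z *\<^sub>v z = - z"
  by (subst mrefl_vec) (auto intro!: eq_vecI)

lemma normal_space_norm:
  assumes b: "b \<in> V" "mink (vertex 0) b = 0"  "mink (vertex 2) b = 0"
  shows "(mink nu b)\<^sup>2 + (\<Sum>k = 3..n. (b $ k)\<^sup>2) = mink b b"
proof -
  have z: "(\<Sum>i = 3..n. vertex 0 $ i * b $ i) = 0" "(\<Sum>i = 3..n. nu $ i * b $ i) = 0" by (auto intro: sum.neutral)
  have 1: "b $ 1 = b $ 0" using b z(1) by (simp add: mink_split)
  have 2: "mink nu b = b $ 2" using b z(2) 1 by (simp add: mink_split)
  show ?thesis unfolding 2 using mink_split[OF b(1), of b] 1 by (simp add: power2_eq_square)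
qed

text \<open>Shear and image \<open>b\<close> of \<open>nu\<close> determine \<open>G\<close> only on the span of the triangle. The remaining freedom makes the
bend almost diagonal: \<open>G\<close> is the product of the reflection in \<open>v\<close>, which exchanges the ends of the edge, of the reflection
in \<open>z\<close>, which moves \<open>nu\<close> to \<open>b\<close> or \<open>- b\<close>, and, if the sign then comes out wrong, of the half turn \<open>W\<close> in the
plane of \<open>nu\<close> and \<open>e 3\<close>. If \<open>b\<close> is almost orthogonal to all \<open>e k\<close> with \<open>k\<close> at least 3, then \<open>z\<close> is almost parallel to
\<open>nu\<close>, and its reflection is almost diagonal.\<close>

lemma gluing_with_normal:
  fixes \<delta> E :: real
  assumes b: "b \<in> V" "mink b b = 1" "mink (vertex 0) b = 0"  "mink (vertex 2) b = 0" and E: "E > 0"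
    and \<delta>: "\<And>k. 3 \<le> k \<Longrightarrow> k \<le> n \<Longrightarrow> \<bar>mink (e k) b\<bar> \<le> \<delta>"
  obtains G bad where "glues G E" "G *\<^sub>v nu = b"
    "\<And>a c. 2 \<le> a \<Longrightarrow> a \<le> n \<Longrightarrow> 2 \<le> c \<Longrightarrow> c \<le> n \<Longrightarrow> \<bar>bend G a c - (if a = c then bend_sign bad a else 0)\<bar> \<le> n * \<delta>"
proof -
  define P where "P = mink nu b"
  define bad where "bad = (P > 0)"
  define \<tau> :: real where "\<tau> = (if bad then 1 else - 1)"
  have n3: "3 \<le> n" by (fact dim3)
  have \<tau>2: "\<tau> * \<tau> = 1" "\<bar>\<tau>\<bar> = 1" by (simp_all add: \<tau>_def)
  have \<tau>P: "\<tau> * P = \<bar>P\<bar>" by (auto simp: \<tau>_def bad_def)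
  \<comment> \<open>the sign keeps \<open>nu\<close> and \<open>b'\<close> apart, so that \<open>mink z z\<close> is at least 2\<close>
  define b' where "b' = (- \<tau>) \<cdot>\<^sub>v b"
  define z where "z = nu - b'"
  have b'V: "b' \<in> V" and zV: "z \<in> V" using b by (auto simp: b'_def z_def)
  have nb': "mink nu b' = - \<bar>P\<bar>" using b by (simp add: b'_def P_def[symmetric] \<tau>P)
  have b'n: "mink b' nu = - \<bar>P\<bar>" using nb' mink_commute[OF b'V nu_V] by simp
  have b'b': "mink b' b' = 1" using b \<tau>2 by (simp add: b'_def)
  have zz: "mink z z = 2 * (1 + \<bar>P\<bar>)" using b'V nb' b'n b'b' by (simp add: z_def)
  have znu: "mink z nu = 1 + \<bar>P\<bar>" using b'V b'n by (simp add: z_def)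
  have zN: "mink z (vertex 0) = 0" "mink z (vertex 2) = 0"
    using b mink_commute[OF b(1), of "vertex 0"] mink_commute[OF b(1), of "vertex 2"] by (simp_all add: z_def b'_def)
  have zz0: "mink z z > 0" unfolding zz by simp
  define v where "v = vertex 0 - (1 / E) \<cdot>\<^sub>v vertex 2"
  have vV: "v \<in> V" by (simp add: v_def)
  have vv: "mink v v = 3 / E" using E by (simp add: v_def mink_vertex_vertex)
  have vv0: "mink v v > 0" unfolding vv using E by simp
  define W where "W = (if bad then mrefl nu * mrefl (e 3) else 1\<^sub>m (Suc n))"
  have r3: "mrefl (e 3) \<in> Lor" "mrefl nu \<in> Lor" using n3 by (auto intro!: mrefl_Lor simp: mink_e_e)
  have WL: "W \<in> Lor" using r3 by (simp add: W_def)
  have rz: "mrefl z \<in> Lor" "mrefl v \<in> Lor" using zz0 vv0 zV vV by (auto intro!: mrefl_Lor)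
  define G where "G = mrefl z * (mrefl v * W)"
  have GL: "G \<in> Lor" unfolding G_def using WL rz by simp
  have Gvec: "G *\<^sub>v x = mrefl z *\<^sub>v (mrefl v *\<^sub>v (W *\<^sub>v x))" if "x \<in> V" for x
    using that WL rz by (simp add: G_def)
  have WN: "W *\<^sub>v vertex 0 = vertex 0" "W *\<^sub>v vertex 2 = vertex 2"
    using r3 n3 by (simp_all add: W_def mrefl_fix)
  have vN0: "mrefl v *\<^sub>v vertex 0 = (1 / E) \<cdot>\<^sub>v vertex 2"
  proof -
    have "2 * mink v (vertex 0) / mink v v = 1" unfolding vv using E by (simp add: v_def mink_vertex_vertex)
    then have "mrefl v *\<^sub>v vertex 0 = vertex 0 - 1 \<cdot>\<^sub>v v" using vV by (simp only: mrefl_vec vertex_V)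
    then show ?thesis by (auto simp: v_def vertex_def intro!: eq_vecI)
  qed
  have vN2: "mrefl v *\<^sub>v vertex 2 = E \<cdot>\<^sub>v vertex 0"
  proof -
    have "2 * mink v (vertex 2) / mink v v = - E" unfolding vv using E by (simp add: v_def mink_vertex_vertex)
    then have "mrefl v *\<^sub>v vertex 2 = vertex 2 - (- E) \<cdot>\<^sub>v v" using vV by (simp only: mrefl_vec vertex_V)
    also have "\<dots> = E \<cdot>\<^sub>v vertex 0" using E by (intro eq_vecI) (auto simp: v_def vertex_def right_diff_distrib)
    finally show ?thesis .
  qed
  have fixz: "mrefl z *\<^sub>v (t \<cdot>\<^sub>v vertex 0) = t \<cdot>\<^sub>v vertex 0" "mrefl z *\<^sub>v (t \<cdot>\<^sub>v vertex 2) = t \<cdot>\<^sub>v vertex 2" for t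
    using zV zN by (auto intro!: mrefl_fix)
  have GN: "G *\<^sub>v vertex 0 = (1 / E) \<cdot>\<^sub>v vertex 2" "G *\<^sub>v vertex 2 = E \<cdot>\<^sub>v vertex 0"
    by (simp_all add: Gvec WN vN0 vN2 fixz)
  have det: "det (A * B) = det A * det B" if "A \<in> Lor" "B \<in> Lor" for A B
    using that by (intro det_mult[where n="Suc n"] Lor_carrier)
  have "det W = 1" using r3 n3 mrefl_det[of nu] mrefl_det[of "e 3"] by (simp add: W_def det mink_e_e)
  then have "det G = 1" unfolding G_def using WL rz zV vV zz0 vv0 by (simp add: det mrefl_det)
  moreover have "G *\<^sub>v e 0 \<in> hyp n"
  proof -
    have eN: "mink (e 0) (vertex 0) = - 1" by (simp add: mink_e)
    have "mink (G *\<^sub>v e 0) (G *\<^sub>v vertex 0) = - 1" using GL eN by simp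
    then have "mink (G *\<^sub>v e 0) (vertex 2) < 0" unfolding GN using GL E by (simp add: divide_eq_eq)
    then have "(G *\<^sub>v e 0) $ 0 > 0"
      using GL by (intro future_by_causal[of "vertex 2" "G *\<^sub>v e 0"]) (auto simp: mink_vertex_vertex mink_e_e)
    then show ?thesis using GL by (simp add: hyp_def mink_e_e)
  qed
  ultimately have "G \<in> Isom" unfolding Isom_iff[OF e0_hyp] using GL by simp
  then have gl: "glues G E" using GN E by (simp add: glues_def)
  \<comment> \<open>the action on the normal space of the edge\<close>
  define ws :: "nat \<Rightarrow> real" where "ws a = (if bad \<and> (a = 2 \<or> a = 3) then - 1 else 1)" for a
  have Wf: "W *\<^sub>v edge_frame a = ws a \<cdot>\<^sub>v edge_frame a" if a: "2 \<le> a" "a \<le> n" for a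
  proof (cases bad)
    case True
    consider "a = 2" | "a = 3" | "a > 3" using a by linarith
    then show ?thesis
    proof cases
      case 1
      then have "W *\<^sub>v edge_frame a = mrefl nu *\<^sub>v (mrefl (e 3) *\<^sub>v nu)" using True r3 by (simp add: W_def edge_frame_def)
      also have "\<dots> = - nu" using n3 by (simp add: mrefl_fix mrefl_self)
      finally show ?thesis using 1 True by (auto simp: ws_def edge_frame_def intro!: eq_vecI)
    next
      case 2
      then have "W *\<^sub>v edge_frame a = mrefl nu *\<^sub>v (mrefl (e 3) *\<^sub>v e 3)" using True r3 by (simp add: W_def edge_frame_def)
      also have "\<dots> = - e 3" using n3 by (simp add: mrefl_fix mrefl_self mink_e_e)
      finally show ?thesis using 2 True by (auto simp: ws_def edge_frame_def intro!: eq_vecI)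
    next
      case 3
      then have "W *\<^sub>v edge_frame a = mrefl nu *\<^sub>v (mrefl (e 3) *\<^sub>v e a)" using True r3 by (simp add: W_def edge_frame_def)
      also have "\<dots> = e a" using n3 a 3 by (simp add: mrefl_fix mink_e_e)
      finally show ?thesis using 3 by (auto simp: ws_def edge_frame_def intro!: eq_vecI)
    qed
  next
    case False
    then show ?thesis by (auto simp: W_def ws_def intro!: eq_vecI)
  qed
  have vf: "mink v (edge_frame a) = 0" if "2 \<le> a" "a \<le> n" for a using that by (simp add: v_def mink_edge_frame_vertex)
  have Gf: "G *\<^sub>v edge_frame a = ws a \<cdot>\<^sub>v edge_frame a - (2 * (ws a * mink z (edge_frame a)) / mink z z) \<cdot>\<^sub>v z" if a: "2 \<le> a" "a \<le> n" for a
  proof -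
    have "mrefl v *\<^sub>v (ws a \<cdot>\<^sub>v edge_frame a) = ws a \<cdot>\<^sub>v edge_frame a" using vf[OF a] vV by (intro mrefl_fix) auto
    then show ?thesis using a zV by (simp add: Gvec Wf mrefl_vec)
  qed
  have Gnu: "G *\<^sub>v nu = b"
  proof -
    have w2: "ws 2 = - \<tau>" by (simp add: ws_def \<tau>_def)
    have k: "2 * (ws 2 * mink z nu) / mink z z = - \<tau>" unfolding zz znu w2 by (simp add: field_simps)
    have "G *\<^sub>v nu = ws 2 \<cdot>\<^sub>v nu - (2 * (ws 2 * mink z nu) / mink z z) \<cdot>\<^sub>v z" using Gf[of 2] n3 by (simp add: edge_frame_def)
    then have "G *\<^sub>v nu = (- \<tau>) \<cdot>\<^sub>v nu - (- \<tau>) \<cdot>\<^sub>v z" unfolding k unfolding w2 .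
    also have "\<dots> = b"
    proof (rule eq_vecI)
      fix i assume "i < dim_vec b"
      then have i: "i < Suc n" using b by auto
      have "\<tau> * (\<tau> * b $ i) = b $ i" using \<tau>2 by (simp add: mult.assoc[symmetric])
      then show "((- \<tau>) \<cdot>\<^sub>v nu - (- \<tau>) \<cdot>\<^sub>v z) $ i = b $ i"
        using i b by (simp add: z_def b'_def nu_def algebra_simps)
    qed (use b in \<open>simp add: z_def b'_def\<close>)
    finally show ?thesis .
  qed
  define za where "za a = mink z (edge_frame a)" for a
  have fz: "mink (edge_frame a) z = za a" for a unfolding za_def by (rule mink_commute) (use zV in auto)
  have bG: "bend G a c = ws c * ((if a = c then 1 else 0) - 2 * za a * za c / mink z z)"
    if "2 \<le> a" "a \<le> n" "2 \<le> c" "c \<le> n" for a c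
    using that zV by (simp add: bend_def Gf mink_edge_frame fz) (simp add: za_def algebra_simps)
  have za2: "za 2 = 1 + \<bar>P\<bar>" by (simp add: za_def edge_frame_def znu)
  have P1: "P\<^sup>2 + (\<Sum>k = 3..n. (b $ k)\<^sup>2) = 1" using normal_space_norm[OF b(1,3,4)] b(2) by (simp add: P_def)
  have bk: "mink (e k) b = b $ k" if "3 \<le> k" "k \<le> n" for k using b that by (simp add: mink_e)
  have bk1: "\<bar>b $ k\<bar> \<le> 1" if "3 \<le> k" "k \<le> n" for k
  proof -
    have "(b $ k)\<^sup>2 \<le> (\<Sum>k = 3..n. (b $ k)\<^sup>2)" by (rule member_le_sum) (use that in auto)
    then have "(b $ k)\<^sup>2 \<le> 1" using P1 zero_le_power2[of P] by linarith
    then show ?thesis by (simp add: abs_square_le_1)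
  qed
  have zak: "\<bar>za k\<bar> \<le> \<delta>" "\<bar>za k\<bar> \<le> 1" if k: "3 \<le> k" "k \<le> n" for k
  proof -
    have "mink (e k) z = \<tau> * b $ k" using k b b'V bk[OF k] by (simp add: z_def b'_def)
    then have "za k = \<tau> * b $ k" using fz[of k] k by (simp add: edge_frame_def)
    then have "\<bar>za k\<bar> = \<bar>b $ k\<bar>" using \<tau>2 by (simp add: abs_mult)
    then show "\<bar>za k\<bar> \<le> \<delta>" "\<bar>za k\<bar> \<le> 1" using \<delta>[OF k] bk1[OF k] bk[OF k] by auto
  qed
  have \<delta>0: "\<delta> \<ge> 0" using \<delta>[of 3] n3 by linarith
  have \<delta>n: "\<delta> \<le> n * \<delta>" using \<delta>0 n3 mult_right_mono[of 1 "real n" \<delta>] by simp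
  have P_le: "\<bar>P\<bar> \<le> 1" "1 - \<bar>P\<bar> \<le> n * \<delta>"
  proof -
    have "P\<^sup>2 \<le> 1" using P1 sum_nonneg[of "{3..n}" "\<lambda>k. (b $ k)\<^sup>2"] by simp
    then show P1': "\<bar>P\<bar> \<le> 1" by (simp add: abs_square_le_1)
    have "P\<^sup>2 \<le> \<bar>P\<bar>" using P1' mult_left_mono[of "\<bar>P\<bar>" 1 "\<bar>P\<bar>"] by (simp add: power2_eq_square abs_mult[symmetric])
    then have "1 - \<bar>P\<bar> \<le> (\<Sum>k = 3..n. (b $ k)\<^sup>2)" using P1 by linarith
    also have "\<dots> \<le> (\<Sum>k = 3..n. \<delta>)"
    proof (rule sum_mono)
      fix k assume "k \<in> {3..n}"
      then have k: "3 \<le> k" "k \<le> n" by auto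
      have "\<bar>b $ k\<bar> * \<bar>b $ k\<bar> \<le> \<delta> * 1" using \<delta>[OF k] bk1[OF k] bk[OF k] by (intro mult_mono) auto
      then show "(b $ k)\<^sup>2 \<le> \<delta>" by (simp add: power2_eq_square)
    qed
    also have "\<dots> \<le> n * \<delta>" using \<delta>0 by (simp add: mult_right_mono)
    finally show "1 - \<bar>P\<bar> \<le> n * \<delta>" .
  qed
  have ws1: "\<bar>ws c\<bar> = 1" for c by (simp add: ws_def)
  have "\<bar>bend G a c - (if a = c then bend_sign bad a else 0)\<bar> \<le> n * \<delta>"
    if ac: "2 \<le> a" "a \<le> n" "2 \<le> c" "c \<le> n" for a c
  proof -
    have h: "2 * x * y / mink z z = x * y / (1 + \<bar>P\<bar>)" for x y unfolding zz by (simp add: field_simps)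
    have bG': "bend G a c = ws c * ((if a = c then 1 else 0) - za a * za c / (1 + \<bar>P\<bar>))"
      if "2 \<le> a" "a \<le> n" "2 \<le> c" "c \<le> n" for a c
      using bG[OF that] unfolding h .
    have Pp: "1 + \<bar>P\<bar> > 0" "1 + \<bar>P\<bar> \<noteq> 0" by linarith+
    consider "a = 2" "c = 2" | "a = 2" "3 \<le> c" | "3 \<le> a" "c = 2" | "3 \<le> a" "3 \<le> c"
      using ac by linarith
    then show ?thesis
    proof cases
      case 1
      have "bend G 2 2 = ws 2 * (1 - (1 + \<bar>P\<bar>))" using bG'[of 2 2] n3 Pp by (simp add: za2)
      moreover have "bend_sign bad 2 = - ws 2" by (simp add: ws_def bend_sign_def)
      ultimately have "bend G 2 2 - bend_sign bad 2 = ws 2 * (1 - \<bar>P\<bar>)" by (simp add: algebra_simps)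
      then have "\<bar>bend G 2 2 - bend_sign bad 2\<bar> = 1 - \<bar>P\<bar>" using P_le by (simp add: abs_mult ws1)
      then show ?thesis using 1 P_le by simp
    next
      case 2
      have "bend G 2 c = - (ws c * za c)" using bG'[of 2 c] n3 ac 2 Pp by (simp add: za2)
      then have "\<bar>bend G 2 c\<bar> \<le> \<delta>" using zak(1)[of c] 2 ac by (simp add: abs_mult ws1)
      then show ?thesis using 2 \<delta>n by simp
    next
      case 3
      have "bend G a 2 = - (ws 2 * za a)" using bG'[of a 2] n3 ac 3 Pp by (simp add: za2)
      then have "\<bar>bend G a 2\<bar> \<le> \<delta>" using zak(1)[of a] 3 ac by (simp add: abs_mult ws1)
      then show ?thesis using 3 \<delta>n by simp
    next
      case 4
      have "bend_sign bad a = ws a" using 4 by (simp add: ws_def bend_sign_def)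
      then have "bend G a c - (if a = c then bend_sign bad a else 0) = - (ws c * (za a * za c / (1 + \<bar>P\<bar>)))"
        using bG'[OF ac] by (cases "a = c") (auto simp: algebra_simps)
      then have "\<bar>bend G a c - (if a = c then bend_sign bad a else 0)\<bar> = \<bar>za a\<bar> * \<bar>za c\<bar> / (1 + \<bar>P\<bar>)"
        using Pp by (simp add: abs_mult ws1)
      also have "\<dots> \<le> \<bar>za a\<bar> * \<bar>za c\<bar> / 1" using Pp by (intro divide_left_mono) auto
      also have "\<dots> \<le> \<delta> * 1" using zak(1)[of a] zak(2)[of c] 4 ac \<delta>0 by (simp del: mult_1_right) (intro mult_mono, auto)
      finally show ?thesis using \<delta>n by simp
    qed
  qed
  then show ?thesis using that[OF gl Gnu] by blast
qed

section \<open>Good curves\<close>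

lemma closed_geodesicD:
  assumes a: "a \<in> Lor" and c: "closed_geodesic n a p v l"
  shows "a *\<^sub>v p = cosh l \<cdot>\<^sub>v p + sinh l \<cdot>\<^sub>v v" "a *\<^sub>v v = sinh l \<cdot>\<^sub>v p + cosh l \<cdot>\<^sub>v v"
proof -
  have p: "p \<in> V" and v: "v \<in> V" and g: "\<And>t. a *\<^sub>v geod p v t = geod p v (t + l)"
    using c by (auto simp: closed_geodesic_def hyp_V unit_tangentD)
  have "geod p v 0 = p" using p v by (auto simp: geod_def intro!: eq_vecI)
  then show ap: "a *\<^sub>v p = cosh l \<cdot>\<^sub>v p + sinh l \<cdot>\<^sub>v v" using g[of 0] by (simp add: geod_def)
  show "a *\<^sub>v v = sinh l \<cdot>\<^sub>v p + cosh l \<cdot>\<^sub>v v"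
  proof (rule vec_eq_by_mink)
    fix w assume w: "w \<in> V"
    have s1: "sinh (1::real) \<noteq> 0" by simp
    have "mink w (a *\<^sub>v geod p v 1) = mink w (geod p v (1 + l))" using g[of 1] by simp
    then have "cosh 1 * mink w (a *\<^sub>v p) + sinh 1 * mink w (a *\<^sub>v v)
        = cosh (1 + l) * mink w p + sinh (1 + l) * mink w v"
      using a p v w by (simp add: Lor_move geod_def)
    then have "sinh 1 * mink w (a *\<^sub>v v) = sinh 1 * (sinh l * mink w p + cosh l * mink w v)"
      using p v w by (simp add: ap cosh_add sinh_add algebra_simps)
    then show "mink w (a *\<^sub>v v) = mink w (sinh l \<cdot>\<^sub>v p + cosh l \<cdot>\<^sub>v v)"
      using p v w s1 by simp
  qed (use a p v in auto)
qed

text \<open>The vector \<open>p + v\<close> represents the end point of the geodesic at infinity, which is attracting.\<close>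

lemma closed_geodesic_ray:
  assumes a: "a \<in> Lor" and c: "closed_geodesic n a p v l"
  shows "a *\<^sub>v (p + v) = exp l \<cdot>\<^sub>v (p + v)"
proof (rule vec_eq_by_mink)
  have p: "p \<in> V" and v: "v \<in> V" using c by (auto simp: closed_geodesic_def hyp_V unit_tangentD)
  show "a *\<^sub>v (p + v) \<in> V" "exp l \<cdot>\<^sub>v (p + v) \<in> V" using a p v by auto
  fix w assume w: "w \<in> V"
  have "mink w (a *\<^sub>v (p + v)) = mink w (a *\<^sub>v p) + mink w (a *\<^sub>v v)" using a p v w by (simp add: Lor_move)
  also have "\<dots> = (cosh l + sinh l) * (mink w p + mink w v)"
    unfolding closed_geodesicD[OF a c] using p v w by (simp add: algebra_simps)
  finally show "mink w (a *\<^sub>v (p + v)) = mink w (exp l \<cdot>\<^sub>v (p + v))"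
    using p v w by (simp add: cosh_plus_sinh)
qed

text \<open>The definition of parallel transport allows any parallel field, so its uniqueness is needed. For a field \<open>W\<close> normal to the
velocity at the start, the product with the velocity stays \<open>0\<close>; differentiating the relation that
\<open>W\<close> is tangent then shows that \<open>W\<close> has derivative \<open>0\<close>.\<close>

lemma parallel_transport_normal:
  assumes p: "p \<in> hyp n" and v: "v \<in> unit_tangent n p" and l: "l > 0"
    and w: "mink v w = 0" and pt: "parallel_transport n (geod p v) l w w'"
  shows "w' = w"
proof -
  note vD = unit_tangentD[OF v]
  have pV: "p \<in> V" using p by (rule hyp_V)
  have vp: "mink v p = 0" using vD pV mink_commute by auto
  obtain W where pf: "parallel_field n (geod p v) l W" and W0: "W 0 = w" and Wl: "W l = w'"
    using pt unfolding parallel_transport_def by blast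
  let ?I = "{0..l}"
  have WV: "W t \<in> V" and Wt: "mink (geod p v t) (W t) = 0" if "t \<in> ?I" for t
    using pf that unfolding parallel_field_def tangent_def by auto
  have "\<forall>t\<in>?I. \<exists>c. \<forall>k<n + 1. ((\<lambda>s. W s $ k) has_real_derivative c * geod p v t $ k) (at t within ?I)"
    using pf unfolding parallel_field_def by blast
  then obtain c where c: "\<And>t k. t \<in> ?I \<Longrightarrow> k < Suc n \<Longrightarrow> ((\<lambda>s. W s $ k) has_real_derivative c t * geod p v t $ k) (at t within ?I)"
    by (metis Suc_eq_plus1)
  have gi: "geod p v t $ k = cosh t * p $ k + sinh t * v $ k" "geod_vel p v t $ k = sinh t * p $ k + cosh t * v $ k"
    if "k < Suc n" for t k using that pV vD by (auto simp: geod_def geod_vel_def)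
  have dg: "((\<lambda>s. geod p v s $ k) has_real_derivative geod_vel p v t $ k) (at t within ?I)"
     "((\<lambda>s. geod_vel p v s $ k) has_real_derivative geod p v t $ k) (at t within ?I)" if k: "k < Suc n" for t k
    unfolding gi[OF k] by (auto intro!: derivative_eq_intros)
  have gV: "geod p v t \<in> V" "geod_vel p v t \<in> V" for t using pV vD by auto
  have gg: "mink (geod p v t) (geod p v t) = - 1" "mink (geod_vel p v t) (geod p v t) = 0" for t
    using pV vD vp hyp_mink[OF p] cosh_square_eq[of t] by (simp_all add: geod_def geod_vel_def power2_eq_square algebra_simps)
  \<comment> \<open>the component along the velocity is constant, because the velocity is itself parallel\<close>
  have dphi: "((\<lambda>s. mink (geod_vel p v s) (W s)) has_real_derivative 0) (at t within ?I)" if t: "t \<in> ?I" for t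
  proof -
    have "((\<lambda>s. \<Sum>k = 0..<Suc n. eta k * (geod_vel p v s $ k * W s $ k)) has_real_derivative
        (\<Sum>k = 0..<Suc n. eta k * (geod p v t $ k * W t $ k + (c t * geod p v t $ k) * geod_vel p v t $ k))) (at t within ?I)"
      by (intro DERIV_sum DERIV_cmult DERIV_mult dg c t) auto
    also have "(\<Sum>k = 0..<Suc n. eta k * (geod p v t $ k * W t $ k + (c t * geod p v t $ k) * geod_vel p v t $ k))
       = mink (geod p v t) (W t) + c t * mink (geod_vel p v t) (geod p v t)"
      unfolding mink_eta[OF WV[OF t]] mink_eta[OF gV(1)]
      by (simp add: sum.distrib[symmetric] sum_distrib_left algebra_simps)
    finally have "((\<lambda>s. \<Sum>k = 0..<Suc n. eta k * (geod_vel p v s $ k * W s $ k)) has_real_derivative 0) (at t within ?I)"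
      using Wt[OF t] gg by simp
    then show ?thesis
      by (rule has_field_derivative_transform_within[where d=1]) (use t WV in \<open>auto simp: mink_eta\<close>)
  qed
  have phi: "mink (geod_vel p v t) (W t) = 0" if t: "t \<in> ?I" for t
  proof -
    obtain C where C: "\<And>t. t \<in> ?I \<Longrightarrow> mink (geod_vel p v t) (W t) = C"
      using has_field_derivative_zero_constant[OF convex_real_interval(5) dphi] by blast
    have "geod_vel p v 0 = v" using pV vD by (auto simp: geod_vel_def intro!: eq_vecI)
    then show ?thesis using C[OF t] C[of 0] l w W0 by simp
  qed
  have c0: "c t = 0" if t: "t \<in> ?I" for t
  proof -
    have "((\<lambda>s. \<Sum>k = 0..<Suc n. eta k * (geod p v s $ k * W s $ k)) has_real_derivative
        (\<Sum>k = 0..<Suc n. eta k * (geod_vel p v t $ k * W t $ k + (c t * geod p v t $ k) * geod p v t $ k))) (at t within ?I)"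
      by (intro DERIV_sum DERIV_cmult DERIV_mult dg c t) auto
    also have "(\<Sum>k = 0..<Suc n. eta k * (geod_vel p v t $ k * W t $ k + (c t * geod p v t $ k) * geod p v t $ k))
       = mink (geod_vel p v t) (W t) + c t * mink (geod p v t) (geod p v t)"
      unfolding mink_eta[OF WV[OF t]] mink_eta[OF gV(1)]
      by (simp add: sum.distrib[symmetric] sum_distrib_left algebra_simps)
    finally have 1: "((\<lambda>s. \<Sum>k = 0..<Suc n. eta k * (geod p v s $ k * W s $ k)) has_real_derivative - c t) (at t within ?I)"
      using phi[OF t] gg by simp
    have 2: "((\<lambda>s. \<Sum>k = 0..<Suc n. eta k * (geod p v s $ k * W s $ k)) has_real_derivative 0) (at t within ?I)"
      by (rule has_field_derivative_transform_within[where d=1 and f="\<lambda>s. 0"])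
        (use t WV Wt in \<open>auto simp: mink_eta[symmetric]\<close>)
    have "- c t = 0"
      by (rule vector_derivative_unique_within_closed_interval[of 0 l t])
        (use l t 1 2 in \<open>auto simp: has_real_derivative_iff_has_vector_derivative\<close>)
    then show ?thesis by simp
  qed
  show ?thesis
  proof (rule eq_vecI)
    have wV: "w \<in> V" "w' \<in> V" using WV[of 0] WV[of l] l W0 Wl by auto
    then show "dim_vec w' = dim_vec w" by simp
    fix k assume "k < dim_vec w"
    then have k: "k < Suc n" using wV by simp
    have "((\<lambda>s. W s $ k) has_real_derivative 0) (at t within ?I)" if "t \<in> ?I" for t
      using c[OF that k] c0[OF that] by simp
    then obtain C where "\<And>t. t \<in> ?I \<Longrightarrow> W t $ k = C"
      using has_field_derivative_zero_constant[OF convex_real_interval(5), of 0 l "\<lambda>t. W t $ k"] by blast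
    then show "w' $ k = w $ k" using W0 Wl l by fastforce
  qed
qed

text \<open>Normal vectors are constant along the geodesic, so the comparison with the basis moved by \<open>a\<close> is all that remains of
the monodromy.\<close>

lemma monodromy_entries:
  assumes a: "a \<in> Isom" and cg: "closed_geodesic n a p v l" and X: "X \<in> SO (n - 1)"
    and pf: "pos_frame n p (v # ws)" and pt: "list_all2 (parallel_transport n (geod p v) l) ws ws'"
    and tf: "transforms_frame n X (map (\<lambda>w. a *\<^sub>v w) ws) ws'" and i: "i < n - 1" and j: "j < n - 1"
  shows "mink (a *\<^sub>v (ws ! i)) (ws ! j) = X $$ (i, j)"
proof -
  have p: "p \<in> hyp n" and v: "v \<in> unit_tangent n p" and l: "l > 0" using cg by (auto simp: closed_geodesic_def)
  have aL: "a \<in> Lor" using a by simp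
  have len: "length ws = n - 1" using pf by (auto simp: pos_frame_def)
  have tan: "set (v # ws) \<subseteq> tangent n p" and orth: "\<And>i j. i < n \<Longrightarrow> j < n \<Longrightarrow> mink ((v # ws) ! i) ((v # ws) ! j) = (if i = j then 1 else 0)"
    using pf by (auto simp: pos_frame_def)
  have wsV: "ws ! k \<in> V" if "k < n - 1" for k using tan that len by (force simp: tangent_def)
  have vws: "mink v (ws ! k) = 0" and wsws: "mink (ws ! k) (ws ! m) = (if k = m then 1 else 0)" if "k < n - 1" "m < n - 1" for k m
    using orth[of 0 "Suc k"] orth[of "Suc k" "Suc m"] that by auto
  have "ws' = ws"
  proof (rule nth_equalityI)
    show "length ws' = length ws" using pt by (simp add: list_all2_lengthD)
    fix k assume "k < length ws'"
    then have k: "k < n - 1" using pt len by (simp add: list_all2_lengthD)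
    show "ws' ! k = ws ! k"
      by (rule parallel_transport_normal[OF p v l vws[OF k k]]) (use pt k len in \<open>auto dest: list_all2_nthD\<close>)
  qed
  then have M: "mat_of_cols (n + 1) ws = mat_of_cols (n + 1) (map (\<lambda>w. a *\<^sub>v w) ws) * X"
    using tf by (simp add: transforms_frame_def)
  have aw: "a *\<^sub>v (ws ! k) \<in> V" if "k < n - 1" for k using aL wsV[OF that] by simp
  have Xc: "X \<in> carrier_mat (n - 1) (n - 1)" using X by (simp add: SO_def)
  have comp: "(ws ! j) $ r = (\<Sum>k = 0..<n - 1. (a *\<^sub>v (ws ! k)) $ r * X $$ (k, j))" if r: "r < Suc n" for r
  proof -
    have "(ws ! j) $ r = mat_of_cols (n + 1) ws $$ (r, j)" using r j len by (simp add: mat_of_cols_index)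
    also have "\<dots> = (\<Sum>k = 0..<n - 1. mat_of_cols (n + 1) (map (\<lambda>w. a *\<^sub>v w) ws) $$ (r, k) * X $$ (k, j))"
      unfolding M using r j Xc len mat_of_cols_carrier(1)[of "n + 1" "map (\<lambda>w. a *\<^sub>v w) ws"] by (intro mult_mat_entry) auto
    also have "\<dots> = (\<Sum>k = 0..<n - 1. (a *\<^sub>v (ws ! k)) $ r * X $$ (k, j))"
      by (intro sum.cong) (use r len in \<open>auto simp: mat_of_cols_index simp del: index_mult_mat_vec\<close>)
    finally show ?thesis .
  qed
  have "mink (a *\<^sub>v (ws ! i)) (ws ! j) = (\<Sum>r = 0..<Suc n. eta r * ((a *\<^sub>v (ws ! i)) $ r * (\<Sum>k = 0..<n - 1. (a *\<^sub>v (ws ! k)) $ r * X $$ (k, j))))"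
    unfolding mink_eta[OF wsV[OF j]] by (intro sum.cong) (auto simp: comp simp del: index_mult_mat_vec)
  also have "\<dots> = (\<Sum>r = 0..<Suc n. \<Sum>k = 0..<n - 1. X $$ (k, j) * (eta r * ((a *\<^sub>v (ws ! i)) $ r * (a *\<^sub>v (ws ! k)) $ r)))"
    by (simp add: sum_distrib_left mult_ac del: index_mult_mat_vec)
  also have "\<dots> = (\<Sum>k = 0..<n - 1. \<Sum>r = 0..<Suc n. X $$ (k, j) * (eta r * ((a *\<^sub>v (ws ! i)) $ r * (a *\<^sub>v (ws ! k)) $ r)))"
    by (rule sum.swap)
  also have "\<dots> = (\<Sum>k = 0..<n - 1. X $$ (k, j) * mink (a *\<^sub>v (ws ! i)) (a *\<^sub>v (ws ! k)))"
    by (intro sum.cong) (auto simp: mink_eta[OF aw] sum_distrib_left simp del: index_mult_mat_vec)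
  also have "\<dots> = (\<Sum>k = 0..<n - 1. if k = i then X $$ (k, j) else 0)"
    by (intro sum.cong) (use aL wsV wsws i in auto)
  finally show ?thesis using i by simp
qed

text \<open>On the orthogonal complement of the attracting null vector, the form only sees the quotient by that
vector. There \<open>a\<close> acts as on the normal space of the geodesic, that is, by the monodromy, and the coordinates of a unit
vector are at most 1. Summing the \<open>n\<^sup>2\<close> entries gives the factor \<open>n\<^sup>3\<close>, where one \<open>n\<close> comes from
\<open>entries_le_SO_dist\<close>.\<close>

lemma good_curve_action:
  fixes \<epsilon> :: real
  assumes a: "a \<in> Isom" and g: "good_curve n R \<epsilon> a"
  obtains p v l where "closed_geodesic n a p v l" "\<bar>l - 2 * R\<bar> < 2 * \<epsilon>"
    "\<And>x y. x \<in> V \<Longrightarrow> y \<in> V \<Longrightarrow> mink x (p + v) = 0 \<Longrightarrow> mink y (p + v) = 0 \<Longrightarrow> mink x x = 1 \<Longrightarrow> mink y y = 1 \<Longrightarrow>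
       \<bar>mink x (a *\<^sub>v y) - mink x y\<bar> \<le> n ^ 3 * \<epsilon>"
proof -
  obtain p v l X where cg: "closed_geodesic n a p v l" and mo: "monodromy n a p v l X"
    and le: "\<bar>l - 2 * R\<bar> < 2 * \<epsilon>" and d: "SO_dist (n - 1) X (1\<^sub>m (n - 1)) < \<epsilon>"
    using g unfolding good_curve_def by blast
  obtain ws ws' where X: "X \<in> SO (n - 1)" and pf: "pos_frame n p (v # ws)"
    and pt: "list_all2 (parallel_transport n (geod p v) l) ws ws'"
    and tf: "transforms_frame n X (map (\<lambda>w. a *\<^sub>v w) ws) ws'"
    using mo unfolding monodromy_def by blast
  have p: "p \<in> hyp n" using cg by (simp add: closed_geodesic_def)
  have aL: "a \<in> Lor" using a by simp
  have n3: "3 \<le> n" by (fact dim3)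
  have \<epsilon>0: "\<epsilon> > 0" using le by linarith
  obtain H where H: "H \<in> Isom" "H *\<^sub>v e 0 = p" "frame_of H = v # ws" using frame_matrix[OF pf p] by blast
  have HL: "H \<in> Lor" using H by simp
  have He1: "H *\<^sub>v e 1 = v" using frame_of_nth[of 0 H] H(3) n3 by simp
  have len: "length ws = n - 1" using pf by (auto simp: pos_frame_def)
  have Hk: "H *\<^sub>v e k = ws ! (k - 2)" if "2 \<le> k" "k \<le> n" for k
  proof -
    have "frame_of H ! (k - 1) = ws ! (k - 2)" using H(3) that by (simp add: nth_Cons' numeral_2_eq_2)
    then show ?thesis using frame_of_nth[of "k - 1" H] that by simp
  qed
  define A where "A = adj H * (a * H)"
  have AL: "A \<in> Lor" using HL aL by (simp add: A_def)
  have Am: "mink u (A *\<^sub>v w) = mink (H *\<^sub>v u) (a *\<^sub>v (H *\<^sub>v w))" if "u \<in> V" "w \<in> V" for u w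
    using that HL aL Lor_mink[OF HL, of u "adj H *\<^sub>v (a *\<^sub>v (H *\<^sub>v w))"] by (simp add: A_def)
  have pV: "p \<in> V" and vV: "v \<in> V" using cg by (auto simp: closed_geodesic_def hyp_V unit_tangentD)
  have aH0: "a *\<^sub>v (H *\<^sub>v e 0) = H *\<^sub>v (cosh l \<cdot>\<^sub>v e 0 + sinh l \<cdot>\<^sub>v e 1)"
    and aH1: "a *\<^sub>v (H *\<^sub>v e 1) = H *\<^sub>v (sinh l \<cdot>\<^sub>v e 0 + cosh l \<cdot>\<^sub>v e 1)"
    unfolding H(2) He1 closed_geodesicD[OF aL cg]
    by (rule vec_eq_by_mink; use HL pV vV in \<open>auto simp: Lor_move H(2)[symmetric] He1[symmetric]\<close>)+
  have A0: "A *\<^sub>v e 0 = cosh l \<cdot>\<^sub>v e 0 + sinh l \<cdot>\<^sub>v e 1" and A1: "A *\<^sub>v e 1 = sinh l \<cdot>\<^sub>v e 0 + cosh l \<cdot>\<^sub>v e 1"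
    using HL aL by (simp_all add: A_def aH0 aH1[simplified])
  have n1: "1 \<le> n" using n3 by simp
  have ent0: "A $$ (k, 0) = 0" "A $$ (k, 1) = 0" if "2 \<le> k" "k \<le> n" for k
    using that n1 Lor_entry[OF AL, of k 0] Lor_entry[OF AL, of k 1] by (simp_all add: A0 A1[simplified] mink_e_e)
  have ent1: "A $$ (0, 0) = cosh l" "A $$ (0, 1) = sinh l" "A $$ (1, 0) = sinh l" "A $$ (1, 1) = cosh l"
    using n1 Lor_entry[OF AL, of 0 0] Lor_entry[OF AL, of 0 1] Lor_entry[OF AL, of 1 0] Lor_entry[OF AL, of 1 1]
    by (simp_all add: A0 A1[simplified] mink_e_e eta_def)
  have ent2: "A $$ (0, k) = 0" "A $$ (1, k) = 0" if k: "2 \<le> k" "k \<le> n" for k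
  proof -
    have kV: "A *\<^sub>v e k \<in> V" using AL by simp
    have "mink (A *\<^sub>v e 0) (A *\<^sub>v e k) = 0" "mink (A *\<^sub>v e 1) (A *\<^sub>v e k) = 0"
      using AL k n1 by (simp_all add: mink_e_e)
    then have q: "cosh l * mink (e 0) (A *\<^sub>v e k) + sinh l * mink (e 1) (A *\<^sub>v e k) = 0"
       "sinh l * mink (e 0) (A *\<^sub>v e k) + cosh l * mink (e 1) (A *\<^sub>v e k) = 0"
      using kV by (simp_all add: A0 A1[simplified])
    have cs: "cosh l * cosh l - sinh l * sinh l = (1::real)" using cosh_square_eq[of l] by (simp add: power2_eq_square)
    have elim: "(C * C - S * S) * x = C * (C * x + S * y) - S * (S * x + C * y)"
      "(C * C - S * S) * y = C * (S * x + C * y) - S * (C * x + S * y)" for C S x y :: real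
      by (simp_all add: algebra_simps)
    have "(cosh l * cosh l - sinh l * sinh l) * mink (e 0) (A *\<^sub>v e k) = 0"
      unfolding elim(1)[of _ _ _ "mink (e 1) (A *\<^sub>v e k)"] q by simp
    moreover have "(cosh l * cosh l - sinh l * sinh l) * mink (e 1) (A *\<^sub>v e k) = 0"
      unfolding elim(2)[of _ _ _ "mink (e 0) (A *\<^sub>v e k)"] q by simp
    ultimately
    have "mink (e 0) (A *\<^sub>v e k) = 0" "mink (e 1) (A *\<^sub>v e k) = 0" unfolding cs by simp_all
    then show "A $$ (0, k) = 0" "A $$ (1, k) = 0"
      using k n1 Lor_entry[OF AL, of 0 k] Lor_entry[OF AL, of 1 k] by simp_all
  qed
  have ent: "\<bar>A $$ (i, j) - (if i = j then 1 else 0)\<bar> \<le> n * \<epsilon>" if ij: "2 \<le> i" "i \<le> n" "2 \<le> j" "j \<le> n" for i j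
  proof -
    have ij': "i - 2 < n - 1" "j - 2 < n - 1" using ij by auto
    have "A $$ (i, j) = mink (ws ! (i - 2)) (a *\<^sub>v (ws ! (j - 2)))"
      using ij Lor_entry[OF AL, of i j] by (simp add: eta_def Am Hk)
    also have "\<dots> = mink (a *\<^sub>v (ws ! (j - 2))) (ws ! (i - 2))"
      by (rule mink_commute) (use HL aL Hk[symmetric] ij in auto)
    also have "\<dots> = X $$ (j - 2, i - 2)" by (rule monodromy_entries[OF a cg X pf pt tf ij'(2,1)])
    finally have "A $$ (i, j) = X $$ (j - 2, i - 2)" .
    have "\<bar>A $$ (i, j) - (if i = j then 1 else 0)\<bar> \<le> (n - 1) * \<epsilon>"
    proof -
      have "(j - 2 = i - 2) = (i = j)" using ij by auto
      then show ?thesis using entries_le_SO_dist[OF X d ij'(2,1)] \<open>A $$ (i, j) = X $$ (j - 2, i - 2)\<close> by auto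
    qed
    also have "\<dots> \<le> n * \<epsilon>" using \<epsilon>0 by (intro mult_right_mono) auto
    finally show ?thesis .
  qed
  have "\<bar>mink x (a *\<^sub>v y) - mink x y\<bar> \<le> n ^ 3 * \<epsilon>"
    if xy: "x \<in> V" "y \<in> V" "mink x (p + v) = 0" "mink y (p + v) = 0" "mink x x = 1" "mink y y = 1" for x y
  proof -
    define x' y' where "x' = adj H *\<^sub>v x" and "y' = adj H *\<^sub>v y"
    have V': "x' \<in> V" "y' \<in> V" using HL xy by (auto simp: x'_def y'_def)
    have 1: "mink x (a *\<^sub>v y) = mink x' (A *\<^sub>v y')" using HL xy V' by (simp add: Am) (simp add: x'_def y'_def)
    have 2: "mink x y = mink x' y'" using HL xy by (simp add: x'_def y'_def)
    have pv: "p + v = H *\<^sub>v (e 0 + e 1)"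
      unfolding H(2)[symmetric] He1[symmetric] by (rule vec_eq_by_mink) (use HL in \<open>auto simp: Lor_move\<close>)
    have lead: "z' $ 1 = z' $ 0" if "z' = adj H *\<^sub>v z" "z \<in> V" "mink z (p + v) = 0" for z z'
    proof -
      have z'V: "z' \<in> V" using that HL by simp
      have "mink z' (e 0 + e 1) = 0" using that HL Lor_move[OF HL, of z "e 0 + e 1"] by (simp add: pv)
      then have "mink (e 0) z' + mink (e 1) z' = 0" using z'V mink_commute[OF z'V, of "e 0"] mink_commute[OF z'V, of "e 1"] by simp
      then show ?thesis using z'V n1 by (simp add: mink_e)
    qed
    have sp: "{1..n} = insert 1 {2..n}" "{0..<Suc n} = insert 0 (insert 1 {2..n})" using n1 by auto
    have lx: "x' $ 1 = x' $ 0" and ly: "y' $ 1 = y' $ 0" using lead xy x'_def y'_def by blast+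
    have m: "mink u w = (\<Sum>i = 2..n. u $ i * w $ i)" if "w \<in> V" "w $ 1 = w $ 0" "u $ 1 = u $ 0" for u w
      unfolding mink_eq[OF that(1)] sp using that by simp
    have Ay: "(A *\<^sub>v y') $ i = A $$ (i, 0) * y' $ 0 + A $$ (i, 1) * y' $ 1 + (\<Sum>j = 2..n. A $$ (i, j) * y' $ j)" if "i \<le> n" for i
      using that V' AL by (subst mult_mat_vec_entry) (auto simp: sp Lor_carrier)
    have Ay0: "(A *\<^sub>v y') $ 0 = cosh l * y' $ 0 + sinh l * y' $ 0"  "(A *\<^sub>v y') $ 1 = sinh l * y' $ 0 + cosh l * y' $ 0"
      using n1 by (simp_all add: Ay ent1[simplified] ent2[simplified] ly[simplified] del: index_mult_mat_vec)
    have Ayk: "(A *\<^sub>v y') $ i = (\<Sum>j = 2..n. A $$ (i, j) * y' $ j)" if "2 \<le> i" "i \<le> n" for i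
      using that by (simp add: Ay ent0[simplified] del: index_mult_mat_vec)
    have "mink x' (A *\<^sub>v y') = (\<Sum>i = 2..n. x' $ i * (\<Sum>j = 2..n. A $$ (i, j) * y' $ j))"
      using AL V' Ay0 lx by (subst m) (auto simp: Ayk simp del: index_mult_mat_vec)
    moreover have "mink x' y' = (\<Sum>i = 2..n. x' $ i * (\<Sum>j = 2..n. (if i = j then 1 else 0) * y' $ j))"
      using V' lx ly by (subst m) (auto simp: if_distrib[of "\<lambda>t. t * _"] cong: if_cong)
    ultimately have "mink x (a *\<^sub>v y) - mink x y = (\<Sum>i = 2..n. \<Sum>j = 2..n. x' $ i * ((A $$ (i, j) - (if i = j then 1 else 0)) * y' $ j))"
      unfolding 1 2 by (simp add: sum_subtractf[symmetric] sum_distrib_left algebra_simps)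
    also have "\<bar>\<dots>\<bar> \<le> (\<Sum>i = 2..n. \<Sum>j = 2..n. 1 * (n * \<epsilon> * 1))"
    proof (intro order_trans[OF sum_abs] sum_mono)
      fix i j assume ij: "i \<in> {2..n}" "j \<in> {2..n}"
      have le1: "\<bar>z $ k\<bar> \<le> 1" if "z \<in> V" "z $ 1 = z $ 0" "mink z z = 1" "k \<in> {2..n}" for z k
      proof -
        have "(z $ k)\<^sup>2 \<le> (\<Sum>i = 2..n. (z $ i)\<^sup>2)" by (rule member_le_sum) (use that in auto)
        also have "\<dots> = 1" using m[OF that(1,2,2)] that(3) by (simp add: power2_eq_square)
        finally show ?thesis by (simp add: abs_square_le_1)
      qed
      have "mink x' x' = 1" "mink y' y' = 1" using HL xy by (simp_all add: x'_def y'_def)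
      then show "\<bar>x' $ i * ((A $$ (i, j) - (if i = j then 1 else 0)) * y' $ j)\<bar> \<le> 1 * (n * \<epsilon> * 1)"
        using ij lx ly V' ent[of i j] by (intro abs_mult_le le1) auto
    qed
    also have "\<dots> = (real (n - 1) * real (n - 1)) * (n * \<epsilon>)" using n1 by (simp add: of_nat_diff)
    also have "\<dots> \<le> (real n * real n) * (n * \<epsilon>)" using \<epsilon>0 by (intro mult_right_mono mult_mono) auto
    finally show ?thesis by (simp add: power3_eq_cube mult_ac)
  qed
  then show ?thesis using that[OF cg le] by blast
qed

section \<open>Deck transformations with a common fixed point at infinity\<close>

text \<open>In coordinates this is a closed subset of a box. The box has infinitely many factors, as the topology is pulled back from
functions on all natural numbers, but all coordinates beyond \<open>n\<close> vanish.\<close>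

lemma compact_hyp_part: "compactin (hyp_topology n) {x \<in> hyp n. x $ 0 \<le> C}"
proof -
  define \<phi> :: "real vec \<Rightarrow> nat \<Rightarrow> real" where "\<phi> x = (\<lambda>i. if i < n + 1 then x $ i else 0)" for x
  have top: "hyp_topology n = pullback_topology (hyp n) \<phi> euclidean" unfolding hyp_topology_def \<phi>_def ..
  let ?K = "{x \<in> hyp n. x $ 0 \<le> C}"
  define B where "B = \<bar>C\<bar> + 1"
  let ?box = "PiE UNIV (\<lambda>i::nat. {- B..B})"
  let ?Y = "{y :: nat \<Rightarrow> real. (\<forall>i. i \<ge> n + 1 \<longrightarrow> y i = 0) \<and> (\<Sum>i = 1..n. y i * y i) - y 0 * y 0 = - 1 \<and> 0 \<le> y 0 \<and> y 0 \<le> C}"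
  have cont: "continuous_on UNIV (\<lambda>y :: nat \<Rightarrow> real. y i)" for i by (rule continuous_on_product_coordinates)
  have "closed ?Y"
    by (intro closed_Collect_conj closed_Collect_all closed_Collect_imp closed_Collect_eq closed_Collect_le
        continuous_intros cont) auto
  moreover have "compact ?box"
  proof -
    have "compactin (product_topology (\<lambda>i::nat. euclidean :: real topology) UNIV) ?box"
      by (subst compactin_PiE) auto
    then show ?thesis by (simp add: euclidean_product_topology)
  qed
  ultimately have "compact (?box \<inter> ?Y)" by (rule compact_Int_closed[rotated])
  moreover have "\<phi> ` ?K = ?box \<inter> ?Y"
  proof (intro equalityI subsetI)
    fix y assume "y \<in> \<phi> ` ?K"
    then obtain x where x: "x \<in> hyp n" "x $ 0 \<le> C" and y: "y = \<phi> x" by blast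
    have m: "(\<Sum>i = 1..n. x $ i * x $ i) - x $ 0 * x $ 0 = - 1" and pos: "x $ 0 > 0"
      using x hyp_mink[OF x(1)] mink_eq[OF hyp_V[OF x(1)], of x] by (auto simp: hyp_def)
    have "\<bar>x $ i\<bar> \<le> B" if "i \<le> n" for i
    proof (cases "i = 0")
      case False
      have "x $ i * x $ i \<le> (\<Sum>i = 1..n. x $ i * x $ i)" by (rule member_le_sum) (use that False in auto)
      also have "\<dots> \<le> C * C" using m x pos mult_mono[of "x $ 0" C "x $ 0" C] by simp
      finally have "\<bar>x $ i\<bar> \<le> \<bar>C\<bar>" by (simp add: abs_le_square_iff power2_eq_square)
      then show ?thesis by (simp add: B_def)
    qed (use x pos in \<open>simp add: B_def\<close>)
    then have "\<bar>y i\<bar> \<le> B" for i by (cases "i \<le> n") (auto simp: y \<phi>_def B_def)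
    then have "y \<in> ?box" by (auto simp: PiE_iff abs_le_iff minus_le_iff)
    moreover have "y \<in> ?Y" using m pos x by (simp add: y \<phi>_def)
    ultimately show "y \<in> ?box \<inter> ?Y" by blast
  next
    fix y assume y: "y \<in> ?box \<inter> ?Y"
    define x where "x = vec (Suc n) y"
    have "y 0 \<noteq> 0"
    proof
      assume "y 0 = 0"
      then have "(\<Sum>i = 1..n. y i * y i) = - 1" using y by simp
      moreover have "(\<Sum>i = 1..n. y i * y i) \<ge> 0" by (simp add: sum_nonneg)
      ultimately show False by simp
    qed
    then have "x \<in> hyp n" "x $ 0 \<le> C" using y by (auto simp: hyp_def mink_eq x_def)
    moreover have "\<phi> x = y" using y by (auto simp: \<phi>_def x_def)
    ultimately show "y \<in> \<phi> ` ?K" by blast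
  qed
  ultimately have cpt: "compact (\<phi> ` ?K)" by simp
  show ?thesis unfolding compactin_def top
  proof (intro conjI allI impI)
    show "?K \<subseteq> topspace (pullback_topology (hyp n) \<phi> euclidean)" by (auto simp: topspace_pullback_topology)
    fix \<U> assume U: "(\<forall>U\<in>\<U>. openin (pullback_topology (hyp n) \<phi> euclidean) U) \<and> ?K \<subseteq> \<Union> \<U>"
    let ?V = "{W. open W \<and> \<phi> -` W \<inter> hyp n \<in> \<U>}"
    have "\<phi> ` ?K \<subseteq> \<Union> ?V"
    proof
      fix y assume "y \<in> \<phi> ` ?K"
      then obtain x where x: "x \<in> ?K" "y = \<phi> x" by blast
      then obtain T where T: "T \<in> \<U>" "x \<in> T" using U by blast
      then obtain W where "open W" "T = \<phi> -` W \<inter> hyp n" using U by (auto simp: openin_pullback_topology)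
      then show "y \<in> \<Union> ?V" using T x by blast
    qed
    then obtain D where D: "D \<subseteq> ?V" "finite D" "\<phi> ` ?K \<subseteq> \<Union> D" using compactE[OF cpt, of ?V] by blast
    show "\<exists>\<F>. finite \<F> \<and> \<F> \<subseteq> \<U> \<and> ?K \<subseteq> \<Union> \<F>"
      by (rule exI[of _ "(\<lambda>W. \<phi> -` W \<inter> hyp n) ` D"]) (use D in blast)
  qed
qed

text \<open>Hence the points of bounded distance from \<open>p\<close> lie in one of the compact sets above.\<close>

lemma hyp_time_le:
  assumes p: "p \<in> hyp n" and x: "x \<in> hyp n"
  shows "x $ 0 \<le> 2 * p $ 0 * (- mink p x)"
proof -
  \<comment> \<open>the point symmetric to \<open>e 0\<close> with respect to \<open>p\<close>\<close>
  define u where "u = (2 * p $ 0) \<cdot>\<^sub>v p - e 0"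
  have pV: "p \<in> V" and xV: "x \<in> V" using p x by (auto simp: hyp_V)
  have ep: "mink (e 0) p = - p $ 0" "mink p (e 0) = - p $ 0"
    using pV mink_commute[OF pV, of "e 0"] by (auto simp: mink_e)
  have "mink u u = - 1" using pV hyp_mink[OF p] ep by (simp add: u_def mink_e_e algebra_simps)
  moreover have "mink u p < 0" using pV hyp_mink[OF p] ep p by (simp add: u_def hyp_def)
  ultimately have "u \<in> hyp n" using pV by (intro hyp_by_mink[OF p]) (auto simp: u_def)
  then have "mink u x < 0" using x by (rule hyp_mink_less)
  then show ?thesis using pV xV by (simp add: u_def mink_e)
qed

lemma pow_mat_Lor [simp]: "a \<in> Lor \<Longrightarrow> a ^\<^sub>m k \<in> Lor"
  by (induction k) (auto dest: Lor_carrier)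

lemma pow_mat_add_vec:
  assumes a: "a \<in> Lor" and v: "v \<in> V"
  shows "(a ^\<^sub>m (d + k)) *\<^sub>v v = (a ^\<^sub>m d) *\<^sub>v ((a ^\<^sub>m k) *\<^sub>v v)"
  using v
proof (induction k arbitrary: v)
  case 0
  then show ?case using Lor_carrier[OF a] by simp
next
  case (Suc k)
  then show ?case using a by simp
qed

text \<open>The points \<open>a\<^sup>k p\<close> move along the axis of \<open>a\<close> towards the common fixed point at infinity, and \<open>b\<close> moves them by a
bounded distance. So the elements \<open>\<gamma> k\<close>, the conjugates of \<open>b\<close> by the powers of \<open>a\<close>, move \<open>p\<close> by a bounded
distance. By discreteness two of them are equal, and then a power of \<open>a\<close> commutes with \<open>b\<close>.\<close>

lemma common_ray_commute:
  assumes ch: "closed_hyperbolic n \<Gamma>" and a: "a \<in> \<Gamma>" and b: "b \<in> \<Gamma>"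
    and cg: "closed_geodesic n a p v l" and bN: "b *\<^sub>v (p + v) = \<mu> \<cdot>\<^sub>v (p + v)"
  shows "\<exists>d>0. \<forall>x\<in>V. (a ^\<^sub>m d) *\<^sub>v (b *\<^sub>v x) = b *\<^sub>v ((a ^\<^sub>m d) *\<^sub>v x)"
proof -
  have sub: "subgroup \<Gamma> (hyp_isom n)"
    and fin: "\<And>K. compactin (hyp_topology n) K \<Longrightarrow> finite {g \<in> \<Gamma>. (\<lambda>x. g *\<^sub>v x) ` K \<inter> K \<noteq> {}}"
    using ch by (auto simp: closed_hyperbolic_def)
  have \<Gamma>I: "g \<in> Isom" if "g \<in> \<Gamma>" for g using subgroup.mem_carrier[OF sub that] .
  have \<Gamma>m: "g * g' \<in> \<Gamma>" if "g \<in> \<Gamma>" "g' \<in> \<Gamma>" for g g'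
    using subgroup.m_closed[OF sub that] by (simp add: hyp_isom_simps)
  have \<Gamma>1: "1\<^sub>m (Suc n) \<in> \<Gamma>" using subgroup.one_closed[OF sub] by (simp add: hyp_isom_simps)
  have \<Gamma>i: "adj g \<in> \<Gamma>" if "g \<in> \<Gamma>" for g
    using subgroup.m_inv_closed[OF sub that] \<Gamma>I[OF that] by (simp add: hyp_isom_inv)
  have aL: "a \<in> Lor" and bL: "b \<in> Lor" using a b \<Gamma>I by auto
  have pow: "a ^\<^sub>m k \<in> \<Gamma>" for k
    by (induction k) (use a \<Gamma>1 \<Gamma>m Lor_carrier[OF aL] in auto)
  have p: "p \<in> hyp n" and v: "v \<in> unit_tangent n p" and l: "l > 0"
    and g: "\<And>t. a *\<^sub>v geod p v t = geod p v (t + l)" using cg by (auto simp: closed_geodesic_def)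
  have pV: "p \<in> V" and vV: "v \<in> V" using p unit_tangentD[OF v] by (auto simp: hyp_V)
  have pgeod: "(a ^\<^sub>m k) *\<^sub>v geod p v t = geod p v (t + k * l)" for k t
  proof (induction k arbitrary: t)
    case 0
    then show ?case using pV vV Lor_carrier[OF aL] by simp
  next
    case (Suc k)
    have "(a ^\<^sub>m Suc k) *\<^sub>v geod p v t = (a ^\<^sub>m k) *\<^sub>v (a *\<^sub>v geod p v t)" using aL pV vV by simp
    then show ?case unfolding g Suc by (simp add: algebra_simps)
  qed
  have geod0: "geod p v 0 = p" using pV vV by (auto simp: geod_def intro!: eq_vecI)
  define \<gamma> where "\<gamma> k = adj (a ^\<^sub>m k) * (b * (a ^\<^sub>m k))" for k
  have \<gamma>\<Gamma>: "\<gamma> k \<in> \<Gamma>" for k unfolding \<gamma>_def by (intro \<Gamma>m \<Gamma>i pow b)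
  define N' where "N' = p - v"
  define Np where "Np = p + v"
  have NV: "N' \<in> V" "Np \<in> V" using pV vV by (auto simp: N'_def Np_def)
  define C where "C = (\<bar>mink Np (b *\<^sub>v N')\<bar> + \<bar>mink N' (b *\<^sub>v Np)\<bar> + \<bar>mink N' (b *\<^sub>v N')\<bar>) / 4"
  have vp: "mink p v = 0" "mink v p = 0" "mink v v = 1" using unit_tangentD[OF v] pV mink_commute[OF vV pV] by auto
  \<comment> \<open>since \<open>b\<close> preserves the ray, the term that would grow like \<open>exp (2 * k * l)\<close> is absent\<close>
  have NN: "mink Np (b *\<^sub>v Np) = 0"
    using bN NV pV vV vp hyp_mink[OF p] unfolding Np_def by simp
  have bound: "- mink p (\<gamma> k *\<^sub>v p) \<le> C" for k
  proof -
    define t where "t = k * l"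
    have t: "t \<ge> 0" using l by (simp add: t_def)
    define E where "E = exp t"
    define E' where "E' = exp (- t)"
    have E': "0 < E'" "E' \<le> 1" and EE: "E * E' = 1"
      using t by (auto simp: E_def E'_def exp_add[symmetric])
    have "geod p v t = (E / 2) \<cdot>\<^sub>v Np + (E' / 2) \<cdot>\<^sub>v N'"
      using pV vV by (intro eq_vecI) (auto simp: geod_def Np_def N'_def E_def E'_def cosh_field_def sinh_field_def field_simps)
    then have \<sigma>: "(a ^\<^sub>m k) *\<^sub>v p = (E / 2) \<cdot>\<^sub>v Np + (E' / 2) \<cdot>\<^sub>v N'" using pgeod[of k 0] by (simp add: geod0 t_def)
    have "mink p (\<gamma> k *\<^sub>v p) = mink p (adj (a ^\<^sub>m k) *\<^sub>v (b *\<^sub>v ((a ^\<^sub>m k) *\<^sub>v p)))"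
      using aL bL pV by (simp add: \<gamma>_def)
    also have "\<dots> = mink ((a ^\<^sub>m k) *\<^sub>v p) ((a ^\<^sub>m k) *\<^sub>v (adj (a ^\<^sub>m k) *\<^sub>v (b *\<^sub>v ((a ^\<^sub>m k) *\<^sub>v p))))"
      using aL bL pV by (intro Lor_mink[symmetric]) auto
    also have "\<dots> = mink ((a ^\<^sub>m k) *\<^sub>v p) (b *\<^sub>v ((a ^\<^sub>m k) *\<^sub>v p))"
      using aL bL pV by simp
    also have "\<dots> = (E * E') / 4 * mink Np (b *\<^sub>v N') + (E * E') / 4 * mink N' (b *\<^sub>v Np) + (E' * E') / 4 * mink N' (b *\<^sub>v N')"
    proof -
      have "mink (r \<cdot>\<^sub>v Np + s \<cdot>\<^sub>v N') (b *\<^sub>v (r \<cdot>\<^sub>v Np + s \<cdot>\<^sub>v N'))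
        = r * r * mink Np (b *\<^sub>v Np) + r * s * mink Np (b *\<^sub>v N') + r * s * mink N' (b *\<^sub>v Np) + s * s * mink N' (b *\<^sub>v N')" for r s
        using NV bL
        by (simp add: mult_add_distrib_mat_vec[OF Lor_carrier] mult_mat_vec[OF Lor_carrier] algebra_simps)
      then show ?thesis unfolding \<sigma> NN by simp
    qed
    also have "\<dots> = (1 / 4) * mink Np (b *\<^sub>v N') + (1 / 4) * mink N' (b *\<^sub>v Np) + (E' * E') / 4 * mink N' (b *\<^sub>v N')" unfolding EE ..
    also have "- \<dots> \<le> C"
    proof -
      have "\<bar>E' * E' * mink N' (b *\<^sub>v N')\<bar> \<le> 1 * \<bar>mink N' (b *\<^sub>v N')\<bar>"
        unfolding abs_mult[of "E' * E'"] using E' mult_mono[of E' 1 E' 1] by (intro mult_right_mono) auto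
      then show ?thesis unfolding C_def by (simp add: abs_le_iff) linarith
    qed
    finally show ?thesis by simp
  qed
  define K where "K = {x \<in> hyp n. x $ 0 \<le> max (p $ 0) (2 * p $ 0 * C)}"
  have "\<gamma> k *\<^sub>v p \<in> K" for k
  proof -
    have h: "\<gamma> k *\<^sub>v p \<in> hyp n" by (rule Isom_hyp[OF \<Gamma>I[OF \<gamma>\<Gamma>] p])
    have "(\<gamma> k *\<^sub>v p) $ 0 \<le> 2 * p $ 0 * (- mink p (\<gamma> k *\<^sub>v p))" by (rule hyp_time_le[OF p h])
    also have "\<dots> \<le> 2 * p $ 0 * C" using bound[of k] p by (intro mult_left_mono) (auto simp: hyp_def)
    finally show ?thesis using h by (simp add: K_def)
  qed
  moreover have "p \<in> K" using p by (simp add: K_def)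
  ultimately have "range \<gamma> \<subseteq> {g \<in> \<Gamma>. (\<lambda>x. g *\<^sub>v x) ` K \<inter> K \<noteq> {}}" using \<gamma>\<Gamma> by blast
  moreover have "compactin (hyp_topology n) K" unfolding K_def by (rule compact_hyp_part)
  ultimately have "finite (range \<gamma>)" using fin finite_subset by blast
  then have "\<not> inj \<gamma>" using finite_imageD infinite_UNIV_nat by blast
  then obtain i j where "i \<noteq> j" "\<gamma> i = \<gamma> j" by (auto simp: inj_def)
  then obtain k m where km: "k < m" "\<gamma> k = \<gamma> m" by (metis linorder_neqE_nat)
  define d where "d = m - k"
  have m: "m = d + k" and d: "d > 0" using km by (auto simp: d_def)
  have "(a ^\<^sub>m d) *\<^sub>v (b *\<^sub>v x) = b *\<^sub>v ((a ^\<^sub>m d) *\<^sub>v x)" if x: "x \<in> V" for x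
  proof -
    define y where "y = adj (a ^\<^sub>m k) *\<^sub>v x"
    have y: "y \<in> V" and ky: "(a ^\<^sub>m k) *\<^sub>v y = x" using aL x by (auto simp: y_def)
    have my: "(a ^\<^sub>m m) *\<^sub>v z = (a ^\<^sub>m d) *\<^sub>v ((a ^\<^sub>m k) *\<^sub>v z)" if "z \<in> V" for z
      unfolding m by (rule pow_mat_add_vec[OF aL that])
    have "\<gamma> k *\<^sub>v y = \<gamma> m *\<^sub>v y" using km by simp
    then have "adj (a ^\<^sub>m k) *\<^sub>v (b *\<^sub>v x) = adj (a ^\<^sub>m m) *\<^sub>v (b *\<^sub>v ((a ^\<^sub>m d) *\<^sub>v x))"
      using aL bL y by (simp add: \<gamma>_def ky my)
    then have "(a ^\<^sub>m m) *\<^sub>v (adj (a ^\<^sub>m k) *\<^sub>v (b *\<^sub>v x)) = b *\<^sub>v ((a ^\<^sub>m d) *\<^sub>v x)"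
      using aL bL x by simp
    then show ?thesis using aL bL x by (simp add: my)
  qed
  then show ?thesis using d by blast
qed

lemma null_orthogonal_parallel:
  assumes u: "u \<in> V" "mink u u = 0" "u $ 0 > 0" and w: "w \<in> V" "mink w w = 0" "w $ 0 > 0" and uw: "mink u w = 0"
  shows "w = (w $ 0 / u $ 0) \<cdot>\<^sub>v u"
proof (rule ccontr)
  define x where "x = w - (w $ 0 / u $ 0) \<cdot>\<^sub>v u"
  assume ne: "w \<noteq> (w $ 0 / u $ 0) \<cdot>\<^sub>v u"
  have xV: "x \<in> V" using u w by (simp add: x_def)
  have "mink w u = 0" using uw mink_commute[OF w(1) u(1)] by simp
  then have "mink x x = 0" using u w uw by (simp add: x_def)
  moreover have "x $ 0 = 0" using u w by (simp add: x_def)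
  ultimately have "x = 0\<^sub>v (Suc n)" using causal_time_nonzero[OF xV] by force
  then have "w = (w $ 0 / u $ 0) \<cdot>\<^sub>v u"
  proof -
    assume x0: "x = 0\<^sub>v (Suc n)"
    show ?thesis
    proof (rule eq_vecI)
      fix i assume "i < dim_vec ((w $ 0 / u $ 0) \<cdot>\<^sub>v u)"
      then have i: "i < Suc n" using u by simp
      have "x $ i = 0" using x0 i by simp
      then show "w $ i = ((w $ 0 / u $ 0) \<cdot>\<^sub>v u) $ i" using i u w by (simp add: x_def)
    qed (use u w in simp)
  qed
  then show False using ne by simp
qed

end

section \<open>Powers of a generator in the group of the pants\<close>

lemma foldr_cons_reduce_replicate:
  assumes "\<not> cancels x y"
  shows "foldr cons_reduce (replicate d x) (y # w) = replicate d x @ (y # w)"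
proof (induction d)
  case (Suc d)
  have "\<not> cancels x x" by (simp add: cancels_def)
  then show ?case using Suc assms by (cases d) auto
qed simp

lemma reduced_replicate_append:
  assumes "\<not> cancels x y"
  shows "successively (\<lambda>x y. \<not> cancels x y) (replicate d x @ [y])"
proof (induction d)
  case (Suc d)
  have "\<not> cancels x x" by (simp add: cancels_def)
  then show ?case using Suc assms by (cases d) auto
qed simp

lemma reduced_replicate: "successively (\<lambda>x y. \<not> cancels x y) (replicate d x)"
  using reduced_replicate_append[of x x "d - 1"]
  by (cases d) (auto simp: cancels_def replicate_append_same)

lemma reduced_Cons_replicate:
  assumes "\<not> cancels y x"
  shows "successively (\<lambda>x y. \<not> cancels x y) (y # replicate d x)"
  using reduced_replicate[of d x] assms by (cases d) auto

lemma power_letter_not_commuting: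
  assumes "\<not> cancels x y" "\<not> cancels y x" "x \<noteq> y" "d > 0"
    and h: "\<rho> \<in> hom pants_group G" and inj: "inj_on \<rho> (carrier pants_group)"
  shows "\<rho> (replicate d x) \<otimes>\<^bsub>G\<^esub> \<rho> [y] \<noteq> \<rho> [y] \<otimes>\<^bsub>G\<^esub> \<rho> (replicate d x)"
proof
  assume eq: "\<rho> (replicate d x) \<otimes>\<^bsub>G\<^esub> \<rho> [y] = \<rho> [y] \<otimes>\<^bsub>G\<^esub> \<rho> (replicate d x)"
  obtain d' where d': "d = Suc d'" using assms(4) by (cases d) auto
  have c: "replicate d x \<in> carrier pants_group" "[y] \<in> carrier pants_group"
    "replicate d x @ [y] \<in> carrier pants_group" "y # replicate d x \<in> carrier pants_group"
    using reduced_replicate reduced_replicate_append[OF assms(1)] reduced_Cons_replicate[OF assms(2)]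
    by (auto simp: pants_group_def)
  have m: "replicate d x \<otimes>\<^bsub>pants_group\<^esub> [y] = replicate d x @ [y]" "[y] \<otimes>\<^bsub>pants_group\<^esub> replicate d x = y # replicate d x"
    using foldr_cons_reduce_replicate[OF assms(1), of d "[]"] assms(2) by (auto simp: pants_group_def d')
  have "\<rho> (replicate d x @ [y]) = \<rho> (y # replicate d x)"
    using eq hom_mult[OF h c(1,2)] hom_mult[OF h c(2,1)] by (simp add: m)
  then have "replicate d x @ [y] = y # replicate d x" using inj_onD[OF inj _ c(3,4)] by blast
  then show False using assms(3) by (simp add: d')
qed

lemma hom_replicate:
  assumes h: "\<rho> \<in> hom pants_group G" and d: "d > 0"
  shows "\<rho> (replicate (Suc d) x) = \<rho> (replicate d x) \<otimes>\<^bsub>G\<^esub> \<rho> [x]"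
proof -
  have "\<not> cancels x x" by (simp add: cancels_def)
  then have "replicate d x \<otimes>\<^bsub>pants_group\<^esub> [x] = replicate (Suc d) x"
    using foldr_cons_reduce_replicate[of x x d "[]"] by (simp add: pants_group_def replicate_append_same)
  moreover have "replicate d x \<in> carrier pants_group" "[x] \<in> carrier pants_group"
    using reduced_replicate by (auto simp: pants_group_def)
  ultimately show ?thesis using hom_mult[OF h] by metis
qed

context minkowski_space begin

section \<open>Ideal triangles\<close>

lemma Lor_linear:
  assumes "A \<in> Lor" "x \<in> V" 
  shows "A *\<^sub>v (t \<cdot>\<^sub>v x) = t \<cdot>\<^sub>v (A *\<^sub>v x)"
    and "y \<in> V \<Longrightarrow> A *\<^sub>v (x + y) = A *\<^sub>v x + A *\<^sub>v y" and "y \<in> V \<Longrightarrow> A *\<^sub>v (x - y) = A *\<^sub>v x - A *\<^sub>v y"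
  using assms by (simp_all add: mult_mat_vec[OF Lor_carrier] mult_add_distrib_mat_vec[OF Lor_carrier]
    mult_minus_distrib_mat_vec[OF Lor_carrier])

lemma tangent_positive:
  assumes p: "p \<in> hyp n" and x: "x \<in> V" "mink p x = 0" "x \<noteq> 0\<^sub>v (Suc n)"
  shows "mink x x > 0"
proof (rule ccontr)
  assume "\<not> mink x x > 0"
  then have le: "mink x x \<le> 0" by simp
  have pV: "p \<in> V" and p0: "p $ 0 > 0" using p by (auto simp: hyp_def)
  have "x $ 0 \<noteq> 0" by (rule causal_time_nonzero) (use x le in auto)
  then consider "x $ 0 > 0" | "(- x) $ 0 > 0" using x by fastforce
  then show False
  proof cases
    case 1
    have "mink p x < 0" by (rule causal_mink(2)[OF pV x(1) _ le p0 1]) (use hyp_mink[OF p] in auto)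
    then show ?thesis using x by simp
  next
    case 2
    have "mink p (- x) < 0" by (rule causal_mink(2)[OF pV _ _ _ p0 2]) (use hyp_mink[OF p] x le in auto)
    then show ?thesis using x pV by simp
  qed
qed

lemma exchange_isometry:
  assumes u: "u \<in> V" and w: "w \<in> V" and eq: "mink u u = mink w w"
    and pos: "u \<noteq> w \<Longrightarrow> mink (u - w) (u - w) \<noteq> 0"
  obtains r where "r \<in> Lor" "r *\<^sub>v u = w" "\<And>x. x \<in> V \<Longrightarrow> mink x u = mink x w \<Longrightarrow> r *\<^sub>v x = x"
proof (cases "u = w")
  case True
  then show ?thesis using that[of "1\<^sub>m (Suc n)"] u by simp
next
  case False
  define z where "z = u - w"
  have zV: "z \<in> V" using u w by (simp add: z_def)
  have zz: "mink z z \<noteq> 0" using pos False by (simp add: z_def)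
  have wu: "mink w u = mink u w" using u w by (simp add: mink_commute)
  have "2 * mink z u = mink z z" using u w eq wu by (simp add: z_def)
  then have "2 * mink z u / mink z z = 1" using zz by simp
  then have "mrefl z *\<^sub>v u = u - 1 \<cdot>\<^sub>v z" using zV u by (simp only: mrefl_vec)
  also have "\<dots> = w" using u w by (auto simp: z_def intro!: eq_vecI)
  finally have 1: "mrefl z *\<^sub>v u = w" .
  have 2: "mrefl z *\<^sub>v x = x" if x: "x \<in> V" "mink x u = mink x w" for x
  proof (rule mrefl_fix[OF zV x(1)])
    have "mink x z = 0" using x u w by (simp add: z_def)
    then show "mink z x = 0" using mink_commute[OF x(1) zV] by simp
  qed
  show ?thesis using that[OF mrefl_Lor[OF zV zz] 1 2] .
qed

text \<open>Three reflections carry \<open>e 0\<close>, \<open>e 1\<close> and \<open>e 2\<close> one after the other to their targets, each of them fixing the targets reached before.\<close>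

lemma isometry_from_triple:
  assumes p: "p \<in> hyp n" and v: "v \<in> V" "mink p v = 0" "mink v v = 1"
    and w: "w \<in> V" "mink p w = 0" "mink v w = 0" "mink w w = 1"
  obtains h where "h \<in> Isom" "h *\<^sub>v e 0 = p" "h *\<^sub>v e 1 = v" "h *\<^sub>v e 2 = w"
proof -
  have pV: "p \<in> V" using p by (rule hyp_V)
  have n3: "1 \<le> n" "2 \<le> n" "3 \<le> n" using dim3 by auto
  have vp: "mink v p = 0" and wp: "mink w p = 0" and wv: "mink w v = 0"
    using v w pV mink_commute by auto
  have pos: "mink (x - y) (x - y) \<noteq> 0" if "x \<in> V" "y \<in> V" "mink p x = 0" "mink p y = 0" "x \<noteq> y" for x y
  proof -
    have "x - y \<noteq> 0\<^sub>v (Suc n)"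
    proof
      assume z: "x - y = 0\<^sub>v (Suc n)"
      have "x = y"
      proof (rule eq_vecI)
        fix i assume "i < dim_vec y"
        then have i: "i < Suc n" using that by auto
        then have "(x - y) $ i = 0" using z by simp
        then show "x $ i = y $ i" using i that by simp
      qed (use that in auto)
      then show False using that by simp
    qed
    then have "mink (x - y) (x - y) > 0" using that pV by (intro tangent_positive[OF p]) auto
    then show ?thesis by simp
  qed
  have p1: "mink (e 0 - p) (e 0 - p) \<noteq> 0" if "e 0 \<noteq> p"
  proof
    assume z: "mink (e 0 - p) (e 0 - p) = 0"
    have pe: "mink p (e 0) = - p $ 0" using pV mink_commute[OF pV, of "e 0"] by (simp add: mink_e)
    have "p $ 0 = 1" using z pV hyp_mink[OF p] pe by (simp add: mink_e_e mink_e)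
    then have "(e 0 - p) $ 0 = 0" using pV by simp
    then have d: "e 0 - p = 0\<^sub>v (Suc n)" using causal_time_nonzero[of "e 0 - p"] z pV by force
    have "e 0 = p"
    proof (rule eq_vecI)
      fix i assume "i < dim_vec p"
      then have i: "i < Suc n" using pV by auto
      then have "(e 0 - p) $ i = 0" using d by simp
      then show "e 0 $ i = p $ i" using i pV by simp
    qed (use pV in auto)
    then show False using that by simp
  qed
  obtain r1 where r1: "r1 \<in> Lor" "r1 *\<^sub>v e 0 = p"
    using exchange_isometry[OF _ pV _ p1] hyp_mink[OF p] by (metis mink_e_e unit_vec_carrier le0)
  define x1 x2 where "x1 = r1 *\<^sub>v e 1" and "x2 = r1 *\<^sub>v e 2"
  have x: "x1 \<in> V" "x2 \<in> V" "mink p x1 = 0" "mink p x2 = 0" "mink x1 x1 = 1" "mink x2 x2 = 1" "mink x1 x2 = 0"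
    using r1 n3 by (auto simp: x1_def x2_def r1(2)[symmetric] mink_e_e)
  obtain r2 where r2: "r2 \<in> Lor" "r2 *\<^sub>v x1 = v" "\<And>x. x \<in> V \<Longrightarrow> mink x x1 = mink x v \<Longrightarrow> r2 *\<^sub>v x = x"
  proof -
    have "mink x1 x1 = mink v v" using x v by simp
    from exchange_isometry[OF x(1) v(1) this pos[OF x(1) v(1) x(3) v(2)]] that show ?thesis by blast
  qed
  have r2p: "r2 *\<^sub>v p = p" using r2(3)[OF pV] x v by simp
  define y2 where "y2 = r2 *\<^sub>v x2"
  have y: "y2 \<in> V" "mink p y2 = 0" "mink v y2 = 0" "mink y2 y2 = 1"
    using x r2(1) Lor_mink[OF r2(1) pV x(2)] Lor_mink[OF r2(1) x(1,2)] by (auto simp: y2_def r2p r2(2))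
  obtain r3 where r3: "r3 \<in> Lor" "r3 *\<^sub>v y2 = w" "\<And>x. x \<in> V \<Longrightarrow> mink x y2 = mink x w \<Longrightarrow> r3 *\<^sub>v x = x"
  proof -
    have "mink y2 y2 = mink w w" using y w by simp
    from exchange_isometry[OF y(1) w(1) this pos[OF y(1) w(1) y(2) w(2)]] that show ?thesis by blast
  qed
  have r3p: "r3 *\<^sub>v p = p" "r3 *\<^sub>v v = v" using r3(3)[OF pV] r3(3)[OF v(1)] y w by simp_all
  define g where "g = r3 * (r2 * r1)"
  have gL: "g \<in> Lor" using r1 r2 r3 by (simp add: g_def)
  have ge: "g *\<^sub>v e 0 = p" "g *\<^sub>v e 1 = v" "g *\<^sub>v e 2 = w"
    using r1 r2 r3 r2p r3p by (simp_all add: g_def x1_def[simplified, symmetric] x2_def[symmetric] y2_def[symmetric])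
  \<comment> \<open>a reflection in a direction outside the plane corrects the orientation\<close>
  define m where "m = (if det g = 1 then 1\<^sub>m (Suc n) else mrefl (e 3))"
  have mL: "m \<in> Lor" using n3 by (auto simp: m_def mink_e_e intro!: mrefl_Lor)
  have me: "m *\<^sub>v e k = e k" if "k < 3" for k using that n3 by (simp add: m_def mrefl_fix mink_e_e)
  have "det g * det g = 1" using Lor_det_sq[OF gL] .
  then have "det g = 1 \<or> det g = - 1" by (simp add: square_eq_1_iff)
  moreover have "det (mrefl (e 3)) = - 1" using n3 by (intro mrefl_det) (auto simp: mink_e_e)
  ultimately have "det (g * m) = 1"
    using det_mult[OF Lor_carrier[OF gL] Lor_carrier[OF mL]] by (auto simp: m_def)
  moreover have gm: "(g * m) *\<^sub>v e k = g *\<^sub>v e k" if "k < 3" for k using gL mL me[OF that] by simp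
  ultimately have "g * m \<in> Isom" unfolding Isom_iff[OF e0_hyp] using gL mL ge p gm[of 0] by simp
  then show ?thesis using that[of "g * m"] gm[of 0] gm[of 1] gm[of 2] ge by simp
qed

text \<open>The three null vectors determine the centre of the triangle and two orthonormal directions in its plane.\<close>

lemma triangle_isometry:
  assumes xi: "\<And>i. \<xi> i \<in> V" "\<And>i j. mink (\<xi> i) (\<xi> j) = (if i = j then 0 else - 3/2)" "\<And>i. \<xi> i $ 0 > 0"
  obtains h where "h \<in> Isom" "\<And>i :: 3. h *\<^sub>v vertex i = \<xi> i"
proof -
  define p where "p = (1/3) \<cdot>\<^sub>v (\<xi> 0 + \<xi> 1 + \<xi> 2)"
  define v where "v = \<xi> 0 - p"
  define w where "w = (1 / sqrt 3) \<cdot>\<^sub>v (\<xi> 1 - \<xi> 2)"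
  have V': "p \<in> V" "v \<in> V" "w \<in> V" using xi(1) by (auto simp: p_def v_def w_def)
  have dims: "dim_vec (\<xi> k) = Suc n" for k using xi(1)[of k] by auto
  have px: "mink p (\<xi> i) = - 1" "mink (\<xi> i) p = - 1" for i
    using exhaust_mod_3[of i] by (auto simp: p_def xi(1,2))
  have "mink p p = (1/3) * (mink p (\<xi> 0) + mink p (\<xi> 1) + mink p (\<xi> 2))"
    using xi(1) V' by (subst (2) p_def) simp
  then have pp: "mink p p = - 1" by (simp add: px)
  have "p $ 0 > 0" using xi(1) xi(3)[of 0] xi(3)[of 1] xi(3)[of 2] by (simp add: p_def dims)
  then have p: "p \<in> hyp n" using V' pp by (simp add: hyp_def)
  have v: "mink p v = 0" "mink v v = 1" using xi(1) V' pp px by (simp_all add: v_def xi(2))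
  have w: "mink p w = 0" "mink v w = 0" "mink w w = 1"
    using xi(1) V' px by (simp_all add: v_def w_def xi(2) field_simps)
  obtain h where h: "h \<in> Isom" "h *\<^sub>v e 0 = p" "h *\<^sub>v e 1 = v" "h *\<^sub>v e 2 = w"
    using isometry_from_triple[OF p V'(2) v V'(3) w] by blast
  have hL: "h \<in> Lor" using h by simp
  have Ne: "vertex i = e 0 + cos (ang i) \<cdot>\<^sub>v e 1 + sin (ang i) \<cdot>\<^sub>v e 2" for i
    by (rule eq_vecI) (auto simp: vertex_def unit_vec_def)
  have hN: "h *\<^sub>v vertex i = p + cos (ang i) \<cdot>\<^sub>v v + sin (ang i) \<cdot>\<^sub>v w" for i
    unfolding Ne using hL by (simp add: Lor_linear h[simplified])
  have "h *\<^sub>v vertex i = \<xi> i" for i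
  proof (rule eq_vecI)
    fix k assume "k < dim_vec (\<xi> i)"
    then have k: "k < Suc n" using dims by simp
    show "(h *\<^sub>v vertex i) $ k = \<xi> i $ k"
      using exhaust_mod_3[of i] k V' unfolding hN by (auto simp: v_def w_def p_def dims field_simps)
  qed (use hL xi(1)[of i] carrier_matD[OF Lor_carrier[OF hL]] in auto)
  then show ?thesis using that[OF h(1)] by blast
qed

text \<open>Null vectors can be rescaled freely, which makes their three mutual products equal to those of the
standard vertices.\<close>

lemma scaling_factors:
  fixes x y z :: real
  assumes "x > 0" "y > 0" "z > 0"
  obtains r s t where "r > 0" "s > 0" "t > 0" "r * s * x = 3/2" "r * t * y = 3/2" "s * t * z = 3/2"
proof -
  define r s t where "r = sqrt ((3/2) * z / (x * y))" and "s = sqrt ((3/2) * y / (x * z))" and "t = sqrt ((3/2) * x / (y * z))"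
  have rs: "sqrt a * sqrt b * c = d" if "a * b * c\<^sup>2 = d\<^sup>2" "c > 0" "d > 0" for a b c d :: real
  proof -
    have "sqrt a * sqrt b * c = sqrt (a * b * c\<^sup>2)" using that(2) by (simp add: real_sqrt_mult)
    then show ?thesis unfolding that(1) using that(3) by simp
  qed
  show ?thesis
  proof (rule that[of r s t])
    show "r > 0" "s > 0" "t > 0" using assms by (simp_all add: r_def s_def t_def)
    show "r * s * x = 3/2" unfolding r_def s_def by (rule rs) (use assms in \<open>auto simp: field_simps power2_eq_square\<close>)
    show "r * t * y = 3/2" unfolding r_def t_def by (rule rs) (use assms in \<open>auto simp: field_simps power2_eq_square\<close>)
    show "s * t * z = 3/2" unfolding s_def t_def by (rule rs) (use assms in \<open>auto simp: field_simps power2_eq_square\<close>)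
  qed
qed

section \<open>Shears and bends of a pair of pants\<close>

lemma uminus_mod_3 [simp]: "(- 1 :: 3) = 2" "(- 2 :: 3) = 1" by simp_all

lemma turn_nu: "turn 2 *\<^sub>v nu = (- 1) \<cdot>\<^sub>v nu + (- (2 / sqrt 3)) \<cdot>\<^sub>v vertex 2"
proof (rule eq_vecI)
  have r: "sqrt 3 * sqrt 3 = (3::real)" by simp
  fix i assume "i < dim_vec ((- 1) \<cdot>\<^sub>v nu + (- (2 / sqrt 3)) \<cdot>\<^sub>v vertex 2)"
  then have "i < Suc n" by (simp add: nu_def vertex_def)
  then show "(turn 2 *\<^sub>v nu) $ i = ((- 1) \<cdot>\<^sub>v nu + (- (2 / sqrt 3)) \<cdot>\<^sub>v vertex 2) $ i"
    unfolding turn_def Rot_vec[OF nu_V] using r dim3 by (auto simp: nu_def vertex_def field_simps)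
qed (simp add: turn_def Rot_def vertex_def)

text \<open>Turning the triangle takes one edge ending at vertex 2 to the other one and reverses the normal within the plane. This holds
modulo vertex 2, which is invisible to vectors orthogonal to it.\<close>

lemma turn_edge_frame:
  assumes "2 \<le> c" "c \<le> n"
  obtains t where "turn 2 *\<^sub>v edge_frame c = (if c = 2 then - 1 else 1) \<cdot>\<^sub>v edge_frame c + t \<cdot>\<^sub>v vertex 2"
proof (cases "c = 2")
  case True
  then show ?thesis using that[of "- (2 / sqrt 3)"] turn_nu by (simp add: edge_frame_def)
next
  case False
  then have "turn 2 *\<^sub>v edge_frame c = edge_frame c" using assms by (simp add: edge_frame_def turn_e)
  also have "\<dots> = 1 \<cdot>\<^sub>v edge_frame c + 0 \<cdot>\<^sub>v vertex 2" by (rule eq_vecI) (auto simp: edge_frame_def vertex_def)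
  finally show ?thesis using that[of 0] False by simp
qed

text \<open>The edges belonging to \<open>G\<close> and \<open>G'\<close> both end at the cuff \<open>a\<close>, whose fixed point is the vertex \<open>i + 1\<close>. Going around the cuff
relates the two gluings through \<open>a\<close>, which acts on the normal directions as the identity up to \<open>\<eta>\<close>.\<close>

lemma bend_relation:
  fixes i :: 3 and \<eta> :: real
  assumes g: "glues G E" and g': "glues G' E'" and a: "a \<in> Lor"
    and rel: "\<And>x. x \<in> V \<Longrightarrow> G' *\<^sub>v (turn 2 *\<^sub>v x) = turn (- (i + 1)) *\<^sub>v (a *\<^sub>v (turn (i - 1) *\<^sub>v (G *\<^sub>v x)))"
    and near: "\<And>x y. x \<in> V \<Longrightarrow> y \<in> V \<Longrightarrow> mink x (vertex (i + 1)) = 0 \<Longrightarrow> mink y (vertex (i + 1)) = 0 \<Longrightarrow>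
      mink x x = 1 \<Longrightarrow> mink y y = 1 \<Longrightarrow> \<bar>mink x (a *\<^sub>v y) - mink x y\<bar> \<le> \<eta>"
    and cd: "2 \<le> c" "c \<le> n" "2 \<le> d" "d \<le> n"
  shows "\<bar>(if d = 2 then - 1 else 1) * bend G' c d - (if c = 2 then - 1 else 1) * bend G c d\<bar> \<le> \<eta>"
proof -
  have GL: "G \<in> Lor" and GL': "G' \<in> Lor" using g g' by (auto simp: glues_def)
  define u y where "u = turn (i + 1) *\<^sub>v edge_frame c" and "y = turn (i - 1) *\<^sub>v (G *\<^sub>v edge_frame d)"
  have uV: "u \<in> V" and yV: "y \<in> V" using GL by (auto simp: u_def y_def)
  have GdV: "G *\<^sub>v edge_frame d \<in> V" using GL by simp
  have Gd: "mink (vertex 2) (G *\<^sub>v edge_frame d) = 0" using glues_perp(2)[OF g edge_frame_V] mink_edge_frame_vertex[OF cd(3,4)] by blast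
  have uN: "mink u (vertex (i + 1)) = 0"
    using turn_move[of "edge_frame c" "vertex (i + 1)" "- (i + 1)"] mink_edge_frame_vertex[OF cd(1,2)]
    using Lor_mink[of "turn (i + 1)" "edge_frame c" "vertex 0"] by (simp add: u_def)
  have yN: "mink y (vertex (i + 1)) = 0"
    using Lor_mink[of "turn (i - 1)" "G *\<^sub>v edge_frame d" "vertex 2"] Gd mink_commute[OF GdV, of "vertex 2"] GdV by (simp add: y_def add.commute)
  have uu: "mink u u = 1" using mink_edge_frame[OF cd(1,2,1,2)] by (simp add: u_def)
  have yy: "mink y y = 1" using mink_edge_frame[OF cd(3,4,3,4)] GL by (simp add: y_def)
  have 1: "mink u (a *\<^sub>v y) = (if d = 2 then - 1 else 1) * bend G' c d"
  proof -
    obtain t where t: "turn 2 *\<^sub>v edge_frame d = (if d = 2 then - 1 else 1) \<cdot>\<^sub>v edge_frame d + t \<cdot>\<^sub>v vertex 2" using turn_edge_frame[OF cd(3,4)] .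
    have "mink (edge_frame c) (turn (- (i + 1)) *\<^sub>v (a *\<^sub>v y)) = mink (turn (- (- (i + 1))) *\<^sub>v edge_frame c) (a *\<^sub>v y)"
      using a yV by (intro turn_move) auto
    then have "mink u (a *\<^sub>v y) = mink (edge_frame c) (turn (- (i + 1)) *\<^sub>v (a *\<^sub>v y))"
      unfolding minus_minus u_def ..
    also have "\<dots> = mink (edge_frame c) (G' *\<^sub>v (turn 2 *\<^sub>v edge_frame d))" unfolding y_def by (simp only: rel edge_frame_V)
    also have "\<dots> = mink (adj G' *\<^sub>v edge_frame c) (turn 2 *\<^sub>v edge_frame d)" using GL' by (simp add: Lor_move)
    also have "\<dots> = (if d = 2 then - 1 else 1) * mink (adj G' *\<^sub>v edge_frame c) (edge_frame d) + t * mink (adj G' *\<^sub>v edge_frame c) (vertex 2)"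
      unfolding t using GL' by simp
    also have "mink (adj G' *\<^sub>v edge_frame c) (vertex 2) = 0"
      using glues_perp(4)[OF g' edge_frame_V, of c] mink_edge_frame_vertex[OF cd(1,2)] GL' by (simp add: Lor_move)
    also have "mink (adj G' *\<^sub>v edge_frame c) (edge_frame d) = bend G' c d" using GL' by (simp add: bend_def Lor_move)
    finally show ?thesis by simp
  qed
  have 2: "mink u y = (if c = 2 then - 1 else 1) * bend G c d"
  proof -
    obtain t where t: "turn 2 *\<^sub>v edge_frame c = (if c = 2 then - 1 else 1) \<cdot>\<^sub>v edge_frame c + t \<cdot>\<^sub>v vertex 2" using turn_edge_frame[OF cd(1,2)] .
    have i2: "- (i - 1) + (i + 1) = (2 :: 3)" by simp
    have "mink u y = mink (turn (- (i - 1)) *\<^sub>v u) (G *\<^sub>v edge_frame d)" unfolding y_def by (rule turn_move[OF uV GdV])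
    also have "turn (- (i - 1)) *\<^sub>v u = turn 2 *\<^sub>v edge_frame c" unfolding u_def turn_turn_vec[OF edge_frame_V] i2 ..
    also have "mink (turn 2 *\<^sub>v edge_frame c) (G *\<^sub>v edge_frame d) = (if c = 2 then - 1 else 1) * mink (edge_frame c) (G *\<^sub>v edge_frame d) + t * mink (vertex 2) (G *\<^sub>v edge_frame d)"
      unfolding t using GdV by simp
    finally show ?thesis using Gd by (simp add: bend_def)
  qed
  show ?thesis using near[OF uV yV uN yN uu yy] unfolding 1 2 .
qed

end

text \<open>The cuffs of the pants in coordinates where their attracting fixed points are the vertices of the
standard triangle.\<close>

locale spun_pants = minkowski_space +
  fixes cuff :: "3 \<Rightarrow> real mat" and l :: "3 \<Rightarrow> real" and \<eta> :: real
  assumes cuff_Isom: "cuff i \<in> Isom"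
    and relation: "x \<in> V \<Longrightarrow> cuff 0 *\<^sub>v (cuff 1 *\<^sub>v (cuff 2 *\<^sub>v x)) = x"
    and cuff_vertex: "cuff i *\<^sub>v vertex (i + 1) = exp (l i) \<cdot>\<^sub>v vertex (i + 1)"
    and near: "\<And>x y. x \<in> V \<Longrightarrow> y \<in> V \<Longrightarrow> mink x (vertex (i + 1)) = 0 \<Longrightarrow> mink y (vertex (i + 1)) = 0 \<Longrightarrow>
      mink x x = 1 \<Longrightarrow> mink y y = 1 \<Longrightarrow> \<bar>mink x (cuff i *\<^sub>v y) - mink x y\<bar> \<le> \<eta>"
begin

text \<open>The solution of \<open>l i = shear (i + 1) + shear (i - 1)\<close>: the length of a cuff is the sum of the shears along the two
edges that spiral towards it.\<close>

definition shear :: "3 \<Rightarrow> real" where "shear j = (l (j + 1) + l (j - 1) - l j) / 2"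

lemma shear_simps: "shear 0 = (l 1 + l 2 - l 0) / 2" "shear 1 = (l 2 + l 0 - l 1) / 2" "shear 2 = (l 0 + l 1 - l 2) / 2"
  by (simp_all add: shear_def)

lemma cuff_Lor [simp]: "cuff i \<in> Lor" using cuff_Isom by simp

lemma cuff_vertex' : "cuff 0 *\<^sub>v vertex 1 = exp (l 0) \<cdot>\<^sub>v vertex 1" "cuff 1 *\<^sub>v vertex 2 = exp (l 1) \<cdot>\<^sub>v vertex 2" "cuff 2 *\<^sub>v vertex 0 = exp (l 2) \<cdot>\<^sub>v vertex 0"
  using cuff_vertex[of 0] cuff_vertex[of 1] cuff_vertex[of 2] by simp_all

lemma adj_cuff_0: "x \<in> V \<Longrightarrow> adj (cuff 0) *\<^sub>v x = cuff 1 *\<^sub>v (cuff 2 *\<^sub>v x)"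
  using Lor_adj_vec(1)[OF cuff_Lor, of "cuff 1 *\<^sub>v (cuff 2 *\<^sub>v x)" 0] by (simp add: relation)

lemma adj_cuff_2: "x \<in> V \<Longrightarrow> adj (cuff 2) *\<^sub>v x = cuff 0 *\<^sub>v (cuff 1 *\<^sub>v x)"
  using relation[of "adj (cuff 2) *\<^sub>v x"] by simp

text \<open>The vertex of the second triangle opposite to the edge 1. It is a translate of the vertex 2, scaled so as to match the
shears.\<close>

definition third_vertex :: "real vec" where
  "third_vertex = exp (- shear 0) \<cdot>\<^sub>v (adj (cuff 2) *\<^sub>v vertex 2)"

text \<open>The image of \<open>nu\<close> under the gluing along the edge 1, obtained by solving
\<open>vertex 1 = vertex 0 + vertex 2 + sqrt 3 nu\<close> for \<open>nu\<close>.\<close>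

definition normal :: "real vec" where
  "normal = (1 / sqrt 3) \<cdot>\<^sub>v (turn 2 *\<^sub>v third_vertex - exp (- shear 1) \<cdot>\<^sub>v vertex 2 - exp (shear 1) \<cdot>\<^sub>v vertex 0)"

lemma third_vertex_V [simp]: "third_vertex \<in> V" by (simp add: third_vertex_def)

lemma normal_V [simp]: "normal \<in> V" by (simp add: normal_def)

lemma third_vertex_mink:
  "mink third_vertex third_vertex = 0" 
  "mink (vertex 0) third_vertex = - (3/2) * exp (shear 1)"
  "mink (vertex 1) third_vertex = - (3/2) * exp (- shear 1)"
proof -
  show "mink third_vertex third_vertex = 0" by (simp add: third_vertex_def mink_vertex_vertex)
  have "mink (vertex 0) third_vertex = exp (- shear 0) * mink (cuff 2 *\<^sub>v vertex 0) (vertex 2)"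
    using Lor_mink[OF cuff_Lor, of "vertex 0" "adj (cuff 2) *\<^sub>v vertex 2" 2] by (simp add: third_vertex_def)
  also have "\<dots> = - (3/2) * (exp (- shear 0) * exp (l 2))" by (simp add: cuff_vertex' mink_vertex_vertex)
  also have "exp (- shear 0) * exp (l 2) = exp (shear 1)" unfolding exp_add[symmetric] by (simp add: shear_simps field_simps)
  finally show "mink (vertex 0) third_vertex = - (3/2) * exp (shear 1)" .
  have "exp (l 0) * mink (vertex 1) (adj (cuff 2) *\<^sub>v vertex 2) = mink (cuff 0 *\<^sub>v vertex 1) (cuff 0 *\<^sub>v (cuff 1 *\<^sub>v vertex 2))"
    by (simp only: adj_cuff_2 vertex_V) (simp add: cuff_vertex'(1) del: Lor_mink)
  also have "\<dots> = mink (vertex 1) (cuff 1 *\<^sub>v vertex 2)" by simp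
  also have "\<dots> = - (3/2) * exp (l 1)" by (simp add: cuff_vertex' mink_vertex_vertex)
  finally have e1: "exp (l 0) * mink (vertex 1) (adj (cuff 2) *\<^sub>v vertex 2) = - (3/2) * exp (l 1)" .
  have "mink (vertex 1) third_vertex = exp (- shear 0 - l 0) * (exp (l 0) * mink (vertex 1) (adj (cuff 2) *\<^sub>v vertex 2))"
    by (simp add: third_vertex_def mult.assoc[symmetric] exp_add[symmetric])
  also have "\<dots> = - (3/2) * exp (- shear 0 - l 0 + l 1)" unfolding e1 by (simp add: exp_add)
  also have "- shear 0 - l 0 + l 1 = - shear 1" by (simp add: shear_simps field_simps)
  finally show "mink (vertex 1) third_vertex = - (3/2) * exp (- shear 1)" .
qed

lemma normal_mink:
  "mink (vertex 0) normal = 0" "mink (vertex 2) normal = 0" "mink normal normal = 1"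
proof -
  let ?Z = "turn 2 *\<^sub>v third_vertex" and ?E = "exp (shear 1)" and ?E' = "exp (- shear 1)"
  have ZV: "?Z \<in> V" by simp
  have EE: "?E * ?E' = 1" "?E' * ?E = 1" by (simp_all add: exp_add[symmetric])
  have Z0: "mink (vertex 0) ?Z = - (3/2) * ?E'" by (subst turn_move) (simp_all add: third_vertex_mink)
  have Z2: "mink (vertex 2) ?Z = - (3/2) * ?E" by (subst turn_move) (simp_all add: third_vertex_mink)
  have Z0': "mink ?Z (vertex 0) = - (3/2) * ?E'" "mink ?Z (vertex 2) = - (3/2) * ?E" 
    using Z0 Z2 mink_commute[OF ZV, of "vertex 0"] mink_commute[OF ZV, of "vertex 2"] by simp_all
  have ZZ: "mink ?Z ?Z = 0" by (simp add: third_vertex_mink)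
  show n0: "mink (vertex 0) normal = 0" and n2: "mink (vertex 2) normal = 0"
    by (simp_all add: normal_def Z0 Z2 mink_vertex_vertex)
  have "mink normal normal = (1 / sqrt 3) * mink ?Z normal"
    using n0 n2 by (subst (1) normal_def) simp
  also have "mink ?Z normal = (1 / sqrt 3) * 3"
    by (simp add: normal_def ZZ Z0' EE mult.assoc[symmetric] del: Lor_mink) (simp add: EE algebra_simps)?
  also have "(1 / sqrt 3) * ((1 / sqrt 3) * 3) = (1::real)" by simp
  finally show "mink normal normal = 1" .
qed

text \<open>The gluing along the edge 1 is \<open>G\<close>, and \<open>Q\<close> is the same isometry from the first triangle to the second one without the turns that
put the edge in standard position. The lifts of the second triangle at the other edges are obtained from
this one by deck transformations.\<close>

definition gluing_of :: "real mat \<Rightarrow> 3 \<Rightarrow> real mat" where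
  "gluing_of G j = (let Q = turn 1 * G * turn 1 in
     if j = 0 then cuff 2 * Q else if j = 1 then G else turn 1 * (adj (cuff 0) * Q) * turn 1)"

lemma gluing_of_1 [simp]: "gluing_of G 1 = G" by (simp add: gluing_of_def)

lemma gluing_of_vec:
  assumes "G \<in> Lor" "x \<in> V"
  shows "gluing_of G 0 *\<^sub>v x = cuff 2 *\<^sub>v (turn 1 *\<^sub>v (G *\<^sub>v (turn 1 *\<^sub>v x)))"
    and "gluing_of G 2 *\<^sub>v x = turn 1 *\<^sub>v (adj (cuff 0) *\<^sub>v (turn 1 *\<^sub>v (G *\<^sub>v (turn 2 *\<^sub>v x))))"
  using assms by (simp_all add: gluing_of_def Let_def del: mult_carrier_mat)

lemma glues_gluing_of:
  assumes g: "glues G (exp (shear 1))" and nu: "G *\<^sub>v nu = normal"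
  shows "glues (gluing_of G j) (exp (shear j))"
proof -
  have GI: "G \<in> Isom" and G0: "G *\<^sub>v vertex 0 = exp (- shear 1) \<cdot>\<^sub>v vertex 2" and G2: "G *\<^sub>v vertex 2 = exp (shear 1) \<cdot>\<^sub>v vertex 0"
    using g by (auto simp: glues_def exp_minus divide_inverse)
  have GL: "G \<in> Lor" using GI by simp
  have G1: "G *\<^sub>v vertex 1 = turn 2 *\<^sub>v third_vertex"
  proof (rule vec_eq_by_mink)
    fix w assume w: "w \<in> V"
    have "mink w (G *\<^sub>v vertex 1) = mink w (G *\<^sub>v vertex 0) + mink w (G *\<^sub>v vertex 2) + sqrt 3 * mink w (G *\<^sub>v nu)"
      unfolding e_decomposition(4) using GL w by (simp add: Lor_move)
    then show "mink w (G *\<^sub>v vertex 1) = mink w (turn 2 *\<^sub>v third_vertex)"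
      unfolding G0 G2 nu using w by (simp add: normal_def)
  qed (use GL in auto)
  have ex: "exp x \<cdot>\<^sub>v (exp y \<cdot>\<^sub>v v) = exp (x + y) \<cdot>\<^sub>v v" for x y and v :: "real vec"
    by (simp add: exp_add smult_smult_assoc)
  have sh: "l 2 - shear 1 = shear 0" "- shear 1 + l 2 = shear 0" "shear 1 - l 0 = - shear 2" "shear 1 + - l 0 = - shear 2"
    "l 1 - shear 0 = shear 2" "- shear 0 + l 1 = shear 2" by (simp_all add: shear_simps field_simps)
  have inv1: "1 / exp x = exp (- x)" for x :: real by (simp add: exp_minus divide_inverse)
  have "gluing_of G 0 *\<^sub>v vertex 0 = exp (- shear 0) \<cdot>\<^sub>v vertex 2"
    using GL by (simp add: gluing_of_vec G1 third_vertex_def Lor_linear)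
  moreover have "gluing_of G 0 *\<^sub>v vertex 2 = exp (shear 0) \<cdot>\<^sub>v vertex 0"
    using GL by (simp add: gluing_of_vec G0 Lor_linear cuff_vertex' ex sh)
  moreover have "gluing_of G 0 \<in> Isom" using GI cuff_Isom by (simp add: gluing_of_def)
  ultimately have 0: "glues (gluing_of G 0) (exp (shear 0))" by (simp add: glues_def inv1)
  have a0: "adj (cuff 0) *\<^sub>v vertex 1 = exp (- l 0) \<cdot>\<^sub>v vertex 1"
  proof -
    have "adj (cuff 0) *\<^sub>v (exp (- l 0) \<cdot>\<^sub>v (cuff 0 *\<^sub>v vertex 1)) = exp (- l 0) \<cdot>\<^sub>v vertex 1" by (simp add: Lor_linear)
    then show ?thesis by (simp add: cuff_vertex'(1) ex) 
  qed
  have a02: "adj (cuff 0) *\<^sub>v (adj (cuff 2) *\<^sub>v vertex 2) = exp (l 1) \<cdot>\<^sub>v vertex 2" by (simp add: adj_cuff_0 cuff_vertex')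
  have "gluing_of G 2 *\<^sub>v vertex 0 = exp (- shear 2) \<cdot>\<^sub>v vertex 2"
    using GL by (simp add: gluing_of_vec G2 Lor_linear a0 ex sh)
  moreover have "gluing_of G 2 *\<^sub>v vertex 2 = exp (shear 2) \<cdot>\<^sub>v vertex 0"
    using GL by (simp add: gluing_of_vec G1 third_vertex_def Lor_linear a02 ex sh)
  moreover have "gluing_of G 2 \<in> Isom" using GI cuff_Isom by (simp add: gluing_of_def)
  ultimately have 2: "glues (gluing_of G 2) (exp (shear 2))" by (simp add: glues_def inv1)
  show ?thesis using exhaust_mod_3[of j] 0 2 g by auto
qed

lemma gluing_of_relation:
  assumes "G \<in> Lor" "x \<in> V"
  shows "gluing_of G (i + 1) *\<^sub>v (turn 2 *\<^sub>v x) = turn (- (i + 1)) *\<^sub>v (cuff i *\<^sub>v (turn (i - 1) *\<^sub>v (gluing_of G (i - 1) *\<^sub>v x)))"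
proof -
  consider "i = 0" | "i = 1" | "i = 2" using exhaust_mod_3 by blast
  then show ?thesis using assms
    by cases (simp_all add: gluing_of_vec adj_cuff_0 relation)
qed

lemma bends_cyclic:
  assumes g: "glues G (exp (shear 1))" and nu: "G *\<^sub>v nu = normal"
    and cd: "2 \<le> c" "c \<le> n" "2 \<le> d" "d \<le> n"
  shows "\<bar>(if d = 2 then - 1 else 1) * bend (gluing_of G (i + 1)) c d
     - (if c = 2 then - 1 else 1) * bend (gluing_of G (i - 1)) c d\<bar> \<le> \<eta>"
proof (rule bend_relation[OF glues_gluing_of[OF g nu] glues_gluing_of[OF g nu] cuff_Lor _ _ cd])
  have "G \<in> Lor" using g by (simp add: glues_def)
  then show "gluing_of G (i + 1) *\<^sub>v (turn 2 *\<^sub>v x)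
      = turn (- (i + 1)) *\<^sub>v (cuff i *\<^sub>v (turn (i - 1) *\<^sub>v (gluing_of G (i - 1) *\<^sub>v x)))" if "x \<in> V" for x
    using that by (rule gluing_of_relation)
qed (fact near)

text \<open>The entries of the bend between \<open>nu\<close> and another normal change sign from each gluing to the next one, up to \<open>\<eta>\<close>.
After three steps such an entry equals its negative up to \<open>3\<eta>\<close>, so it is small. This allows a choice of \<open>G\<close> with almost
diagonal bend, and the other two bends follow it.\<close>

theorem spun_gluing:
  obtains G bad where "\<And>j. glues (gluing_of G j) (exp (shear j))"
    "\<And>j c d. 2 \<le> c \<Longrightarrow> c \<le> n \<Longrightarrow> 2 \<le> d \<Longrightarrow> d \<le> n \<Longrightarrow>
       \<bar>bend (gluing_of G j) c d - (if c = d then bend_sign bad c else 0)\<bar> \<le> 3 * n * \<eta>"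
proof -
  note gl = gluing_with_normal[OF normal_V normal_mink(3,1,2) exp_gt_zero[of "shear 1"]]
  \<comment> \<open>the image of \<open>nu\<close> does not depend on the choice of \<open>G\<close>; any choice, with the trivial bound for \<open>\<delta>\<close>, serves to estimate it\<close>
  have small: "\<bar>mink (e k) normal\<bar> \<le> 2 * \<eta>" if k: "3 \<le> k" "k \<le> n" for k
  proof -
    have "\<bar>mink (e k) normal\<bar> \<le> (\<Sum>k = 3..n. \<bar>mink (e k) normal\<bar>)" if "3 \<le> k" "k \<le> n" for k
      by (rule member_le_sum) (use that in auto)
    then obtain G bad where g: "glues G (exp (shear 1))" and nu: "G *\<^sub>v nu = normal"
      using gl by blast
    have "2 \<le> k" "2 \<le> n" using k by auto
    note cyc = bends_cyclic[OF g nu this(1) k(2) order.refl this(2)]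
    have "\<bar>bend (gluing_of G 1) k 2 + bend (gluing_of G 2) k 2\<bar> \<le> \<eta>"
      "\<bar>bend (gluing_of G 2) k 2 + bend (gluing_of G 0) k 2\<bar> \<le> \<eta>"
      "\<bar>bend (gluing_of G 0) k 2 + bend (gluing_of G 1) k 2\<bar> \<le> \<eta>"
      using cyc[of 0] cyc[of 1] cyc[of 2] k by auto
    then have "\<bar>bend (gluing_of G 1) k 2\<bar> \<le> 2 * \<eta>" by linarith
    then show ?thesis using k nu by (simp add: bend_def edge_frame_def)
  qed
  obtain G bad where g: "glues G (exp (shear 1))" and nu: "G *\<^sub>v nu = normal"
    and B: "\<And>c d. 2 \<le> c \<Longrightarrow> c \<le> n \<Longrightarrow> 2 \<le> d \<Longrightarrow> d \<le> n \<Longrightarrow>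
      \<bar>bend G c d - (if c = d then bend_sign bad c else 0)\<bar> \<le> n * (2 * \<eta>)"
    using gl[OF small] by blast
  have n3: "3 \<le> n" by (fact dim3)
  have \<eta>0: "\<eta> \<ge> 0" using small[of 3] n3 by linarith
  have n\<eta>: "\<eta> \<le> n * \<eta>" using mult_right_mono[of 1 "real n" \<eta>] \<eta>0 n3 by simp
  have "\<bar>bend (gluing_of G j) c d - (if c = d then bend_sign bad c else 0)\<bar> \<le> 3 * n * \<eta>"
    if cd: "2 \<le> c" "c \<le> n" "2 \<le> d" "d \<le> n" for j c d
  proof -
    note cyc = bends_cyclic[OF g nu cd]
    have "\<bar>bend (gluing_of G j) c d - (if c = d then bend_sign bad c else 0)\<bar> \<le> n * (2 * \<eta>) + \<eta>"
      using exhaust_mod_3[of j] cyc[of 0] cyc[of 2] B[OF cd] \<eta>0 by (cases "c = d"; cases "c = 2"; cases "d = 2") auto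
    then show ?thesis using n\<eta> by linarith
  qed
  then show ?thesis using that[of G bad] glues_gluing_of[OF g nu] by blast
qed

end

context minkowski_space begin

section \<open>Framed tripods from isometries\<close>

definition tail_frame :: "real mat \<Rightarrow> real vec list" where
  "tail_frame H = map (\<lambda>j. H *\<^sub>v e (Suc j)) [2..<n]"

definition legs :: "real mat \<Rightarrow> 3 \<Rightarrow> real vec" where
  "legs H i = (H * turn i) *\<^sub>v e 1"

lemma turn_e1: "turn i *\<^sub>v e 1 = vertex i - e 0"
  using Lor_linear(3)[of "turn i" "vertex 0" "e 0"] by (simp add: e_decomposition(2)[simplified] turn_e)

lemma turn_e2: "turn i *\<^sub>v e 2 = (1 / sqrt 3) \<cdot>\<^sub>v (turn (i + 1) *\<^sub>v e 1 - turn (i - 1) *\<^sub>v e 1)"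
proof -
  have "vertex 1 - vertex 2 = sqrt 3 \<cdot>\<^sub>v e 2"
    by (rule eq_vecI) (auto simp: vertex_def unit_vec_def)
  then have "e 2 = (1 / sqrt 3) \<cdot>\<^sub>v (vertex 1 - vertex 2)" by (auto intro!: eq_vecI)
  then have "turn i *\<^sub>v e 2 = (1 / sqrt 3) \<cdot>\<^sub>v (vertex (i + 1) - vertex (i + 2))" by (simp add: Lor_linear)
  also have "i + 2 = i - 1" using exhaust_mod_3[of i] by auto
  also have "vertex (i + 1) - vertex (i - 1) = turn (i + 1) *\<^sub>v e 1 - turn (i - 1) *\<^sub>v e 1"
    unfolding turn_e1 by (rule eq_vecI) (auto simp: vertex_def)
  finally show ?thesis .
qed

lemma tripod_frame_legs:
  assumes H: "H \<in> Lor"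
  shows "tripod_frame (legs H) (tail_frame H) i = frame_of (H * turn i)"
proof -
  have up: "[0..<n] = 0 # 1 # [2..<n]" using dim3 by (simp add: upt_conv_Cons numeral_2_eq_2)
  have "perp (legs H) i = (H * turn i) *\<^sub>v e 2"
    using H turn_e2[of i] by (simp add: perp_def legs_def Lor_linear)
  moreover have "map (\<lambda>j. (H * turn i) *\<^sub>v e (Suc j)) [2..<n] = tail_frame H"
    unfolding tail_frame_def using H by (intro map_cong) (auto simp: turn_e)
  ultimately show ?thesis unfolding frame_of_def up tripod_frame_def by (simp add: legs_def numeral_2_eq_2[symmetric])
qed

lemma framed_tripod_legs:
  assumes H: "H \<in> Isom"
  shows "framed_tripod n (H *\<^sub>v e 0) (legs H) (tail_frame H)"
proof -
  have HL: "H \<in> Lor" using H by simp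
  have e0N: "mink (e 0) (vertex j) = - 1" "mink (vertex j) (e 0) = - 1" for j
    using mink_commute[of "vertex j" "e 0"] by (auto simp: mink_e)
  have m: "mink (turn i *\<^sub>v e 1) (turn j *\<^sub>v e 1) = (if i = j then 1 else - 1/2)" for i j
    unfolding turn_e1 by (simp add: mink_vertex_vertex e0N mink_e_e)
  have mp: "mink (e 0) (turn i *\<^sub>v e 1) = 0" for i
    unfolding turn_e1 by (simp add: e0N mink_e_e)
  have legs_m: "mink (legs H i) (legs H j) = (if i = j then 1 else - 1/2)" for i j
    using HL m[of i j] by (simp add: legs_def)
  have "legs H i \<in> unit_tangent n (H *\<^sub>v e 0)" for i
    using HL legs_m[of i i] mp[of i] by (intro unit_tangentI) (auto simp: legs_def)
  moreover have "hangle (legs H i) (legs H j) = 2 * pi / 3" if "i \<noteq> j" for i j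
  proof -
    have "hangle (legs H i) (legs H j) = arccos (- 1/2)" using that by (simp add: hangle_def legs_m)
    also have "\<dots> = arccos (cos (2 * pi / 3))" by (simp add: cos_120)
    also have "\<dots> = 2 * pi / 3" by (rule arccos_cos) auto
    finally show ?thesis .
  qed
  moreover have "pos_frame n (H *\<^sub>v e 0) (tripod_frame (legs H) (tail_frame H) 0)"
    using pos_frame_frame_of[of "H * turn 0"] H HL by (simp add: tripod_frame_legs turn_e)
  ultimately show ?thesis using Isom_hyp[OF H e0_hyp] by (simp add: framed_tripod_def tripod_def)
qed

section \<open>The attracting fixed points of the cuffs\<close>

lemma pants_boundary_carrier: "pants_boundary i \<in> carrier pants_group"
  by (simp add: pants_group_def pants_boundary_def cancels_def)

lemma pants_elements:
  assumes ch: "closed_hyperbolic n \<Gamma>" and pi: "pants_in n \<Gamma> \<rho>"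
  shows "\<rho> (pants_boundary i) \<in> \<Gamma>" "\<rho> (pants_boundary i) \<in> Isom"
proof -
  have "\<rho> \<in> hom pants_group (deck_group n \<Gamma>)" using pi by (simp add: pants_in_def)
  from hom_in_carrier[OF this pants_boundary_carrier] show "\<rho> (pants_boundary i) \<in> \<Gamma>" by simp
  then show "\<rho> (pants_boundary i) \<in> Isom" using ch subgroup.mem_carrier by (fastforce simp: closed_hyperbolic_def)
qed

lemma pants_relation:
  assumes ch: "closed_hyperbolic n \<Gamma>" and pi: "pants_in n \<Gamma> \<rho>" and x: "x \<in> V"
  shows "\<rho> (pants_boundary 0) *\<^sub>v (\<rho> (pants_boundary 1) *\<^sub>v (\<rho> (pants_boundary 2) *\<^sub>v x)) = x"
proof -
  have h: "\<rho> \<in> hom pants_group (deck_group n \<Gamma>)" using pi by (simp add: pants_in_def)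
  note pe = pants_elements[OF ch pi]
  have nil: "[] \<in> carrier pants_group" "[] \<otimes>\<^bsub>pants_group\<^esub> [] = []" by (auto simp: pants_group_def)
  have "\<rho> [] \<in> \<Gamma>" using hom_in_carrier[OF h nil(1)] by simp
  then have nI: "\<rho> [] \<in> Isom" using ch subgroup.mem_carrier by (fastforce simp: closed_hyperbolic_def)
  have sq: "\<rho> [] = \<rho> [] * \<rho> []" using hom_mult[OF h nil(1) nil(1)] by (simp add: nil hyp_isom_simps)
  have one: "\<rho> [] *\<^sub>v x = x"
  proof -
    have "\<rho> [] *\<^sub>v x = \<rho> [] *\<^sub>v (\<rho> [] *\<^sub>v x)" using nI x Lor_mult_vec[of "\<rho> []" "\<rho> []" x] sq by simp
    then have "adj (\<rho> []) *\<^sub>v (\<rho> [] *\<^sub>v x) = adj (\<rho> []) *\<^sub>v (\<rho> [] *\<^sub>v (\<rho> [] *\<^sub>v x))" by simp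
    then show ?thesis using nI x by simp
  qed
  have c: "[(False, True), (True, True)] \<in> carrier pants_group"
    and m: "pants_boundary 0 \<otimes>\<^bsub>pants_group\<^esub> pants_boundary 1 = [(False, True), (True, True)]"
    by (simp_all add: pants_group_def pants_boundary_def cancels_def)
  have "\<rho> [] = \<rho> (pants_boundary 0) * \<rho> (pants_boundary 1) * \<rho> (pants_boundary 2)"
  proof -
    have "pants_boundary 0 \<otimes>\<^bsub>pants_group\<^esub> pants_boundary 1 \<otimes>\<^bsub>pants_group\<^esub> pants_boundary 2 = []"
      using pants_boundary_relation by (simp add: pants_group_def)
    then show ?thesis
      using hom_mult[OF h c pants_boundary_carrier[of 2]] hom_mult[OF h pants_boundary_carrier[of 0] pants_boundary_carrier[of 1]]
      by (simp add: m hyp_isom_simps)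
  qed
  then show ?thesis using one pe x by simp
qed

lemma pants_not_commuting:
  assumes ch: "closed_hyperbolic n \<Gamma>" and pi: "pants_in n \<Gamma> \<rho>" and d: "d > 0"
    and ij: "{i, j} = {0, 1 :: 3}" "i \<noteq> j"
  shows "\<not> (\<forall>x\<in>V. (\<rho> (pants_boundary i) ^\<^sub>m d) *\<^sub>v (\<rho> (pants_boundary j) *\<^sub>v x) = \<rho> (pants_boundary j) *\<^sub>v ((\<rho> (pants_boundary i) ^\<^sub>m d) *\<^sub>v x))"
proof
  assume comm: "\<forall>x\<in>V. (\<rho> (pants_boundary i) ^\<^sub>m d) *\<^sub>v (\<rho> (pants_boundary j) *\<^sub>v x) = \<rho> (pants_boundary j) *\<^sub>v ((\<rho> (pants_boundary i) ^\<^sub>m d) *\<^sub>v x)"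
  have h: "\<rho> \<in> hom pants_group (deck_group n \<Gamma>)" and inj: "inj_on \<rho> (carrier pants_group)" using pi by (auto simp: pants_in_def)
  obtain x y where xy: "pants_boundary i = [x]" "pants_boundary j = [y]" "fst x \<noteq> fst y"
  proof -
    have "i = 0 \<and> j = 1 \<or> i = 1 \<and> j = 0" using ij by (simp add: doubleton_eq_iff)
    then show thesis using that[of "(False, True)" "(True, True)"] that[of "(True, True)" "(False, True)"]
      by (auto simp: pants_boundary_def)
  qed
  have L: "\<rho> [x] \<in> Lor" "\<rho> [y] \<in> Lor" using pants_elements(2)[OF ch pi] xy by (metis Isom_Lor)+
  have pow: "\<rho> (replicate (Suc k) x) = \<rho> [x] ^\<^sub>m (Suc k)" for k
  proof (induction k)
    case 0
    then show ?case using Lor_carrier[OF L(1)] by simp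
  next
    case (Suc k)
    have "\<rho> (replicate (Suc (Suc k)) x) = \<rho> (replicate (Suc k) x) * \<rho> [x]"
      using hom_replicate[OF h, of "Suc k" x] by (simp add: hyp_isom_simps)
    then show ?case unfolding Suc.IH by simp
  qed
  have p: "\<rho> (replicate d x) = \<rho> [x] ^\<^sub>m d" using pow[of "d - 1"] d by simp
  have "\<rho> [x] ^\<^sub>m d * \<rho> [y] = \<rho> [y] * \<rho> [x] ^\<^sub>m d"
    by (rule Lor_eqI) (use L comm xy in auto)
  then have "\<rho> (replicate d x) \<otimes>\<^bsub>deck_group n \<Gamma>\<^esub> \<rho> [y] = \<rho> [y] \<otimes>\<^bsub>deck_group n \<Gamma>\<^esub> \<rho> (replicate d x)"
    by (simp add: p hyp_isom_simps)
  moreover have "\<not> cancels x y" "\<not> cancels y x" "x \<noteq> y" using xy(3) by (auto simp: cancels_def)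
  ultimately show False using power_letter_not_commuting[OF _ _ _ d h inj] by blast
qed

lemma attracting_null:
  assumes cg: "closed_geodesic n a p v l"
  shows "p + v \<in> V" "mink (p + v) (p + v) = 0" "(p + v) $ 0 > 0"
proof -
  have p: "p \<in> hyp n" and v: "v \<in> unit_tangent n p" using cg by (auto simp: closed_geodesic_def)
  note vD = unit_tangentD[OF v]
  have pV: "p \<in> V" using p by (rule hyp_V)
  have vp: "mink v p = 0" using vD pV mink_commute by auto
  show V': "p + v \<in> V" and n: "mink (p + v) (p + v) = 0" using pV vD vp hyp_mink[OF p] by simp_all
  show "(p + v) $ 0 > 0" by (rule future_by_mink[OF p V']) (use n pV vD vp hyp_mink[OF p] in auto)
qed

text \<open>If two of the rays were equal, each of the two cuffs would have a power commuting with the other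
one. The third cuff is a product of inverses of the first two, so in every case a power of one of two free
generators would commute with the other.\<close>

lemma attracting_distinct:
  assumes ch: "closed_hyperbolic n \<Gamma>" and pi: "pants_in n \<Gamma> \<rho>"
    and cg: "\<And>i. closed_geodesic n (\<rho> (pants_boundary i)) (P i) (W i) (l i)" and ij: "i \<noteq> j"
  shows "mink (P i + W i) (P j + W j) < 0"
proof -
  define a where "a i = \<rho> (pants_boundary i)" for i
  define M where "M i = P i + W i" for i
  note pe = pants_elements[OF ch pi, folded a_def]
  note M = attracting_null[OF cg, folded M_def]
  have aL: "a i \<in> Lor" for i using pe by simp
  have rel: "a 0 *\<^sub>v (a 1 *\<^sub>v (a 2 *\<^sub>v x)) = x" if "x \<in> V" for x
    using pants_relation[OF ch pi that] by (simp add: a_def)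
  have ray: "a i *\<^sub>v M i = exp (l i) \<cdot>\<^sub>v M i" for i
    unfolding M_def by (rule closed_geodesic_ray[OF aL cg[folded a_def]])
  define comm where "comm i j \<longleftrightarrow> (\<exists>d>0. \<forall>x\<in>V. (a i ^\<^sub>m d) *\<^sub>v (a j *\<^sub>v x) = a j *\<^sub>v ((a i ^\<^sub>m d) *\<^sub>v x))" for i j
  have C: "comm i j" if z: "mink (M i) (M j) = 0" for i j
  proof -
    have Mj: "M j = (M j $ 0 / M i $ 0) \<cdot>\<^sub>v M i" using M z by (intro null_orthogonal_parallel)
    define t where "t = M j $ 0 / M i $ 0"
    have t: "t > 0" using M(3)[of i] M(3)[of j] by (simp add: t_def)
    have Mj: "M j = t \<cdot>\<^sub>v M i" using Mj by (simp add: t_def)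
    then have Mi: "M i = (1 / t) \<cdot>\<^sub>v M j" using t by (simp add: smult_smult_assoc)
    have "a j *\<^sub>v M i = (1 / t) \<cdot>\<^sub>v (exp (l j) \<cdot>\<^sub>v M j)" unfolding Mi by (simp add: Lor_linear[OF aL M(1)] ray)
    also have "\<dots> = exp (l j) \<cdot>\<^sub>v M i" using t by (simp add: Mj smult_smult_assoc)
    finally have "a j *\<^sub>v (P i + W i) = exp (l j) \<cdot>\<^sub>v (P i + W i)" by (simp add: M_def)
    then show ?thesis unfolding comm_def by (rule common_ray_commute[OF ch pe(1) pe(1) cg[folded a_def]])
  qed
  have nc: "\<not> comm 0 1" "\<not> comm 1 0"
    using pants_not_commuting[OF ch pi, of _ 0 1] pants_not_commuting[OF ch pi, of _ 1 0]
    unfolding comm_def a_def by (auto simp: insert_commute)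
  have pw: "(a i ^\<^sub>m d) *\<^sub>v (a i *\<^sub>v x) = a i *\<^sub>v ((a i ^\<^sub>m d) *\<^sub>v x)" if "x \<in> V" for i d x
  proof -
    have a1: "(a i ^\<^sub>m 1) *\<^sub>v z = a i *\<^sub>v z" if "z \<in> V" for z using Lor_carrier[OF aL] by simp
    have "(a i ^\<^sub>m (d + 1)) *\<^sub>v x = (a i ^\<^sub>m (1 + d)) *\<^sub>v x" by simp
    then show ?thesis
      unfolding pow_mat_add_vec[OF aL that] using a1 that aL by simp
  qed
  have nc12: "\<not> comm 1 2"
  proof
    assume "comm 1 2"
    then obtain d where d: "d > 0" and c: "\<And>x. x \<in> V \<Longrightarrow> (a 1 ^\<^sub>m d) *\<^sub>v (a 2 *\<^sub>v x) = a 2 *\<^sub>v ((a 1 ^\<^sub>m d) *\<^sub>v x)"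
      unfolding comm_def by blast
    have "(a 1 ^\<^sub>m d) *\<^sub>v (a 0 *\<^sub>v x) = a 0 *\<^sub>v ((a 1 ^\<^sub>m d) *\<^sub>v x)" if x: "x \<in> V" for x
    proof -
      define w where "w = adj (a 2) *\<^sub>v (adj (a 1) *\<^sub>v x)"
      have w: "w \<in> V" and xw: "x = a 1 *\<^sub>v (a 2 *\<^sub>v w)" using x aL by (simp_all add: w_def)
      have "(a 1 ^\<^sub>m d) *\<^sub>v (a 0 *\<^sub>v x) = (a 1 ^\<^sub>m d) *\<^sub>v w" unfolding xw rel[OF w] ..
      also have "\<dots> = a 0 *\<^sub>v (a 1 *\<^sub>v (a 2 *\<^sub>v ((a 1 ^\<^sub>m d) *\<^sub>v w)))" using w aL by (simp add: rel)
      also have "\<dots> = a 0 *\<^sub>v ((a 1 ^\<^sub>m d) *\<^sub>v x)" using w aL by (simp add: xw pw c)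
      finally show ?thesis .
    qed
    then show False using nc(2) d unfolding comm_def by blast
  qed
  have nc02: "\<not> comm 0 2"
  proof
    assume "comm 0 2"
    then obtain d where d: "d > 0" and c: "\<And>x. x \<in> V \<Longrightarrow> (a 0 ^\<^sub>m d) *\<^sub>v (a 2 *\<^sub>v x) = a 2 *\<^sub>v ((a 0 ^\<^sub>m d) *\<^sub>v x)"
      unfolding comm_def by blast
    have a12: "a 1 *\<^sub>v (a 2 *\<^sub>v w) = adj (a 0) *\<^sub>v w" if "w \<in> V" for w
      using Lor_adj_vec(1)[OF aL, of "a 1 *\<^sub>v (a 2 *\<^sub>v w)" 0] that aL by (simp add: rel)
    have "(a 0 ^\<^sub>m d) *\<^sub>v (a 1 *\<^sub>v x) = a 1 *\<^sub>v ((a 0 ^\<^sub>m d) *\<^sub>v x)" if x: "x \<in> V" for x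
    proof -
      define w where "w = adj (a 2) *\<^sub>v x"
      define z where "z = adj (a 0) *\<^sub>v w"
      have w: "w \<in> V" and xw: "x = a 2 *\<^sub>v w" and z: "z \<in> V" and wz: "w = a 0 *\<^sub>v z" using x aL by (simp_all add: w_def z_def)
      have "(a 0 ^\<^sub>m d) *\<^sub>v (a 1 *\<^sub>v x) = (a 0 ^\<^sub>m d) *\<^sub>v z" unfolding xw a12[OF w] z_def ..
      also have "\<dots> = adj (a 0) *\<^sub>v ((a 0 ^\<^sub>m d) *\<^sub>v w)" using z aL by (simp add: wz pw)
      also have "\<dots> = a 1 *\<^sub>v ((a 0 ^\<^sub>m d) *\<^sub>v x)" using w aL by (simp add: xw c a12)
      finally show ?thesis .
    qed
    then show False using nc(1) d unfolding comm_def by blast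
  qed
  have "mink (M i) (M j) \<noteq> 0"
  proof
    assume z: "mink (M i) (M j) = 0"
    then have "mink (M j) (M i) = 0" using mink_commute[OF M(1) M(1)] by metis
    have "comm i j" by (rule C[OF z])
    moreover have "comm j i" by (rule C) fact
    moreover have False if c: "comm i j" "comm j i"
    proof -
      consider "i = 0" "j = 1" | "i = 1" "j = 0" | "i = 0" "j = 2" | "i = 2" "j = 0" | "i = 1" "j = 2" | "i = 2" "j = 1"
        using exhaust_mod_3[of i] exhaust_mod_3[of j] ij by blast
      then show False using nc nc12 nc02 c by cases (simp_all only:)
    qed
    ultimately show False by blast
  qed
  moreover have "mink (M i) (M j) \<le> 0" by (rule causal_mink(1)) (simp_all add: M)
  ultimately show ?thesis unfolding M_def by linarith
qed

end

section \<open>From gluings to connected tripods\<close>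

lemma half_turn_SO:
  assumes "3 \<le> n"
  shows "mat_diag n (\<lambda>i. if i = 1 \<or> i = 2 then - 1 else 1) \<in> SO n"
proof -
  let ?s = "\<lambda>i :: nat. if i = 1 \<or> i = 2 then - 1 else 1 :: real"
  have "det (mat_diag n ?s) = prod_list (diag_mat (mat_diag n ?s))"
    by (rule det_upper_triangular[of _ n]) (auto simp: upper_triangular_def mat_diag_def)
  also have "\<dots> = (\<Prod>i = 0..<n. ?s i)"
    by (simp add: diag_mat_def prod.list_conv_set_nth mat_diag_def)
  also have "\<dots> = (\<Prod>i\<in>{1, 2}. ?s i)" using assms by (intro prod.mono_neutral_right) auto
  finally have "det (mat_diag n ?s) = 1" by simp
  moreover have "transpose_mat (mat_diag n ?s) * mat_diag n ?s = 1\<^sub>m n"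
  proof -
    have "transpose_mat (mat_diag n ?s) = mat_diag n ?s" by (rule eq_matI) (auto simp: mat_diag_def)
    then have "transpose_mat (mat_diag n ?s) * mat_diag n ?s = mat_diag n (\<lambda>i. ?s i * ?s i)"
      by (simp only: mat_diag_diag)
    also have "\<dots> = 1\<^sub>m n" by (rule eq_matI) (auto simp: mat_diag_def)
    finally show ?thesis .
  qed
  ultimately show ?thesis by (simp add: SO_def mat_diag_def)
qed

context minkowski_space begin

text \<open>The isometry \<open>h\<close> takes the standard triangle to the one spanned by the attracting fixed points. These are numbered with a
shift by one, so that the edge opposite to the vertex \<open>i + 1\<close> is the one that avoids the cuff \<open>i\<close>.\<close>

lemma spun_triangle:
  fixes \<epsilon> :: real
  assumes ch: "closed_hyperbolic n \<Gamma>" and pi: "pants_in n \<Gamma> \<rho>" and good: "cuff_good n R \<epsilon> \<rho>"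
  obtains h l where "h \<in> Isom" "\<And>i. \<bar>l i - 2 * R\<bar> < 2 * \<epsilon>"
    "spun_pants n (\<lambda>i. adj h * (\<rho> (pants_boundary i) * h)) l (n ^ 3 * \<epsilon>)"
proof -
  define a where "a i = \<rho> (pants_boundary i)" for i
  note aI = pants_elements(2)[OF ch pi, folded a_def]
  have aL: "a i \<in> Lor" for i using aI by simp
  have "\<exists>p v l. closed_geodesic n (a i) p v l \<and> \<bar>l - 2 * R\<bar> < 2 * \<epsilon> \<and>
      (\<forall>x\<in>V. \<forall>y\<in>V. mink x (p + v) = 0 \<longrightarrow> mink y (p + v) = 0 \<longrightarrow> mink x x = 1 \<longrightarrow> mink y y = 1 \<longrightarrow>
       \<bar>mink x (a i *\<^sub>v y) - mink x y\<bar> \<le> n ^ 3 * \<epsilon>)" for i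
  proof -
    have "good_curve n R \<epsilon> (a i)" using good by (simp add: cuff_good_def a_def)
    from good_curve_action[OF aI this] show ?thesis by metis
  qed
  then obtain P W l where cg: "\<And>i. closed_geodesic n (a i) (P i) (W i) (l i)"
    and l: "\<And>i. \<bar>l i - 2 * R\<bar> < 2 * \<epsilon>"
    and near: "\<And>i x y. x \<in> V \<Longrightarrow> y \<in> V \<Longrightarrow> mink x (P i + W i) = 0 \<Longrightarrow> mink y (P i + W i) = 0 \<Longrightarrow>
      mink x x = 1 \<Longrightarrow> mink y y = 1 \<Longrightarrow> \<bar>mink x (a i *\<^sub>v y) - mink x y\<bar> \<le> n ^ 3 * \<epsilon>"
    by metis
  define M where "M i = P i + W i" for i
  note M = attracting_null[OF cg, folded M_def]
  have neg: "mink (M i) (M j) < 0" if "i \<noteq> j" for i j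
    unfolding M_def by (rule attracting_distinct[OF ch pi cg[unfolded a_def] that])
  have ray: "a i *\<^sub>v M i = exp (l i) \<cdot>\<^sub>v M i" for i
    unfolding M_def by (rule closed_geodesic_ray[OF aL cg])
  have "- mink (M 0) (M 1) > 0" "- mink (M 0) (M 2) > 0" "- mink (M 1) (M 2) > 0" using neg by simp_all
  then obtain r s t where rst: "r > 0" "s > 0" "t > 0" "r * s * - mink (M 0) (M 1) = 3/2"
    "r * t * - mink (M 0) (M 2) = 3/2" "s * t * - mink (M 1) (M 2) = 3/2"
    by (rule scaling_factors)
  define scale :: "3 \<Rightarrow> real" where "scale i = (if i = 0 then r else if i = 1 then s else t)" for i
  have scale: "scale i > 0" for i using rst by (simp add: scale_def)
  have gram: "scale i * scale j * mink (M i) (M j) = - 3/2" if ij: "i \<noteq> j" for i j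
  proof -
    have c: "mink (M 1) (M 0) = mink (M 0) (M 1)" "mink (M 2) (M 0) = mink (M 0) (M 2)" "mink (M 2) (M 1) = mink (M 1) (M 2)"
      by (rule mink_commute; rule M)+
    consider "i = 0" "j = 1" | "i = 1" "j = 0" | "i = 0" "j = 2" | "i = 2" "j = 0" | "i = 1" "j = 2" | "i = 2" "j = 1"
      using exhaust_mod_3[of i] exhaust_mod_3[of j] ij by blast
    then show ?thesis using rst c by cases (simp_all add: scale_def mult.commute)
  qed
  define \<xi> where "\<xi> i = scale (i - 1) \<cdot>\<^sub>v M (i - 1)" for i
  have "\<xi> i \<in> V" for i using M by (simp add: \<xi>_def)
  moreover have "mink (\<xi> i) (\<xi> j) = (if i = j then 0 else - 3/2)" for i j
    using gram[of "i - 1" "j - 1"] M by (cases "i = j") (simp_all add: \<xi>_def mult_ac)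
  moreover have "\<xi> i $ 0 > 0" for i using M(1,3)[of "i - 1"] scale[of "i - 1"] by (auto simp: \<xi>_def)
  ultimately obtain h where h: "h \<in> Isom" and hN: "\<And>i. h *\<^sub>v vertex i = \<xi> i"
    by (rule triangle_isometry[of \<xi>]) blast+
  have hL: "h \<in> Lor" using h by simp
  have hNi: "h *\<^sub>v vertex (i + 1) = scale i \<cdot>\<^sub>v M i" for i by (simp add: hN \<xi>_def)
  have "spun_pants n (\<lambda>i. adj h * (a i * h)) l (n ^ 3 * \<epsilon>)"
  proof (unfold_locales)
    show "adj h * (a i * h) \<in> Isom" for i using h aI by simp
    show "(adj h * (a 0 * h)) *\<^sub>v ((adj h * (a 1 * h)) *\<^sub>v ((adj h * (a 2 * h)) *\<^sub>v x)) = x" if "x \<in> V" for x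
      using that hL aL pants_relation[OF ch pi, of "h *\<^sub>v x"] by (simp add: a_def)
    show "(adj h * (a i * h)) *\<^sub>v vertex (i + 1) = exp (l i) \<cdot>\<^sub>v vertex (i + 1)" for i
    proof -
      have "a i *\<^sub>v (h *\<^sub>v vertex (i + 1)) = exp (l i) \<cdot>\<^sub>v (h *\<^sub>v vertex (i + 1))"
        by (simp add: hNi Lor_linear[OF aL M(1)] ray smult_smult_assoc mult.commute)
      then show ?thesis using hL aL by (simp add: Lor_linear)
    qed
    show "\<bar>mink x ((adj h * (a i * h)) *\<^sub>v y) - mink x y\<bar> \<le> n ^ 3 * \<epsilon>"
      if x: "x \<in> V" "mink x (vertex (i + 1)) = 0" "mink x x = 1" and y: "y \<in> V" "mink y (vertex (i + 1)) = 0" "mink y y = 1" for i x y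
    proof -
      have perp: "mink (h *\<^sub>v z) (P i + W i) = 0" if "z \<in> V" "mink z (vertex (i + 1)) = 0" for z
      proof -
        have "mink (h *\<^sub>v z) (scale i \<cdot>\<^sub>v M i) = mink z (vertex (i + 1))" unfolding hNi[symmetric] using hL that by simp
        then show ?thesis using hL that M scale[of i] by (simp add: M_def)
      qed
      have "\<bar>mink (h *\<^sub>v x) (a i *\<^sub>v (h *\<^sub>v y)) - mink (h *\<^sub>v x) (h *\<^sub>v y)\<bar> \<le> n ^ 3 * \<epsilon>"
        by (rule near) (use hL x y perp in simp_all)
      moreover have "mink (h *\<^sub>v x) (a i *\<^sub>v (h *\<^sub>v y)) = mink x (adj h *\<^sub>v (a i *\<^sub>v (h *\<^sub>v y)))"
        using Lor_mink[of h x "adj h *\<^sub>v (a i *\<^sub>v (h *\<^sub>v y))"] hL aL x y by simp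
      ultimately show ?thesis using hL aL x y by simp
    qed
  qed
  then show thesis unfolding a_def by (rule that[OF h l])
qed

lemma deck_group_inv:
  assumes ch: "closed_hyperbolic n \<Gamma>" and g: "g \<in> \<Gamma>"
  shows "inv\<^bsub>deck_group n \<Gamma>\<^esub> g = adj g" "adj g \<in> \<Gamma>"
proof -
  have S: "subgroup \<Gamma> (hyp_isom n)" using ch by (simp add: closed_hyperbolic_def)
  have gI: "g \<in> Isom" using subgroup.mem_carrier[OF S g] .
  show "inv\<^bsub>deck_group n \<Gamma>\<^esub> g = adj g"
    using group.m_inv_consistent[OF group_hyp_isom S g] hyp_isom_inv[OF gI] by simp
  show "adj g \<in> \<Gamma>" using subgroup.m_inv_closed[OF S g] hyp_isom_inv[OF gI] by simp
qed

text \<open>For these \<open>g\<close> the products \<open>g (i + 1) * adj (g (i - 1))\<close> are the cuffs themselves, so no conjugation is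
needed; for \<open>i = 1\<close> this is the relation between the cuffs.\<close>

lemma generates_pants_by_cuffs:
  assumes ch: "closed_hyperbolic n \<Gamma>" and pi: "pants_in n \<Gamma> \<rho>"
    and g: "g = (\<lambda>i. if i = 0 then \<rho> (pants_boundary 2) else if i = 1 then 1\<^sub>m (Suc n) else adj (\<rho> (pants_boundary 0)))"
  shows "\<And>i. g i \<in> \<Gamma>" "generates_pants n \<Gamma> g \<rho>"
proof -
  define a where "a i = \<rho> (pants_boundary i)" for i
  note a = pants_elements[OF ch pi, folded a_def]
  have aL: "a i \<in> Lor" for i using a(2) by simp
  have S: "subgroup \<Gamma> (hyp_isom n)" using ch by (simp add: closed_hyperbolic_def)
  have one: "1\<^sub>m (Suc n) \<in> \<Gamma>" using subgroup.one_closed[OF S] by (simp add: hyp_isom_simps)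
  have g_def: "g i = (if i = 0 then a 2 else if i = 1 then 1\<^sub>m (Suc n) else adj (a 0))" for i by (simp add: g a_def)
  show gG: "g i \<in> \<Gamma>" for i using a one deck_group_inv(2)[OF ch a(1)] by (simp add: g_def)
  have gI: "g i \<in> Isom" for i using gG S subgroup.mem_carrier by fastforce
  have gL: "g i \<in> Lor" for i using gI by simp
  have prod: "g (i + 1) * adj (g (i - 1)) = a i" for i
  proof (rule Lor_eqI)
    fix x assume x: "x \<in> V"
    have rel: "a 0 *\<^sub>v (a 1 *\<^sub>v (a 2 *\<^sub>v y)) = y" if "y \<in> V" for y
      using pants_relation[OF ch pi that] by (simp add: a_def)
    have inv1: "adj (1\<^sub>m (Suc n)) *\<^sub>v y = y" if "y \<in> V" for y
      using Lor_adj_vec(1)[OF Lor_one that] that by simp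
    have inv2: "adj (adj (a 0)) *\<^sub>v x = a 0 *\<^sub>v x"
      using Lor_adj_vec(1)[OF adj_Lor[OF aL], of "a 0 *\<^sub>v x" 0] aL x by simp
    have inv3: "adj (a 0) *\<^sub>v (adj (a 2) *\<^sub>v x) = a 1 *\<^sub>v x"
    proof -
      have "adj (a 2) *\<^sub>v x = a 0 *\<^sub>v (a 1 *\<^sub>v x)" using rel[of "adj (a 2) *\<^sub>v x"] aL x by simp
      then show ?thesis using aL x by simp
    qed
    consider "i = 0" | "i = 1" | "i = 2" using exhaust_mod_3 by blast
    then show "(g (i + 1) * adj (g (i - 1))) *\<^sub>v x = a i *\<^sub>v x"
      using aL x by cases (simp_all add: g_def inv1 inv2 inv3)
  qed (use gL aL in simp_all)
  show "generates_pants n \<Gamma> g \<rho>"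
    unfolding generates_pants_def freely_homotopic_def
  proof (intro allI bexI[OF _ one])
    fix i
    have "1\<^sub>m (Suc n) * a i * adj (1\<^sub>m (Suc n)) = a i"
      by (rule Lor_eqI) (use aL Lor_adj_vec(1)[OF Lor_one] in simp_all)
    then show "\<rho> (pants_boundary i) = 1\<^sub>m (Suc n) \<otimes>\<^bsub>deck_group n \<Gamma>\<^esub>
        (g (i + 1) \<otimes>\<^bsub>deck_group n \<Gamma>\<^esub> inv\<^bsub>deck_group n \<Gamma>\<^esub> (g (i - 1))) \<otimes>\<^bsub>deck_group n \<Gamma>\<^esub> inv\<^bsub>deck_group n \<Gamma>\<^esub> (1\<^sub>m (Suc n))"
      unfolding deck_group_inv(1)[OF ch gG] deck_group_inv(1)[OF ch one]
      by (simp add: hyp_isom_simps prod a_def)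
  qed
qed

text \<open>The tripods are at the centres of the triangles of \<open>h\<close> and \<open>q\<close>. Each of the three gluings gives a segment from the first
centre to the translate of the second one by \<open>g i\<close>, as expressed by the fact \<open>side\<close> below.\<close>

lemma connected_pants_of_gluing:
  fixes \<epsilon> K C R :: real
  assumes ch: "closed_hyperbolic n \<Gamma>" and pi: "pants_in n \<Gamma> \<rho>" and h: "h \<in> Isom"
    and l: "\<And>i. \<bar>l i - 2 * R\<bar> < 2 * \<epsilon>"
    and sp: "spun_pants n (\<lambda>i. adj h * (\<rho> (pants_boundary i) * h)) l (n ^ 3 * \<epsilon>)"
    and gl: "\<And>j. glues (spun_pants.gluing_of n (\<lambda>i. adj h * (\<rho> (pants_boundary i) * h)) G j) (exp (spun_pants.shear l j))"
    and be: "\<And>j c d. 2 \<le> c \<Longrightarrow> c \<le> n \<Longrightarrow> 2 \<le> d \<Longrightarrow> d \<le> n \<Longrightarrow>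
       \<bar>bend (spun_pants.gluing_of n (\<lambda>i. adj h * (\<rho> (pants_boundary i) * h)) G j) c d - (if c = d then bend_sign bad c else 0)\<bar> \<le> \<delta>"
    and \<delta>: "0 \<le> \<delta>" "\<delta> \<le> 1"
    and R: "6 \<le> exp (R - 3 * \<epsilon>)" "8 * exp (- (R - 3 * \<epsilon>)) \<le> (exp (- R / 4))\<^sup>2" "0 \<le> R" "20 * exp (- (R - 3 * \<epsilon>)) \<le> \<epsilon>"
    and D: "D \<in> SO n" "\<And>i j. i < n \<Longrightarrow> j < n \<Longrightarrow> D $$ (i, j) = (if i = j then frame_sign bad i else 0)"
    and K: "\<forall>X\<in>SO n. \<forall>D\<in>SO n. \<forall>\<delta>. (\<forall>i<n. \<forall>j<n. \<bar>X $$ (i, j) - D $$ (i, j)\<bar> \<le> \<delta>) \<longrightarrow> \<delta> \<ge> 0 \<longrightarrow> SO_dist n X D \<le> K * \<delta>"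
    and C: "K * (\<delta> + \<epsilon>) < C" "4 * \<epsilon> < C"
  shows "connected_pants n \<Gamma> R C D \<rho>"
proof -
  define a where "a i = \<rho> (pants_boundary i)" for i
  define cuff where "cuff = (\<lambda>i. adj h * (a i * h))"
  interpret spun_pants n cuff l "n ^ 3 * \<epsilon>" using sp by (simp add: cuff_def a_def)
  note gl = gl[folded a_def, folded cuff_def] and be = be[folded a_def, folded cuff_def]
  define g :: "3 \<Rightarrow> real mat" where "g = (\<lambda>i. if i = 0 then a 2 else if i = 1 then 1\<^sub>m (Suc n) else adj (a 0))"
  note gen = generates_pants_by_cuffs[OF ch pi g_def[unfolded a_def]]
  note a = pants_elements[OF ch pi, folded a_def]
  have aL: "a i \<in> Lor" for i using a(2) by simp
  have hL: "h \<in> Lor" using h by simp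
  have S: "subgroup \<Gamma> (hyp_isom n)" using ch by (simp add: closed_hyperbolic_def)
  have gI: "g i \<in> Isom" for i using gen(1) S subgroup.mem_carrier by fastforce
  have gL: "g i \<in> Lor" for i using gI by simp
  have GI: "G \<in> Isom" using gl[of 1] by (simp add: glues_def)
  have GL: "G \<in> Lor" using GI by simp
  define q where "q = h * (turn 1 * G * turn 1)"
  have q: "q \<in> Isom" using h GI by (simp add: q_def)
  have qL: "q \<in> Lor" using q by simp
  have glI: "gluing_of G i \<in> Isom" for i using gl by (simp add: glues_def)
  have glL: "gluing_of G i \<in> Lor" for i using glI by simp
  have side: "(h * turn i) * gluing_of G i = g i * (q * turn (- i))" for i
  proof (rule Lor_eqI)
    fix x assume x: "x \<in> V"
    have adj_cuff0: "adj (cuff 0) *\<^sub>v y = adj h *\<^sub>v (adj (a 0) *\<^sub>v (h *\<^sub>v y))" if y: "y \<in> V" for y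
    proof -
      have "cuff 0 *\<^sub>v (adj h *\<^sub>v (adj (a 0) *\<^sub>v (h *\<^sub>v y))) = y" using hL aL y by (simp add: cuff_def)
      then show ?thesis using Lor_adj_vec(1)[OF cuff_Lor, of "adj h *\<^sub>v (adj (a 0) *\<^sub>v (h *\<^sub>v y))" 0] hL aL y by simp
    qed
    have turn_turn: "turn i *\<^sub>v (turn j *\<^sub>v y) = turn (i + j) *\<^sub>v y" if "y \<in> V" for i j y
      using Lor_mult_vec[of "turn i" "turn j" y] that by (simp add: turn_add)
    have cuff2: "cuff 2 *\<^sub>v y = adj h *\<^sub>v (a 2 *\<^sub>v (h *\<^sub>v y))" if "y \<in> V" for y using hL aL that by (simp add: cuff_def)
    consider "i = 0" | "i = 1" | "i = 2" using exhaust_mod_3 by blast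
    then show "((h * turn i) * gluing_of G i) *\<^sub>v x = (g i * (q * turn (- i))) *\<^sub>v x"
      using x hL aL GL glL gL qL
      by cases (simp_all add: gluing_of_vec g_def q_def cuff2 adj_cuff0 turn_turn)
  qed (use hL glL gL qL in simp_all)
  have "connected_near n R C D (h *\<^sub>v e 0) (legs h) (tail_frame h) (q *\<^sub>v e 0) (legs q) (tail_frame q) g"
    unfolding connected_near_def
  proof
    fix i
    have "\<bar>(x + y - z) / 2 - R\<bar> \<le> 3 * \<epsilon>"
      if "\<bar>x - 2 * R\<bar> < 2 * \<epsilon>" "\<bar>y - 2 * R\<bar> < 2 * \<epsilon>" "\<bar>z - 2 * R\<bar> < 2 * \<epsilon>" for x y z
      using that by (simp add: abs_le_iff abs_less_iff field_simps)
    then have sh: "\<bar>shear i - R\<bar> \<le> 3 * \<epsilon>" unfolding shear_def using l by blast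
    have ex: "exp (- shear i) \<le> exp (- (R - 3 * \<epsilon>))" "exp (R - 3 * \<epsilon>) \<le> exp (shear i)" using sh by auto
    have hK: "h * turn i \<in> Isom" using h by simp
    have base: "(h * turn i) *\<^sub>v e 0 = h *\<^sub>v e 0" using hL by (simp add: turn_e)
    have far: "((h * turn i) * gluing_of G i) *\<^sub>v e 0 = g i *\<^sub>v (q *\<^sub>v e 0)" unfolding side using gL qL by (simp add: turn_e)
    have leg: "((h * turn i) * gluing_of G i) *\<^sub>v e 1 = g i *\<^sub>v legs q (- i)" unfolding side using gL qL by (simp add: legs_def)
    have frame_of': "frame_of ((h * turn i) * gluing_of G i) = map (\<lambda>x. g i *\<^sub>v x) (tripod_frame (legs q) (tail_frame q) (- i))"
      unfolding side tripod_frame_legs[OF qL] using gL qL by (simp add: frame_of_def)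
    have "8 * exp (- shear i) \<le> (exp (- R / 4))\<^sup>2" using R(2) ex(1) by linarith
    then have \<theta>: "0 \<le> exp (- R / 4)" "exp (- R / 4) \<le> 1" "8 * exp (- shear i) \<le> (exp (- R / 4))\<^sup>2" using R(3) by auto
    have "6 \<le> exp (shear i)" using R ex by linarith
    note conn = connection[OF hK gl this \<delta>(2) be \<theta>, unfolded base far leg frame_of' tripod_frame_legs[OF hL, symmetric] legs_def[symmetric]]
    obtain w L X E' where w: "w \<in> unit_tangent n (h *\<^sub>v e 0)" and L: "L > 0" "geod (h *\<^sub>v e 0) w L = g i *\<^sub>v (q *\<^sub>v e 0)"
      "\<bar>L - (shear i + ln (4/3))\<bar> \<le> 6 * exp (- shear i)"
      and ang: "hangle (legs h i) w \<le> exp (- R / 4)" "hangle (g i *\<^sub>v legs q (- i)) (- geod_vel (h *\<^sub>v e 0) w L) \<le> exp (- R / 4)"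
      and E': "list_all2 (parallel_transport n (geod (h *\<^sub>v e 0) w) L) (tripod_frame (legs h) (tail_frame h) i) E'"
      and X: "X \<in> SO n" "transforms_frame n X (negate_first_two E') (map (\<lambda>x. g i *\<^sub>v x) (tripod_frame (legs q) (tail_frame q) (- i)))"
      and Xe: "\<And>a b. a < n \<Longrightarrow> b < n \<Longrightarrow> \<bar>X $$ (a, b) - (if a = b then frame_sign bad a else 0)\<bar> \<le> \<delta> + 20 * exp (- shear i)"
      proof -
      show thesis by (rule conn; (assumption | rule that; (assumption | blast)))
    qed
    have "0 < exp (- (R - 3 * \<epsilon>))" by simp
    then have \<epsilon>: "0 \<le> \<epsilon>" "20 * exp (- shear i) \<le> \<epsilon>" using R(4) ex(1) by linarith+
    have "SO_dist n X D \<le> K * (\<delta> + \<epsilon>)"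
    proof (rule K[rule_format, OF X(1) D(1)])
      fix a b assume "a < n" "b < n"
      then show "\<bar>X $$ (a, b) - D $$ (a, b)\<bar> \<le> \<delta> + \<epsilon>" using Xe[of a b] \<epsilon>(2) D(2)[of a b] by linarith
    qed (use \<delta> \<epsilon> in simp)
    then have "SO_dist n X D < C" using C by linarith
    moreover have "R + ln (4/3) - C < L" "L < R + ln (4/3) + C" using L(3) sh \<epsilon> C by linarith+
    ultimately show "\<exists>w\<in>unit_tangent n (h *\<^sub>v e 0). \<exists>l>0. geod (h *\<^sub>v e 0) w l = g i *\<^sub>v (q *\<^sub>v e 0) \<and>
        R + ln (4/3) - C < l \<and> l < R + ln (4/3) + C \<and>
        hangle (legs h i) w \<le> exp (- R / 4) \<and>
        hangle (g i *\<^sub>v legs q (- i)) (- geod_vel (h *\<^sub>v e 0) w l) \<le> exp (- R / 4) \<and>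
        (\<exists>E' X. list_all2 (parallel_transport n (geod (h *\<^sub>v e 0) w) l) (tripod_frame (legs h) (tail_frame h) i) E' \<and>
           X \<in> SO n \<and>
           transforms_frame n X (negate_first_two E')
             (map (\<lambda>x. g i *\<^sub>v x) (tripod_frame (legs q) (tail_frame q) (- i))) \<and>
           SO_dist n X D < C)"
      using w L(1,2) ang E' X by (intro bexI[of _ w] exI[of _ L] conjI exI[of _ E'] exI[of _ X])
  qed
  then show ?thesis
    unfolding connected_pants_def using framed_tripod_legs[OF h] framed_tripod_legs[OF q] gen by blast
qed

end

theorem theorem2p20:
  fixes n :: nat
  assumes "n \<ge> 4"
  shows "\<exists>C>0. \<exists>\<epsilon>\<^sub>0>0. \<forall>\<epsilon>. 0 < \<epsilon> \<and> \<epsilon> < \<epsilon>\<^sub>0 \<longrightarrow>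
    (\<forall>\<^sub>F R in at_top. \<forall>\<Gamma> \<rho>. closed_hyperbolic n \<Gamma> \<and> pants_in n \<Gamma> \<rho> \<and> cuff_good n R \<epsilon> \<rho> \<longrightarrow>
      good_pants n \<Gamma> R (C * \<epsilon>) \<rho> \<or> bad_pants n \<Gamma> R (C * \<epsilon>) \<rho>)"
proof -
  interpret minkowski_space n using assms by unfold_locales simp
  from SO_dist_le_entries[of n] obtain K where K0: "K > 0"
    and K: "\<forall>X\<in>SO n. \<forall>D\<in>SO n. \<forall>\<delta>. (\<forall>i<n. \<forall>j<n. \<bar>X $$ (i, j) - D $$ (i, j)\<bar> \<le> \<delta>) \<longrightarrow> \<delta> \<ge> 0 \<longrightarrow> SO_dist n X D \<le> K * \<delta>"
    by (elim exE conjE)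
  \<comment> \<open>the bends are within \<open>c * \<epsilon>\<close> of their limits: \<open>n ^ 3\<close> for the action of a cuff and \<open>3 * n\<close> from \<open>spun_gluing\<close>\<close>
  define c :: real where "c = 3 * n * n ^ 3"
  have c: "c > 0" using assms by (simp add: c_def)
  \<comment> \<open>one \<open>\<epsilon>\<close> is added for the terms decaying with \<open>R\<close>, and 5 makes the bounds on the distance and the length strict\<close>
  define C where "C = K * (c + 1) + 5"
  have main: "\<forall>\<^sub>F R in at_top. \<forall>\<Gamma> \<rho>. closed_hyperbolic n \<Gamma> \<and> pants_in n \<Gamma> \<rho> \<and> cuff_good n R \<epsilon> \<rho> \<longrightarrow>
      good_pants n \<Gamma> R (C * \<epsilon>) \<rho> \<or> bad_pants n \<Gamma> R (C * \<epsilon>) \<rho>" if \<epsilon>: "0 < \<epsilon>" "\<epsilon> < 1 / c" for \<epsilon>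
  proof -
    have "\<forall>\<^sub>F R in at_top. 6 \<le> exp (R - 3 * \<epsilon>)" by real_asymp
    moreover have "\<forall>\<^sub>F R in at_top. 8 * exp (- (R - 3 * \<epsilon>)) \<le> (exp (- R / 4))\<^sup>2" by real_asymp
    moreover have "\<forall>\<^sub>F R in at_top. (0 :: real) \<le> R" by (rule eventually_ge_at_top)
    moreover have "\<forall>\<^sub>F R in at_top. 20 * exp (- (R - 3 * \<epsilon>)) \<le> \<epsilon>" using \<epsilon> by real_asymp
    ultimately show ?thesis
    proof eventually_elim
      case (elim R)
      show ?case
      proof (intro allI impI)
        fix \<Gamma> \<rho> assume "closed_hyperbolic n \<Gamma> \<and> pants_in n \<Gamma> \<rho> \<and> cuff_good n R \<epsilon> \<rho>"
        then have ch: "closed_hyperbolic n \<Gamma>" and pi: "pants_in n \<Gamma> \<rho>" and good: "cuff_good n R \<epsilon> \<rho>" by auto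
        obtain h l where h: "h \<in> Isom" and l: "\<And>i. \<bar>l i - 2 * R\<bar> < 2 * \<epsilon>"
          and sp: "spun_pants n (\<lambda>i. adj h * (\<rho> (pants_boundary i) * h)) l (n ^ 3 * \<epsilon>)"
          using spun_triangle[OF ch pi good] by blast
        obtain G bad where
          gl: "\<And>j. glues (spun_pants.gluing_of n (\<lambda>i. adj h * (\<rho> (pants_boundary i) * h)) G j) (exp (spun_pants.shear l j))"
          and be: "\<And>j c d. 2 \<le> c \<Longrightarrow> c \<le> n \<Longrightarrow> 2 \<le> d \<Longrightarrow> d \<le> n \<Longrightarrow>
             \<bar>bend (spun_pants.gluing_of n (\<lambda>i. adj h * (\<rho> (pants_boundary i) * h)) G j) c d
               - (if c = d then bend_sign bad c else 0)\<bar> \<le> 3 * n * (n ^ 3 * \<epsilon>)"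
          using spun_pants.spun_gluing[OF sp] by blast
        have \<delta>: "3 * n * (n ^ 3 * \<epsilon>) = c * \<epsilon>" by (simp add: c_def)
        have \<delta>1: "0 \<le> c * \<epsilon>" "c * \<epsilon> \<le> 1" using \<epsilon> c by (auto simp: field_simps)
        have C': "K * (c * \<epsilon> + \<epsilon>) < C * \<epsilon>" "4 * \<epsilon> < C * \<epsilon>" 
        proof -
          have "C * \<epsilon> = K * (c * \<epsilon> + \<epsilon>) + 5 * \<epsilon>" by (simp add: C_def algebra_simps)
          moreover have "K * (c * \<epsilon> + \<epsilon>) > 0" using K0 c \<epsilon> by (intro mult_pos_pos add_pos_pos)
          ultimately show "K * (c * \<epsilon> + \<epsilon>) < C * \<epsilon>" "4 * \<epsilon> < C * \<epsilon>" using \<epsilon> by linarith+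
        qed
        have connected: "connected_pants n \<Gamma> R (C * \<epsilon>) D \<rho>"
          if "D \<in> SO n" "\<And>i j. i < n \<Longrightarrow> j < n \<Longrightarrow> D $$ (i, j) = (if i = j then frame_sign bad i else 0)" for D
          by (rule connected_pants_of_gluing[OF ch pi h l sp gl _ \<delta>1 elim that K C']) (rule be[unfolded \<delta>])
        show "good_pants n \<Gamma> R (C * \<epsilon>) \<rho> \<or> bad_pants n \<Gamma> R (C * \<epsilon>) \<rho>"
        proof (cases bad)
          case False
          have "connected_pants n \<Gamma> R (C * \<epsilon>) (1\<^sub>m n) \<rho>"
            by (rule connected[OF SO_one]) (simp_all add: frame_sign_def False)
          then show ?thesis by (simp add: good_pants_def)
        next
          case True
          have "connected_pants n \<Gamma> R (C * \<epsilon>) (mat_diag n (\<lambda>i. if i = 1 \<or> i = 2 then - 1 else 1)) \<rho>"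
            by (rule connected[OF half_turn_SO]) (use dim3 True in \<open>simp_all add: frame_sign_def mat_diag_def\<close>)
          then show ?thesis by (simp add: bad_pants_def)
        qed
      qed
    qed
  qed
  have "C > 0" using K0 c by (simp add: C_def add_pos_pos)
  moreover have "1 / c > 0" using c by simp
  moreover have "\<forall>\<epsilon>. 0 < \<epsilon> \<and> \<epsilon> < 1 / c \<longrightarrow>
    (\<forall>\<^sub>F R in at_top. \<forall>\<Gamma> \<rho>. closed_hyperbolic n \<Gamma> \<and> pants_in n \<Gamma> \<rho> \<and> cuff_good n R \<epsilon> \<rho> \<longrightarrow>
      good_pants n \<Gamma> R (C * \<epsilon>) \<rho> \<or> bad_pants n \<Gamma> R (C * \<epsilon>) \<rho>)"
    by (intro allI impI, elim conjE) (rule main)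
  ultimately show ?thesis by (intro exI conjI)
qed

end
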